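(* Let $P$ be a finite connected polyhedron with $\dim P = 2$ such that $\pi_1(P)$ is a limit group and has a finite aspherical presentation. Then every homotopy domination $d: P \rightarrow P$ is a homotopy equivalence.
   Context: A map $d: X \to Y$ is a homotopy domination (of $X$ over $Y$) if there is a map $u: Y \to X$ with $d \circ u \simeq \mathrm{id}_Y$. A group presentation is aspherical if the standard $2$-dimensional CW-complex associated with it (one $0$-cell, one $1$-cell per generator, one $2$-cell per relator) is aspherical, i.e. $\pi_i = 0$ for all $i \geq 2$. A finitely generated group $G$ is a limit group if, for any finite subset $S \subset G$, there exists a homomorphism $f: G \to F$, where $F$ is a free group of finite rank, such that the restriction of $f$ to $S$ is injective. *)

theory Defs
  imports "HOL-Analysis.Analysis" "HOL-Homology.Homology" "HOL-Algebra.Generated_Groups"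
begin

section \<open>Homotopy dominations and homotopy equivalences\<close>

definition homotopy_domination :: "'a topology \<Rightarrow> 'b topology \<Rightarrow> ('a \<Rightarrow> 'b) \<Rightarrow> bool" where
  "homotopy_domination X Y d \<longleftrightarrow>
     continuous_map X Y d \<and>
     (\<exists>u. continuous_map Y X u \<and> homotopic_with (\<lambda>_. True) Y Y (d \<circ> u) id)"

definition homotopy_equivalence_map :: "'a topology \<Rightarrow> 'b topology \<Rightarrow> ('a \<Rightarrow> 'b) \<Rightarrow> bool" where
  "homotopy_equivalence_map X Y f \<longleftrightarrow>
     continuous_map X Y f \<and>
     (\<exists>g. continuous_map Y X g \<and>
          homotopic_with (\<lambda>_. True) X X (g \<circ> f) id \<and>
          homotopic_with (\<lambda>_. True) Y Y (f \<circ> g) id)"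


section \<open>Finite polyhedra\<close>

text \<open>
  A finite polyhedron is the underlying space of a finite geometric simplicial complex; this is
  not the library predicate \<^const>\<open>polyhedron\<close>, which describes convex sets. The library's
  simplicial complexes are finite by definition, and may contain the empty simplex (of dimension
  \<open>-1\<close>). The dimension is that of a triangulating complex, and does not depend on its choice.
\<close>

definition finite_polyhedron_of_dim :: "'a::euclidean_space set \<Rightarrow> int \<Rightarrow> bool" where
  "finite_polyhedron_of_dim P k \<longleftrightarrow>
     (\<exists>\<T>. simplicial_complex \<T> \<and> \<Union>\<T> = P \<and> \<T> \<noteq> {} \<and> Max (aff_dim ` \<T>) = k)"


section \<open>The fundamental group\<close>

definition loops_at :: "'a::real_normed_vector set \<Rightarrow> 'a \<Rightarrow> (real \<Rightarrow> 'a) set" where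
  "loops_at S x = {p. path p \<and> path_image p \<subseteq> S \<and> pathstart p = x \<and> pathfinish p = x}"

definition loop_rel :: "'a::real_normed_vector set \<Rightarrow> 'a \<Rightarrow> ((real \<Rightarrow> 'a) \<times> (real \<Rightarrow> 'a)) set" where
  "loop_rel S x = {(p, q). p \<in> loops_at S x \<and> q \<in> loops_at S x \<and> homotopic_paths S p q}"

definition fundamental_group :: "'a::real_normed_vector set \<Rightarrow> 'a \<Rightarrow> (real \<Rightarrow> 'a) set monoid" where
  "fundamental_group S x =
     \<lparr> carrier = loops_at S x // loop_rel S x,
       mult = (\<lambda>A B. loop_rel S x `` {p +++ q | p q. p \<in> A \<and> q \<in> B}),
       one = loop_rel S x `` {linepath x x} \<rparr>"

lemma equiv_loop_rel: "equiv (loops_at S x) (loop_rel S x)"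
  unfolding loop_rel_def
  by (rule equivI)
     (auto simp: refl_on_def sym_def trans_def loops_at_def
           intro: homotopic_paths_sym homotopic_paths_trans)

lemma join_loops_at: "p \<in> loops_at S x \<Longrightarrow> q \<in> loops_at S x \<Longrightarrow> p +++ q \<in> loops_at S x"
  by (auto simp: loops_at_def subset_path_image_join)

lemma mult_fundamental_group:
  assumes "p \<in> loops_at S x" "q \<in> loops_at S x"
  shows "loop_rel S x `` {p} \<otimes>\<^bsub>fundamental_group S x\<^esub> loop_rel S x `` {q} =
         loop_rel S x `` {p +++ q}"
proof -
  have r: "(p +++ q, p' +++ q') \<in> loop_rel S x"
    if "(p, p') \<in> loop_rel S x" "(q, q') \<in> loop_rel S x" for p' q'
    using that unfolding loop_rel_def
    by (auto intro!: homotopic_paths_join join_loops_at simp: loops_at_def subset_path_image_join)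
  have self: "(p, p) \<in> loop_rel S x" "(q, q) \<in> loop_rel S x"
    using assms equiv_loop_rel[of S x] by (auto simp: equiv_def refl_on_def)
  have "loop_rel S x `` {p' +++ q' | p' q'. (p, p') \<in> loop_rel S x \<and> (q, q') \<in> loop_rel S x} =
        loop_rel S x `` {p +++ q}"
    using r self equiv_class_eq[OF equiv_loop_rel r] by blast
  then show ?thesis
    by (simp add: fundamental_group_def)
qed

lemma group_fundamental_group:
  assumes "x \<in> S"
  shows "group (fundamental_group S x)"
proof (rule groupI)
  let ?G = "fundamental_group S x"
  let ?c = "\<lambda>p. loop_rel S x `` {p}"
  have car: "carrier ?G = ?c ` loops_at S x"
    by (auto simp: fundamental_group_def quotient_def)
  have one: "\<one>\<^bsub>?G\<^esub> = ?c (linepath x x)"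
    by (simp add: fundamental_group_def)
  have lin: "linepath x x \<in> loops_at S x"
    using assms by (simp add: loops_at_def)
  have eq: "?c p = ?c q" if "p \<in> loops_at S x" "q \<in> loops_at S x" "homotopic_paths S p q" for p q
    using that by (intro equiv_class_eq[OF equiv_loop_rel]) (simp add: loop_rel_def)
  show "\<one>\<^bsub>?G\<^esub> \<in> carrier ?G"
    using car one lin by auto
  show "A \<otimes>\<^bsub>?G\<^esub> B \<in> carrier ?G" if "A \<in> carrier ?G" "B \<in> carrier ?G" for A B
    using that by (auto simp: car mult_fundamental_group intro: join_loops_at)
  show "A \<otimes>\<^bsub>?G\<^esub> B \<otimes>\<^bsub>?G\<^esub> C = A \<otimes>\<^bsub>?G\<^esub> (B \<otimes>\<^bsub>?G\<^esub> C)"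
    if ABC: "A \<in> carrier ?G" "B \<in> carrier ?G" "C \<in> carrier ?G" for A B C
  proof -
    obtain p q r where pqr: "p \<in> loops_at S x" "q \<in> loops_at S x" "r \<in> loops_at S x"
      and "A = ?c p" "B = ?c q" "C = ?c r"
      using ABC by (auto simp: car)
    moreover have "?c (p +++ (q +++ r)) = ?c ((p +++ q) +++ r)"
      using pqr by (intro eq join_loops_at homotopic_paths_assoc) (auto simp: loops_at_def)
    ultimately show ?thesis
      by (simp add: mult_fundamental_group join_loops_at)
  qed
  show "\<one>\<^bsub>?G\<^esub> \<otimes>\<^bsub>?G\<^esub> A = A" if A: "A \<in> carrier ?G" for A
  proof -
    obtain p where p: "p \<in> loops_at S x" "A = ?c p"
      using A by (auto simp: car)
    have "?c (linepath x x +++ p) = ?c p"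
      using p lin by (intro eq join_loops_at homotopic_paths_lid') (auto simp: loops_at_def)
    with p lin show ?thesis
      by (simp add: one mult_fundamental_group)
  qed
  show "\<exists>B\<in>carrier ?G. B \<otimes>\<^bsub>?G\<^esub> A = \<one>\<^bsub>?G\<^esub>" if A: "A \<in> carrier ?G" for A
  proof -
    obtain p where p: "p \<in> loops_at S x" "A = ?c p"
      using A by (auto simp: car)
    have rp: "reversepath p \<in> loops_at S x"
      using p by (auto simp: loops_at_def)
    have "?c (reversepath p +++ p) = ?c (linepath x x)"
      using p rp lin homotopic_paths_linv[of p S]
      by (intro eq join_loops_at) (auto simp: loops_at_def)
    with p rp show ?thesis
      by (auto simp: car one mult_fundamental_group intro!: bexI[of _ "?c (reversepath p)"])
  qed
qed


section \<open>Free groups and groups given by presentations\<close>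

text \<open>The letter \<open>(a, True)\<close> stands for the generator \<open>a\<close>, and \<open>(a, False)\<close> for its inverse.\<close>

type_synonym 'g word = "('g \<times> bool) list"

definition words :: "'g set \<Rightarrow> 'g word set" where
  "words X = lists (X \<times> UNIV)"

inductive_set free_rel :: "'g set \<Rightarrow> ('g word \<times> 'g word) set" for X :: "'g set" where
  cancel: "u \<in> words X \<Longrightarrow> v \<in> words X \<Longrightarrow> a \<in> X \<Longrightarrow>
             (u @ [(a, b), (a, \<not> b)] @ v, u @ v) \<in> free_rel X"
| refl: "w \<in> words X \<Longrightarrow> (w, w) \<in> free_rel X"
| sym: "(u, v) \<in> free_rel X \<Longrightarrow> (v, u) \<in> free_rel X"
| trans: "(u, v) \<in> free_rel X \<Longrightarrow> (v, w) \<in> free_rel X \<Longrightarrow> (u, w) \<in> free_rel X"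

definition free_group :: "'g set \<Rightarrow> 'g word set monoid" where
  "free_group X =
     \<lparr> carrier = words X // free_rel X,
       mult = (\<lambda>A B. free_rel X `` {u @ v | u v. u \<in> A \<and> v \<in> B}),
       one = free_rel X `` {[]} \<rparr>"

definition normal_closure :: "('a, 'b) monoid_scheme \<Rightarrow> 'a set \<Rightarrow> 'a set" where
  "normal_closure G R = \<Inter>{N. N \<lhd> G \<and> R \<subseteq> N}"

text \<open>
  Relators form a list rather than a set, so that a presentation may repeat a relator (each
  occurrence contributes its own 2-cell below), and they need not be freely reduced.
\<close>

definition presented_group :: "'g set \<Rightarrow> 'g word list \<Rightarrow> 'g word set set monoid" where
  "presented_group X rs =
     free_group X Mod normal_closure (free_group X) {free_rel X `` {r} | r. r \<in> set rs}"

lemma words_append [simp]: "u @ v \<in> words X \<longleftrightarrow> u \<in> words X \<and> v \<in> words X"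
  by (auto simp: words_def)

lemma free_rel_words: "(u, v) \<in> free_rel X \<Longrightarrow> u \<in> words X \<and> v \<in> words X"
  by (induction rule: free_rel.induct) (auto simp: words_def)

lemma equiv_free_rel: "equiv (words X) (free_rel X)"
  by (rule equivI)
     (auto simp: refl_on_def sym_def trans_def intro: free_rel.intros dest: free_rel_words)

lemma free_rel_append:
  assumes "(u, u') \<in> free_rel X" "(v, v') \<in> free_rel X"
  shows "(u @ v, u' @ v') \<in> free_rel X"
proof -
  have l: "(s @ w, s' @ w) \<in> free_rel X" if "(s, s') \<in> free_rel X" "w \<in> words X" for s s' w
    using that
  proof (induction rule: free_rel.induct)
    case (cancel u v a b)
    then show ?case
      using free_rel.cancel[of u X "v @ w" a b] by simp
  qed (auto intro: free_rel.intros)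
  have r: "(w @ s, w @ s') \<in> free_rel X" if "(s, s') \<in> free_rel X" "w \<in> words X" for s s' w
    using that
  proof (induction rule: free_rel.induct)
    case (cancel u v a b)
    then show ?case
      using free_rel.cancel[of "w @ u" X v a b] by simp
  qed (auto intro: free_rel.intros)
  show ?thesis
    using l[OF assms(1)] r[OF assms(2)] assms by (blast intro: free_rel.trans dest: free_rel_words)
qed

lemma mult_free_group:
  assumes "u \<in> words X" "v \<in> words X"
  shows "free_rel X `` {u} \<otimes>\<^bsub>free_group X\<^esub> free_rel X `` {v} = free_rel X `` {u @ v}"
proof -
  have "free_rel X `` {u' @ v' | u' v'. (u, u') \<in> free_rel X \<and> (v, v') \<in> free_rel X} =
        free_rel X `` {u @ v}"
    using assms free_rel.refl[of u X] free_rel.refl[of v X]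
    by (blast intro: free_rel_append free_rel.trans free_rel.sym)
  then show ?thesis
    by (simp add: free_group_def)
qed

lemma group_free_group: "group (free_group X)"
proof (rule groupI)
  let ?G = "free_group X"
  let ?c = "\<lambda>p. free_rel X `` {p}"
  have car: "carrier ?G = ?c ` words X"
    by (auto simp: free_group_def quotient_def)
  have one: "\<one>\<^bsub>?G\<^esub> = ?c []"
    by (simp add: free_group_def)
  have nil: "[] \<in> words X"
    by (simp add: words_def)
  show "\<one>\<^bsub>?G\<^esub> \<in> carrier ?G"
    using car one nil by auto
  show "A \<otimes>\<^bsub>?G\<^esub> B \<in> carrier ?G" if "A \<in> carrier ?G" "B \<in> carrier ?G" for A B
    using that by (auto simp: car mult_free_group)
  show "A \<otimes>\<^bsub>?G\<^esub> B \<otimes>\<^bsub>?G\<^esub> C = A \<otimes>\<^bsub>?G\<^esub> (B \<otimes>\<^bsub>?G\<^esub> C)"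
    if "A \<in> carrier ?G" "B \<in> carrier ?G" "C \<in> carrier ?G" for A B C
    using that by (auto simp: car mult_free_group)
  show "\<one>\<^bsub>?G\<^esub> \<otimes>\<^bsub>?G\<^esub> A = A" if "A \<in> carrier ?G" for A
    using that nil by (auto simp: car one mult_free_group)
  show "\<exists>B\<in>carrier ?G. B \<otimes>\<^bsub>?G\<^esub> A = \<one>\<^bsub>?G\<^esub>" if A: "A \<in> carrier ?G" for A
  proof -
    obtain w where w: "w \<in> words X" "A = ?c w"
      using A by (auto simp: car)
    have "\<exists>w'\<in>words X. (w' @ w, []) \<in> free_rel X"
      using w(1)
    proof (induction w)
      case Nil
      then show ?case
        using nil free_rel.refl by fastforce
    next
      case (Cons l w)
      obtain a b where l: "l = (a, b)"
        by (cases l)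
      have aw: "a \<in> X" "w \<in> words X"
        using Cons.prems by (auto simp: l words_def)
      obtain w' where w': "w' \<in> words X" "(w' @ w, []) \<in> free_rel X"
        using Cons.IH aw by blast
      have "(w' @ [(a, \<not> b), (a, b)] @ w, w' @ w) \<in> free_rel X"
        using free_rel.cancel[of w' X w a "\<not> b"] w' aw by simp
      then have "((w' @ [(a, \<not> b)]) @ l # w, []) \<in> free_rel X"
        using w'(2) by (simp add: l) (blast intro: free_rel.trans)
      moreover have "w' @ [(a, \<not> b)] \<in> words X"
        using w' aw by (simp add: words_def)
      ultimately show ?case
        by blast
    qed
    then obtain w' where w': "w' \<in> words X" "?c (w' @ w) = ?c []"
      using equiv_class_eq[OF equiv_free_rel] by blast
    with w show ?thesis
      by (auto simp: car one mult_free_group intro!: bexI[of _ "?c w'"])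
  qed
qed

lemma normal_normal_closure:
  assumes "group G" "R \<subseteq> carrier G"
  shows "normal_closure G R \<lhd> G"
proof -
  interpret group G
    by fact
  have ne: "carrier G \<in> {N. N \<lhd> G \<and> R \<subseteq> N}"
    using assms subgroup_self by (auto intro!: normal_invI)
  have "subgroup (normal_closure G R) G"
    unfolding normal_closure_def
    using ne by (intro subgroups_Inter) (auto simp: normal_imp_subgroup)
  then show ?thesis
    by (rule normal_invI) (auto simp: normal_closure_def normal_invE(2))
qed

lemma group_presented_group:
  assumes "set rs \<subseteq> words X"
  shows "group (presented_group X rs)"
  unfolding presented_group_def
  using assms
  by (intro normal.factorgroup_is_group normal_normal_closure group_free_group)
     (auto simp: free_group_def quotient_def)


section \<open>Limit groups\<close>

definition finitely_generated_group :: "('a, 'b) monoid_scheme \<Rightarrow> bool" where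
  "finitely_generated_group G \<longleftrightarrow>
     group G \<and> (\<exists>S. finite S \<and> S \<subseteq> carrier G \<and> generate G S = carrier G)"

definition limit_group :: "('a, 'b) monoid_scheme \<Rightarrow> bool" where
  "limit_group G \<longleftrightarrow>
     finitely_generated_group G \<and>
     (\<forall>S. finite S \<and> S \<subseteq> carrier G \<longrightarrow>
        (\<exists>(n::nat) f. f \<in> hom G (free_group {..<n}) \<and> inj_on f S))"


section \<open>The standard 2-complex of a presentation\<close>

text \<open>
  The points of the complex are those of its open cells: the vertex, the points of the open
  interval for every generator, and those of the open unit disc for every position in the list
  of relators. The characteristic maps on the closed cells are \<open>edge_map\<close> and \<open>face_map\<close>, and
  the topology is the quotient topology they induce. The boundary circle of the 2-cell of a
  relator \<open>w\<close> of length \<open>n\<close> is cut into \<open>n\<close> arcs of equal length, starting at \<open>1\<close> and going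
  counterclockwise; the \<open>k\<close>-th arc traverses the edge of the \<open>k\<close>-th letter of \<open>w\<close>, backwards if
  the letter is an inverse. The parameter \<open>t\<close> of \<open>attaching_map\<close> ranges over \<open>[0,1)\<close>.
\<close>

datatype 'g cell_point = Vertex | Edge 'g real | Face nat complex

definition edge_map :: "'g \<Rightarrow> real \<Rightarrow> 'g cell_point" where
  "edge_map a t = (if 0 < t \<and> t < 1 then Edge a t else Vertex)"

definition attaching_map :: "'g word \<Rightarrow> real \<Rightarrow> 'g cell_point" where
  "attaching_map w t =
     (if w = [] then Vertex
      else let s = real (length w) * t; (a, b) = w ! nat \<lfloor>s\<rfloor>
           in edge_map a (if b then frac s else 1 - frac s))"

definition face_map :: "'g word list \<Rightarrow> nat \<Rightarrow> complex \<Rightarrow> 'g cell_point" where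
  "face_map rs i z =
     (if norm z < 1 then Face i z else attaching_map (rs ! i) (Arg2pi z / (2 * pi)))"

definition complex_points :: "'g set \<Rightarrow> 'g word list \<Rightarrow> 'g cell_point set" where
  "complex_points X rs =
     {Vertex} \<union> {Edge a t | a t. a \<in> X \<and> 0 < t \<and> t < 1} \<union>
     {Face i z | i z. i < length rs \<and> norm z < 1}"

definition presentation_complex :: "'g set \<Rightarrow> 'g word list \<Rightarrow> 'g cell_point topology" where
  "presentation_complex X rs = topology (\<lambda>U.
     U \<subseteq> complex_points X rs \<and>
     (\<forall>a\<in>X. openin (top_of_set {0..1}) {t \<in> {0..1}. edge_map a t \<in> U}) \<and>
     (\<forall>i<length rs. openin (top_of_set (cball 0 1)) {z \<in> cball 0 1. face_map rs i z \<in> U}))"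

lemma openin_presentation_complex:
  "openin (presentation_complex X rs) U \<longleftrightarrow>
     U \<subseteq> complex_points X rs \<and>
     (\<forall>a\<in>X. openin (top_of_set {0..1}) {t \<in> {0..1}. edge_map a t \<in> U}) \<and>
     (\<forall>i<length rs. openin (top_of_set (cball 0 1)) {z \<in> cball 0 1. face_map rs i z \<in> U})"
proof -
  have int: "{t \<in> A. f t \<in> U \<inter> V} = {t \<in> A. f t \<in> U} \<inter> {t \<in> A. f t \<in> V}"
    for A :: "'c set" and f :: "'c \<Rightarrow> 'a cell_point" and U V
    by blast
  have un: "{t \<in> A. f t \<in> \<Union>\<K>} = (\<Union>U\<in>\<K>. {t \<in> A. f t \<in> U})"
    for A :: "'c set" and f :: "'c \<Rightarrow> 'a cell_point" and \<K>
    by blast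
  have "istopology (\<lambda>U.
     U \<subseteq> complex_points X rs \<and>
     (\<forall>a\<in>X. openin (top_of_set {0..1}) {t \<in> {0..1}. edge_map a t \<in> U}) \<and>
     (\<forall>i<length rs. openin (top_of_set (cball 0 1)) {z \<in> cball 0 1. face_map rs i z \<in> U}))"
    unfolding istopology_def int un by (blast intro: openin_Int openin_Union)
  then show ?thesis
    by (simp add: presentation_complex_def topology_inverse')
qed

lemma edge_map_in_complex_points: "a \<in> X \<Longrightarrow> edge_map a t \<in> complex_points X rs"
  by (auto simp: edge_map_def complex_points_def)

lemma face_map_in_complex_points:
  assumes "set rs \<subseteq> words X" "i < length rs"
  shows "face_map rs i z \<in> complex_points X rs"
proof -
  let ?w = "rs ! i" and ?t = "Arg2pi z / (2 * pi)"
  have "attaching_map ?w ?t \<in> complex_points X rs"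
  proof (cases "?w = []")
    case True
    then show ?thesis
      by (simp add: attaching_map_def complex_points_def)
  next
    case False
    have t: "0 \<le> ?t" "?t < 1"
      using Arg2pi[of z] by auto
    then have "real (length ?w) * ?t < real (length ?w)"
      using False mult_strict_left_mono[OF t(2), of "real (length ?w)"] by simp
    then have "\<lfloor>real (length ?w) * ?t\<rfloor> < int (length ?w)"
      by (simp only: floor_less_iff of_int_of_nat_eq)
    then have "nat \<lfloor>real (length ?w) * ?t\<rfloor> < length ?w"
      using False by (metis length_greater_0_conv nat_int of_nat_0_less_iff zless_nat_conj)
    then have "?w ! nat \<lfloor>real (length ?w) * ?t\<rfloor> \<in> X \<times> UNIV"
      using assms nth_mem[of i rs] nth_mem[of _ ?w] unfolding words_def by blast
    then show ?thesis
      using False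
      by (auto simp: attaching_map_def Let_def edge_map_in_complex_points split: prod.split)
  qed
  then show ?thesis
    using assms by (auto simp: face_map_def complex_points_def)
qed

lemma topspace_presentation_complex:
  assumes "set rs \<subseteq> words X"
  shows "topspace (presentation_complex X rs) = complex_points X rs"
proof -
  have "openin (presentation_complex X rs) (complex_points X rs)"
  proof -
    have "{t \<in> {0..1}. edge_map a t \<in> complex_points X rs} = {0..1}" if "a \<in> X" for a
      using edge_map_in_complex_points[OF that] by auto
    moreover have "{z \<in> cball 0 1. face_map rs i z \<in> complex_points X rs} = cball 0 1"
      if "i < length rs" for i
      using face_map_in_complex_points[OF assms that] by auto
    ultimately show ?thesis
      by (simp add: openin_presentation_complex del: atLeastAtMost_iff mem_cball)
  qed
  then show ?thesis
    by (meson openin_presentation_complex openin_subset openin_topspace subset_antisym)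
qed


section \<open>Homotopy groups and asphericity\<close>

text \<open>
  \<open>pi_set n X x\<close> is the underlying set of the \<open>n\<close>-th homotopy group of \<open>X\<close> at \<open>x\<close>: homotopy
  classes, relative to the boundary, of maps from the \<open>n\<close>-cube sending the boundary to \<open>x\<close>.
  The group vanishes iff the class of the constant map is the only one, so its
  multiplication is not needed.
\<close>

definition cube :: "nat \<Rightarrow> (nat \<Rightarrow> real) topology" where
  "cube n = product_topology (\<lambda>_. top_of_set {0..1}) {..<n}"

definition cube_boundary :: "nat \<Rightarrow> (nat \<Rightarrow> real) set" where
  "cube_boundary n = {t \<in> topspace (cube n). \<exists>i<n. t i = 0 \<or> t i = 1}"

definition based_cubes :: "nat \<Rightarrow> 'a topology \<Rightarrow> 'a \<Rightarrow> ((nat \<Rightarrow> real) \<Rightarrow> 'a) set" where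
  "based_cubes n X x = {f. continuous_map (cube n) X f \<and> (\<forall>t\<in>cube_boundary n. f t = x)}"

definition cube_rel ::
  "nat \<Rightarrow> 'a topology \<Rightarrow> 'a \<Rightarrow> (((nat \<Rightarrow> real) \<Rightarrow> 'a) \<times> ((nat \<Rightarrow> real) \<Rightarrow> 'a)) set" where
  "cube_rel n X x =
     {(f, g). f \<in> based_cubes n X x \<and> g \<in> based_cubes n X x \<and>
              homotopic_with (\<lambda>h. \<forall>t\<in>cube_boundary n. h t = x) (cube n) X f g}"

definition pi_set :: "nat \<Rightarrow> 'a topology \<Rightarrow> 'a \<Rightarrow> ((nat \<Rightarrow> real) \<Rightarrow> 'a) set set" where
  "pi_set n X x = based_cubes n X x // cube_rel n X x"

lemma equiv_cube_rel: "equiv (based_cubes n X x) (cube_rel n X x)"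
  unfolding cube_rel_def
  by (rule equivI)
     (auto simp: refl_on_def sym_def trans_def based_cubes_def homotopic_with_sym
           intro: homotopic_with_trans)

definition aspherical :: "'a topology \<Rightarrow> bool" where
  "aspherical X \<longleftrightarrow>
     (\<forall>n\<ge>2. \<forall>x\<in>topspace X. pi_set n X x = {cube_rel n X x `` {\<lambda>_. x}})"

definition aspherical_presentation :: "'g set \<Rightarrow> 'g word list \<Rightarrow> bool" where
  "aspherical_presentation X rs \<longleftrightarrow>
     set rs \<subseteq> words X \<and> aspherical (presentation_complex X rs)"

text \<open>A finite set of generators may be taken to consist of natural numbers.\<close>

definition has_finite_aspherical_presentation :: "('a, 'b) monoid_scheme \<Rightarrow> bool" where
  "has_finite_aspherical_presentation G \<longleftrightarrow>
     (\<exists>(X::nat set) rs. finite X \<and> aspherical_presentation X rs \<and> G \<cong> presented_group X rs)"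

end

theory Submission
  imports Defs "HOL-Algebra.Elementary_Groups"
begin

text \<open>
  Let \<open>u\<close> be a right homotopy inverse of \<open>d\<close>. Since the fundamental group of \<open>P\<close> is finitely generated, there are
  only finitely many coverings of \<open>P\<close> with a given finite fibre. Hence each of them is isomorphic to its pullback
  along some \<open>d ^^ k\<close> with \<open>k \<ge> 1\<close>, that is, \<open>d ^^ k\<close> lifts to a self-map of the covering. The lift is again a
  domination, so it is surjective on the second homology, a finitely generated free abelian group, and therefore
  injective.

  Limit groups are residually finite, so finite coverings detect homotopy classes of paths, and \<open>d\<close> is injective on
  these. Consider two discs in \<open>P\<close> with the same boundary whose images under \<open>d\<close> are homotopic relative to the
  boundary. The difference of their lifts to a finite covering is a cycle killed by the lift of a power of \<open>d\<close>,
  so it bounds. As \<open>P\<close> is 2-dimensional, a 2-cycle of the universal covering bounds if its local degrees at all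
  triangles vanish, and by residual finiteness each local degree can be read off in a finite covering. By Hurewicz, the
  two discs are homotopic relative to their boundary.

  So \<open>d\<close> reflects homotopies relative to the boundary of points, paths and discs. Simplex by simplex this yields a
  right homotopy inverse of \<open>u\<close>, so \<open>u\<close> and \<open>d\<close> are homotopy equivalences.
\<close>

subsection \<open>Finite actions of limit groups\<close>

text \<open>Finite coverings are forced by finite rank: the second homology of the universal
  covering is in general not finitely generated as an abelian group, and there a surjective
  endomorphism may have a kernel. The price is that \<open>d\<close> itself need not lift to a given
  finite covering, only a power \<open>d ^^ k\<close>; this is harmless, because whatever
  \<open>d\<close> identifies is identified by \<open>d ^^ k\<close> too. A covering is encoded by
  its monodromy, a function from paths to permutations of one fixed fibre. Pulling back along a map
  is then precomposition, an isomorphism of coverings is a family of permutations of the fibre, and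
  counting coverings is counting values on generating loops. The topology of the total space serves
  only to define its singular homology. Hurewicz is used in one direction, for discs with common
  boundary, and comes from an explicit inverse: singular simplices of the universal covering are
  pushed to the base point along prisms, built dimension by dimension. Working relative to
  boundaries, rather than with homotopy groups, lets the last induction over simplices run without
  base points.\<close>

definition linv :: "'g \<times> bool \<Rightarrow> 'g \<times> bool" where
  "linv l = (fst l, \<not> snd l)"

abbreviation reduced :: "'g word \<Rightarrow> bool" where
  "reduced \<equiv> successively (\<lambda>x y. y \<noteq> linv x)"

text \<open>Right multiplication by one letter in the tree of freely reduced words;
  \<open>foldl rmul []\<close> computes the reduced form of a word.\<close>

definition rmul :: "'g word \<Rightarrow> 'g \<times> bool \<Rightarrow> 'g word" where
  "rmul e l = (if e \<noteq> [] \<and> last e = linv l then butlast e else e @ [l])"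

lemma linv_linv [simp]: "linv (linv l) = l"
  by (simp add: linv_def)

lemma reduced_snoc: "reduced (e @ [l]) \<longleftrightarrow> reduced e \<and> (e = [] \<or> l \<noteq> linv (last e))"
  by (auto simp: successively_append_iff)

lemma reduced_rmul: "reduced e \<Longrightarrow> reduced (rmul e l)"
proof (cases e rule: rev_cases)
  case (snoc ys y)
  assume "reduced e"
  then have "reduced ys" "ys = [] \<or> y \<noteq> linv (last ys)"
    using snoc by (simp_all add: reduced_snoc)
  moreover have "l \<noteq> linv y" if "y \<noteq> linv l"
    using that by auto
  ultimately show ?thesis
    using snoc reduced_snoc[of ys y] reduced_snoc[of "ys @ [y]" l] by (simp add: rmul_def)
qed (simp add: rmul_def)

text \<open>If \<open>l\<close> has cancelled the last letter of \<open>e\<close>, reducedness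
  prevents the restored letter from cancelling the letter before it.\<close>

lemma rmul_rmul_linv:
  assumes "reduced e"
  shows "rmul (rmul e l) (linv l) = e"
proof (cases e rule: rev_cases)
  case (snoc ys y)
  have "ys = [] \<or> y \<noteq> linv (last ys)"
    using assms snoc by (simp add: reduced_snoc)
  then have "last ys \<noteq> l" if "y = linv l" "ys \<noteq> []"
    using that by auto
  with snoc show ?thesis
    by (auto simp: rmul_def butlast_append)
qed (simp add: rmul_def)

lemma reduced_foldl_rmul: "reduced e \<Longrightarrow> reduced (foldl rmul e w)"
  by (induction w arbitrary: e) (auto simp: reduced_rmul)

lemma rmul_in_words: "e \<in> words X \<Longrightarrow> l \<in> X \<times> UNIV \<Longrightarrow> rmul e l \<in> words X"
  by (cases e rule: rev_cases) (auto simp: rmul_def words_def)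

lemma free_rel_rmul:
  assumes "e \<in> words X" "l \<in> X \<times> UNIV"
  shows "(e @ [l], rmul e l) \<in> free_rel X"
proof (cases "e \<noteq> [] \<and> last e = linv l")
  case True
  then obtain e' where e: "e = e' @ [linv l]"
    by (metis append_butlast_last_id)
  have "(e' @ [(fst l, \<not> snd l), (fst l, \<not> \<not> snd l)] @ [], e' @ []) \<in> free_rel X"
    using assms e by (intro free_rel.cancel) (auto simp: words_def)
  with True e show ?thesis
    by (simp add: rmul_def linv_def)
next
  case False
  then show ?thesis
    using assms by (auto simp: rmul_def words_def intro!: free_rel.refl)
qed

lemma free_rel_foldl_rmul:
  assumes "e \<in> words X" "w \<in> words X"
  shows "(e @ w, foldl rmul e w) \<in> free_rel X"
  using assms
proof (induction w arbitrary: e)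
  case Nil
  then show ?case
    by (simp add: free_rel.refl)
next
  case (Cons l w)
  have l: "l \<in> X \<times> UNIV" "w \<in> words X"
    using Cons.prems by (auto simp: words_def)
  have "((e @ [l]) @ w, rmul e l @ w) \<in> free_rel X"
    using free_rel_append[OF free_rel_rmul[OF Cons.prems(1) l(1)] free_rel.refl[OF l(2)]] .
  moreover have "(rmul e l @ w, foldl rmul (rmul e l) w) \<in> free_rel X"
    using Cons.IH[OF rmul_in_words[OF Cons.prems(1) l(1)] l(2)] .
  ultimately show ?case
    by (auto intro: free_rel.trans)
qed

text \<open>Domain and image of a partial injection have equally large complements in a finite set,
  so a bijection of the complements completes it.\<close>

lemma extend_partial_bij:
  assumes "finite V" "D \<subseteq> V" "inj_on f D" "f ` D \<subseteq> V"
  obtains p where "bij_betw p V V" "\<And>x. x \<in> D \<Longrightarrow> p x = f x"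
proof -
  have "card (V - D) = card (V - f ` D)"
    using assms by (simp add: card_Diff_subset finite_subset card_image)
  then obtain h where h: "bij_betw h (V - D) (V - f ` D)"
    using assms(1) by (metis finite_Diff finite_same_card_bij)
  define p where "p = (\<lambda>x. if x \<in> D then f x else h x)"
  have "bij_betw p (D \<union> (V - D)) (f ` D \<union> (V - f ` D))"
  proof (rule bij_betw_combine)
    show "bij_betw p D (f ` D)"
      using assms(3) by (auto simp: p_def bij_betw_def inj_on_def)
    show "bij_betw p (V - D) (V - f ` D)"
      using h bij_betw_cong[of "V - D" p h] by (simp add: p_def)
  qed auto
  moreover have "D \<union> (V - D) = V" "f ` D \<union> (V - f ` D) = V"
    using assms by auto
  ultimately show thesis
    using that[of p] by (auto simp: p_def)
qed

text \<open>Truncating the Cayley graph of a free group at radius \<open>L\<close>: left multiplication by a generator is a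
  partial injection of the finite ball, so it extends to a permutation of it.\<close>

lemma free_group_ball_action:
  assumes X: "finite X"
  obtains step :: "'g word \<Rightarrow> 'g \<times> bool \<Rightarrow> 'g word"
  where "\<And>l. l \<in> X \<times> UNIV \<Longrightarrow> bij_betw (\<lambda>e. step e l) {w \<in> words X. reduced w \<and> length w \<le> L} {w \<in> words X. reduced w \<and> length w \<le> L}"
    and "\<And>l e. l \<in> X \<times> UNIV \<Longrightarrow> e \<in> {w \<in> words X. reduced w \<and> length w \<le> L} \<Longrightarrow> step (step e l) (linv l) = e"
    and "\<And>w. w \<in> words X \<Longrightarrow> reduced w \<Longrightarrow> length w \<le> L \<Longrightarrow> foldl step [] w = w"
proof -
  define V where "V = {w \<in> words X. reduced w \<and> length w \<le> L}"
  have "V \<subseteq> {w. set w \<subseteq> X \<times> UNIV \<and> length w \<le> L}"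
    by (auto simp: V_def words_def)
  then have V: "finite V"
    using finite_lists_length_le[of "X \<times> (UNIV::bool set)" L] X by (meson finite_SigmaI finite finite_subset)
  define D where "D l = {e \<in> V. rmul e l \<in> V}" for l
  have "\<exists>p. bij_betw p V V \<and> (\<forall>e\<in>D (a, True). p e = rmul e (a, True))" for a
  proof -
    have "inj_on (\<lambda>e. rmul e (a, True)) (D (a, True))"
      by (rule inj_on_inverseI[where g = "\<lambda>e. rmul e (linv (a, True))"]) (simp add: D_def V_def rmul_rmul_linv)
    then show ?thesis
      using extend_partial_bij[OF V, of "D (a, True)" "\<lambda>e. rmul e (a, True)"] by (auto simp: D_def)
  qed
  then have "\<forall>a. \<exists>p. bij_betw p V V \<and> (\<forall>e\<in>D (a, True). p e = rmul e (a, True))"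
    by blast
  from choice[OF this] obtain p where p: "\<And>a. bij_betw (p a) V V" "\<And>a e. e \<in> D (a, True) \<Longrightarrow> p a e = rmul e (a, True)"
    by blast
  \<comment> \<open>Only positive letters get a chosen permutation. Inverse letters act by the
    inverse permutations, so the cancellation law holds on the whole ball, while along edges inside
    the ball every letter still acts as \<open>rmul\<close>.\<close>
  define step where "step e l = (if snd l then p (fst l) e else inv_into V (p (fst l)) e)" for e l
  have bij: "bij_betw (\<lambda>e. step e l) V V" for l
    using p(1)[of "fst l"] bij_betw_inv_into[OF p(1)[of "fst l"]] unfolding step_def
    by (cases "snd l") (simp_all only: if_True if_False)
  have cancel: "step (step e l) (linv l) = e" if "e \<in> V" for e l
    using bij_betw_inv_into_left[OF p(1)[of "fst l"] that] bij_betw_inv_into_right[OF p(1)[of "fst l"] that]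
    unfolding step_def linv_def by (cases "snd l") simp_all
  have fold: "foldl step [] w = w" if "w \<in> words X" "reduced w" "length w \<le> L" for w
    using that
  proof (induction w rule: rev_induct)
    case (snoc l w)
    then have w: "w \<in> V" and wl: "w @ [l] \<in> V"
      by (auto simp: V_def reduced_snoc)
    have eq: "rmul w l = w @ [l]"
      using snoc.prems by (cases "w = []") (auto simp: rmul_def reduced_snoc)
    have "step w l = w @ [l]"
    proof (cases "snd l")
      case True
      then have l: "(fst l, True) = l"
        by (cases l) auto
      have "w \<in> D l"
        using w wl eq by (simp add: D_def)
      then show ?thesis
        using True p(2)[of w "fst l"] l eq by (simp add: step_def)
    next
      case False
      then have l: "(fst l, True) = linv l"
        by (cases l) (auto simp: linv_def)
      have r: "rmul (w @ [l]) (linv l) = w"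
        by (simp add: rmul_def)
      then have "w @ [l] \<in> D (linv l)"
        using w wl by (simp add: D_def)
      then have "p (fst l) (w @ [l]) = w"
        using p(2)[of "w @ [l]" "fst l"] l r by simp
      then have "inv_into V (p (fst l)) w = w @ [l]"
        using p(1)[of "fst l"] wl by (metis bij_betw_inv_into_left)
      then show ?thesis
        using False by (simp add: step_def)
    qed
    with snoc w show ?case
      by (simp add: V_def)
  qed simp
  show thesis
    using that[of step] bij cancel fold unfolding V_def by blast
qed

text \<open>Cancellation of adjacent inverse letters is the only generator of
  \<open>free_rel\<close>, so permutations satisfying the cancellation law define an action of the
  free group.\<close>

lemma foldl_step_free_rel:
  assumes step: "\<And>l. l \<in> X \<times> UNIV \<Longrightarrow> bij_betw (\<lambda>e. step e l) V V"
    and cancel: "\<And>l e. l \<in> X \<times> UNIV \<Longrightarrow> e \<in> V \<Longrightarrow> step (step e l) (linv l) = e"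
  shows "w \<in> words X \<Longrightarrow> bij_betw (\<lambda>e. foldl step e w) V V"
    and "(w, w') \<in> free_rel X \<Longrightarrow> e \<in> V \<Longrightarrow> foldl step e w = foldl step e w'"
proof -
  show bij: "bij_betw (\<lambda>e. foldl step e w) V V" if "w \<in> words X" for w
    using that
  proof (induction w)
    case Nil
    then show ?case
      by (simp add: bij_betw_def)
  next
    case (Cons l w)
    then have "l \<in> X \<times> UNIV" "w \<in> words X"
      by (auto simp: words_def)
    with Cons.IH step show ?case
      using bij_betw_trans[of "\<lambda>e. step e l" V V "\<lambda>e. foldl step e w" V] by (simp add: o_def)
  qed
  show "foldl step e w = foldl step e w'" if "(w, w') \<in> free_rel X" "e \<in> V" for e w w'
    using that
  proof (induction arbitrary: e rule: free_rel.induct)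
    case (cancel u v a b)
    then have "foldl step e u \<in> V"
      using bij[of u] by (auto simp: bij_betw_def)
    with cancel show ?case
      using assms(2)[of "(a, b)" "foldl step e u"] by (simp add: linv_def)
  qed auto
qed

text \<open>Residual finiteness in the form needed for coverings: the orbit of a single point
  separates the given elements. A homomorphism to a free group is composed with the action on a ball
  of reduced words; moving the empty word by \<open>g\<close> returns the reduced word of
  \<open>f g\<close>, as long as the ball contains it. Products act in the order of path
  concatenation.\<close>

lemma limit_group_finite_action:
  assumes G: "limit_group G" and S: "finite S" "S \<subseteq> carrier G"
  obtains V :: "nat word set" and act :: "'a \<Rightarrow> nat word \<Rightarrow> nat word" and e0
  where "finite V" "e0 \<in> V" "\<And>g. g \<in> carrier G \<Longrightarrow> bij_betw (act g) V V"
    "\<And>g h e. g \<in> carrier G \<Longrightarrow> h \<in> carrier G \<Longrightarrow> e \<in> V \<Longrightarrow> act (g \<otimes>\<^bsub>G\<^esub> h) e = act h (act g e)"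
    "inj_on (\<lambda>g. act g e0) S"
proof -
  obtain n :: nat and f where f: "f \<in> hom G (free_group {..<n})" "inj_on f S"
    using G S unfolding limit_group_def by blast
  let ?X = "{..<n}"
  have "\<exists>w\<in>words ?X. f g = free_rel ?X `` {w}" if "g \<in> carrier G" for g
    using hom_in_carrier[OF f(1) that] by (auto simp: free_group_def quotient_def)
  then obtain w0 where w0: "\<And>g. g \<in> carrier G \<Longrightarrow> w0 g \<in> words ?X" "\<And>g. g \<in> carrier G \<Longrightarrow> f g = free_rel ?X `` {w0 g}"
    by metis
  define w where "w g = foldl rmul [] (w0 g)" for g
  have w: "w g \<in> words ?X" "f g = free_rel ?X `` {w g}" "reduced (w g)" if "g \<in> carrier G" for g
  proof -
    have *: "(w0 g, w g) \<in> free_rel ?X"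
      using free_rel_foldl_rmul[of "[]" ?X "w0 g"] w0(1)[OF that] by (simp add: w_def words_def)
    then show "w g \<in> words ?X"
      by (auto dest: free_rel_words)
    show "f g = free_rel ?X `` {w g}"
      using w0(2)[OF that] equiv_class_eq[OF equiv_free_rel *] by simp
    show "reduced (w g)"
      by (simp add: w_def reduced_foldl_rmul)
  qed
  \<comment> \<open>The radius is the largest length occurring for \<open>S\<close>, so on the empty
    word these elements act as in the full Cayley graph; \<open>insert 0\<close> covers the empty
    set.\<close>
  define L where "L = Max (insert 0 ((length \<circ> w) ` S))"
  define V where "V = {u \<in> words ?X. reduced u \<and> length u \<le> L}"
  obtain step where bij: "\<And>l. l \<in> ?X \<times> UNIV \<Longrightarrow> bij_betw (\<lambda>e. step e l) V V"
    and cancel: "\<And>l e. l \<in> ?X \<times> UNIV \<Longrightarrow> e \<in> V \<Longrightarrow> step (step e l) (linv l) = e"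
    and id: "\<And>u. u \<in> words ?X \<Longrightarrow> reduced u \<Longrightarrow> length u \<le> L \<Longrightarrow> foldl step [] u = u"
    by (rule free_group_ball_action[OF finite_lessThan[of n], of L, folded V_def]) (rule that)
  have bij': "bij_betw (\<lambda>e. foldl step e u) V V" if "u \<in> words ?X" for u
    using foldl_step_free_rel(1)[of ?X step V u] bij cancel that by blast
  have rel: "foldl step e u = foldl step e u'" if "(u, u') \<in> free_rel ?X" "e \<in> V" for u u' e
    using foldl_step_free_rel(2)[of ?X step V u u' e] bij cancel that by blast
  define act where "act = (\<lambda>g e. foldl step e (w g))"
  have "V \<subseteq> {u. set u \<subseteq> ?X \<times> UNIV \<and> length u \<le> L}"
    by (auto simp: V_def words_def)
  then have "finite V"
    using finite_lists_length_le[of "?X \<times> (UNIV::bool set)" L] by (meson finite_SigmaI finite finite_lessThan finite_subset)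
  moreover have "[] \<in> V"
    by (simp add: V_def words_def)
  moreover have "bij_betw (act g) V V" if "g \<in> carrier G" for g
    using bij'[OF w(1)[OF that]] unfolding act_def .
  moreover have "act (g \<otimes>\<^bsub>G\<^esub> h) e = act h (act g e)" if gh: "g \<in> carrier G" "h \<in> carrier G" "e \<in> V" for g h e
  proof -
    have gr: "group G"
      using G by (simp add: limit_group_def finitely_generated_group_def)
    have c: "g \<otimes>\<^bsub>G\<^esub> h \<in> carrier G"
      using gh gr by (simp add: group.is_monoid monoid.m_closed)
    have *: "free_rel ?X `` {w (g \<otimes>\<^bsub>G\<^esub> h)} = free_rel ?X `` {w g @ w h}"
      using w(2)[OF c] hom_mult[OF f(1) gh(1,2)] w[OF gh(1)] w[OF gh(2)] by (simp add: mult_free_group)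
    then have "(w (g \<otimes>\<^bsub>G\<^esub> h), w g @ w h) \<in> free_rel ?X"
      using eq_equiv_class[OF * equiv_free_rel] w(1)[OF gh(1)] w(1)[OF gh(2)] by simp
    from rel[OF this gh(3)] show ?thesis
      by (simp add: act_def)
  qed
  moreover have "inj_on (\<lambda>g. act g []) S"
  proof (rule inj_onI)
    fix g h assume gh: "g \<in> S" "h \<in> S" "act g [] = act h []"
    have "act k [] = w k" if "k \<in> S" for k
      using w[of k] that S id[of "w k"] by (auto simp: act_def L_def)
    with gh have "f g = f h"
      using w(2) S by (metis subsetD)
    with gh f(2) show "g = h"
      by (auto dest: inj_onD)
  qed
  ultimately show thesis
    using that by blast
qed

subsection \<open>Surjective endomorphisms of subgroups of a free abelian group\<close>

text \<open>Elimination without division: an equation with a nonzero pivot removes one unknown, and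
  cross-multiplication keeps the coefficients integral.\<close>

lemma int_homogeneous_system:
  fixes M :: "'i \<Rightarrow> 'k \<Rightarrow> int"
  assumes "finite I" "finite K" "card I < card K"
  shows "\<exists>c. (\<exists>k\<in>K. c k \<noteq> 0) \<and> (\<forall>i\<in>I. (\<Sum>k\<in>K. c k * M i k) = 0)"
  using assms
proof (induction I arbitrary: K M rule: finite_induct)
  case empty
  then obtain k where "k \<in> K"
    by fastforce
  then show ?case
    by (intro exI[of _ "\<lambda>_. 1"]) auto
next
  case (insert i I)
  show ?case
  proof (cases "\<forall>k\<in>K. M i k = 0")
    case True
    obtain c where "\<exists>k\<in>K. c k \<noteq> 0" "\<forall>j\<in>I. (\<Sum>k\<in>K. c k * M j k) = 0"
      using insert.IH[of K M] insert.prems insert.hyps by auto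
    then show ?thesis
      using True by (intro exI[of _ c]) simp
  next
    case False
    then obtain p where p: "p \<in> K" "M i p \<noteq> 0"
      by blast
    let ?K = "K - {p}"
    \<comment> \<open>Minors along the pivot. \<open>N i k\<close> vanishes identically, so the
      eliminated equation holds by itself once the pivot unknown is chosen as in
      \<open>c'\<close>.\<close>
    define N where "N j k = M i p * M j k - M i k * M j p" for j k
    have "finite ?K" "card I < card ?K"
      using insert.prems insert.hyps p by auto
    then obtain c where c: "\<exists>k\<in>?K. c k \<noteq> 0" "\<forall>j\<in>I. (\<Sum>k\<in>?K. c k * N j k) = 0"
      using insert.IH[of ?K N] by blast
    define c' where "c' k = (if k = p then - (\<Sum>k\<in>?K. c k * M i k) else M i p * c k)" for k
    have row: "(\<Sum>k\<in>K. c' k * M j k) = (\<Sum>k\<in>?K. c k * N j k)" for j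
    proof -
      have "(\<Sum>k\<in>K. c' k * M j k) = c' p * M j p + (\<Sum>k\<in>?K. c' k * M j k)"
        using p insert.prems(1) by (simp add: sum.remove)
      also have "(\<Sum>k\<in>?K. c' k * M j k) = (\<Sum>k\<in>?K. M i p * c k * M j k)"
        by (intro sum.cong) (auto simp: c'_def)
      also have "c' p * M j p = (\<Sum>k\<in>?K. - (c k * M i k * M j p))"
        by (simp add: c'_def sum_distrib_right sum_negf)
      finally show ?thesis
        by (simp add: N_def sum.distrib[symmetric] algebra_simps sum_subtractf)
    qed
    have "(\<Sum>k\<in>?K. c k * N i k) = 0"
      by (simp add: N_def)
    moreover have "\<exists>k\<in>K. c' k \<noteq> 0"
      using c(1) p by (auto simp: c'_def)
    ultimately show ?thesis
      using c(2) row by (intro exI[of _ c']) auto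
  qed
qed

text \<open>If \<open>a\<^sub>0\<close> is a nontrivial element of the kernel and \<open>\<phi> a\<^sub>n\<^sub>+\<^sub>1 = a\<^sub>n\<close>, then the
  \<open>a\<^sub>n\<close> are independent over the integers, contradicting finite rank.\<close>

lemma surj_endomorphism_finite_rank_inj:
  assumes A: "comm_group A" and phi: "\<phi> \<in> hom A A" "\<phi> ` carrier A = carrier A"
    and I: "finite I" and lamh: "\<And>i. i \<in> I \<Longrightarrow> lam i \<in> hom A integer_group"
    and inj: "\<And>x. x \<in> carrier A \<Longrightarrow> (\<And>i. i \<in> I \<Longrightarrow> lam i x = 0) \<Longrightarrow> x = \<one>\<^bsub>A\<^esub>"
    and x: "x \<in> carrier A" "\<phi> x = \<one>\<^bsub>A\<^esub>"
  shows "x = \<one>\<^bsub>A\<^esub>"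
proof (rule ccontr)
  assume x1: "x \<noteq> \<one>\<^bsub>A\<^esub>"
  interpret A: comm_group A
    by fact
  interpret phi: group_hom A A \<phi>
    using phi by unfold_locales auto
  have "\<forall>y\<in>carrier A. \<exists>z\<in>carrier A. \<phi> z = y"
    using phi(2) by (metis imageE)
  then obtain g where g: "\<And>y. y \<in> carrier A \<Longrightarrow> g y \<in> carrier A \<and> \<phi> (g y) = y"
    by metis
  define a where "a = rec_nat x (\<lambda>_. g)"
  have a0: "a 0 = x" and aS: "a (Suc n) = g (a n)" for n
    by (auto simp: a_def)
  have a: "a n \<in> carrier A" for n
    by (induction n) (auto simp: a0 aS x g)
  have phia: "\<phi> (a (Suc n)) = a n" for n
    using a g by (simp add: aS)
  \<comment> \<open>\<open>P c n\<close> is the product of the \<open>a k\<close> raised to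
    \<open>c k\<close> for \<open>k < n\<close>. Since \<phi> kills \<open>a 0\<close> and moves
    every other \<open>a k\<close> one place down, it shifts the coefficients; this drives the
    induction in \<open>indep\<close>.\<close>
  define P where "P = (\<lambda>c::nat \<Rightarrow> int. rec_nat \<one>\<^bsub>A\<^esub> (\<lambda>n y. y \<otimes>\<^bsub>A\<^esub> a n [^]\<^bsub>A\<^esub> c n))"
  have P0: "P c 0 = \<one>\<^bsub>A\<^esub>" and PS: "P c (Suc n) = P c n \<otimes>\<^bsub>A\<^esub> a n [^]\<^bsub>A\<^esub> c n" for c n
    by (auto simp: P_def)
  have P: "P c n \<in> carrier A" for c n
    by (induction n) (auto simp: P0 PS a)
  have lP: "lam i (P c n) = (\<Sum>k<n. c k * lam i (a k))" if "i \<in> I" for i c n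
  proof -
    interpret l: group_hom A integer_group "lam i"
      using lamh[OF that] by (simp add: group_hom_def group_hom_axioms_def)
    show ?thesis
      by (induction n) (auto simp: P0 PS P a l.hom_int_pow mult.commute)
  qed
  have phiP: "\<phi> (P c (Suc n)) = P (c \<circ> Suc) n" for c n
  proof (induction n)
    case 0
    then show ?case
      using x by (simp add: P0 PS a0 phi.hom_int_pow)
  next
    case (Suc n)
    then show ?case
      using P a by (simp add: PS[of c "Suc n"] PS[of "\<lambda>k. c (Suc k)" n] phi.hom_int_pow phia)
  qed
  have indep: "P c n = \<one>\<^bsub>A\<^esub> \<Longrightarrow> k < n \<Longrightarrow> c k = 0" for c n k
  proof (induction n arbitrary: c k)
    case (Suc n)
    have "P (c \<circ> Suc) n = \<one>\<^bsub>A\<^esub>"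
      using Suc.prems(1) by (simp flip: phiP)
    then have S: "c (Suc k) = 0" if "k < n" for k
      using Suc.IH[OF \<open>P (c \<circ> Suc) n = \<one>\<^bsub>A\<^esub>\<close> that] by simp
    have "P c (Suc m) = x [^]\<^bsub>A\<^esub> c 0" if "m \<le> n" for m
      using that
    proof (induction m)
      case 0
      then show ?case
        using x by (simp add: P0 PS a0)
    next
      case (Suc m)
      then show ?case
        using S[of m] x by (simp add: PS[of c "Suc m"])
    qed
    then have "x [^]\<^bsub>A\<^esub> c 0 = \<one>\<^bsub>A\<^esub>"
      using Suc.prems(1) by simp
    \<comment> \<open>A power of \<open>x\<close> is trivial. Integer-valued functionals separate
      the points of \<open>A\<close>, so there is no torsion and the exponent is 0.\<close>
    have "c 0 * lam i x = 0" if "i \<in> I" for i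
    proof -
      interpret l: group_hom A integer_group "lam i"
        using lamh[OF that] by (simp add: group_hom_def group_hom_axioms_def)
      have "lam i (x [^]\<^bsub>A\<^esub> c 0) = lam i x * c 0"
        using x by (simp add: l.hom_int_pow mult.commute)
      then show ?thesis
        using \<open>x [^]\<^bsub>A\<^esub> c 0 = \<one>\<^bsub>A\<^esub>\<close> l.hom_one by auto
    qed
    with inj x x1 have "c 0 = 0"
      by (metis mult_eq_0_iff)
    with S Suc.prems(2) show ?case
      by (cases k) auto
  qed simp
  \<comment> \<open>One element more than there are functionals: some nontrivial combination is
    killed by all of them, hence is the neutral element.\<close>
  let ?n = "Suc (card I)"
  obtain c where c: "\<exists>k<?n. c k \<noteq> 0" "\<forall>i\<in>I. (\<Sum>k<?n. c k * lam i (a k)) = 0"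
    using int_homogeneous_system[OF I, of "{..<?n}" "\<lambda>i k. lam i (a k)"] by auto
  have "P c ?n = \<one>\<^bsub>A\<^esub>"
    using c(2) lP P by (intro inj) auto
  with indep c(1) show False
    by blast
qed

subsection \<open>Covering spaces defined by path transport\<close>

text \<open>Local simple connectivity in its simplest usable form: near \<open>x\<close> every path
  starting at \<open>x\<close> can be replaced by the segment to its end.\<close>

definition star_radius :: "'a::real_normed_vector set \<Rightarrow> 'a \<Rightarrow> real \<Rightarrow> bool" where
  "star_radius P x d \<longleftrightarrow> 0 < d \<and> (\<forall>y\<in>P \<inter> ball x d. closed_segment x y \<subseteq> P)"

definition locally_starlike :: "'a::real_normed_vector set \<Rightarrow> bool" where
  "locally_starlike P \<longleftrightarrow> (\<forall>x\<in>P. \<exists>d. star_radius P x d)"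

lemma star_radius_mono: "star_radius P x d \<Longrightarrow> 0 < r \<Longrightarrow> r \<le> d \<Longrightarrow> star_radius P x r"
  unfolding star_radius_def by force

lemma star_radius_starlike:
  assumes "star_radius P x d" "x \<in> P"
  shows "starlike (P \<inter> ball x d)"
proof -
  have "closed_segment x y \<subseteq> P \<inter> ball x d" if "y \<in> P \<inter> ball x d" for y
  proof -
    have "x \<in> ball x d" "y \<in> ball x d"
      using assms that by (auto simp: star_radius_def)
    then have "closed_segment x y \<subseteq> ball x d"
      by (rule closed_segment_subset) simp
    with that assms show ?thesis
      by (auto simp: star_radius_def)
  qed
  moreover have "x \<in> P \<inter> ball x d"
    using assms by (auto simp: star_radius_def)
  ultimately show ?thesis
    unfolding starlike_def by blast
qed

lemma star_homotopic_paths: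
  assumes "star_radius P x d" "x \<in> P"
    and "path p" "path_image p \<subseteq> P \<inter> ball x d" "path q" "path_image q \<subseteq> P \<inter> ball x d"
    and "pathstart q = pathstart p" "pathfinish q = pathfinish p"
  shows "homotopic_paths P p q"
proof -
  have "simply_connected (P \<inter> ball x d)"
    using star_radius_starlike[OF assms(1,2)] by (rule starlike_imp_simply_connected)
  then have "homotopic_paths (P \<inter> ball x d) p q"
    using assms unfolding simply_connected_eq_homotopic_paths by blast
  then show ?thesis
    by (rule homotopic_paths_subset) auto
qed

text \<open>A transport \<open>\<rho>\<close> moves the fibre over the start of a path to the fibre over its end. In the covering space,
  the lift of \<open>p\<close> starting at \<open>(pathstart p, e)\<close> ends at \<open>(pathfinish p, \<rho> p e)\<close>, and a set is open if
  it contains the ends of the lifts of all short paths starting in it.\<close>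

definition cover_space :: "'a::real_normed_vector set \<Rightarrow> 'e set \<Rightarrow> ((real \<Rightarrow> 'a) \<Rightarrow> 'e \<Rightarrow> 'e) \<Rightarrow> ('a \<times> 'e) topology" where
  "cover_space P E \<rho> = topology (\<lambda>U. U \<subseteq> P \<times> E \<and>
     (\<forall>x e. (x, e) \<in> U \<longrightarrow> (\<exists>r>0. \<forall>p. path p \<and> path_image p \<subseteq> P \<inter> ball x r \<and> pathstart p = x \<longrightarrow>
        (pathfinish p, \<rho> p e) \<in> U)))"

lemma openin_cover_space:
  "openin (cover_space P E \<rho>) U \<longleftrightarrow> U \<subseteq> P \<times> E \<and>
     (\<forall>x e. (x, e) \<in> U \<longrightarrow> (\<exists>r>0. \<forall>p. path p \<and> path_image p \<subseteq> P \<inter> ball x r \<and> pathstart p = x \<longrightarrow>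
        (pathfinish p, \<rho> p e) \<in> U))"
proof -
  let ?Q = "\<lambda>U. U \<subseteq> P \<times> E \<and>
     (\<forall>x e. (x, e) \<in> U \<longrightarrow> (\<exists>r>0. \<forall>p. path p \<and> path_image p \<subseteq> P \<inter> ball x r \<and> pathstart p = x \<longrightarrow>
        (pathfinish p, \<rho> p e) \<in> U))"
  have int: "?Q (U \<inter> V)" if U: "?Q U" and V: "?Q V" for U V
  proof (intro conjI allI impI)
    show "U \<inter> V \<subseteq> P \<times> E"
      using U by blast
    fix x e assume xe: "(x, e) \<in> U \<inter> V"
    let ?N = "\<lambda>U r. \<forall>p. path p \<and> path_image p \<subseteq> P \<inter> ball x r \<and> pathstart p = x \<longrightarrow> (pathfinish p, \<rho> p e) \<in> U"
    have "\<exists>r>0. ?N U r" "\<exists>r>0. ?N V r"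
      using U V xe by auto
    then obtain r s where "r > 0" "s > 0" "?N U r" "?N V s"
      by blast
    then show "\<exists>r>0. \<forall>p. path p \<and> path_image p \<subseteq> P \<inter> ball x r \<and> pathstart p = x \<longrightarrow>
        (pathfinish p, \<rho> p e) \<in> U \<inter> V"
      by (intro exI[of _ "min r s"]) (simp add: ball_min_Int)
  qed
  have un: "?Q (\<Union>K)" if K: "\<forall>U\<in>K. ?Q U" for K
  proof (intro conjI allI impI)
    show "\<Union>K \<subseteq> P \<times> E"
      using K by blast
    fix x e assume "(x, e) \<in> \<Union>K"
    then obtain U where U: "U \<in> K" "(x, e) \<in> U"
      by blast
    then have "\<exists>r>0. \<forall>p. path p \<and> path_image p \<subseteq> P \<inter> ball x r \<and> pathstart p = x \<longrightarrow>
        (pathfinish p, \<rho> p e) \<in> U"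
      using K by auto
    then obtain r where "r > 0" "\<forall>p. path p \<and> path_image p \<subseteq> P \<inter> ball x r \<and> pathstart p = x \<longrightarrow>
        (pathfinish p, \<rho> p e) \<in> U"
      by blast
    with U show "\<exists>r>0. \<forall>p. path p \<and> path_image p \<subseteq> P \<inter> ball x r \<and> pathstart p = x \<longrightarrow>
        (pathfinish p, \<rho> p e) \<in> \<Union>K"
      by (intro exI[of _ r]) blast
  qed
  have "istopology ?Q"
    unfolding istopology_def using int un by (intro conjI allI impI) simp_all
  then show ?thesis
    by (simp add: cover_space_def topology_inverse')
qed

text \<open>An action of the fundamental groupoid of \<open>P\<close> whose fibres are all
  identified with the same set \<open>E\<close>. The law for constant paths is a consequence, see
  \<open>rho_const\<close>.\<close>

locale transport =
  fixes P :: "'a::euclidean_space set" and E :: "'e set" and \<rho> :: "(real \<Rightarrow> 'a) \<Rightarrow> 'e \<Rightarrow> 'e"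
  assumes star: "locally_starlike P"
    and bij: "path p \<Longrightarrow> path_image p \<subseteq> P \<Longrightarrow> bij_betw (\<rho> p) E E"
    and homotopic: "homotopic_paths P p q \<Longrightarrow> e \<in> E \<Longrightarrow> \<rho> p e = \<rho> q e"
    and join: "path p \<Longrightarrow> path_image p \<subseteq> P \<Longrightarrow> path q \<Longrightarrow> path_image q \<subseteq> P \<Longrightarrow>
      pathfinish p = pathstart q \<Longrightarrow> e \<in> E \<Longrightarrow> \<rho> (p +++ q) e = \<rho> q (\<rho> p e)"
begin

abbreviation X where "X \<equiv> cover_space P E \<rho>"

text \<open>The slice through \<open>(x, e)\<close> over a star-shaped ball, obtained by transport
  along radii; for small \<open>r\<close> these slices form a neighbourhood base.\<close>

definition sheet :: "'a \<Rightarrow> 'e \<Rightarrow> real \<Rightarrow> ('a \<times> 'e) set" where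
  "sheet x e r = (\<lambda>y. (y, \<rho> (linepath x y) e)) ` (P \<inter> ball x r)"

lemma rho_in: "path p \<Longrightarrow> path_image p \<subseteq> P \<Longrightarrow> e \<in> E \<Longrightarrow> \<rho> p e \<in> E"
  using bij by (auto simp: bij_betw_def)

lemma rho_inj: "path p \<Longrightarrow> path_image p \<subseteq> P \<Longrightarrow> e \<in> E \<Longrightarrow> e' \<in> E \<Longrightarrow> \<rho> p e = \<rho> p e' \<longleftrightarrow> e = e'"
  using bij[of p] by (auto simp: bij_betw_def inj_on_def)

text \<open>A constant path is homotopic to its own square, and an injective idempotent is the
  identity.\<close>

lemma rho_const:
  assumes "x \<in> P" "e \<in> E"
  shows "\<rho> (linepath x x) e = e"
proof -
  have p: "path (linepath x x)" "path_image (linepath x x) \<subseteq> P"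
    using assms by auto
  have "\<rho> (linepath x x +++ linepath x x) e = \<rho> (linepath x x) e"
    using assms by (intro homotopic homotopic_paths_rid') auto
  then have "\<rho> (linepath x x) (\<rho> (linepath x x) e) = \<rho> (linepath x x) e"
    using join[OF p p] assms by simp
  then show ?thesis
    using rho_inj[OF p] rho_in[OF p] assms by blast
qed

lemma rho_const': "x \<in> P \<Longrightarrow> e \<in> E \<Longrightarrow> \<rho> (\<lambda>_. x) e = e"
  using rho_const[of x e] by (simp add: linepath_def scaleR_add_left[symmetric])

lemma rho_reverse:
  assumes "path p" "path_image p \<subseteq> P" "e \<in> E"
  shows "\<rho> (reversepath p) (\<rho> p e) = e"
proof -
  have "\<rho> (p +++ reversepath p) e = \<rho> (linepath (pathstart p) (pathstart p)) e"
    using assms by (intro homotopic homotopic_paths_rinv) auto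
  moreover have "pathstart p \<in> P"
    using assms by auto
  ultimately show ?thesis
    using assms by (simp add: join rho_const)
qed

lemma topspace_cover [simp]: "topspace X = P \<times> E"
proof -
  have "openin X (P \<times> E)"
    unfolding openin_cover_space
  proof (intro conjI allI impI)
    fix x e assume "(x, e) \<in> P \<times> E"
    then have "(pathfinish p, \<rho> p e) \<in> P \<times> E" if "path p" "path_image p \<subseteq> P \<inter> ball x 1" for p
      using that rho_in[of p e] pathfinish_in_path_image[of p] by auto
    then show "\<exists>r>0. \<forall>p. path p \<and> path_image p \<subseteq> P \<inter> ball x r \<and> pathstart p = x \<longrightarrow> (pathfinish p, \<rho> p e) \<in> P \<times> E"
      by (intro exI[of _ 1]) auto
  qed simp
  moreover have "topspace X \<subseteq> P \<times> E"
    using openin_topspace[of X] unfolding openin_cover_space by simp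
  ultimately show ?thesis
    using openin_subset by blast
qed

lemma rho_star:
  assumes "star_radius P x d" "x \<in> P" "e \<in> E" "path p" "path_image p \<subseteq> P \<inter> ball x d" "pathstart p = x"
  shows "\<rho> p e = \<rho> (linepath x (pathfinish p)) e"
proof (rule homotopic)
  have "pathfinish p \<in> P \<inter> ball x d"
    using assms by auto
  then have "closed_segment x (pathfinish p) \<subseteq> P" "closed_segment x (pathfinish p) \<subseteq> ball x d"
    using assms(1) closed_segment_subset[of x "ball x d" "pathfinish p"] by (auto simp: star_radius_def)
  then show "homotopic_paths P p (linepath x (pathfinish p))"
    using assms by (intro star_homotopic_paths[OF assms(1,2)]) auto
qed (use assms in auto)

lemma linepath_star:
  assumes "star_radius P x d" "x \<in> P" "y \<in> P" "y \<in> ball x d" "r \<le> d" "y \<in> ball x r"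
  shows "path_image (linepath x y) \<subseteq> P \<inter> ball x r"
proof -
  have "0 < r"
    using assms(6) by (metis mem_ball dist_not_less_zero le_less_trans not_le)
  then have "closed_segment x y \<subseteq> ball x r"
    using assms by (intro closed_segment_subset) auto
  with assms show ?thesis
    by (auto simp: star_radius_def)
qed

text \<open>A short path leaving a point of the sheet, preceded by the radius to that point, is
  homotopic to the radius of its end, so its lift stays in the sheet.\<close>

lemma openin_sheet:
  assumes "star_radius P x d" "x \<in> P" "e \<in> E" "r \<le> d"
  shows "openin X (sheet x e r)"
  unfolding openin_cover_space
proof (intro conjI allI impI)
  show "sheet x e r \<subseteq> P \<times> E"
  proof -
    have "\<rho> (linepath x y) e \<in> E" if "y \<in> P \<inter> ball x r" for y
      using linepath_star[OF assms(1,2), of y r] that assms by (intro rho_in) auto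
    then show ?thesis
      by (auto simp: sheet_def)
  qed
  fix y e' assume "(y, e') \<in> sheet x e r"
  then have y: "y \<in> P" "y \<in> ball x r" and e': "e' = \<rho> (linepath x y) e"
    by (auto simp: sheet_def)
  then obtain s where s: "s > 0" "ball y s \<subseteq> ball x r"
    by (meson open_ball open_contains_ball)
  have xy: "path_image (linepath x y) \<subseteq> P \<inter> ball x r"
    using linepath_star[OF assms(1,2), of y r] y assms by auto
  show "\<exists>s>0. \<forall>p. path p \<and> path_image p \<subseteq> P \<inter> ball y s \<and> pathstart p = y \<longrightarrow> (pathfinish p, \<rho> p e') \<in> sheet x e r"
  proof (intro exI[of _ s] conjI allI impI)
    fix p assume p: "path p \<and> path_image p \<subseteq> P \<inter> ball y s \<and> pathstart p = y"
    then have "\<rho> p e' = \<rho> (linepath x y +++ p) e"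
      using xy assms by (subst join) (auto simp: e')
    also have "\<dots> = \<rho> (linepath x (pathfinish p)) e"
    proof (subst rho_star[OF assms(1-3)])
      show "path_image (linepath x y +++ p) \<subseteq> P \<inter> ball x d"
        using p xy s assms(4) subset_ball[OF assms(4), of x] by (subst path_image_join) auto
    qed (use p in auto)
    finally have "\<rho> p e' = \<rho> (linepath x (pathfinish p)) e" .
    moreover have "pathfinish p \<in> P \<inter> ball x r"
      using p s by (meson IntE IntI pathfinish_in_path_image subsetD)
    ultimately show "(pathfinish p, \<rho> p e') \<in> sheet x e r"
      by (auto simp: sheet_def)
  qed (use s in auto)
qed

lemma centre_in_sheet: "x \<in> P \<Longrightarrow> e \<in> E \<Longrightarrow> 0 < r \<Longrightarrow> (x, e) \<in> sheet x e r"
  unfolding sheet_def using rho_const[of x e] by (force intro!: image_eqI[where x = x])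

lemma sheet_basis:
  assumes "openin X U" "(x, e) \<in> U" "star_radius P x d"
  obtains r where "0 < r" "r \<le> d" "sheet x e r \<subseteq> U" "x \<in> P" "e \<in> E"
proof -
  have xe: "x \<in> P" "e \<in> E"
    using assms openin_subset[OF assms(1)] by auto
  obtain r where r: "r > 0"
    and U: "\<And>p. path p \<Longrightarrow> path_image p \<subseteq> P \<inter> ball x r \<Longrightarrow> pathstart p = x \<Longrightarrow> (pathfinish p, \<rho> p e) \<in> U"
    using assms(1,2) unfolding openin_cover_space by meson
  have d: "d > 0"
    using assms(3) by (simp add: star_radius_def)
  have "sheet x e (min r d) \<subseteq> U"
  proof -
    have "(y, \<rho> (linepath x y) e) \<in> U" if "y \<in> P \<inter> ball x (min r d)" for y
      using U[of "linepath x y"] linepath_star[OF assms(3) xe(1), of y "min r d"] that by force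
    then show ?thesis
      by (auto simp: sheet_def)
  qed
  with r d xe that[of "min r d"] show thesis
    by auto
qed

text \<open>The criterion behind the continuity proofs into a covering. The witnessing paths need
  only stay in one fixed star-shaped ball: there they may be exchanged for radii, which become short
  with the distance of their ends.\<close>

lemma continuous_map_coverI:
  assumes f1: "continuous_map Y (top_of_set P) f1"
    and f2: "\<And>z. z \<in> topspace Y \<Longrightarrow> f2 z \<in> E"
    and loc: "\<And>z. z \<in> topspace Y \<Longrightarrow> \<exists>N d. openin Y N \<and> z \<in> N \<and> star_radius P (f1 z) d \<and>
       (\<forall>z'\<in>N. \<exists>p. path p \<and> path_image p \<subseteq> P \<inter> ball (f1 z) d \<and> pathstart p = f1 z \<and> pathfinish p = f1 z' \<and> f2 z' = \<rho> p (f2 z))"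
  shows "continuous_map Y X (\<lambda>z. (f1 z, f2 z))"
  unfolding continuous_map_def
proof (intro conjI allI impI)
  have f1P: "f1 z \<in> P" if "z \<in> topspace Y" for z
    using f1 that by (auto simp: continuous_map_def)
  then show "(\<lambda>z. (f1 z, f2 z)) \<in> topspace Y \<rightarrow> topspace X"
    using f2 by auto
  fix U assume U: "openin X U"
  show "openin Y {z \<in> topspace Y. (f1 z, f2 z) \<in> U}"
  proof (subst openin_subopen, intro ballI)
    fix z assume "z \<in> {z \<in> topspace Y. (f1 z, f2 z) \<in> U}"
    then have z: "z \<in> topspace Y" "(f1 z, f2 z) \<in> U"
      by auto
    obtain N d where N: "openin Y N" "z \<in> N" "star_radius P (f1 z) d"
      and p: "\<And>z'. z' \<in> N \<Longrightarrow> \<exists>p. path p \<and> path_image p \<subseteq> P \<inter> ball (f1 z) d \<and> pathstart p = f1 z \<and> pathfinish p = f1 z' \<and> f2 z' = \<rho> p (f2 z)"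
      using loc[OF z(1)] by blast
    obtain r where r: "0 < r" "r \<le> d" "sheet (f1 z) (f2 z) r \<subseteq> U"
      using sheet_basis[OF U z(2) N(3)] by blast
    define M where "M = N \<inter> {z' \<in> topspace Y. f1 z' \<in> ball (f1 z) r}"
    have "continuous_map Y euclidean f1"
      using f1 continuous_map_into_fulltopology by blast
    then have "openin Y {z' \<in> topspace Y. f1 z' \<in> ball (f1 z) r}"
      using openin_continuous_map_preimage[of Y euclidean f1 "ball (f1 z) r"] by simp
    then have "openin Y M"
      using N(1) unfolding M_def by (rule openin_Int[rotated])
    moreover have "z \<in> M"
      using N z r by (simp add: M_def)
    moreover have "(f1 z', f2 z') \<in> U" if "z' \<in> M" for z'
    proof -
      have "z' \<in> N"
        using that by (simp add: M_def)
      from p[OF this] obtain p where p: "path p" "path_image p \<subseteq> P \<inter> ball (f1 z) d" "pathstart p = f1 z" "pathfinish p = f1 z'" "f2 z' = \<rho> p (f2 z)"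
        by blast
      have "f2 z' = \<rho> (linepath (f1 z) (f1 z')) (f2 z)"
        using rho_star[OF N(3) f1P[OF z(1)] f2[OF z(1)] p(1-3)] p by simp
      moreover have "f1 z' \<in> P \<inter> ball (f1 z) r"
        using that f1P by (auto simp: M_def)
      ultimately show ?thesis
        using r(3) by (auto simp: sheet_def)
    qed
    ultimately show "\<exists>T. openin Y T \<and> z \<in> T \<and> T \<subseteq> {z \<in> topspace Y. (f1 z, f2 z) \<in> U}"
      using openin_subset[of Y M] by (intro exI[of _ M]) auto
  qed
qed

lemma continuous_map_fst_cover: "continuous_map X (top_of_set P) fst"
  unfolding continuous_map_def
proof (intro conjI allI impI)
  show "fst \<in> topspace X \<rightarrow> topspace (top_of_set P)"
    by auto
  fix U assume "openin (top_of_set P) U"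
  then obtain W where W: "open W" "U = P \<inter> W"
    by (auto simp: openin_open)
  show "openin X {z \<in> topspace X. fst z \<in> U}"
    unfolding openin_cover_space
  proof (intro conjI allI impI)
    fix x e assume "(x, e) \<in> {z \<in> topspace X. fst z \<in> U}"
    then have xe: "x \<in> P" "e \<in> E" "x \<in> W"
      using W by auto
    then obtain r where r: "r > 0" "ball x r \<subseteq> W"
      using W(1) open_contains_ball by blast
    show "\<exists>r>0. \<forall>p. path p \<and> path_image p \<subseteq> P \<inter> ball x r \<and> pathstart p = x \<longrightarrow>
      (pathfinish p, \<rho> p e) \<in> {z \<in> topspace X. fst z \<in> U}"
    proof (intro exI[of _ r] conjI allI impI r(1))
      fix p assume p: "path p \<and> path_image p \<subseteq> P \<inter> ball x r \<and> pathstart p = x"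
      then have "pathfinish p \<in> P \<inter> ball x r"
        by (meson pathfinish_in_path_image subsetD)
      then show "(pathfinish p, \<rho> p e) \<in> {z \<in> topspace X. fst z \<in> U}"
        using p r W rho_in[of p e] xe by auto
    qed
  qed auto
qed

text \<open>Continuity in the covering topology, read near one parameter: the second component is
  carried along by transport. The parameter \<open>t\<close> may lie on either side of
  \<open>t0\<close>.\<close>

lemma local_sheet_eq:
  assumes d: "star_radius P x d" "x \<in> P" "e \<in> E"
    and f: "continuous_map (top_of_set {0..1}) X f" and f0: "f t0 = (x, e)" and t0: "t0 \<in> {0..1}"
  shows "\<exists>\<epsilon>>0. \<forall>t\<in>{0..1}. \<bar>t - t0\<bar> < \<epsilon> \<longrightarrow> snd (f t) = \<rho> (subpath t0 t (fst \<circ> f)) e"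
proof -
  have "openin (top_of_set {0..1}) {t \<in> {0..1}. f t \<in> sheet x e d}"
    using openin_continuous_map_preimage[OF f openin_sheet[OF d order.refl]] by simp
  moreover have "t0 \<in> {t \<in> {0..1}. f t \<in> sheet x e d}"
    using t0 f0 centre_in_sheet[OF d(2,3), of d] d(1) by (simp add: star_radius_def)
  ultimately obtain \<epsilon> where eps: "\<epsilon> > 0" "ball t0 \<epsilon> \<inter> {0..1} \<subseteq> {t \<in> {0..1}. f t \<in> sheet x e d}"
    using openin_contains_ball[of "{0..1}"] by meson
  have f1: "path (fst \<circ> f)" "path_image (fst \<circ> f) \<subseteq> P"
    using continuous_map_compose[OF f continuous_map_fst_cover]
    by (auto simp: path_def path_image_def)
  show ?thesis
  proof (intro exI[of _ \<epsilon>] conjI ballI impI eps(1))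
    fix t :: real assume t: "t \<in> {0..1}" "\<bar>t - t0\<bar> < \<epsilon>"
    have in_ball: "f s \<in> sheet x e d" if "s \<in> closed_segment t0 t" for s
    proof -
      have "closed_segment t0 t \<subseteq> ball t0 \<epsilon> \<inter> {0..1}"
        using t t0 eps by (intro closed_segment_subset) (auto simp: dist_real_def abs_minus_commute intro: convex_Int)
      with that eps show ?thesis
        by blast
    qed
    have "path_image (subpath t0 t (fst \<circ> f)) \<subseteq> P \<inter> ball x d"
    proof -
      have "path_image (subpath t0 t (fst \<circ> f)) = (fst \<circ> f) ` closed_segment t0 t"
        by (rule path_image_subpath_gen)
      also have "\<dots> \<subseteq> P \<inter> ball x d"
        using in_ball by (force simp: sheet_def)
      finally show ?thesis .
    qed
    then have "\<rho> (subpath t0 t (fst \<circ> f)) e = \<rho> (linepath x (fst (f t))) e"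
      using rho_star[OF d, of "subpath t0 t (fst \<circ> f)"] f1 t0 t f0 by (simp add: pathstart_subpath pathfinish_subpath)
    then show "snd (f t) = \<rho> (subpath t0 t (fst \<circ> f)) e"
      using in_ball[of t] by (force simp: sheet_def)
  qed
qed

text \<open>Near every parameter the claim for one point is equivalent to the claim for its
  neighbours, by local transport and its injectivity; connectedness of the interval does the
  rest.\<close>

lemma unique_path_lifting:
  assumes f: "continuous_map (top_of_set {0..1}) X f"
  shows "snd (f 1) = \<rho> (fst \<circ> f) (snd (f 0))"
proof -
  have fX: "fst (f t) \<in> P" "snd (f t) \<in> E" if "t \<in> {0..1}" for t
    using continuous_map_funspace[OF f] that by (auto simp: Pi_iff mem_Times_iff)
  have f1: "path (fst \<circ> f)" "path_image (fst \<circ> f) \<subseteq> P"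
    using continuous_map_compose[OF f continuous_map_fst_cover]
    by (auto simp: path_def path_image_def)
  have sub: "path (subpath s t (fst \<circ> f))" "path_image (subpath s t (fst \<circ> f)) \<subseteq> P" if "s \<in> {0..1}" "t \<in> {0..1}" for s t
    using that f1 path_image_subpath_subset by (auto intro: path_subpath) blast
  define A where "A t \<longleftrightarrow> snd (f t) = \<rho> (subpath 0 t (fst \<circ> f)) (snd (f 0))" for t
  have "A 1"
  proof (rule connected_induction_simple[of "{0..1::real}" 0])
    show "A 0"
      using rho_const'[of "fst (f 0)" "snd (f 0)"] fX[of 0] by (simp add: A_def subpath_def comp_def)
    fix t0 :: real assume t0: "t0 \<in> {0..1}"
    obtain d where d: "star_radius P (fst (f t0)) d"
      using star fX(1)[OF t0] unfolding locally_starlike_def by blast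
    obtain \<epsilon> where eps: "\<epsilon> > 0" "\<And>t. t \<in> {0..1} \<Longrightarrow> \<bar>t - t0\<bar> < \<epsilon> \<Longrightarrow> snd (f t) = \<rho> (subpath t0 t (fst \<circ> f)) (snd (f t0))"
      using local_sheet_eq[OF d fX[OF t0] f _ t0] by auto
    have "A t \<longleftrightarrow> A t0" if t: "t \<in> {0..1}" "\<bar>t - t0\<bar> < \<epsilon>" for t
    proof -
      have "homotopic_paths P (subpath 0 t0 (fst \<circ> f) +++ subpath t0 t (fst \<circ> f)) (subpath 0 t (fst \<circ> f))"
        using f1 t t0 by (intro homotopic_join_subpaths) auto
      then have "\<rho> (subpath 0 t (fst \<circ> f)) (snd (f 0)) = \<rho> (subpath 0 t0 (fst \<circ> f) +++ subpath t0 t (fst \<circ> f)) (snd (f 0))"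
        using homotopic fX(2)[of 0] by simp
      also have "\<dots> = \<rho> (subpath t0 t (fst \<circ> f)) (\<rho> (subpath 0 t0 (fst \<circ> f)) (snd (f 0)))"
        using sub[of 0 t0] sub[of t0 t] t t0 fX(2)[of 0] by (intro join) auto
      finally show ?thesis
        unfolding A_def using eps(2)[OF t] rho_inj[OF sub[OF t0 t(1)], of "snd (f t0)" "\<rho> (subpath 0 t0 (fst \<circ> f)) (snd (f 0))"]
          fX(2)[OF t0] rho_in[OF sub[of 0 t0], of "snd (f 0)"] fX(2)[of 0] t0 by auto
    qed
    then have "A t \<longleftrightarrow> A t0" if "t \<in> {0..1} \<inter> ball t0 \<epsilon>" for t
      using that by (simp add: dist_real_def abs_minus_commute)
    then have "\<forall>s\<in>{0..1} \<inter> ball t0 \<epsilon>. \<forall>t\<in>{0..1} \<inter> ball t0 \<epsilon>. A s \<longrightarrow> A t"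
      by blast
    moreover have "openin (top_of_set {0..1}) ({0..1} \<inter> ball t0 \<epsilon>)"
      by (simp add: openin_open_Int)
    moreover have "t0 \<in> {0..1} \<inter> ball t0 \<epsilon>"
      using t0 eps(1) by simp
    ultimately show "\<exists>T. openin (top_of_set {0..1}) T \<and> t0 \<in> T \<and> (\<forall>s\<in>T. \<forall>t\<in>T. A s \<longrightarrow> A t)"
      by blast
  qed auto
  then show ?thesis
    by (simp add: A_def subpath_def comp_def)
qed

lemma continuous_map_sheet_section:
  assumes "star_radius P x d" "x \<in> P" "e \<in> E" "r \<le> d"
  shows "continuous_map (top_of_set (P \<inter> ball x r)) X (\<lambda>y. (y, \<rho> (linepath x y) e))"
proof (rule continuous_map_coverI)
  show "continuous_map (top_of_set (P \<inter> ball x r)) (top_of_set P) (\<lambda>y. y)"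
    by auto
  have xy: "path_image (linepath x y) \<subseteq> P \<inter> ball x r" if "y \<in> P \<inter> ball x r" for y
    using linepath_star[OF assms(1,2), of y r] that assms by auto
  show "\<rho> (linepath x y) e \<in> E" if "y \<in> topspace (top_of_set (P \<inter> ball x r))" for y
    using xy[of y] that assms by (intro rho_in) auto
  fix y assume "y \<in> topspace (top_of_set (P \<inter> ball x r))"
  then have y: "y \<in> P \<inter> ball x r"
    by simp
  then obtain s where s: "star_radius P y s"
    using star unfolding locally_starlike_def by blast
  show "\<exists>N s. openin (top_of_set (P \<inter> ball x r)) N \<and> y \<in> N \<and> star_radius P y s \<and>
       (\<forall>z\<in>N. \<exists>p. path p \<and> path_image p \<subseteq> P \<inter> ball y s \<and> pathstart p = y \<and> pathfinish p = z
          \<and> \<rho> (linepath x z) e = \<rho> p (\<rho> (linepath x y) e))"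
  proof (intro exI[of _ "P \<inter> ball x r \<inter> ball y s"] exI[of _ s] conjI ballI)
    fix z assume z: "z \<in> P \<inter> ball x r \<inter> ball y s"
    have yz: "path_image (linepath y z) \<subseteq> P \<inter> ball y s"
      using linepath_star[OF s, of z s] y z by auto
    have yz': "path_image (linepath y z) \<subseteq> ball x r"
      using y z by (simp add: closed_segment_subset)
    have "\<rho> (linepath y z) (\<rho> (linepath x y) e) = \<rho> (linepath x y +++ linepath y z) e"
      using xy[OF y] yz assms by (subst join) auto
    also have "\<dots> = \<rho> (linepath x z) e"
    proof (subst rho_star[OF assms(1-3)])
      show "path_image (linepath x y +++ linepath y z) \<subseteq> P \<inter> ball x d"
        using xy[OF y] yz yz' subset_ball[OF assms(4), of x] by (subst path_image_join) auto
    qed auto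
    finally show "\<exists>p. path p \<and> path_image p \<subseteq> P \<inter> ball y s \<and> pathstart p = y \<and> pathfinish p = z
          \<and> \<rho> (linepath x z) e = \<rho> p (\<rho> (linepath x y) e)"
      using yz by (intro exI[of _ "linepath y z"]) auto
  qed (use s y in \<open>auto simp: star_radius_def openin_open intro: exI[of _ "ball y s"]\<close>)
qed

text \<open>Sheets are images of star-shaped sets under continuous sections. The lemma supplies the
  hypothesis of \<open>covering_homotopy\<close> for deformations of the covering itself.\<close>

lemma locally_path_connected_cover: "locally_path_connected_space X"
  unfolding locally_path_connected_space
proof (intro allI impI)
  fix V z assume V: "openin X V \<and> z \<in> V"
  obtain x e where z: "z = (x, e)"
    by (cases z)
  have xe: "x \<in> P" "e \<in> E"
    using V openin_subset[of X V] z by auto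
  then obtain d where d: "star_radius P x d"
    using star unfolding locally_starlike_def by blast
  obtain r where r: "0 < r" "r \<le> d" "sheet x e r \<subseteq> V"
    using V sheet_basis[of V x e d] d z by auto
  have "path_connected (P \<inter> ball x r)"
    using star_radius_starlike[OF star_radius_mono[OF d r(1,2)] xe(1)] starlike_imp_path_connected by blast
  then have "path_connectedin (top_of_set (P \<inter> ball x r)) (P \<inter> ball x r)"
    by (simp add: path_connectedin_subtopology)
  then have "path_connectedin X (sheet x e r)"
    unfolding sheet_def using path_connectedin_continuous_map_image[OF continuous_map_sheet_section[OF d xe r(2)]] by blast
  then show "\<exists>U. openin X U \<and> path_connectedin X U \<and> z \<in> U \<and> U \<subseteq> V"
    using openin_sheet[OF d xe r(2)] centre_in_sheet[OF xe r(1)] r(3) z by blast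
qed

end

section \<open>Homotopy lifting and maps between coverings\<close>

context transport begin

text \<open>The second component at time \<open>t\<close> is transport along the track of the point
  up to \<open>t\<close>. For continuity, a nearby point of \<open>Y\<close> is reached by a path
  \<open>g\<close>; the tracks along \<open>g\<close> fill a square, and the two ways around it give
  the same transport.\<close>

lemma covering_homotopy:
  assumes Y: "locally_path_connected_space Y"
    and F: "continuous_map Y X F"
    and h: "continuous_map (prod_topology (top_of_set {0..1}) Y) (top_of_set P) h"
    and h0: "\<And>z. z \<in> topspace Y \<Longrightarrow> h (0, z) = fst (F z)"
  shows "continuous_map (prod_topology (top_of_set {0..1::real}) Y) X
     (\<lambda>w. (h w, \<rho> (\<lambda>s. h (fst w * s, snd w)) (snd (F (snd w)))))"
proof (rule continuous_map_coverI)
  let ?I = "top_of_set {0..1::real}"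
  let ?Z = "prod_topology ?I Y"
  have FX: "fst (F z) \<in> P" "snd (F z) \<in> E" if "z \<in> topspace Y" for z
    using continuous_map_funspace[OF F] that by (auto simp: Pi_iff mem_Times_iff)
  have hP: "h (t, z) \<in> P" if "t \<in> {0..1}" "z \<in> topspace Y" for t z
    using continuous_map_funspace[OF h] that by (auto simp: Pi_iff)
  have path1: "path (\<lambda>s. h (t * s, z))" "path_image (\<lambda>s. h (t * s, z)) \<subseteq> P" if "t \<in> {0..1}" "z \<in> topspace Y" for t z
  proof -
    have "continuous_map ?I ?I (\<lambda>s. t * s)"
      using that by (auto intro!: continuous_intros simp: mult_le_one)
    then have "continuous_map ?I ?Z (\<lambda>s. (t * s, z))"
      using that by (simp add: continuous_map_paired)
    from continuous_map_compose[OF this h] show "path (\<lambda>s. h (t * s, z))" "path_image (\<lambda>s. h (t * s, z)) \<subseteq> P"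
      by (auto simp: path_def path_image_def comp_def)
  qed
  show "continuous_map ?Z (top_of_set P) h"
    by fact
  show "\<rho> (\<lambda>s. h (fst w * s, snd w)) (snd (F (snd w))) \<in> E" if "w \<in> topspace ?Z" for w
    using that path1[of "fst w" "snd w"] FX[of "snd w"] by (intro rho_in) auto
  fix w assume w: "w \<in> topspace ?Z"
  obtain t0 z0 where w0: "w = (t0, z0)" "t0 \<in> {0..1}" "z0 \<in> topspace Y"
    using w by auto
  obtain d where d: "star_radius P (h w) d"
    using star hP w0 unfolding locally_starlike_def by blast
  have d0: "d > 0"
    using d by (simp add: star_radius_def)
  have "continuous_map ?Z euclidean h"
    using h continuous_map_into_fulltopology by blast
  then have "openin ?Z {w' \<in> topspace ?Z. h w' \<in> ball (h w) d}"
    using openin_continuous_map_preimage[of ?Z euclidean h "ball (h w) d"] by simp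
  moreover have "(t0, z0) \<in> {w' \<in> topspace ?Z. h w' \<in> ball (h w) d}"
    using w w0 d0 by simp
  ultimately obtain U V where UV: "openin ?I U" "openin Y V" "t0 \<in> U" "z0 \<in> V"
    "U \<times> V \<subseteq> {w' \<in> topspace ?Z. h w' \<in> ball (h w) d}"
    unfolding openin_prod_topology_alt by meson
  obtain \<epsilon> where eps: "\<epsilon> > 0" "ball t0 \<epsilon> \<inter> {0..1} \<subseteq> U"
    using UV(1,3) openin_contains_ball[of "{0..1}"] by meson
  obtain V' where V': "openin Y V'" "path_connectedin Y V'" "z0 \<in> V'" "V' \<subseteq> V"
    using Y UV(2,4) unfolding locally_path_connected_space by meson
  define N where "N = ({0..1} \<inter> ball t0 \<epsilon>) \<times> V'"
  show "\<exists>N d. openin ?Z N \<and> w \<in> N \<and> star_radius P (h w) d \<and>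
     (\<forall>w'\<in>N. \<exists>p. path p \<and> path_image p \<subseteq> P \<inter> ball (h w) d \<and> pathstart p = h w \<and> pathfinish p = h w' \<and>
       \<rho> (\<lambda>s. h (fst w' * s, snd w')) (snd (F (snd w'))) = \<rho> p (\<rho> (\<lambda>s. h (fst w * s, snd w)) (snd (F (snd w)))))"
  proof (intro exI[of _ N] exI[of _ d] conjI ballI d)
    have "openin ?I ({0..1} \<inter> ball t0 \<epsilon>)"
      by (simp add: openin_open_Int)
    then show "openin ?Z N"
      using V'(1) unfolding N_def by (simp add: openin_prod_Times_iff)
    show "w \<in> N"
      using w0 V'(3) eps(1) by (simp add: N_def)
    fix w' assume "w' \<in> N"
    then obtain t z where t: "w' = (t, z)" "t \<in> {0..1}" "t \<in> ball t0 \<epsilon>" "z \<in> V'"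
      by (auto simp: N_def)
    have zY: "z \<in> topspace Y"
      using t(4) V'(1) openin_subset by blast
    obtain g where g: "pathin Y g" "g \<in> {0..1} \<rightarrow> V'" "g 0 = z0" "g 1 = z"
      using V'(2,3) t(4) unfolding path_connectedin by blast
    \<comment> \<open>The square of tracks: \<open>s\<close> follows a track, \<open>r\<close> moves
      along \<open>g\<close> and simultaneously from \<open>t0\<close> to \<open>t\<close>. The side
      \<open>s = 0\<close> is the projection of \<open>F \<circ> g\<close>, and this is where unique
      path lifting enters.\<close>
    define k where "k = (\<lambda>(s, r). h ((t0 + (t - t0) * r) * s, g r))"
    let ?S = "{0..1::real} \<times> {0..1::real}"
    have seg: "t0 + (t - t0) * r \<in> {0..1} \<inter> ball t0 \<epsilon>" if "r \<in> {0..1}" for r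
    proof -
      have "convex ({0..1} \<inter> ball t0 \<epsilon>)"
        by (intro convex_Int convex_ball) simp
      then have "(1 - r) *\<^sub>R t0 + r *\<^sub>R t \<in> {0..1} \<inter> ball t0 \<epsilon>"
        using that t w0 eps(1) unfolding convex_alt by auto
      moreover have "(1 - r) *\<^sub>R t0 + r *\<^sub>R t = t0 + (t - t0) * r"
        by (simp add: algebra_simps)
      ultimately show ?thesis
        by simp
    qed
    have k: "continuous_on ?S k" "k ` ?S \<subseteq> P"
    proof -
      have "continuous_map (top_of_set ?S) ?I (\<lambda>q. (t0 + (t - t0) * snd q) * fst q)"
        using seg by (fastforce intro!: continuous_intros simp: mult_le_one)
      moreover have "continuous_map (top_of_set ?S) Y (g \<circ> snd)"
        using g(1) unfolding pathin_def by (intro continuous_map_compose[of _ ?I]) (auto intro!: continuous_intros)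
      ultimately have "continuous_map (top_of_set ?S) ?Z (\<lambda>q. ((t0 + (t - t0) * snd q) * fst q, (g \<circ> snd) q))"
        by (simp add: continuous_map_paired comp_def)
      from continuous_map_compose[OF this h] show "continuous_on ?S k" "k ` ?S \<subseteq> P"
        by (auto simp: k_def comp_def case_prod_unfold)
    qed
    let ?p1 = "linepath (0, 0) (0, 1) :: real \<Rightarrow> real \<times> real"
    let ?p2 = "linepath (0, 1) (1, 1) :: real \<Rightarrow> real \<times> real"
    let ?q1 = "linepath (0, 0) (1, 0) :: real \<Rightarrow> real \<times> real"
    let ?q2 = "linepath (1, 0) (1, 1) :: real \<Rightarrow> real \<times> real"
    have convS: "convex ?S"
      by (intro convex_Times) auto
    have im: "path_image (linepath a b) \<subseteq> ?S" if "a \<in> ?S" "b \<in> ?S" for a b :: "real \<times> real"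
      using that convS by (simp add: closed_segment_subset)
    have "simply_connected ?S"
      using convS by (rule convex_imp_simply_connected)
    then have "homotopic_paths ?S (?p1 +++ ?p2) (?q1 +++ ?q2)"
      unfolding simply_connected_eq_homotopic_paths by (auto simp: path_image_join im simp del: path_image_linepath)
    then have hom: "homotopic_paths P ((k \<circ> ?p1) +++ (k \<circ> ?p2)) ((k \<circ> ?q1) +++ (k \<circ> ?q2))"
      unfolding path_compose_join[symmetric] using k by (intro homotopic_paths_continuous_image) auto
    have kp: "k \<circ> ?p1 = (\<lambda>r. h (0, g r))" "k \<circ> ?p2 = (\<lambda>s. h (t * s, z))" "k \<circ> ?q1 = (\<lambda>s. h (t0 * s, z0))"
      "k \<circ> ?q2 = (\<lambda>r. h (t0 + (t - t0) * r, g r))"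
      using g by (auto simp: k_def linepath_def fun_eq_iff)
    have kpath: "path (k \<circ> linepath a b)" "path_image (k \<circ> linepath a b) \<subseteq> P" if "a \<in> ?S" "b \<in> ?S" for a b
      using im[OF that] k by (auto intro!: path_continuous_image continuous_on_subset[OF k(1)] simp: path_image_compose simp del: path_image_linepath)
    define p where "p = (\<lambda>r. h (t0 + (t - t0) * r, g r))"
    have gY: "g r \<in> topspace Y" if "r \<in> {0..1}" for r
      using g(2) V'(1) openin_subset that by blast
    have Fg: "continuous_map ?I X (F \<circ> g)"
      using g(1) F continuous_map_compose unfolding pathin_def by blast
    have "\<rho> (fst \<circ> (F \<circ> g)) (snd (F z0)) = \<rho> (\<lambda>r. h (0, g r)) (snd (F z0))"
    proof (rule homotopic)
      show "homotopic_paths P (fst \<circ> (F \<circ> g)) (\<lambda>r. h (0, g r))"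
        using continuous_map_compose[OF Fg continuous_map_fst_cover] h0 gY
        by (intro homotopic_paths_eq) (auto simp: path_def path_image_def)
    qed (use FX w0 in auto)
    then have 1: "snd (F z) = \<rho> (\<lambda>r. h (0, g r)) (snd (F z0))"
      using unique_path_lifting[OF Fg] g by simp
    have "\<rho> (\<lambda>s. h (t * s, z)) (snd (F z)) = \<rho> ((k \<circ> ?p1) +++ (k \<circ> ?p2)) (snd (F z0))"
      using kpath[of "(0, 0)" "(0, 1)"] kpath[of "(0, 1)" "(1, 1)"] FX(2)[OF w0(3)]
      by (subst join) (simp_all add: pathfinish_def pathstart_def g kp 1)
    also have "\<dots> = \<rho> ((k \<circ> ?q1) +++ (k \<circ> ?q2)) (snd (F z0))"
      using hom FX w0 by (intro homotopic) auto
    also have "\<dots> = \<rho> p (\<rho> (\<lambda>s. h (t0 * s, z0)) (snd (F z0)))"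
      using kpath[of "(0, 0)" "(1, 0)"] kpath[of "(1, 0)" "(1, 1)"] FX(2)[OF w0(3)]
      by (subst join) (simp_all add: pathfinish_def pathstart_def g kp p_def)
    finally have eq: "\<rho> (\<lambda>s. h (t * s, z)) (snd (F z)) = \<rho> p (\<rho> (\<lambda>s. h (t0 * s, z0)) (snd (F z0)))" .
    have "path_image p \<subseteq> ball (h w) d"
    proof -
      have "(t0 + (t - t0) * r, g r) \<in> U \<times> V" if "r \<in> {0..1}" for r
        using seg[OF that] eps(2) g(2) V'(4) that by blast
      then have "h (t0 + (t - t0) * r, g r) \<in> ball (h w) d" if "r \<in> {0..1}" for r
        using UV(5) that by blast
      then show ?thesis
        by (auto simp: p_def path_image_def)
    qed
    moreover have "path p" "path_image p \<subseteq> P"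
      using kpath[of "(1, 0)" "(1, 1)"] by (auto simp: kp p_def)
    moreover have "pathstart p = h w" "pathfinish p = h w'"
      using w0 t g by (auto simp: p_def pathstart_def pathfinish_def)
    ultimately show "\<exists>p. path p \<and> path_image p \<subseteq> P \<inter> ball (h w) d \<and> pathstart p = h w \<and> pathfinish p = h w' \<and>
       \<rho> (\<lambda>s. h (fst w' * s, snd w')) (snd (F (snd w'))) = \<rho> p (\<rho> (\<lambda>s. h (fst w * s, snd w)) (snd (F (snd w))))"
      using eq w0(1) t(1) by (intro exI[of _ p]) simp
  qed
qed

text \<open>A fibrewise map commuting with transport takes the lift of a radius to the lift of the
  image of that radius, which is the local form of continuity.\<close>

lemma continuous_map_cover_map:
  assumes "transport Q E' \<rho>'" and f: "continuous_on Q f" "f ` Q \<subseteq> P"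
    and s: "\<And>x e. x \<in> Q \<Longrightarrow> e \<in> E' \<Longrightarrow> s x e \<in> E"
    and eqv: "\<And>p e. path p \<Longrightarrow> path_image p \<subseteq> Q \<Longrightarrow> e \<in> E' \<Longrightarrow>
      s (pathfinish p) (\<rho>' p e) = \<rho> (f \<circ> p) (s (pathstart p) e)"
  shows "continuous_map (cover_space Q E' \<rho>') X (\<lambda>w. (f (fst w), s (fst w) (snd w)))"
proof (rule continuous_map_coverI)
  interpret Q: transport Q E' \<rho>'
    by fact
  have cf: "continuous_map (top_of_set Q) (top_of_set P) f"
    using f by auto
  show "continuous_map Q.X (top_of_set P) (\<lambda>w. f (fst w))"
    using continuous_map_compose[OF Q.continuous_map_fst_cover cf] by (simp add: comp_def)
  show "s (fst w) (snd w) \<in> E" if "w \<in> topspace Q.X" for w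
    using that s by auto
  fix w assume w: "w \<in> topspace Q.X"
  then obtain x e where xe: "w = (x, e)" "x \<in> Q" "e \<in> E'"
    by auto
  obtain d where d: "star_radius P (f x) d"
    using star f xe unfolding locally_starlike_def by blast
  obtain c where c: "star_radius Q x c"
    using Q.star xe unfolding locally_starlike_def by blast
  have "openin (top_of_set Q) (Q \<inter> f -` ball (f x) d)"
    using f(1) by (intro continuous_openin_preimage_gen) auto
  moreover have "x \<in> Q \<inter> f -` ball (f x) d"
    using d xe by (simp add: star_radius_def)
  ultimately obtain r where r: "r > 0" "ball x r \<inter> Q \<subseteq> Q \<inter> f -` ball (f x) d"
    using openin_contains_ball[of Q] by meson
  define m where "m = min r c"
  have m: "m > 0" "m \<le> c" "star_radius Q x m" "ball x m \<subseteq> ball x r"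
    using c r star_radius_mono[OF c, of m] by (auto simp: m_def star_radius_def)
  show "\<exists>N d. openin Q.X N \<and> w \<in> N \<and> star_radius P (f (fst w)) d \<and>
       (\<forall>w'\<in>N. \<exists>p. path p \<and> path_image p \<subseteq> P \<inter> ball (f (fst w)) d \<and> pathstart p = f (fst w) \<and>
          pathfinish p = f (fst w') \<and> s (fst w') (snd w') = \<rho> p (s (fst w) (snd w)))"
  proof (intro exI[of _ "Q.sheet x e m"] exI[of _ d] conjI ballI)
    show "openin Q.X (Q.sheet x e m)"
      using c xe m by (intro Q.openin_sheet) auto
    show "w \<in> Q.sheet x e m"
      using xe m by (simp add: Q.centre_in_sheet)
    show "star_radius P (f (fst w)) d"
      using d xe by simp
    fix w' assume "w' \<in> Q.sheet x e m"
    then obtain y where y: "y \<in> Q" "y \<in> ball x m" "w' = (y, \<rho>' (linepath x y) e)"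
      by (auto simp: Q.sheet_def)
    have l: "path_image (linepath x y) \<subseteq> Q \<inter> ball x m"
      using Q.linepath_star[OF m(3) xe(2), of y m] y by auto
    have "f ` path_image (linepath x y) \<subseteq> P \<inter> ball (f x) d"
    proof -
      have "path_image (linepath x y) \<subseteq> Q" "path_image (linepath x y) \<subseteq> ball x r \<inter> Q"
        using l m(4) by auto
      with r f(2) show ?thesis
        by (simp del: path_image_linepath) blast
    qed
    then have "path_image (f \<circ> linepath x y) \<subseteq> P \<inter> ball (f x) d"
      by (simp add: path_image_compose)
    moreover have "path (f \<circ> linepath x y)"
      using l by (intro path_continuous_image continuous_on_subset[OF f(1)]) auto
    moreover have "s y (\<rho>' (linepath x y) e) = \<rho> (f \<circ> linepath x y) (s x e)"
      using eqv[of "linepath x y" e] l xe by simp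
    ultimately show "\<exists>p. path p \<and> path_image p \<subseteq> P \<inter> ball (f (fst w)) d \<and> pathstart p = f (fst w) \<and>
          pathfinish p = f (fst w') \<and> s (fst w') (snd w') = \<rho> p (s (fst w) (snd w))"
      using xe y by (intro exI[of _ "f \<circ> linepath x y"]) (auto simp: pathstart_compose pathfinish_compose)
  qed
qed

lemma transport_subset:
  assumes "A \<subseteq> P" "locally_starlike A"
  shows "transport A E \<rho>"
proof
  show "homotopic_paths A p q \<Longrightarrow> e \<in> E \<Longrightarrow> \<rho> p e = \<rho> q e" for p q e
    using assms(1) homotopic homotopic_paths_subset by blast
qed (use assms bij join in auto)

text \<open>One topology is defined by paths in \<open>A\<close>, the other by paths in
  \<open>P\<close>. Both have sheets as neighbourhoods, and a sheet depends on transport along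
  segments alone.\<close>

lemma subtopology_cover:
  assumes "A \<subseteq> P" "locally_starlike A"
  shows "subtopology X (A \<times> E) = cover_space A E \<rho>"
proof -
  interpret A: transport A E \<rho>
    using transport_subset[OF assms] .
  have "openin A.X U" if U: "openin (subtopology X (A \<times> E)) U" for U
  proof -
    obtain V where V: "openin X V" "U = V \<inter> (A \<times> E)"
      using U by (auto simp: openin_subtopology)
    have "continuous_map A.X X (\<lambda>w. (id (fst w), (\<lambda>_. id) (fst w) (snd w)))"
      using assms(1) by (intro continuous_map_cover_map[OF A.transport_axioms]) (auto simp: comp_def)
    then have "openin A.X {w \<in> topspace A.X. w \<in> V}"
      using V(1) by (simp add: continuous_map_def)
    moreover have "{w \<in> topspace A.X. w \<in> V} = U"
      using V by auto
    ultimately show ?thesis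
      by simp
  qed
  moreover have "openin (subtopology X (A \<times> E)) U" if U: "openin A.X U" for U
  proof (subst openin_subopen, intro ballI)
    fix w assume w: "w \<in> U"
    then obtain x e where xe: "w = (x, e)" "x \<in> A" "e \<in> E"
      using openin_subset[OF U] by auto
    obtain d where d: "star_radius P x d"
      using star assms(1) xe(2) unfolding locally_starlike_def by blast
    obtain c where c: "star_radius A x c"
      using assms(2) xe(2) unfolding locally_starlike_def by blast
    obtain r where r: "0 < r" "r \<le> c" "A.sheet x e r \<subseteq> U"
      using A.sheet_basis[OF U _ c, of e] w xe by auto
    have "sheet x e (min r d) \<inter> (A \<times> E) \<subseteq> A.sheet x e r"
      by (auto simp: sheet_def A.sheet_def)
    moreover have "openin X (sheet x e (min r d))"
      using d xe assms by (intro openin_sheet[OF d]) auto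
    moreover have "w \<in> sheet x e (min r d)"
      using xe assms r d by (auto simp: star_radius_def intro!: centre_in_sheet)
    ultimately show "\<exists>T. openin (subtopology X (A \<times> E)) T \<and> w \<in> T \<and> T \<subseteq> U"
      using r xe by (intro exI[of _ "sheet x e (min r d) \<inter> (A \<times> E)"]) (auto simp: openin_subtopology)
  qed
  ultimately show ?thesis
    by (metis topology_eq)
qed

end

section \<open>Lifting maps defined on convex sets\<close>

lemma locally_path_connected_space_convex:
  fixes T :: "'b::real_normed_vector set"
  assumes "convex T"
  shows "locally_path_connected_space (top_of_set T)"
  unfolding locally_path_connected_space
proof (intro allI impI)
  fix V x assume V: "openin (top_of_set T) V \<and> x \<in> V"
  then obtain r where r: "r > 0" "ball x r \<inter> T \<subseteq> V"
    using openin_contains_ball[of T V] by meson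
  have "path_connected (ball x r \<inter> T)"
    using assms by (intro convex_imp_path_connected convex_Int) auto
  moreover have "x \<in> T"
    using V openin_subset[of "top_of_set T" V] by auto
  ultimately show "\<exists>U. openin (top_of_set T) U \<and> path_connectedin (top_of_set T) U \<and> x \<in> U \<and> U \<subseteq> V"
    using r by (intro exI[of _ "ball x r \<inter> T"]) (auto simp: path_connectedin_subtopology openin_open)
qed

context transport begin

definition lift :: "('b::real_normed_vector \<Rightarrow> 'a) \<Rightarrow> 'b \<Rightarrow> 'e \<Rightarrow> 'b \<Rightarrow> 'a \<times> 'e" where
  "lift a z0 e z = (a z, \<rho> (a \<circ> linepath z0 z) e)"

text \<open>The contraction of \<open>T\<close> to \<open>z0\<close> along segments gives a homotopy
  from a constant map to \<open>a\<close>; lifted to the covering, it ends in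
  \<open>lift a z0 e\<close>.\<close>

lemma continuous_map_lift:
  fixes a :: "'b::real_normed_vector \<Rightarrow> 'a"
  assumes T: "convex T" "z0 \<in> T" and a: "continuous_on T a" "a ` T \<subseteq> P" and e: "e \<in> E"
  shows "continuous_map (top_of_set T) X (lift a z0 e)"
proof -
  let ?I = "top_of_set {0..1::real}"
  let ?h = "\<lambda>w. a (z0 + fst w *\<^sub>R (snd w - z0))"
  have inT: "z0 + t *\<^sub>R (z - z0) \<in> T" if "t \<in> {0..1}" "z \<in> T" for t z
  proof -
    have "(1 - t) *\<^sub>R z0 + t *\<^sub>R z \<in> T"
      using T that unfolding convex_alt by auto
    then show ?thesis
      by (simp add: algebra_simps)
  qed
  have prod: "prod_topology ?I (top_of_set T) = top_of_set ({0..1} \<times> T)"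
    by (simp add: prod_topology_subtopology_eu)
  have a0: "a z0 \<in> P"
    using a T by auto
  have 1: "continuous_map (prod_topology ?I (top_of_set T)) X
     (\<lambda>w. (?h w, \<rho> (\<lambda>s. ?h (fst w * s, snd w)) (snd ((\<lambda>_. (a z0, e)) (snd w)))))"
  proof (rule covering_homotopy)
    show "continuous_map (prod_topology ?I (top_of_set T)) (top_of_set P) ?h"
      unfolding prod using inT a
      by (auto intro!: continuous_on_compose2[OF a(1)] continuous_intros)
  qed (use locally_path_connected_space_convex[OF T(1)] a0 e in auto)
  have 2: "continuous_map (top_of_set T) (prod_topology ?I (top_of_set T)) (\<lambda>z. (1, z))"
    unfolding prod by (auto intro!: continuous_intros)
  have "continuous_map (top_of_set T) X ((\<lambda>w. (?h w, \<rho> (\<lambda>s. ?h (fst w * s, snd w)) e)) \<circ> (\<lambda>z. (1, z)))"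
    using continuous_map_compose[OF 2 1] by simp
  moreover have "(\<lambda>w. (?h w, \<rho> (\<lambda>s. ?h (fst w * s, snd w)) e)) \<circ> (\<lambda>z. (1, z)) = lift a z0 e"
    by (auto simp: lift_def fun_eq_iff linepath_def comp_def algebra_simps)
  ultimately show ?thesis
    by simp
qed

text \<open>In a convex set the segment may be traded for any path with the same ends, in particular
  for one running where two maps agree.\<close>

lemma lift_transport:
  fixes a :: "'b::real_normed_vector \<Rightarrow> 'a"
  assumes T: "convex T" and a: "continuous_on T a" "a ` T \<subseteq> P" and e: "e \<in> E"
    and p: "path p" "path_image p \<subseteq> T" "pathstart p = z0" "pathfinish p = z"
  shows "lift a z0 e z = (a z, \<rho> (a \<circ> p) e)"
proof -
  have z: "z0 \<in> T" "z \<in> T"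
    using p by auto
  then have l: "path_image (linepath z0 z) \<subseteq> T"
    using T by (simp add: closed_segment_subset)
  have "simply_connected T"
    using T by (rule convex_imp_simply_connected)
  then have "homotopic_paths T (linepath z0 z) p"
    using p l unfolding simply_connected_eq_homotopic_paths by auto
  then have "homotopic_paths P (a \<circ> linepath z0 z) (a \<circ> p)"
    using a by (intro homotopic_paths_continuous_image) auto
  with e show ?thesis
    by (auto simp: lift_def intro: homotopic)
qed

end

subsection \<open>Homology of coverings of 2-complexes\<close>

text \<open>Exactness of the homology sequence of a pair whose subspace has no homology in degree
  \<open>p\<close>: the error \<open>?a\<close> of a relative bounding chain is a cycle in
  \<open>A\<close>, hence bounds.\<close>

lemma singular_boundary_from_relative:
  assumes c: "singular_relcycle p X {} c" and rel: "singular_relboundary p X A c"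
    and A: "\<And>a. singular_relcycle p (subtopology X A) {} a \<Longrightarrow> singular_relboundary p (subtopology X A) {} a"
  shows "singular_relboundary p X {} c"
proof -
  obtain d where d: "singular_chain (Suc p) X d" "singular_chain p (subtopology X A) (chain_boundary (Suc p) d - c)"
    using rel by (auto simp: singular_relboundary_def mod_subset_def)
  let ?a = "chain_boundary (Suc p) d - c"
  have bd: "singular_relcycle p X {} (chain_boundary (Suc p) d)"
    using d(1) by (intro singular_relboundary_imp_relcycle) (auto simp: singular_boundary)
  have "chain_boundary p ?a = 0"
    using c bd by (auto simp: singular_cycle chain_boundary_diff)
  then have "singular_relcycle p (subtopology X A) {} ?a"
    using d(2) by (simp add: singular_cycle)
  then have "singular_relboundary p X {} ?a"
    using A singular_boundary_mono[of A UNIV p X ?a] by simp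
  moreover have "singular_relboundary p X {} (chain_boundary (Suc p) d)"
    using d(1) by (auto simp: singular_boundary)
  ultimately have "singular_relboundary p X {} (chain_boundary (Suc p) d - ?a)"
    by (rule singular_relboundary_diff[rotated])
  then show ?thesis
    by simp
qed

text \<open>Up to homology the cycle can be moved into \<open>A\<close>, where every cycle
  bounds.\<close>

lemma singular_boundary_from_deformation:
  assumes c: "singular_relcycle p X {} c"
    and r: "homotopic_with (\<lambda>_. True) X X id r" "r ` topspace X \<subseteq> A"
    and A: "\<And>a. singular_relcycle p (subtopology X A) {} a \<Longrightarrow> singular_relboundary p (subtopology X A) {} a"
  shows "singular_relboundary p X {} c"
proof -
  have "homologous_rel p X {} (chain_map p id c) (chain_map p r c)"
    using r(1) c by (intro homotopic_imp_homologous_rel_chain_maps[of "{}"]) auto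
  moreover have "chain_map p id c = c"
    using c chain_map_id_gen[of p X c id] by (simp add: singular_cycle)
  moreover have cr: "continuous_map X (subtopology X A) r"
    using r by (auto simp: continuous_map_in_subtopology dest: homotopic_with_imp_continuous_maps)
  have "singular_relcycle p (subtopology X A) {} (chain_map p r c)"
    using singular_relcycle_chain_map[OF c cr] by auto
  then have "singular_relboundary p X {} (chain_map p r c)"
    using A singular_boundary_mono[of A UNIV p X] by simp
  ultimately show ?thesis
    by (metis homologous_rel_def diff_add_cancel singular_relboundary_add)
qed

text \<open>Injectivity of the excision isomorphism, stated for a single cycle.\<close>

lemma excision_singular_relboundary:
  assumes cl: "X closure_of U \<subseteq> X interior_of T" and T: "T \<subseteq> topspace X"
    and c: "singular_relcycle p (subtopology X (topspace X - U)) (T - U) c"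
    and rel: "singular_relboundary p X T c"
  shows "singular_relboundary p (subtopology X (topspace X - U)) (T - U) c"
proof -
  let ?N = "subtopology X (topspace X - U)"
  let ?f = "hom_induced p ?N (T - U) (subtopology X (topspace X)) T id"
  have iso: "?f \<in> iso (relative_homology_group p ?N (T - U)) (relative_homology_group p (subtopology X (topspace X)) T)"
    using homology_excision_axiom[OF cl T] .
  have cc: "chain_map p id c = c"
    using c by (intro chain_map_id_gen[of p ?N]) (auto simp: singular_relcycle)
  have z: "homologous_rel_set p ?N (T - U) c \<in> carrier (relative_homology_group p ?N (T - U))"
    using c by (auto simp: carrier_relative_homology_group)
  have "?f (homologous_rel_set p ?N (T - U) c) = homologous_rel_set p X T c"
    using c by (subst hom_induced_chain_map) (auto simp: cc intro: continuous_map_from_subtopology)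
  also have "\<dots> = \<one>\<^bsub>relative_homology_group p (subtopology X (topspace X)) T\<^esub>"
    using rel by (simp add: homologous_rel_set_eq_relboundary)
  also have "\<dots> = ?f \<one>\<^bsub>relative_homology_group p ?N (T - U)\<^esub>"
    using hom_one[OF iso_imp_homomorphism[OF iso] group_relative_homology_group group_relative_homology_group] by argo
  finally have "homologous_rel_set p ?N (T - U) c = \<one>\<^bsub>relative_homology_group p ?N (T - U)\<^esub>"
    using iso z monoid.one_closed[OF group.is_monoid[OF group_relative_homology_group[of p ?N "T - U"]]]
    unfolding iso_def bij_betw_def inj_on_def by blast
  then show ?thesis
    by (simp add: homologous_rel_set_eq_relboundary)
qed

lemma singular_simplex_in_one_part:
  assumes f: "singular_simplex p (subtopology X (\<Union>(N ` C))) f"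
    and N: "\<And>q. q \<in> C \<Longrightarrow> openin X (N q)" "\<And>q q'. q \<in> C \<Longrightarrow> q' \<in> C \<Longrightarrow> q \<noteq> q' \<Longrightarrow> N q \<inter> N q' = {}"
  obtains q where "q \<in> C" "f ` standard_simplex p \<subseteq> N q"
proof -
  have im: "f ` standard_simplex p \<subseteq> \<Union>(N ` C)"
    using f by (simp add: singular_simplex_subtopology)
  obtain v where v: "v \<in> standard_simplex p"
    using nonempty_standard_simplex by blast
  then obtain q where q: "q \<in> C" "f v \<in> N q"
    using im by blast
  have con: "connectedin X (f ` standard_simplex p)"
    using connectedin_continuous_map_image[of "subtopology (powertop_real UNIV) (standard_simplex p)" X f "standard_simplex p"]
      connectedin_standard_simplex[of p] f
    by (auto simp: singular_simplex_subtopology singular_simplex_def connectedin_subtopology continuous_map_in_subtopology)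
  have "openin X (N q)" "openin X (\<Union>(N ` (C - {q})))"
    using N(1) q by (auto intro!: openin_Union)
  moreover have "f ` standard_simplex p \<subseteq> N q \<union> \<Union>(N ` (C - {q}))"
    using im by blast
  moreover have "N q \<inter> \<Union>(N ` (C - {q})) \<inter> f ` standard_simplex p = {}"
    using N(2) q by blast
  moreover have "N q \<inter> f ` standard_simplex p \<noteq> {}"
    using q v by blast
  ultimately have "\<Union>(N ` (C - {q})) \<inter> f ` standard_simplex p = {}"
    using con unfolding connectedin by blast
  with im q show thesis
    by (intro that[of q]) auto
qed

lemma frag_extend_diff_fun: "frag_extend (\<lambda>f. g f - h f) c = frag_extend g c - frag_extend h c"
  using subset_UNIV by (induction c rule: frag_induction) (auto simp: frag_extend_diff)

lemma singular_relboundary_mono: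
  "singular_relboundary p X S c \<Longrightarrow> S \<subseteq> T \<Longrightarrow> singular_relboundary p X T c"
  using singular_chain_mono[of p X S _ T] unfolding singular_relboundary_def mod_subset_def by auto

text \<open>There may be infinitely many points \<open>q\<close>, but a chain in the union of the
  disjoint neighbourhoods meets only finitely many of them. After excision the cycle splits into
  pieces, one in each \<open>N q\<close>. Pieces at other points miss \<open>q\<close>, so the
  hypothesis at \<open>q\<close> concerns the piece at \<open>q\<close> alone, and a second excision
  places its bounding chain inside \<open>N q\<close>, away from the rest of
  \<open>C\<close>.\<close>

lemma singular_relboundary_from_points:
  assumes C: "C \<subseteq> topspace X" "closedin X C"
    and N: "\<And>q. q \<in> C \<Longrightarrow> openin X (N q)" "\<And>q. q \<in> C \<Longrightarrow> q \<in> N q"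
      "\<And>q q'. q \<in> C \<Longrightarrow> q' \<in> C \<Longrightarrow> q \<noteq> q' \<Longrightarrow> N q \<inter> N q' = {}"
    and c: "singular_relcycle p X (topspace X - C) c"
    and loc: "\<And>q. q \<in> C \<Longrightarrow> singular_relboundary p X (topspace X - {q}) c"
  shows "singular_relboundary p X (topspace X - C) c"
proof -
  let ?T = "topspace X - C"
  define U where "U = topspace X - \<Union>(N ` C)"
  have NX: "N q \<subseteq> topspace X" if "q \<in> C" for q
    using N(1)[OF that] openin_subset by blast
  then have XU: "topspace X - U = \<Union>(N ` C)"
    by (auto simp: U_def)
  have clU: "closedin X U"
    using N(1) by (auto simp: U_def intro!: openin_Union)
  have opT: "openin X ?T"
    using C by auto
  have "U \<subseteq> ?T"
    using N(2) by (auto simp: U_def)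
  then have cl: "X closure_of U \<subseteq> X interior_of ?T"
    using clU opT by (simp add: closure_of_closedin interior_of_openin)
  obtain c' where c': "singular_relcycle p (subtopology X (\<Union>(N ` C))) (?T - U) c'"
    and hom: "homologous_rel p X ?T c c'"
    using excised_relcycle_exists[OF cl, of "topspace X" p c] c unfolding XU by auto
  have c'ch: "singular_chain p (subtopology X (\<Union>(N ` C))) c'"
    and c'bd: "singular_chain (p - 1) (subtopology X (?T - U)) (chain_boundary p c')"
  proof -
    have "\<Union>(N ` C) \<inter> (?T - U) = ?T - U"
      unfolding XU[symmetric] by auto
    with c' show "singular_chain p (subtopology X (\<Union>(N ` C))) c'" "singular_chain (p - 1) (subtopology X (?T - U)) (chain_boundary p c')"
      by (auto simp: singular_relcycle_def mod_subset_def subtopology_subtopology)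
  qed
  \<comment> \<open>The part of a chain carried by \<open>N q\<close>. A simplex of the union is
    connected, so it lies in exactly one neighbourhood together with its faces; hence \<pi> commutes
    with the boundary.\<close>
  define \<pi> where "\<pi> p q = frag_extend (\<lambda>f. if f ` standard_simplex p \<subseteq> N q then frag_of f else (0 :: 'a chain))" for p q
  have part: "\<exists>!q. q \<in> C \<and> f ` standard_simplex p \<subseteq> N q" if f: "singular_simplex p (subtopology X (\<Union>(N ` C))) f" for f p
  proof -
    obtain q where q: "q \<in> C" "f ` standard_simplex p \<subseteq> N q"
      using singular_simplex_in_one_part[OF f N(1,3)] by blast
    obtain v where "v \<in> standard_simplex p"
      using nonempty_standard_simplex by blast
    with q N(3) show ?thesis
      by (intro ex1I[of _ q]) (blast, metis (no_types, lifting) disjoint_iff image_subset_iff)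
  qed
  have pi_chain: "singular_chain p (subtopology X (A \<inter> N q)) (\<pi> p q b)" if "singular_chain p (subtopology X A) b" for p q b A
    using that unfolding \<pi>_def
  proof (intro singular_chain_extend)
    fix f assume "f \<in> Poly_Mapping.keys b"
    then have "singular_simplex p (subtopology X A) f"
      using that by (auto simp: singular_chain_def)
    then show "singular_chain p (subtopology X (A \<inter> N q)) (if f ` standard_simplex p \<subseteq> N q then frag_of f else 0)"
      by (auto simp: singular_chain_of singular_simplex_subtopology)
  qed
  have pi_bd: "chain_boundary p (\<pi> p q b) = \<pi> (p - 1) q (chain_boundary p b)"
    if b: "singular_chain p (subtopology X (\<Union>(N ` C))) b" and q: "q \<in> C" for p q b
  proof (cases "p = 0")
    case True
    then show ?thesis
      by (simp add: chain_boundary_def \<pi>_def)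
  next
    case False
    show ?thesis
      using b unfolding singular_chain_def
    proof (induction b rule: frag_induction)
      case (one f)
      then have f: "singular_simplex p (subtopology X (\<Union>(N ` C))) f"
        by simp
      have face: "singular_face p k f ` standard_simplex (p - 1) \<subseteq> N q \<longleftrightarrow> f ` standard_simplex p \<subseteq> N q" if "k \<le> p" for k
      proof -
        have sf: "singular_simplex (p - 1) (subtopology X (\<Union>(N ` C))) (singular_face p k f)"
          using singular_simplex_singular_face[OF f, of k] False that by simp
        have sub: "singular_face p k f ` standard_simplex (p - 1) \<subseteq> f ` standard_simplex p"
          using False that simplical_face_in_standard_simplex[of p k] by (auto simp: singular_face_def)
        show ?thesis
          using part[OF sf] part[OF f] q sub by (metis (no_types, lifting) order_trans)
      qed
      show ?case
      proof (cases "f ` standard_simplex p \<subseteq> N q")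
        case True
        then show ?thesis
          using False face
          by (auto simp: \<pi>_def chain_boundary_of frag_extend_sum frag_extend_cmul intro!: sum.cong)
      next
        case no: False
        then show ?thesis
          using False face
          by (auto simp: \<pi>_def chain_boundary_of frag_extend_sum frag_extend_cmul intro!: sum.neutral)
      qed
    qed (auto simp: \<pi>_def frag_extend_diff chain_boundary_diff)
  qed
  define Q where "Q = {q \<in> C. \<exists>f\<in>Poly_Mapping.keys c'. f ` standard_simplex p \<subseteq> N q}"
  define qf where "qf f = (THE q. q \<in> C \<and> f ` standard_simplex p \<subseteq> N q)" for f
  have key: "singular_simplex p (subtopology X (\<Union>(N ` C))) f" if "f \<in> Poly_Mapping.keys c'" for f
    using c'ch that by (auto simp: singular_chain_def)
  have "Q \<subseteq> qf ` Poly_Mapping.keys c'"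
  proof
    fix q assume "q \<in> Q"
    then obtain f where f: "q \<in> C" "f \<in> Poly_Mapping.keys c'" "f ` standard_simplex p \<subseteq> N q"
      by (auto simp: Q_def)
    have "qf f = q"
      unfolding qf_def using f by (intro the1_equality[OF part[OF key]]) auto
    with f show "q \<in> qf ` Poly_Mapping.keys c'"
      by blast
  qed
  then have finQ: "finite Q"
    by (rule finite_subset) simp
  have sum: "c' = (\<Sum>q\<in>Q. \<pi> p q c')"
  proof -
    have "(\<Sum>q\<in>Q. \<pi> p q c') = (\<Sum>q\<in>Q. \<Sum>f\<in>Poly_Mapping.keys c'. if f ` standard_simplex p \<subseteq> N q then frag_cmul (Poly_Mapping.lookup c' f) (frag_of f) else 0)"
      unfolding \<pi>_def frag_extend_def by (intro sum.cong) auto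
    also have "\<dots> = (\<Sum>f\<in>Poly_Mapping.keys c'. \<Sum>q\<in>Q. if f ` standard_simplex p \<subseteq> N q then frag_cmul (Poly_Mapping.lookup c' f) (frag_of f) else 0)"
      by (rule sum.swap)
    also have "\<dots> = (\<Sum>f\<in>Poly_Mapping.keys c'. frag_cmul (Poly_Mapping.lookup c' f) (frag_of f))"
    proof (intro sum.cong HOL.refl)
      fix f assume f: "f \<in> Poly_Mapping.keys c'"
      obtain q where q: "q \<in> C" "f ` standard_simplex p \<subseteq> N q" "\<And>q'. q' \<in> C \<Longrightarrow> f ` standard_simplex p \<subseteq> N q' \<Longrightarrow> q' = q"
      proof -
        from part[OF key[OF f]] obtain q where "q \<in> C \<and> f ` standard_simplex p \<subseteq> N q"
          "\<forall>y. y \<in> C \<and> f ` standard_simplex p \<subseteq> N y \<longrightarrow> y = q"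
          by (elim ex1E)
        then show thesis
          by (intro that[of q]) blast+
      qed
      have "(\<Sum>q'\<in>Q. if f ` standard_simplex p \<subseteq> N q' then frag_cmul (Poly_Mapping.lookup c' f) (frag_of f) else 0)
          = (\<Sum>q'\<in>Q. if q' = q then frag_cmul (Poly_Mapping.lookup c' f) (frag_of f) else 0)"
      proof (rule sum.cong[OF HOL.refl])
        fix q' assume "q' \<in> Q"
        then have "(f ` standard_simplex p \<subseteq> N q') = (q' = q)"
          using q(2) q(3)[of q'] by (auto simp only: Q_def)
        then show "(if f ` standard_simplex p \<subseteq> N q' then frag_cmul (Poly_Mapping.lookup c' f) (frag_of f) else 0)
          = (if q' = q then frag_cmul (Poly_Mapping.lookup c' f) (frag_of f) else 0)"
          by simp
      qed
      also have "\<dots> = frag_cmul (Poly_Mapping.lookup c' f) (frag_of f)"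
        using finQ q(1,2) f by (auto simp: sum.delta Q_def)
      finally show "(\<Sum>q'\<in>Q. if f ` standard_simplex p \<subseteq> N q' then frag_cmul (Poly_Mapping.lookup c' f) (frag_of f) else 0)
          = frag_cmul (Poly_Mapping.lookup c' f) (frag_of f)" .
    qed
    also have "\<dots> = c'"
      by (rule frag_expansion[unfolded frag_extend_def, symmetric])
    finally show ?thesis
      by simp
  qed
  have pi_rel: "singular_relboundary p X ?T (\<pi> p q c')" if q: "q \<in> C" for q
  proof -
    let ?U = "topspace X - N q"
    have XUq: "topspace X - ?U = N q"
      using NX[OF q] by auto
    have Tq: "(topspace X - {q}) - ?U = N q - {q}"
      using NX[OF q] by auto
    have NC: "N q \<inter> (?T - U) \<subseteq> N q - {q}" "N q - {q} \<subseteq> ?T"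
    proof -
      have "x \<notin> C" if "x \<in> N q" "x \<noteq> q" for x
        using N(2)[of x] N(3)[OF q, of x] that by blast
      then show "N q \<inter> (?T - U) \<subseteq> N q - {q}" "N q - {q} \<subseteq> ?T"
        using NX[OF q] q by auto
    qed
    have ch: "singular_chain p (subtopology X (N q)) (\<pi> p q c')"
      using pi_chain[OF c'ch, of q] q by (simp add: Int_absorb1 Sup_upper)
    have "singular_chain (p - 1) (subtopology X ((?T - U) \<inter> N q)) (chain_boundary p (\<pi> p q c'))"
      using pi_chain[OF c'bd, of q] pi_bd[OF c'ch q] by simp
    then have "singular_chain (p - 1) (subtopology X (N q - {q})) (chain_boundary p (\<pi> p q c'))"
      by (rule singular_chain_mono) (use NC in auto)
    then have cyc: "singular_relcycle p (subtopology X (N q)) (N q - {q}) (\<pi> p q c')"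
      using ch by (simp add: singular_relcycle_def mod_subset_def subtopology_subtopology Int_absorb1)
    have "singular_chain p (subtopology X (topspace X - {q})) (c' - \<pi> p q c')"
    proof -
      have "c' - \<pi> p q c' = frag_extend (\<lambda>f. frag_of f - (if f ` standard_simplex p \<subseteq> N q then frag_of f else 0)) c'"
        unfolding frag_extend_diff_fun \<pi>_def by (simp flip: frag_expansion)
      also have "singular_chain p (subtopology X (topspace X - {q})) \<dots>"
      proof (rule singular_chain_extend)
        fix f assume f: "f \<in> Poly_Mapping.keys c'"
        obtain q' where q': "q' \<in> C" "f ` standard_simplex p \<subseteq> N q'"
          using part[OF key[OF f]] by blast
        show "singular_chain p (subtopology X (topspace X - {q})) (frag_of f - (if f ` standard_simplex p \<subseteq> N q then frag_of f else 0))"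
        proof (cases "q' = q")
          case False
          then have "N q' \<subseteq> topspace X - {q}"
            using N(2,3) q q'(1) NX by blast
          with q' key[OF f] have "singular_simplex p (subtopology X (topspace X - {q})) f"
            by (auto simp: singular_simplex_subtopology)
          then show ?thesis
            by (auto simp: singular_chain_of)
        qed (use q' in simp)
      qed
      finally show ?thesis .
    qed
    then have "singular_relboundary p X (topspace X - {q}) (c' - \<pi> p q c')"
      by (rule singular_chain_imp_relboundary)
    moreover have "singular_relboundary p X (topspace X - {q}) c'"
    proof -
      have "singular_relboundary p X (topspace X - {q}) (c - c')"
        using singular_relboundary_mono[of p X ?T "c - c'" "topspace X - {q}"] hom q unfolding homologous_rel_def by blast
      with loc[OF q] show ?thesis
        using singular_relboundary_diff by fastforce
    qed
    ultimately have "singular_relboundary p X (topspace X - {q}) (\<pi> p q c')"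
      using singular_relboundary_diff by fastforce
    moreover have "X closure_of ?U \<subseteq> X interior_of (topspace X - {q})"
    proof -
      have "closedin X ?U"
        using N(1)[OF q] by auto
      moreover have "openin X (topspace X - {q})"
      proof -
        have "topspace X - {q} = ?T \<union> \<Union>(N ` (C - {q}))"
        proof
          show "topspace X - {q} \<subseteq> ?T \<union> \<Union>(N ` (C - {q}))"
            using N(2) by blast
          show "?T \<union> \<Union>(N ` (C - {q})) \<subseteq> topspace X - {q}"
            using N(2)[OF q] N(3)[OF q] NX q by blast
        qed
        moreover have "openin X (\<Union>(N ` (C - {q})))"
          using N(1) by (intro openin_Union) auto
        ultimately show ?thesis
          using opT by (simp add: openin_Un)
      qed
      ultimately show ?thesis
        using N(2)[OF q] by (auto simp: closure_of_closedin interior_of_openin)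
    qed
    ultimately have "singular_relboundary p (subtopology X (N q)) (N q - {q}) (\<pi> p q c')"
      using excision_singular_relboundary[of X ?U "topspace X - {q}" p "\<pi> p q c'"] cyc unfolding XUq Tq by blast
    then obtain d where d: "singular_chain (Suc p) (subtopology X (N q)) d"
      "singular_chain p (subtopology X (N q - {q})) (chain_boundary (Suc p) d - \<pi> p q c')"
      by (auto simp: singular_relboundary_def mod_subset_def subtopology_subtopology Int_absorb1)
    have "singular_chain p (subtopology X ?T) (chain_boundary (Suc p) d - \<pi> p q c')"
      using d(2) NC(2) by (rule singular_chain_mono)
    moreover have "singular_chain (Suc p) X d"
      using singular_chain_mono[OF d(1), of UNIV] by simp
    ultimately show ?thesis
      by (auto simp: singular_relboundary_def mod_subset_def)
  qed
  have "singular_relboundary p X ?T (\<Sum>q\<in>Q. \<pi> p q c')"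
  proof -
    have "singular_relboundary p X ?T (sum (\<lambda>q. \<pi> p q c') Q')" if "Q' \<subseteq> Q" for Q'
      using finite_subset[OF that finQ] that
      by (induction Q' rule: finite_induct) (auto simp: Q_def intro!: singular_relboundary_add pi_rel)
    then show ?thesis
      by blast
  qed
  with sum have "singular_relboundary p X ?T c'"
    by simp
  then show ?thesis
    using hom singular_relboundary_add[of p X ?T "c - c'" c'] unfolding homologous_rel_def by simp
qed

section \<open>Homotopies relative to a subset\<close>

lemma homotopic_with_canon_alt:
  "homotopic_with_canon (\<lambda>_. True) X Y f g \<longleftrightarrow>
    (\<exists>h. continuous_on ({0..1::real} \<times> X) h \<and> h ` ({0..1} \<times> X) \<subseteq> Y \<and> (\<forall>x\<in>X. h (0, x) = f x \<and> h (1, x) = g x))"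
proof -
  have "prod_topology (top_of_set {0..1::real}) (top_of_set X) = top_of_set ({0..1} \<times> X)"
    by (simp add: prod_topology_subtopology_eu)
  then show ?thesis
    by (subst homotopic_with) (auto simp: image_subset_iff_funcset)
qed

text \<open>Running \<Phi>1 forwards and \<Phi>2 backwards joins the two initial maps, and each
  point of \<open>L\<close> goes out and returns along the same track. Homotopy extension turns the
  retraction of these tracks into a deformation of the whole homotopy. The lemma is applied wherever
  a homotopy has to be made stationary on a subset.\<close>

lemma homotopy_rel_from_common_trace:
  fixes \<Phi>1 \<Phi>2 :: "real \<times> 'b::euclidean_space \<Rightarrow> 'a::euclidean_space"
  assumes L: "closedin (top_of_set X) L" and Q: "ANR Q"
    and \<Phi>1: "continuous_on ({0..1} \<times> X) \<Phi>1" "\<Phi>1 ` ({0..1} \<times> X) \<subseteq> Q"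
    and \<Phi>2: "continuous_on ({0..1} \<times> X) \<Phi>2" "\<Phi>2 ` ({0..1} \<times> X) \<subseteq> Q"
    and agree: "\<And>t x. t \<in> {0..1} \<Longrightarrow> x \<in> L \<Longrightarrow> \<Phi>1 (t, x) = \<Phi>2 (t, x)"
    and fin: "\<And>x. x \<in> X \<Longrightarrow> \<Phi>1 (1, x) = \<Phi>2 (1, x)"
  obtains \<Psi> :: "real \<times> 'b \<Rightarrow> 'a" where "continuous_on ({0..1} \<times> X) \<Psi>" "\<Psi> ` ({0..1} \<times> X) \<subseteq> Q"
    "\<And>x. x \<in> X \<Longrightarrow> \<Psi> (0, x) = \<Phi>1 (0, x)" "\<And>x. x \<in> X \<Longrightarrow> \<Psi> (1, x) = \<Phi>2 (0, x)"
    "\<And>t x. t \<in> {0..1} \<Longrightarrow> x \<in> L \<Longrightarrow> \<Psi> (t, x) = \<Phi>1 (0, x)"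
proof -
  have LX: "L \<subseteq> X"
    using L closedin_imp_subset by blast
  \<comment> \<open>At stage \<open>s\<close> only the first \<open>1 - s\<close> of each track is
    used. For \<open>s > 0\<close> the formula has to be continuous merely over \<open>S\<close>: at
    both ends of the time interval it is stationary, and over \<open>L\<close> the two halves
    fit.\<close>
  define K where "K = (\<lambda>(s :: real, w). if fst w \<le> 1/2 then \<Phi>1 ((1 - s) * (2 * fst w), snd w) else \<Phi>2 ((1 - s) * (2 - 2 * fst w), snd w))"
  define S where "S = {0, 1::real} \<times> X \<union> {0..1} \<times> L"
  have inI: "(1 - s) * r \<in> {0..1}" if "s \<in> {0..1}" "r \<in> {0..1}" for s r :: real
    using that by (auto intro: mult_le_one)
  have contK: "continuous_on ({0..1} \<times> S) K"
    unfolding K_def case_prod_unfold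
  proof (rule continuous_on_cases_le)
    show "continuous_on {q \<in> {0..1} \<times> S. fst (snd q) \<le> 1/2} (\<lambda>q. \<Phi>1 ((1 - fst q) * (2 * fst (snd q)), snd (snd q)))"
      using LX inI by (intro continuous_on_compose2[OF \<Phi>1(1)] continuous_intros) (auto simp: S_def)
    show "continuous_on {q \<in> {0..1} \<times> S. 1/2 \<le> fst (snd q)} (\<lambda>q. \<Phi>2 ((1 - fst q) * (2 - 2 * fst (snd q)), snd (snd q)))"
      using LX inI by (intro continuous_on_compose2[OF \<Phi>2(1)] continuous_intros) (auto simp: S_def)
    show "continuous_on ({0..1} \<times> S) (\<lambda>q. fst (snd q))"
      by (intro continuous_intros)
    fix q assume q: "q \<in> {0..1::real} \<times> S" "fst (snd q) = 1/2"
    then have "snd (snd q) \<in> L"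
      by (auto simp: S_def)
    then show "\<Phi>1 ((1 - fst q) * (2 * fst (snd q)), snd (snd q)) = \<Phi>2 ((1 - fst q) * (2 - 2 * fst (snd q)), snd (snd q))"
      unfolding q(2) using q(1) agree[of "1 - fst q" "snd (snd q)"] by auto
  qed
  have G: "(\<lambda>w. K (0, w)) = (\<lambda>w. if fst w \<le> 1/2 then \<Phi>1 (2 * fst w, snd w) else \<Phi>2 (2 - 2 * fst w, snd w))"
    by (simp add: K_def fun_eq_iff)
  have contG: "continuous_on ({0..1} \<times> X) (\<lambda>w. K (0, w))"
    unfolding G
  proof (rule continuous_on_cases_le)
    show "continuous_on {q \<in> {0..1} \<times> X. fst q \<le> 1/2} (\<lambda>q. \<Phi>1 (2 * fst q, snd q))"
      by (intro continuous_on_compose2[OF \<Phi>1(1)] continuous_intros) auto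
    show "continuous_on {q \<in> {0..1} \<times> X. 1/2 \<le> fst q} (\<lambda>q. \<Phi>2 (2 - 2 * fst q, snd q))"
      by (intro continuous_on_compose2[OF \<Phi>2(1)] continuous_intros) auto
    show "continuous_on ({0..1} \<times> X) fst"
      by (intro continuous_intros)
    fix q assume q: "q \<in> {0..1::real} \<times> X" "fst q = 1/2"
    show "\<Phi>1 (2 * fst q, snd q) = \<Phi>2 (2 - 2 * fst q, snd q)"
      unfolding q(2) using fin q(1) by auto
  qed
  have KQ: "K (s, w) \<in> Q" if "s \<in> {0..1}" "w \<in> {0..1} \<times> X" for s w
  proof (cases "fst w \<le> 1/2")
    case True
    then have "((1 - s) * (2 * fst w), snd w) \<in> {0..1} \<times> X"
      using that inI[of s "2 * fst w"] by (auto simp: mem_Times_iff)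
    then show ?thesis
      using \<Phi>1(2) True unfolding K_def by (simp add: image_subset_iff)
  next
    case False
    then have "((1 - s) * (2 - 2 * fst w), snd w) \<in> {0..1} \<times> X"
      using that inI[of s "2 - 2 * fst w"] by (auto simp: mem_Times_iff)
    then show ?thesis
      using \<Phi>2(2) False unfolding K_def by (simp add: image_subset_iff)
  qed
  have SX: "S \<subseteq> {0..1} \<times> X"
    using LX by (auto simp: S_def)
  have clS: "closedin (top_of_set ({0..1} \<times> X)) S"
    unfolding S_def using L by (intro closedin_Un closedin_Times) (auto intro: closed_subset)
  have hom: "homotopic_with_canon (\<lambda>x. True) S Q (\<lambda>w. K (0, w)) (\<lambda>w. K (1, w))"
    unfolding homotopic_with_canon_alt using contK KQ SX by (intro exI[of _ K]) auto
  have K0: "(\<lambda>w. K (0, w)) \<in> {0..1} \<times> X \<rightarrow> Q"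
    using KQ by auto
  obtain \<Psi> :: "real \<times> 'b \<Rightarrow> 'a" where \<Psi>: "continuous_on ({0..1} \<times> X) \<Psi>" "\<Psi> ` ({0..1} \<times> X) \<subseteq> Q" "\<And>w. w \<in> S \<Longrightarrow> \<Psi> w = K (1, w)"
    by (rule Borsuk_homotopy_extension_homotopic[OF clS disjI2[OF Q] contG K0 hom]) (rule that)
  show thesis
  proof (rule that[OF \<Psi>(1,2)])
    show "\<Psi> (0, x) = \<Phi>1 (0, x)" "\<Psi> (1, x) = \<Phi>2 (0, x)" if "x \<in> X" for x
      using that \<Psi>(3)[of "(0, x)"] \<Psi>(3)[of "(1, x)"] by (simp_all add: S_def K_def)
    show "\<Psi> (t, x) = \<Phi>1 (0, x)" if "t \<in> {0..1}" "x \<in> L" for t x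
      using that \<Psi>(3)[of "(t, x)"] agree[of 0 x] by (simp add: S_def K_def)
  qed
qed

text \<open>The radius keeps away from the removed points and from the members of \<open>F\<close>
  that do not contain \<open>x\<close>, so every nearby point shares a convex member with
  \<open>x\<close>.\<close>

lemma locally_starlike_Union_convex:
  fixes C :: "'a::euclidean_space set"
  assumes "finite F" and F: "\<And>S. S \<in> F \<Longrightarrow> closed S \<and> convex S" and C: "finite C"
  shows "locally_starlike (\<Union>F - C)"
  unfolding locally_starlike_def
proof
  fix x assume x: "x \<in> \<Union>F - C"
  define U where "U = (\<Inter>S\<in>{S \<in> F. x \<notin> S}. - S) \<inter> - C"
  have "open U"
    unfolding U_def using assms by (intro open_Int open_INT) (auto simp: finite_imp_closed open_Compl)
  moreover have "x \<in> U"
    using x by (auto simp: U_def)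
  ultimately obtain d where d: "d > 0" "ball x d \<subseteq> U"
    using open_contains_ball by blast
  have "closed_segment x y \<subseteq> \<Union>F - C" if y: "y \<in> (\<Union>F - C) \<inter> ball x d" for y
  proof -
    obtain S where S: "S \<in> F" "y \<in> S"
      using y by blast
    have "x \<in> S"
      using S y d by (auto simp: U_def)
    then have "closed_segment x y \<subseteq> S"
      using F S by (simp add: closed_segment_subset)
    moreover have "closed_segment x y \<subseteq> ball x d"
      using y d by (intro closed_segment_subset) auto
    ultimately show ?thesis
      using S d by (auto simp: U_def)
  qed
  with d show "\<exists>d. star_radius (\<Union>F - C) x d"
    unfolding star_radius_def by blast
qed

section \<open>Skeleta and their deformations\<close>

locale complex2 =
  fixes \<T> :: "'a::euclidean_space set set"
  assumes complex: "simplicial_complex \<T>"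
begin

definition skel :: "int \<Rightarrow> 'a set" where
  "skel n = \<Union>{S \<in> \<T>. aff_dim S \<le> n}"

text \<open>Any point of the relative interior will do; it is fixed once as the place where cycles
  are tested locally.\<close>

definition centre :: "'a set \<Rightarrow> 'a" where
  "centre S = (SOME c. c \<in> rel_interior S)"

definition centres :: "int \<Rightarrow> 'a set" where
  "centres n = centre ` {S \<in> \<T>. aff_dim S = n}"

lemma finite_T: "finite \<T>"
  using complex by (simp add: simplicial_complex_def)

lemma simplex_props:
  assumes "S \<in> \<T>"
  shows "convex S" "compact S" "closed S" "polyhedron S" "bounded S"
proof -
  obtain n where n: "n simplex S"
    using complex assms unfolding simplicial_complex_def by blast
  show "convex S" "compact S" "closed S" "polyhedron S" "bounded S"
    using n convex_simplex compact_simplex closed_simplex simplex_imp_polyhedron compact_imp_bounded by blast+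
qed

lemma face_in_T: "S \<in> \<T> \<Longrightarrow> F face_of S \<Longrightarrow> F \<in> \<T>"
  using complex unfolding simplicial_complex_def by blast

lemma Int_face: "S \<in> \<T> \<Longrightarrow> S' \<in> \<T> \<Longrightarrow> (S \<inter> S') face_of S"
  using complex unfolding simplicial_complex_def by blast

lemma centre_in: "S \<in> \<T> \<Longrightarrow> 0 \<le> aff_dim S \<Longrightarrow> centre S \<in> rel_interior S"
  unfolding centre_def by (rule someI_ex) (metis aff_dim_empty ex_in_conv neg_0_le_iff_le not_one_le_zero rel_interior_eq_empty simplex_props(1))

lemma rel_interior_meets_simplex:
  assumes "S \<in> \<T>" "S' \<in> \<T>" "x \<in> rel_interior S" "x \<in> S'"
  shows "S face_of S'"
proof -
  have "x \<in> S"
    using assms(3) rel_interior_subset by blast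
  then have "S \<subseteq> S \<inter> S'"
    using assms Int_face[of S S'] by (intro subset_of_face_of[of "S \<inter> S'" S S]) auto
  then have "S \<inter> S' = S"
    by blast
  then show ?thesis
    using Int_face[OF assms(2,1)] by (simp add: Int_commute)
qed

lemma rel_interior_unique:
  assumes "S \<in> \<T>" "S' \<in> \<T>" "x \<in> rel_interior S" "x \<in> S'" "aff_dim S' \<le> aff_dim S"
  shows "S' = S"
  using rel_interior_meets_simplex[OF assms(1-4)] face_of_aff_dim_lt[OF simplex_props(1)[OF assms(2)], of S] assms(5) by force

lemma rel_frontier_skel:
  assumes "S \<in> \<T>" "aff_dim S = n"
  shows "rel_frontier S = S \<inter> skel (n - 1)"
proof
  have "rel_frontier S = \<Union>{F. F facet_of S}"
    using simplex_props[OF assms(1)] by (intro rel_frontier_of_polyhedron)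
  also have "\<dots> \<subseteq> S \<inter> skel (n - 1)"
    using assms face_in_T[OF assms(1)] by (auto simp: facet_of_def skel_def dest: face_of_imp_subset)
  finally show "rel_frontier S \<subseteq> S \<inter> skel (n - 1)" .
  show "S \<inter> skel (n - 1) \<subseteq> rel_frontier S"
  proof
    fix x assume x: "x \<in> S \<inter> skel (n - 1)"
    then obtain S' where S': "S' \<in> \<T>" "aff_dim S' \<le> n - 1" "x \<in> S'"
      by (auto simp: skel_def)
    have "x \<notin> rel_interior S"
      using rel_interior_unique[OF assms(1) S'(1) _ S'(3)] S' assms by auto
    then show "x \<in> rel_frontier S"
      using x simplex_props[OF assms(1)] by (simp add: rel_frontier_def)
  qed
qed

lemma simplex_Diff_centres:
  assumes "S \<in> \<T>" "aff_dim S \<le> n" "0 \<le> n"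
  shows "S - centres n = (if aff_dim S = n then S - {centre S} else S)"
proof -
  have "S' = S" if "S' \<in> \<T>" "aff_dim S' = n" "centre S' \<in> S" for S'
    using rel_interior_unique[of S' S "centre S'"] centre_in[of S'] that assms by auto
  then show ?thesis
    using assms by (auto simp: centres_def)
qed

lemma skel_Diff_centres: "0 \<le> n \<Longrightarrow> skel (n - 1) \<subseteq> skel n - centres n"
proof -
  assume n: "0 \<le> n"
  have "S \<subseteq> skel n - centres n" if "S \<in> \<T>" "aff_dim S \<le> n - 1" for S
    using simplex_Diff_centres[OF that(1) _ n] that by (auto simp: skel_def)
  then show ?thesis
    by (auto simp: skel_def)
qed

lemma locally_starlike_skel: "locally_starlike (skel n - C)" if "finite C" for C
  unfolding skel_def using finite_T simplex_props that by (intro locally_starlike_Union_convex) auto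

lemma locally_starlike_skel': "locally_starlike (skel n)"
  using locally_starlike_skel[of "{}"] by simp

lemma finite_centres: "finite (centres n)"
  using finite_T by (simp add: centres_def)

text \<open>A deformation of the punctured simplex onto its frontier may move the frontier
  meanwhile. \<Phi> and \<Phi> preceded by the retraction \<open>r\<close> agree on the frontier and
  end in the same map, so comparing them yields a deformation that is stationary there.\<close>

lemma simplex_deformation:
  assumes S: "S \<in> \<T>" "aff_dim S = n" "0 \<le> n"
  obtains h where "continuous_on ({0..1::real} \<times> (S - {centre S})) h" "h ` ({0..1} \<times> (S - {centre S})) \<subseteq> S - {centre S}"
    "\<And>x. x \<in> S - {centre S} \<Longrightarrow> h (0, x) = x" "\<And>x. x \<in> S - {centre S} \<Longrightarrow> h (1, x) \<in> rel_frontier S"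
    "\<And>t x. t \<in> {0..1} \<Longrightarrow> x \<in> rel_frontier S \<Longrightarrow> h (t, x) = x"
proof -
  note props = simplex_props[OF S(1)]
  let ?X = "S - {centre S}"
  have c: "centre S \<in> rel_interior S"
    using centre_in S by simp
  have "rel_frontier S \<subseteq> S"
    using props by (auto simp: rel_frontier_def)
  then obtain r where r: "homotopic_with_canon (\<lambda>x. True) ?X ?X id r" "retraction ?X (rel_frontier S) r"
    using rel_frontier_deformation_retract_of_punctured_convex[OF props(1) props(1) props(5) c _ hull_subset] by blast
  from r(1)[unfolded homotopic_with_canon_alt id_apply]
  obtain \<Phi> where "continuous_on ({0..1::real} \<times> ?X) \<Phi> \<and> \<Phi> ` ({0..1} \<times> ?X) \<subseteq> ?X \<and> (\<forall>x\<in>?X. \<Phi> (0, x) = x \<and> \<Phi> (1, x) = r x)"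
    by (elim exE)
  then have \<Phi>: "continuous_on ({0..1::real} \<times> ?X) \<Phi>" "\<Phi> ` ({0..1} \<times> ?X) \<subseteq> ?X" "\<And>x. x \<in> ?X \<Longrightarrow> \<Phi> (0, x) = x \<and> \<Phi> (1, x) = r x"
    by simp_all
  have rr: "rel_frontier S \<subseteq> ?X" "continuous_on ?X r" "r ` ?X = rel_frontier S" "\<And>x. x \<in> rel_frontier S \<Longrightarrow> r x = x"
    using r(2) unfolding retraction by auto
  have rX: "r x \<in> rel_frontier S" "r x \<in> ?X" if "x \<in> ?X" for x
    using rr that by blast+
  have clo: "closedin (top_of_set ?X) (rel_frontier S)"
    using rr(1) props by (intro closed_subset) (auto simp: closed_rel_frontier)
  have anr: "ANR ?X"
    using props by (intro ANR_openin[OF convex_imp_ANR[OF props(1)]] openin_delete) auto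
  have \<Phi>2: "continuous_on ({0..1} \<times> ?X) (\<lambda>w. \<Phi> (fst w, r (snd w)))"
    by (intro continuous_on_compose2[OF \<Phi>(1)] continuous_on_compose2[OF rr(2)] continuous_intros) (use rX in \<open>auto\<close>)
  have \<Phi>2': "(\<lambda>w. \<Phi> (fst w, r (snd w))) ` ({0..1} \<times> ?X) \<subseteq> ?X"
    using \<Phi>(2) rX(2) by (auto simp: image_subset_iff)
  have agree: "\<Phi> (t, x) = \<Phi> (fst (t, x), r (snd (t, x)))" if "t \<in> {0..1}" "x \<in> rel_frontier S" for t x
    using rr(4)[OF that(2)] by simp
  have fin: "\<Phi> (1, x) = \<Phi> (fst (1, x), r (snd (1, x)))" if "x \<in> ?X" for x
    using \<Phi>(3)[OF that] \<Phi>(3)[OF rX(2)[OF that]] rr(4)[OF rX(1)[OF that]] by simp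
  obtain h :: "real \<times> 'a \<Rightarrow> 'a" where h: "continuous_on ({0..1} \<times> ?X) h" "h ` ({0..1} \<times> ?X) \<subseteq> ?X"
    "\<And>x. x \<in> ?X \<Longrightarrow> h (0, x) = \<Phi> (0, x)" "\<And>x. x \<in> ?X \<Longrightarrow> h (1, x) = \<Phi> (fst (0::real, x), r (snd (0::real, x)))"
    "\<And>t x. t \<in> {0..1} \<Longrightarrow> x \<in> rel_frontier S \<Longrightarrow> h (t, x) = \<Phi> (0, x)"
    by (rule homotopy_rel_from_common_trace[OF clo anr \<Phi>(1,2) \<Phi>2 \<Phi>2']) (assumption | rule agree fin that)+
  show thesis
  proof (rule that[OF h(1,2)])
    show "h (0, x) = x" "h (1, x) \<in> rel_frontier S" if "x \<in> ?X" for x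
      using h(3,4)[OF that] \<Phi>(3)[OF that] \<Phi>(3)[OF rX(2)[OF that]] rX(1)[OF that] by simp_all
    show "h (t, x) = x" if "t \<in> {0..1}" "x \<in> rel_frontier S" for t x
      using h(5)[OF that] \<Phi>(3)[of x] rr(1) that by auto
  qed
qed

text \<open>The deformations of the single simplices can be pasted because they fix the frontiers;
  simplices of lower dimension do not move.\<close>

lemma skel_deformation:
  assumes n: "0 \<le> n"
  obtains h where "continuous_on ({0..1::real} \<times> (skel n - centres n)) h" "h ` ({0..1} \<times> (skel n - centres n)) \<subseteq> skel n - centres n"
    "\<And>x. x \<in> skel n - centres n \<Longrightarrow> h (0, x) = x" "\<And>x. x \<in> skel n - centres n \<Longrightarrow> h (1, x) \<in> skel (n - 1)"
proof -
  let ?X = "skel n - centres n"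
  let ?I = "{S \<in> \<T>. aff_dim S \<le> n}"
  have "\<forall>S. \<exists>h. S \<in> \<T> \<and> aff_dim S = n \<longrightarrow>
    continuous_on ({0..1::real} \<times> (S - {centre S})) h \<and> h ` ({0..1} \<times> (S - {centre S})) \<subseteq> S - {centre S} \<and>
    (\<forall>x\<in>S - {centre S}. h (0, x) = x) \<and> (\<forall>x\<in>S - {centre S}. h (1, x) \<in> rel_frontier S) \<and>
    (\<forall>t\<in>{0..1}. \<forall>x\<in>rel_frontier S. h (t, x) = x)"
  proof
    fix S
    show "\<exists>h. S \<in> \<T> \<and> aff_dim S = n \<longrightarrow>
    continuous_on ({0..1::real} \<times> (S - {centre S})) h \<and> h ` ({0..1} \<times> (S - {centre S})) \<subseteq> S - {centre S} \<and>
    (\<forall>x\<in>S - {centre S}. h (0, x) = x) \<and> (\<forall>x\<in>S - {centre S}. h (1, x) \<in> rel_frontier S) \<and>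
    (\<forall>t\<in>{0..1}. \<forall>x\<in>rel_frontier S. h (t, x) = x)"
    proof (cases "S \<in> \<T> \<and> aff_dim S = n")
      case True
      then have S: "S \<in> \<T>" "aff_dim S = n"
        by auto
      obtain h where h: "continuous_on ({0..1::real} \<times> (S - {centre S})) h" "h ` ({0..1} \<times> (S - {centre S})) \<subseteq> S - {centre S}"
        "\<And>x. x \<in> S - {centre S} \<Longrightarrow> h (0, x) = x" "\<And>x. x \<in> S - {centre S} \<Longrightarrow> h (1, x) \<in> rel_frontier S"
        "\<And>t x. t \<in> {0..1} \<Longrightarrow> x \<in> rel_frontier S \<Longrightarrow> h (t, x) = x"
        by (rule simplex_deformation[OF S n]) (rule that)
      show ?thesis
        by (intro exI[of _ h] impI conjI ballI h)
    qed blast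
  qed
  from choice[OF this] obtain H where H0: "\<forall>S. S \<in> \<T> \<and> aff_dim S = n \<longrightarrow>
    continuous_on ({0..1::real} \<times> (S - {centre S})) (H S) \<and> H S ` ({0..1} \<times> (S - {centre S})) \<subseteq> S - {centre S} \<and>
    (\<forall>x\<in>S - {centre S}. H S (0, x) = x) \<and> (\<forall>x\<in>S - {centre S}. H S (1, x) \<in> rel_frontier S) \<and>
    (\<forall>t\<in>{0..1}. \<forall>x\<in>rel_frontier S. H S (t, x) = x)"
    by (elim exE)
  note H = H0[THEN spec, THEN mp, OF conjI]
  define f where "f S = (if aff_dim S = n then H S else snd)" for S
  have SC: "S - centres n = (if aff_dim S = n then S - {centre S} else S)" if "S \<in> ?I" for S
    using simplex_Diff_centres[of S n] that n by auto
  have agree: "f S (t, x) = f S' (t, x)" if "S \<in> ?I" "S' \<in> ?I" "t \<in> {0..1}" "x \<in> S" "x \<in> S'" for S S' t x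
  proof -
    have low: "f R (t, x) = x" if R: "R \<in> ?I" "x \<in> R" and x: "x \<in> skel (n - 1)" for R
    proof (cases "aff_dim R = n")
      case True
      then have "x \<in> rel_frontier R"
        using rel_frontier_skel[of R n] R x by auto
      then show ?thesis
        using H[of R] True R \<open>t \<in> {0..1}\<close> by (simp add: f_def)
    qed (simp add: f_def)
    show ?thesis
    proof (cases "x \<in> skel (n - 1)")
      case True
      then show ?thesis
        using low[of S] low[of S'] that by simp
    next
      case False
      have "aff_dim R = n" if "R \<in> ?I" "x \<in> R" for R
        using False that unfolding skel_def by force
      then have "aff_dim S = n" "aff_dim S' = n"
        using that by blast+
      moreover have "x \<in> rel_interior S"
        using rel_frontier_skel[of S n] False that \<open>aff_dim S = n\<close> simplex_props[of S] by (auto simp: rel_frontier_def)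
      ultimately have "S' = S"
        using rel_interior_unique[of S S' x] that by auto
      then show ?thesis
        by simp
    qed
  qed
  define h where "h w = f (SOME S. S \<in> ?I \<and> snd w \<in> S) w" for w
  have h: "h (t, x) = f S (t, x)" if "S \<in> ?I" "x \<in> S" "t \<in> {0..1}" for S t x
  proof -
    have "(SOME S. S \<in> ?I \<and> x \<in> S) \<in> ?I \<and> x \<in> (SOME S. S \<in> ?I \<and> x \<in> S)"
      by (rule someI[of "\<lambda>S. S \<in> ?I \<and> x \<in> S" S]) (use that in auto)
    then show ?thesis
      unfolding h_def snd_conv by (intro agree) (use that in auto)
  qed
  have cov: "\<exists>S. S \<in> ?I \<and> x \<in> S - centres n" if "x \<in> ?X" for x
    using that by (auto simp: skel_def)
  have fS: "continuous_on ({0..1} \<times> (S - centres n)) (f S)" "f S ` ({0..1} \<times> (S - centres n)) \<subseteq> S - centres n"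
    "\<forall>x\<in>S - centres n. f S (0, x) = x" "\<forall>x\<in>S - centres n. f S (1, x) \<in> skel (n - 1)" if "S \<in> ?I" for S
  proof -
    show "continuous_on ({0..1} \<times> (S - centres n)) (f S)" "f S ` ({0..1} \<times> (S - centres n)) \<subseteq> S - centres n"
      "\<forall>x\<in>S - centres n. f S (0, x) = x"
      unfolding SC[OF that] using H[of S] that by (auto simp: f_def intro: continuous_intros)
    show "\<forall>x\<in>S - centres n. f S (1, x) \<in> skel (n - 1)"
    proof (cases "aff_dim S = n")
      case True
      then show ?thesis
        unfolding SC[OF that] using H[of S] rel_frontier_skel[of S n] that by (auto simp: f_def)
    next
      case False
      then have "S \<subseteq> skel (n - 1)"
        using that by (auto simp: skel_def)
      with False show ?thesis
        by (auto simp: f_def)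
    qed
  qed
  show thesis
  proof (rule that[of h])
    have "continuous_map (top_of_set ({0..1::real} \<times> ?X)) euclidean h"
    proof (rule pasting_lemma_closed[where I = ?I and T = "\<lambda>S. {0..1::real} \<times> (S - centres n)" and f = f])
      show "finite ?I"
        using finite_T by simp
      show "closedin (top_of_set ({0..1::real} \<times> ?X)) ({0..1::real} \<times> (S - centres n))" if "S \<in> ?I" for S
      proof -
        have "{0..1::real} \<times> (S - centres n) = ({0..1::real} \<times> ?X) \<inter> ((UNIV :: real set) \<times> S)"
          using that by (auto simp: skel_def)
        moreover have "closed ((UNIV :: real set) \<times> S)"
          using simplex_props[of S] that by (auto intro: closed_Times)
        ultimately show ?thesis
          using closedin_closed_Int[of "UNIV \<times> S" "{0..1::real} \<times> ?X"] by simp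
      qed
      show "continuous_map (subtopology (top_of_set ({0..1::real} \<times> ?X)) ({0..1::real} \<times> (S - centres n))) euclidean (f S)" if "S \<in> ?I" for S
      proof -
        have "({0..1::real} \<times> ?X) \<inter> ({0..1::real} \<times> (S - centres n)) = {0..1::real} \<times> (S - centres n)"
          using that by (auto simp: skel_def)
        then show ?thesis
          using fS(1)[OF that] by (simp add: subtopology_subtopology)
      qed
      show "f S w = f S' w" if "S \<in> ?I" "S' \<in> ?I"
        "w \<in> topspace (top_of_set ({0..1::real} \<times> ?X)) \<inter> {0..1::real} \<times> (S - centres n) \<inter> {0..1::real} \<times> (S' - centres n)" for S S' w
        using agree[OF that(1,2), of "fst w" "snd w"] that(3) by auto
      show "\<exists>S. S \<in> ?I \<and> w \<in> {0..1::real} \<times> (S - centres n) \<and> h w = f S w" if "w \<in> topspace (top_of_set ({0..1::real} \<times> ?X))" for w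
      proof -
        have w: "fst w \<in> {0..1}" "snd w \<in> ?X"
          using that by auto
        obtain S where S: "S \<in> ?I" "snd w \<in> S - centres n"
          using cov[OF w(2)] by blast
        then show ?thesis
          using h[OF S(1), of "snd w" "fst w"] w by (intro exI[of _ S]) (auto simp: mem_Times_iff)
      qed
    qed
    then show "continuous_on ({0..1::real} \<times> ?X) h"
      by simp
    have *: "h (t, x) \<in> ?X \<and> h (0, x) = x \<and> h (1, x) \<in> skel (n - 1)" if x: "x \<in> ?X" and t: "t \<in> {0..1}" for t x
    proof -
      obtain S where S: "S \<in> ?I" "x \<in> S - centres n"
        using cov[OF x] by blast
      have "f S (t, x) \<in> S - centres n"
        using fS(2)[OF S(1)] S(2) t by (auto simp: image_subset_iff)
      moreover have "S - centres n \<subseteq> ?X"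
        using S(1) by (auto simp: skel_def)
      ultimately show ?thesis
        using fS(3,4)[OF S(1)] S h[of S x] t by auto
    qed
    show "h ` ({0..1::real} \<times> ?X) \<subseteq> ?X"
      using * by blast
    show "h (0, x) = x" "h (1, x) \<in> skel (n - 1)" if "x \<in> ?X" for x
      using *[OF that, of 0] by auto
  qed
qed

end

text \<open>The type \<open>'b\<close> only supplies a Euclidean space of the dimension of
  \<open>T\<close>. As \<open>T\<close> may be neither closed nor bounded, the sphere is found as
  the frontier of a small disc \<open>D\<close> around \<open>c\<close> in the affine hull.\<close>

lemma nsphere_homotopy_equivalent_punctured_convex:
  fixes T :: "'a::euclidean_space set"
  assumes T: "convex T" and c: "c \<in> rel_interior T" and dim: "aff_dim T = int DIM('b::euclidean_space)"
  shows "nsphere (DIM('b) - 1) homotopy_equivalent_space top_of_set (T - {c})"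
proof -
  have cT: "c \<in> T"
    using c rel_interior_subset by blast
  obtain e where e: "e > 0" "cball c e \<inter> affine hull T \<subseteq> T"
    using c by (auto simp: rel_interior_cball)
  define D where "D = affine hull T \<inter> cball c e"
  have D: "convex D" "bounded D" "closed D"
    by (auto simp: D_def convex_Int bounded_Int)
  have "c \<in> affine hull T \<inter> interior (cball c e)"
    using cT e(1) by (simp add: hull_inc)
  then have "affine hull T \<inter> interior (cball c e) \<noteq> {}"
    by blast
  then have aff: "affine hull D = affine hull T"
    using affine_hull_convex_Int_nonempty_interior[of "affine hull T" "cball c e"] by (simp add: D_def)
  have "c \<in> rel_interior D"
    unfolding mem_rel_interior_ball aff using e cT by (auto simp: D_def hull_inc intro!: exI[of _ e])
  moreover have "rel_frontier D \<subseteq> T"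
    using D(3) e(2) by (auto simp: rel_frontier_def D_def)
  moreover have "T \<subseteq> affine hull D"
    by (simp add: aff hull_subset)
  ultimately have "rel_frontier D homotopy_eqv T - {c}"
    using D T by (intro homotopy_eqv_rel_frontier_punctured_convex)
  moreover have "rel_frontier D homeomorphic rel_frontier (cball 0 1 :: 'b set)"
  proof (rule homeomorphic_rel_frontiers_convex_bounded_sets)
    show "aff_dim D = aff_dim (cball 0 1 :: 'b set)"
      using dim aff by (metis aff_dim_affine_hull aff_dim_cball zero_less_one)
  qed (use D in auto)
  moreover have "rel_frontier (cball 0 1 :: 'b set) = sphere 0 1"
    by (simp add: rel_frontier_cball)
  moreover have "nsphere (DIM('b) - 1) homeomorphic_space top_of_set (sphere (0::'b) 1)"
  proof -
    have "pairwise orthogonal (Basis :: 'b set)"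
      by (auto simp: pairwise_def orthogonal_def inner_Basis)
    then obtain f :: "(nat \<Rightarrow> real) \<Rightarrow> 'b" and g where "homeomorphic_maps (nsphere (DIM('b) - 1)) (top_of_set (sphere 0 1 \<inter> span Basis)) f g"
      using homeomorphic_maps_nsphere_euclidean_sphere[OF independent_Basis, of "DIM('b)"] by (metis DIM_positive norm_Basis less_numeral_extra(3))
    then show ?thesis
      by (auto simp: homeomorphic_space_def)
  qed
  ultimately have "top_of_set (sphere (0::'b) 1) homotopy_equivalent_space top_of_set (T - {c})"
    "nsphere (DIM('b) - 1) homotopy_equivalent_space top_of_set (sphere (0::'b) 1)"
    using homeomorphic_imp_homotopy_eqv[of "rel_frontier D" "sphere (0::'b) 1"] homotopy_eqv_trans homotopy_equivalent_space_sym
      homeomorphic_imp_homotopy_equivalent_space by (simp_all, blast)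
  then show ?thesis
    by (rule homotopy_eqv_trans[rotated])
qed

text \<open>The sequence of a pair with contractible total space lowers the degree by one, and the
  punctured set is a sphere up to homotopy.\<close>

lemma punctured_convex_relative_homology:
  fixes T :: "'a::euclidean_space set"
  assumes T: "convex T" and c: "c \<in> rel_interior T" and dim: "aff_dim T = int DIM('b::euclidean_space)"
  shows "relative_homology_group 2 (top_of_set T) (T - {c}) \<cong> reduced_homology_group 1 (nsphere (DIM('b) - 1))"
proof -
  have "T - {c} \<noteq> {}"
  proof
    assume "T - {c} = {}"
    then have "T \<subseteq> {c}"
      by auto
    then have "aff_dim T \<le> 0"
      using aff_dim_subset[of T "{c}"] by simp
    with dim show False
      using DIM_positive[where 'a='b] by linarith
  qed
  moreover have "T \<inter> (T - {c}) = T - {c}"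
    by auto
  ultimately have "relative_homology_group 2 (top_of_set T) (T - {c}) \<cong> reduced_homology_group 1 (top_of_set (T - {c}))"
    using isomorphic_group_relative_homology_of_contractible[of "top_of_set T" "T - {c}" 2] convex_imp_contractible[OF T]
    by (simp add: subtopology_subtopology)
  moreover have "reduced_homology_group 1 (top_of_set (T - {c})) \<cong> reduced_homology_group 1 (nsphere (DIM('b) - 1))"
    using nsphere_homotopy_equivalent_punctured_convex[OF assms] homotopy_equivalent_space_sym
    by (intro homotopy_equivalent_space_imp_isomorphic_reduced_homology_groups) blast
  ultimately show ?thesis
    by (rule iso_trans)
qed

lemma trivial_imp_singular_relboundary:
  assumes "trivial_group (relative_homology_group (int p) X A)" "singular_relcycle p X A c"
  shows "singular_relboundary p X A c"
proof -
  have "homologous_rel_set p X A c \<in> carrier (relative_homology_group (int p) X A)"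
    using assms(2) by (auto simp: carrier_relative_homology_group)
  then have "homologous_rel_set p X A c = \<one>\<^bsub>relative_homology_group (int p) X A\<^esub>"
    using assms(1) by (auto simp: trivial_group_def)
  then show ?thesis
    by (simp add: homologous_rel_set_eq_relboundary)
qed

lemma singular_relcycle_absolute:
  assumes "singular_relcycle p X {} c"
  shows "singular_relcycle p X A c"
proof -
  have "singular_chain p X c" "chain_boundary p c = 0"
    using assms by (simp_all add: singular_cycle)
  then show ?thesis
    by (simp add: singular_relcycle_def)
qed

lemma singular_relboundary_subtopology:
  assumes "singular_relboundary p (subtopology X A) S c" "S \<subseteq> T"
  shows "singular_relboundary p X T c"
proof -
  obtain d where d: "singular_chain (Suc p) (subtopology X A) d"
    "singular_chain p (subtopology X (A \<inter> S)) (chain_boundary (Suc p) d - c)"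
    using assms(1) by (auto simp: singular_relboundary_def mod_subset_def subtopology_subtopology)
  have "singular_chain (Suc p) X d"
    using singular_chain_mono[OF d(1), of UNIV] by simp
  moreover have "singular_chain p (subtopology X T) (chain_boundary (Suc p) d - c)"
    using d(2) by (rule singular_chain_mono) (use assms(2) in auto)
  ultimately show ?thesis
    by (auto simp: singular_relboundary_def mod_subset_def)
qed

section \<open>Cells and skeleta of a covering\<close>

locale complex_cover = complex2 \<T> + transport "\<Union>\<T>" E \<rho>
  for \<T> :: "'a::euclidean_space set set" and E :: "'e set" and \<rho>
begin

abbreviation Xs :: "int \<Rightarrow> ('a \<times> 'e) topology" where
  "Xs n \<equiv> cover_space (skel n) E \<rho>"

lemma skel_subset: "skel n \<subseteq> \<Union>\<T>"
  by (auto simp: skel_def)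

lemma transport_skel: "transport (skel n) E \<rho>"
  by (rule transport_subset[OF skel_subset locally_starlike_skel'])

definition cell :: "'a set \<Rightarrow> 'e \<Rightarrow> ('a \<times> 'e) set" where
  "cell S e = (\<lambda>x. (x, \<rho> (linepath (centre S) x) e)) ` rel_interior S"

lemma rel_interior_open_in_skel:
  assumes "S \<in> \<T>" "aff_dim S = n" "x \<in> rel_interior S"
  obtains r where "r > 0" "skel n \<inter> ball x r \<subseteq> rel_interior S"
proof -
  define U where "U = - (\<Union>{S' \<in> \<T>. aff_dim S' \<le> n \<and> S' \<noteq> S} \<union> rel_frontier S)"
  have "open U"
    unfolding U_def using finite_T simplex_props[of _] simplex_props(5)[OF assms(1)]
    by (intro open_Compl closed_Un closed_Union) (auto simp: closed_rel_frontier simplex_props)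
  moreover have "x \<in> U"
    using rel_interior_unique[of S _ x] assms by (auto simp: U_def rel_frontier_def)
  ultimately obtain r where "r > 0" "ball x r \<subseteq> U"
    using open_contains_ball by blast
  moreover have "skel n \<inter> U \<subseteq> rel_interior S"
  proof
    fix y assume y: "y \<in> skel n \<inter> U"
    then obtain S' where "S' \<in> \<T>" "aff_dim S' \<le> n" "y \<in> S'"
      by (auto simp: skel_def)
    with y have "y \<in> S" "y \<notin> rel_frontier S"
      by (auto simp: U_def)
    then show "y \<in> rel_interior S"
      using simplex_props(3)[OF assms(1)] by (simp add: rel_frontier_def)
  qed
  ultimately show thesis
    by (intro that[of r]) auto
qed

context
  fixes S n
  assumes S: "S \<in> \<T>" "aff_dim S = n" "0 \<le> n"
begin

lemma centre_ri: "centre S \<in> rel_interior S"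
  using centre_in S by simp

lemma ri_skel: "rel_interior S \<subseteq> skel n"
  using S rel_interior_subset by (fastforce simp: skel_def)

lemma ri_P: "rel_interior S \<subseteq> \<Union>\<T>"
  using S rel_interior_subset by blast

lemma convex_ri: "convex (rel_interior S)"
  using simplex_props(1)[OF S(1)] by (rule convex_rel_interior)

lemma cell_path:
  assumes "path p" "path_image p \<subseteq> rel_interior S" "pathstart p = centre S" "e \<in> E"
  shows "\<rho> p e = \<rho> (linepath (centre S) (pathfinish p)) e"
proof (rule homotopic)
  have "simply_connected (rel_interior S)"
    using convex_ri by (rule convex_imp_simply_connected)
  moreover have "pathfinish p \<in> rel_interior S"
    using assms(2) pathfinish_in_path_image by blast
  then have "path_image (linepath (centre S) (pathfinish p)) \<subseteq> rel_interior S"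
    using centre_ri convex_ri by (simp add: closed_segment_subset)
  ultimately have "homotopic_paths (rel_interior S) p (linepath (centre S) (pathfinish p))"
    using assms unfolding simply_connected_eq_homotopic_paths by auto
  then show "homotopic_paths (\<Union>\<T>) p (linepath (centre S) (pathfinish p))"
    using ri_P by (rule homotopic_paths_subset)
qed fact

lemma segment_ri: "x \<in> rel_interior S \<Longrightarrow> path_image (linepath (centre S) x) \<subseteq> rel_interior S"
  using centre_ri convex_ri by (simp add: closed_segment_subset)

lemma rho_segment_in: "x \<in> rel_interior S \<Longrightarrow> e \<in> E \<Longrightarrow> \<rho> (linepath (centre S) x) e \<in> E"
  using order_trans[OF segment_ri[of x] ri_P] by (intro rho_in) simp_all

lemma openin_cell:
  assumes e: "e \<in> E"
  shows "openin (Xs n) (cell S e)"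
  unfolding openin_cover_space
proof (intro conjI allI impI)
  show "cell S e \<subseteq> skel n \<times> E"
    using rho_segment_in[OF _ e] ri_skel by (auto simp: cell_def)
  fix x e1 assume "(x, e1) \<in> cell S e"
  then have x: "x \<in> rel_interior S" "e1 = \<rho> (linepath (centre S) x) e"
    by (auto simp: cell_def)
  obtain r where r: "r > 0" "skel n \<inter> ball x r \<subseteq> rel_interior S"
    by (rule rel_interior_open_in_skel[OF S(1,2) x(1)])
  show "\<exists>r>0. \<forall>p. path p \<and> path_image p \<subseteq> skel n \<inter> ball x r \<and> pathstart p = x \<longrightarrow> (pathfinish p, \<rho> p e1) \<in> cell S e"
  proof (intro exI[of _ r] conjI allI impI r(1))
    fix p assume p: "path p \<and> path_image p \<subseteq> skel n \<inter> ball x r \<and> pathstart p = x"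
    then have pi: "path_image p \<subseteq> rel_interior S"
      using r by blast
    have "\<rho> p e1 = \<rho> (linepath (centre S) x +++ p) e"
      using p x(2) order_trans[OF segment_ri[OF x(1)] ri_P] order_trans[OF pi ri_P] e
      by (subst join) (auto simp del: path_image_linepath)
    also have "\<dots> = \<rho> (linepath (centre S) (pathfinish p)) e"
      using p segment_ri[OF x(1)] pi e by (subst cell_path) (auto simp: path_image_join simp del: path_image_linepath)
    finally show "(pathfinish p, \<rho> p e1) \<in> cell S e"
      using pi pathfinish_in_path_image[of p] by (auto simp: cell_def)
  qed
qed

lemma centre_in_cell: "e \<in> E \<Longrightarrow> (centre S, e) \<in> cell S e"
  unfolding cell_def using centre_ri rho_const[of "centre S" e] subsetD[OF ri_P centre_ri]
  by (intro image_eqI[of _ _ "centre S"]) simp_all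

lemma cell_section:
  assumes e: "e \<in> E"
  shows "continuous_map (top_of_set (rel_interior S)) (Xs n) (\<lambda>x. (x, \<rho> (linepath (centre S) x) e))"
proof -
  interpret A: transport "skel n" E \<rho>
    by (rule transport_skel)
  have "continuous_map (top_of_set (rel_interior S)) (Xs n) (A.lift id (centre S) e)"
    using convex_ri centre_ri ri_skel e by (intro A.continuous_map_lift) auto
  then show ?thesis
    by (simp add: A.lift_def[abs_def] comp_def)
qed

lemma homeomorphic_map_cell:
  assumes e: "e \<in> E"
  shows "homeomorphic_map (top_of_set (rel_interior S)) (subtopology (Xs n) (cell S e)) (\<lambda>x. (x, \<rho> (linepath (centre S) x) e))"
proof -
  interpret A: transport "skel n" E \<rho>
    by (rule transport_skel)
  have "continuous_map (subtopology (Xs n) (cell S e)) (top_of_set (skel n)) fst"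
    using A.continuous_map_fst_cover by (rule continuous_map_from_subtopology)
  then have "continuous_map (subtopology (Xs n) (cell S e)) (top_of_set (rel_interior S)) fst"
    by (auto simp: continuous_map_in_subtopology cell_def)
  then have "homeomorphic_maps (top_of_set (rel_interior S)) (subtopology (Xs n) (cell S e)) (\<lambda>x. (x, \<rho> (linepath (centre S) x) e)) fst"
    using cell_section[OF e] by (auto simp: homeomorphic_maps_def continuous_map_in_subtopology cell_def)
  then show ?thesis
    by (auto simp: homeomorphic_map_maps)
qed

text \<open>The complement of the point is the union of the preimage of
  \<open>skel n - {centre S}\<close> and of the cells through the other points of the fibre, all
  open.\<close>

lemma closedin_centre:
  assumes e: "e \<in> E"
  shows "openin (Xs n) (skel n \<times> E - {(centre S, e)})"
proof -
  interpret A: transport "skel n" E \<rho>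
    by (rule transport_skel)
  have "openin (top_of_set (skel n)) (skel n - {centre S})"
    by (simp add: openin_delete)
  then have op1: "openin A.X {w \<in> topspace A.X. fst w \<in> skel n - {centre S}}"
    by (rule openin_continuous_map_preimage[OF A.continuous_map_fst_cover])
  have op2: "openin A.X (\<Union>e'\<in>E - {e}. cell S e')"
    using openin_cell by (intro openin_Union) auto
  have eq: "skel n \<times> E - {(centre S, e)} = {w \<in> topspace A.X. fst w \<in> skel n - {centre S}} \<union> (\<Union>e'\<in>E - {e}. cell S e')"
  proof (intro equalityI subsetI)
    fix w assume w: "w \<in> skel n \<times> E - {(centre S, e)}"
    show "w \<in> {w \<in> topspace A.X. fst w \<in> skel n - {centre S}} \<union> (\<Union>e'\<in>E - {e}. cell S e')"
    proof (cases "fst w = centre S")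
      case True
      then have "snd w \<in> E - {e}" "w = (centre S, snd w)"
        using w by (cases w; auto)+
      moreover have "(centre S, snd w) \<in> cell S (snd w)"
        using w by (intro centre_in_cell) auto
      ultimately have "w \<in> cell S (snd w)"
        by simp
      with \<open>snd w \<in> E - {e}\<close> show ?thesis
        by blast
    qed (use w in auto)
  next
    fix w assume w: "w \<in> {w \<in> topspace A.X. fst w \<in> skel n - {centre S}} \<union> (\<Union>e'\<in>E - {e}. cell S e')"
    have "(centre S, e) \<notin> cell S e'" if "e' \<in> E - {e}" for e'
      using rho_const[of "centre S" e'] subsetD[OF ri_P centre_ri] that by (auto simp: cell_def)
    moreover have "cell S e' \<subseteq> skel n \<times> E" if "e' \<in> E" for e'
      using openin_subset[OF openin_cell[OF that]] by simp
    ultimately show "w \<in> skel n \<times> E - {(centre S, e)}"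
      using w by auto
  qed
  show ?thesis
    unfolding eq by (rule openin_Un[OF op1 op2])
qed

text \<open>Excision shrinks the covering to the open cell, which the projection identifies with the
  relative interior of the simplex.\<close>

lemma local_homology_cell:
  assumes e: "e \<in> E"
  shows "relative_homology_group p (Xs n) (skel n \<times> E - {(centre S, e)})
     \<cong> relative_homology_group p (top_of_set (rel_interior S)) (rel_interior S - {centre S})"
proof -
  interpret A: transport "skel n" E \<rho>
    by (rule transport_skel)
  let ?T = "skel n \<times> E - {(centre S, e)}" and ?U = "skel n \<times> E - cell S e"
  have sub: "cell S e \<subseteq> skel n \<times> E"
    using openin_subset[OF openin_cell[OF e]] by simp
  have "closedin (Xs n) ?U"
    using openin_cell[OF e] by (metis A.topspace_cover closedin_diff closedin_topspace)
  then have cl: "Xs n closure_of ?U \<subseteq> Xs n interior_of ?T"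
    using closedin_centre[OF e] centre_in_cell[OF e] by (auto simp: closure_of_closedin interior_of_openin)
  have 1: "topspace (Xs n) - ?U = cell S e" "?T - ?U = cell S e - {(centre S, e)}"
    using sub by auto
  have "subtopology (Xs n) (skel n \<times> E) = Xs n"
    using subtopology_topspace[of "Xs n"] by simp
  then have "relative_homology_group p (subtopology (Xs n) (cell S e)) (cell S e - {(centre S, e)}) \<cong> relative_homology_group p (Xs n) ?T"
    using homology_excision_axiom[OF cl, of "topspace (Xs n)" p] unfolding 1 is_iso_def by auto
  then have "relative_homology_group p (Xs n) ?T \<cong> relative_homology_group p (subtopology (Xs n) (cell S e)) (cell S e - {(centre S, e)})"
    by (rule group.iso_sym[OF group_relative_homology_group])
  moreover have "relative_homology_group p (top_of_set (rel_interior S)) (rel_interior S - {centre S}) \<cong>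
     relative_homology_group p (subtopology (Xs n) (cell S e)) (cell S e - {(centre S, e)})"
  proof -
    have "\<rho> (linepath (centre S) (centre S)) e = e"
      using rho_const[OF subsetD[OF ri_P centre_ri] e] .
    then have "(\<lambda>x. (x, \<rho> (linepath (centre S) x) e)) ` (rel_interior S - {centre S}) = cell S e - {(centre S, e)}"
      by (auto simp: cell_def)
    then show ?thesis
      using homeomorphic_map_relative_homology_iso[OF homeomorphic_map_cell[OF e], of "rel_interior S - {centre S}" "cell S e - {(centre S, e)}" p]
      unfolding is_iso_def by auto
  qed
  ultimately show ?thesis
    by (meson group.iso_sym group_relative_homology_group iso_trans)
qed

text \<open>A point has no homology in degree 2, and a punctured interval is a 0-sphere up to
  homotopy, without reduced homology in degree 1.\<close>

lemma low_dim_local_boundary: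
  assumes e: "e \<in> E" and n: "n < 2" and c: "singular_relcycle 2 (Xs n) (skel n \<times> E - {(centre S, e)}) c"
  shows "singular_relboundary 2 (Xs n) (skel n \<times> E - {(centre S, e)}) c"
proof -
  have aff: "aff_dim (rel_interior S) = n" "centre S \<in> rel_interior (rel_interior S)"
    using S simplex_props(1)[OF S(1)] centre_ri by (simp_all add: rel_interior_aff_dim rel_interior_rel_interior)
  have "trivial_group (relative_homology_group 2 (top_of_set (rel_interior S)) (rel_interior S - {centre S}))"
  proof (cases "n = 0")
    case True
    then obtain a where "rel_interior S = {a}"
      using aff(1) by (auto simp: aff_dim_eq_0)
    then have "rel_interior S = {centre S}"
      using centre_ri by auto
    then show ?thesis
      using homology_dimension_axiom[of "top_of_set {centre S}" "centre S" 2] by simp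
  next
    case False
    then have "n = int DIM(real)"
      using S n by simp
    then have "relative_homology_group 2 (top_of_set (rel_interior S)) (rel_interior S - {centre S}) \<cong> reduced_homology_group 1 (nsphere (DIM(real) - 1))"
      using aff convex_ri by (intro punctured_convex_relative_homology) auto
    moreover have "trivial_group (reduced_homology_group 1 (nsphere (DIM(real) - 1)))"
      by (simp add: trivial_reduced_homology_group_nsphere)
    ultimately show ?thesis
      using isomorphic_group_triviality by (metis group_reduced_homology_group group_relative_homology_group)
  qed
  then have "trivial_group (relative_homology_group (int 2) (Xs n) (skel n \<times> E - {(centre S, e)}))"
    using isomorphic_group_triviality[OF local_homology_cell[OF e, of 2]] by simp
  then show ?thesis
    using c by (rule trivial_imp_singular_relboundary)
qed

end

lemma local_homology_triangle:
  assumes S: "S \<in> \<T>" "aff_dim S = 2" and e: "e \<in> E"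
  shows "relative_homology_group 2 (Xs 2) (skel 2 \<times> E - {(centre S, e)}) \<cong> integer_group"
proof -
  have "aff_dim (rel_interior S) = int DIM(complex)" "centre S \<in> rel_interior (rel_interior S)"
    using S simplex_props(1)[OF S(1)] centre_ri[OF S] by (simp_all add: rel_interior_aff_dim rel_interior_rel_interior)
  then have 1: "relative_homology_group 2 (top_of_set (rel_interior S)) (rel_interior S - {centre S}) \<cong> reduced_homology_group 1 (nsphere (DIM(complex) - 1))"
    using convex_ri[OF S] by (intro punctured_convex_relative_homology) auto
  have 2: "reduced_homology_group 1 (nsphere (DIM(complex) - 1)) \<cong> integer_group"
    using reduced_homology_group_nsphere(1)[of 1] by simp
  have 3: "relative_homology_group 2 (Xs 2) (skel 2 \<times> E - {(centre S, e)})
     \<cong> relative_homology_group 2 (top_of_set (rel_interior S)) (rel_interior S - {centre S})"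
    using local_homology_cell[OF S _ e] by simp
  show ?thesis
    by (rule iso_trans[OF 3 iso_trans[OF 1 2]])
qed

text \<open>One step down the skeleta. Local vanishing at all centres makes the cycle bound relative
  to the complement of the centres; the deformation of that complement onto the lower skeleton lifts
  to the covering, where \<open>low\<close> applies.\<close>

lemma skel_boundary_step:
  assumes n: "0 \<le> n"
    and low: "\<And>a. singular_relcycle 2 (Xs (n - 1)) {} a \<Longrightarrow> singular_relboundary 2 (Xs (n - 1)) {} a"
    and c: "singular_relcycle 2 (Xs n) {} c"
    and loc: "\<And>S e. S \<in> \<T> \<Longrightarrow> aff_dim S = n \<Longrightarrow> e \<in> E \<Longrightarrow> singular_relboundary 2 (Xs n) (skel n \<times> E - {(centre S, e)}) c"
  shows "singular_relboundary 2 (Xs n) {} c"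
proof -
  interpret A: transport "skel n" E \<rho>
    by (rule transport_skel)
  let ?Y0 = "skel n - centres n"
  have Y0: "?Y0 \<subseteq> skel n" "locally_starlike ?Y0"
    using locally_starlike_skel[OF finite_centres] by auto
  interpret Y: transport ?Y0 E \<rho>
    by (rule A.transport_subset[OF Y0])
  have subY: "subtopology A.X (?Y0 \<times> E) = Y.X"
    by (rule A.subtopology_cover[OF Y0])
  have cut: "cell S e \<inter> cell S' e' = {}"
    if S: "S \<in> \<T>" "aff_dim S = n" "S' \<in> \<T>" "aff_dim S' = n" and e: "e \<in> E" "e' \<in> E" and ne: "(centre S, e) \<noteq> (centre S', e')" for S S' e e'
  proof (rule ccontr)
    assume "cell S e \<inter> cell S' e' \<noteq> {}"
    then obtain x where x: "x \<in> rel_interior S" "x \<in> rel_interior S'" "\<rho> (linepath (centre S) x) e = \<rho> (linepath (centre S') x) e'"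
      by (auto simp: cell_def)
    then have "S' = S"
      using rel_interior_unique[of S S' x] S rel_interior_subset by (metis order.refl subsetD)
    with x have "\<rho> (linepath (centre S) x) e = \<rho> (linepath (centre S) x) e'"
      by simp
    moreover have "path_image (linepath (centre S) x) \<subseteq> \<Union>\<T>"
      using segment_ri[OF S(1,2) n x(1)] ri_skel[OF S(1,2) n] skel_subset[of n] by (meson order_trans)
    ultimately have "e = e'"
      using rho_inj[of "linepath (centre S) x" e e'] e by simp
    with ne \<open>S' = S\<close> show False
      by simp
  qed
  define N where "N q = cell (SOME S. S \<in> \<T> \<and> aff_dim S = n \<and> centre S = fst q) (snd q)" for q
  have N: "\<exists>S. S \<in> \<T> \<and> aff_dim S = n \<and> q = (centre S, snd q) \<and> snd q \<in> E \<and> N q = cell S (snd q)" if "q \<in> centres n \<times> E" for q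
  proof -
    have "\<exists>S. S \<in> \<T> \<and> aff_dim S = n \<and> centre S = fst q"
      using that by (auto simp: centres_def)
    from someI_ex[OF this] show ?thesis
      using that by (intro exI[of _ "SOME S. S \<in> \<T> \<and> aff_dim S = n \<and> centre S = fst q"]) (auto simp: N_def)
  qed
  have cen: "centres n \<subseteq> skel n"
    using centre_in n rel_interior_subset by (fastforce simp: centres_def skel_def)
  have cenE: "centres n \<times> E \<subseteq> topspace A.X"
    using cen by auto
  have diff: "topspace A.X - centres n \<times> E = ?Y0 \<times> E"
    by auto
  have clC: "closedin A.X (centres n \<times> E)"
  proof -
    have "closedin (top_of_set (skel n)) (centres n)"
      using cen finite_centres by (intro closed_subset finite_imp_closed)
    then have "closedin A.X {w \<in> topspace A.X. fst w \<in> centres n}"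
      by (rule closedin_continuous_map_preimage[OF A.continuous_map_fst_cover])
    moreover have "{w \<in> topspace A.X. fst w \<in> centres n} = centres n \<times> E"
      using cen by auto
    ultimately show ?thesis
      by simp
  qed
  have "singular_relboundary 2 A.X (topspace A.X - centres n \<times> E) c"
  proof (rule singular_relboundary_from_points[OF cenE clC, of N])
    fix q assume q: "q \<in> centres n \<times> E"
    obtain S where S: "S \<in> \<T>" "aff_dim S = n" "q = (centre S, snd q)" "snd q \<in> E" "N q = cell S (snd q)"
      using N[OF q] by blast
    show "openin A.X (N q)"
      unfolding S(5) by (rule openin_cell[OF S(1,2) n S(4)])
    show "q \<in> N q"
      unfolding S(5) using centre_in_cell[OF S(1,2) n S(4)] S(3) by simp
    show "singular_relboundary 2 A.X (topspace A.X - {q}) c"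
      using loc[OF S(1,2,4)] S(3) by simp
    fix q' assume q': "q' \<in> centres n \<times> E" and ne: "q \<noteq> q'"
    obtain S' where S': "S' \<in> \<T>" "aff_dim S' = n" "q' = (centre S', snd q')" "snd q' \<in> E" "N q' = cell S' (snd q')"
      using N[OF q'] by blast
    have "(centre S, snd q) \<noteq> (centre S', snd q')"
      using ne S(3) S'(3) by simp
    then show "N q \<inter> N q' = {}"
      unfolding S(5) S'(5) by (rule cut[OF S(1,2) S'(1,2) S(4) S'(4)])
  qed (rule singular_relcycle_absolute[OF c])
  then have rel: "singular_relboundary 2 A.X (?Y0 \<times> E) c"
    unfolding diff .
  show ?thesis
  proof (rule singular_boundary_from_relative[OF c rel])
    fix a assume "singular_relcycle 2 (subtopology A.X (?Y0 \<times> E)) {} a"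
    then have a: "singular_relcycle 2 Y.X {} a"
      unfolding subY .
    have sk: "skel (n - 1) \<subseteq> ?Y0"
      by (rule skel_Diff_centres[OF n])
    obtain h where h: "continuous_on ({0..1::real} \<times> ?Y0) h" "h ` ({0..1} \<times> ?Y0) \<subseteq> ?Y0"
      "\<And>x. x \<in> ?Y0 \<Longrightarrow> h (0, x) = x" "\<And>x. x \<in> ?Y0 \<Longrightarrow> h (1, x) \<in> skel (n - 1)"
      by (rule skel_deformation[OF n]) (rule that)
    let ?I = "top_of_set {0..1::real}"
    let ?h = "\<lambda>w. h (fst w, fst (snd w))"
    let ?H = "\<lambda>w. (?h w, \<rho> (\<lambda>s. ?h (fst w * s, snd w)) (snd (id (snd w))))"
    have ch: "continuous_map (prod_topology ?I Y.X) (top_of_set ?Y0) ?h"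
    proof -
      have 1: "continuous_map (prod_topology ?I Y.X) (prod_topology ?I (top_of_set ?Y0)) (\<lambda>w. (fst w, (fst \<circ> snd) w))"
        by (intro continuous_map_pairedI continuous_map_fst continuous_map_compose[OF continuous_map_snd Y.continuous_map_fst_cover])
      have 2: "continuous_map (prod_topology ?I (top_of_set ?Y0)) (top_of_set ?Y0) h"
        using h(1,2) by (auto simp: prod_topology_subtopology_eu)
      show ?thesis
        using continuous_map_compose[OF 1 2] by (simp add: comp_def)
    qed
    have cH: "continuous_map (prod_topology ?I Y.X) Y.X ?H"
      by (rule Y.covering_homotopy[OF Y.locally_path_connected_cover continuous_map_id ch]) (use h(3) in auto)
    have hom: "homotopic_with (\<lambda>_. True) Y.X Y.X id (\<lambda>w. ?H (1, w))"
    proof (subst homotopic_with)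
      show "\<exists>k. continuous_map (prod_topology ?I Y.X) Y.X k \<and> (\<forall>x\<in>topspace Y.X. k (0, x) = id x) \<and>
        (\<forall>x\<in>topspace Y.X. k (1, x) = ?H (1, x)) \<and> (\<forall>t\<in>{0..1::real}. True)"
        using cH h(3) by (intro exI[of _ ?H]) (auto simp: Y.rho_const')
    qed simp
    have "singular_relboundary 2 Y.X {} a"
    proof (rule singular_boundary_from_deformation[OF a hom, of "skel (n - 1) \<times> E"])
      show "(\<lambda>w. ?H (1, w)) ` topspace Y.X \<subseteq> skel (n - 1) \<times> E"
      proof -
        have "fst (?H (1, w)) \<in> skel (n - 1)" if "w \<in> topspace Y.X" for w
          using h(4)[of "fst w"] that by auto
        moreover have "snd (?H (1, w)) \<in> E" if "w \<in> topspace Y.X" for w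
        proof -
          have "?H (1, w) \<in> topspace Y.X"
            by (rule funcset_mem[OF continuous_map_funspace[OF cH]]) (use that in simp)
          then show ?thesis
            by (simp only: Y.topspace_cover mem_Times_iff)
        qed
        ultimately have "?H (1, w) \<in> skel (n - 1) \<times> E" if "w \<in> topspace Y.X" for w
          using that by (simp only: mem_Times_iff)
        then show ?thesis
          by (rule image_subsetI)
      qed
      have "subtopology Y.X (skel (n - 1) \<times> E) = Xs (n - 1)"
        by (rule Y.subtopology_cover[OF sk locally_starlike_skel'])
      then show "singular_relboundary 2 (subtopology Y.X (skel (n - 1) \<times> E)) {} b"
        if "singular_relcycle 2 (subtopology Y.X (skel (n - 1) \<times> E)) {} b" for b
        using low that by simp
    qed
    then show "singular_relboundary 2 (subtopology A.X (?Y0 \<times> E)) {} a"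
      unfolding subY .
  qed
qed

text \<open>Induction over the skeleta, starting from the empty one; only on the last of them, of
  dimension 2, is the local condition not automatic. The fibre may be infinite, which matters for
  the universal covering.\<close>

lemma boundary_if_locally_boundary:
  assumes dim: "\<And>S. S \<in> \<T> \<Longrightarrow> aff_dim S \<le> 2"
    and c: "singular_relcycle 2 X {} c"
    and loc: "\<And>S e. S \<in> \<T> \<Longrightarrow> aff_dim S = 2 \<Longrightarrow> e \<in> E \<Longrightarrow> singular_relboundary 2 X (topspace X - {(centre S, e)}) c"
  shows "singular_relboundary 2 X {} c"
proof -
  have sk2: "skel 2 = \<Union>\<T>"
    using dim by (auto simp: skel_def)
  have skm: "skel (-1) = {}"
  proof -
    have "S = {}" if "aff_dim S \<le> -1" for S :: "'a set"
      using that aff_dim_geq[of S] aff_dim_empty[of S] by simp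
    then show ?thesis
      by (auto simp: skel_def)
  qed
  have base: "singular_relboundary 2 (Xs (0 - 1)) {} a" if "singular_relcycle 2 (Xs (0 - 1)) {} a" for a
  proof -
    interpret A: transport "skel (-1)" E \<rho>
      by (rule transport_skel)
    have "topspace A.X = {}"
      by (subst A.topspace_cover) (use skm in blast)
    then have "a = 0"
      using that singular_chain_empty[of A.X 2 a] by (simp add: singular_cycle)
    then show ?thesis
      by simp
  qed
  have zero: "singular_relboundary 2 (Xs 0) {} a" if "singular_relcycle 2 (Xs 0) {} a" for a
    by (rule skel_boundary_step[OF order.refl base that]) (auto intro!: low_dim_local_boundary singular_relcycle_absolute[OF that])
  have one: "singular_relboundary 2 (Xs 1) {} a" if "singular_relcycle 2 (Xs 1) {} a" for a
    by (rule skel_boundary_step[OF _ _ that]) (auto intro!: low_dim_local_boundary singular_relcycle_absolute[OF that] zero)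
  have "singular_relboundary 2 (Xs 2) {} c"
    by (rule skel_boundary_step[of 2]) (use one c loc sk2 in auto)
  then show ?thesis
    by (simp add: sk2)
qed

end

text \<open>The local degree at \<open>q'\<close> of a cycle missing all other preimages of \<open>q\<close> is that of its image at \<open>q\<close>.\<close>

lemma local_boundary_reflect:
  assumes Y: "openin X' Y" and f: "continuous_map (subtopology X' Y) X f"
    and N: "openin X N" "q \<in> N" "openin X (topspace X - {q})"
    and N': "openin X' N'" "N' \<subseteq> Y" "q' \<in> N'" "openin X' (topspace X' - {q'})" "f ` N' \<subseteq> N"
    and s: "continuous_map (subtopology X N) (subtopology X' N') s" "\<And>w. w \<in> N' \<Longrightarrow> s (f w) = w"
    and q: "\<And>w. w \<in> Y \<Longrightarrow> f w = q \<Longrightarrow> w = q'" "\<And>w. w \<in> N \<Longrightarrow> s w = q' \<Longrightarrow> w = q"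
    and z: "singular_relcycle p (subtopology X' Y) {} z"
    and rel: "singular_relboundary p X (topspace X - {q}) (chain_map p f z)"
  shows "singular_relboundary p X' (topspace X' - {q'}) z"
proof -
  let ?Y = "subtopology X' Y"
  let ?T = "Y - {q'}" and ?U = "Y - N'"
  have sub: "Y \<subseteq> topspace X'" "N \<subseteq> topspace X"
    using Y N openin_subset by blast+
  have topY: "topspace ?Y = Y"
    using sub by auto
  have opN': "openin ?Y N'"
    using N' Y by (auto simp: openin_open_subtopology)
  have opT: "openin ?Y ?T"
  proof -
    have "?T = Y \<inter> (topspace X' - {q'})"
      using sub by auto
    then show ?thesis
      using N'(4) by (auto simp: openin_subtopology_Int2)
  qed
  have "closedin ?Y ?U"
    using opN' topY by (metis closedin_diff closedin_topspace)
  then have cl: "?Y closure_of ?U \<subseteq> ?Y interior_of ?T"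
    using opT N'(3) by (auto simp: closure_of_closedin interior_of_openin)
  have YU: "Y - ?U = N'" "?T - ?U = N' - {q'}"
    using N'(2) by auto
  obtain z' where z': "singular_relcycle p (subtopology X' N') (N' - {q'}) z'" and hom: "homologous_rel p ?Y ?T z z'"
  proof (rule excised_relcycle_exists[OF cl, of Y p z])
    show "?T \<subseteq> Y"
      by auto
    show "singular_relcycle p (subtopology ?Y Y) ?T z"
      using singular_relcycle_absolute[OF z] by (simp add: subtopology_subtopology)
  qed (use that N'(2) in \<open>simp add: YU subtopology_subtopology Int_absorb1\<close>)
  have fYT: "f \<in> ?T \<rightarrow> topspace X - {q}"
    using continuous_map_funspace[OF f] q(1) topY by (auto simp: Pi_iff)
  have "singular_relboundary p ?Y ?T (z - z')"
    using hom by (simp add: homologous_rel_def)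
  then have "singular_relboundary p X (topspace X - {q}) (chain_map p f (z - z'))"
    using f fYT by (rule singular_relboundary_chain_map)
  then have rel': "singular_relboundary p X (topspace X - {q}) (chain_map p f z')"
    using rel singular_relboundary_diff[of p X _ "chain_map p f z" "chain_map p f (z - z')"] by (simp add: chain_map_diff)
  have fN: "continuous_map (subtopology X' N') (subtopology X N) f"
    using f N'(2,5) continuous_map_from_subtopology_mono[of X' Y X f N'] by (simp add: continuous_map_in_subtopology image_subset_iff_funcset Pi_iff image_subset_iff)
  have fq: "f \<in> N' - {q'} \<rightarrow> N - {q}"
    using N'(2,5) q(1) by auto
  have cyc: "singular_relcycle p (subtopology X N) (N - {q}) (chain_map p f z')"
    using singular_relcycle_chain_map[OF z' fN fq] .
  have XN: "topspace X - (topspace X - N) = N" "(topspace X - {q}) - (topspace X - N) = N - {q}"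
    using sub by auto
  have clN: "X closure_of (topspace X - N) \<subseteq> X interior_of (topspace X - {q})"
  proof -
    have "closedin X (topspace X - N)"
      using N(1) by blast
    with N show ?thesis
      by (auto simp: closure_of_closedin interior_of_openin)
  qed
  have "singular_relboundary p (subtopology X N) (N - {q}) (chain_map p f z')"
    using excision_singular_relboundary[OF clN, of p "chain_map p f z'"] cyc rel' unfolding XN by auto
  then have "singular_relboundary p (subtopology X' N') (N' - {q'}) (chain_map p s (chain_map p f z'))"
  proof (rule singular_relboundary_chain_map[OF _ s(1)])
    show "s \<in> N - {q} \<rightarrow> N' - {q'}"
      using continuous_map_funspace[OF s(1)] q(2) sub by (auto simp: Pi_iff)
  qed
  moreover have "chain_map p s (chain_map p f z') = z'"
  proof -
    have "chain_map p (s \<circ> f) z' = z'"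
      using z' s(2) by (intro chain_map_id_gen[of p "subtopology X' N'"]) (auto simp: singular_relcycle_def)
    then show ?thesis
      by (simp add: chain_map_compose)
  qed
  ultimately have "singular_relboundary p (subtopology X' N') (N' - {q'}) z'"
    by simp
  then have "singular_relboundary p X' (topspace X' - {q'}) z'"
    by (rule singular_relboundary_subtopology) (use N'(2) sub in auto)
  moreover have "singular_relboundary p X' (topspace X' - {q'}) (z - z')"
    using hom unfolding homologous_rel_def by (rule singular_relboundary_subtopology) (use sub in auto)
  ultimately show ?thesis
    using singular_relboundary_add[of p X' _ "z - z'" z'] by simp
qed

subsection \<open>The second homotopy group\<close>

definition sq :: "(real \<times> real) set" where
  "sq = {0..1} \<times> {0..1}"

definition bsq :: "(real \<times> real) set" where
  "bsq = {z \<in> sq. fst z = 0 \<or> fst z = 1 \<or> snd z = 0 \<or> snd z = 1}"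

definition sqs :: "'a::topological_space set \<Rightarrow> 'a \<Rightarrow> (real \<times> real \<Rightarrow> 'a) set" where
  "sqs P x0 = {f. continuous_on sq f \<and> f ` sq \<subseteq> P \<and> (\<forall>z\<in>bsq. f z = x0)}"

definition sqrel :: "'a::topological_space set \<Rightarrow> 'a \<Rightarrow> (real \<times> real \<Rightarrow> 'a) \<Rightarrow> (real \<times> real \<Rightarrow> 'a) \<Rightarrow> bool" where
  "sqrel P x0 f g \<longleftrightarrow> homotopic_with_canon (\<lambda>h. \<forall>z\<in>bsq. h z = x0) sq P f g"

lemma bsq_subset: "bsq \<subseteq> sq"
  by (auto simp: bsq_def)

lemma sqrel_alt:
  "sqrel P x0 f g \<longleftrightarrow> (\<exists>H. continuous_on ({0..1::real} \<times> sq) H \<and> H ` ({0..1} \<times> sq) \<subseteq> P \<and>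
    (\<forall>z\<in>sq. H (0, z) = f z \<and> H (1, z) = g z) \<and> (\<forall>t\<in>{0..1}. \<forall>z\<in>bsq. H (t, z) = x0))"
proof -
  have *: "prod_topology (top_of_set {0..1::real}) (top_of_set sq) = top_of_set ({0..1} \<times> sq)"
    by (simp add: prod_topology_subtopology_eu)
  have "(\<forall>z\<in>bsq. h z = x0) = (\<forall>z\<in>bsq. k z = x0)" if "\<And>z. z \<in> topspace (top_of_set sq) \<Longrightarrow> h z = k z" for h k
    using that bsq_subset by (metis subsetD topspace_euclidean_subtopology)
  from homotopic_with[of "top_of_set sq" "\<lambda>h. \<forall>z\<in>bsq. h z = x0", OF this]
  show ?thesis
    unfolding sqrel_def * by (simp add: image_subset_iff_funcset ball_conj_distrib conj_assoc)
qed

lemma sqrel_sqs: "sqrel P x0 f g \<Longrightarrow> f \<in> sqs P x0 \<and> g \<in> sqs P x0"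
  unfolding sqrel_def sqs_def
  using homotopic_with_imp_property[of _ _ _ f g] homotopic_with_imp_continuous_maps[of _ "top_of_set sq" "top_of_set P" f g]
  by (simp add: image_subset_iff_funcset)

lemma sqrel_refl: "f \<in> sqs P x0 \<Longrightarrow> sqrel P x0 f f"
  by (simp add: sqrel_def sqs_def image_subset_iff_funcset)

lemma sqrel_sym: "sqrel P x0 f g \<Longrightarrow> sqrel P x0 g f"
  by (simp add: sqrel_def homotopic_with_sym)

lemma sqrel_trans: "sqrel P x0 f g \<Longrightarrow> sqrel P x0 g h \<Longrightarrow> sqrel P x0 f h"
  unfolding sqrel_def by (rule homotopic_with_trans)

text \<open>Source of the unit laws and of inverses: moving the argument inside the square is a
  homotopy as long as boundary points stay where \<open>f\<close> is \<open>x0\<close>.\<close>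

lemma sqrel_reparam:
  assumes f: "f \<in> sqs P x0"
    and \<Phi>: "continuous_on ({0..1::real} \<times> sq) \<Phi>" "\<Phi> ` ({0..1} \<times> sq) \<subseteq> sq"
      "\<And>r z. r \<in> {0..1} \<Longrightarrow> z \<in> bsq \<Longrightarrow> f (\<Phi> (r, z)) = x0"
    and g: "\<And>z. z \<in> sq \<Longrightarrow> g z = f (\<Phi> (0, z))" and h: "\<And>z. z \<in> sq \<Longrightarrow> h z = f (\<Phi> (1, z))"
  shows "sqrel P x0 g h"
  unfolding sqrel_alt
proof (intro exI[of _ "f \<circ> \<Phi>"] conjI)
  show "continuous_on ({0..1} \<times> sq) (f \<circ> \<Phi>)"
    unfolding comp_def using f \<Phi>(1,2) by (auto simp: sqs_def intro: continuous_on_compose2)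
  show "(f \<circ> \<Phi>) ` ({0..1} \<times> sq) \<subseteq> P"
  proof -
    have "(f \<circ> \<Phi>) ` ({0..1} \<times> sq) = f ` \<Phi> ` ({0..1} \<times> sq)"
      by (simp add: image_comp)
    also have "\<dots> \<subseteq> f ` sq"
      using \<Phi>(2) by (rule image_mono)
    finally show ?thesis
      using f by (auto simp: sqs_def)
  qed
  show "\<forall>z\<in>sq. (f \<circ> \<Phi>) (0, z) = g z \<and> (f \<circ> \<Phi>) (1, z) = h z"
    using g h by simp
  show "\<forall>t\<in>{0..1}. \<forall>z\<in>bsq. (f \<circ> \<Phi>) (t, z) = x0"
    using \<Phi>(3) by simp
qed

definition hcomp :: "(real \<times> real \<Rightarrow> 'a) \<Rightarrow> (real \<times> real \<Rightarrow> 'a) \<Rightarrow> real \<times> real \<Rightarrow> 'a" where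
  "hcomp f g z = (if fst z \<le> 1/2 then f (2 * fst z, snd z) else g (2 * fst z - 1, snd z))"

definition vcomp :: "(real \<times> real \<Rightarrow> 'a) \<Rightarrow> (real \<times> real \<Rightarrow> 'a) \<Rightarrow> real \<times> real \<Rightarrow> 'a" where
  "vcomp f g z = (if snd z \<le> 1/2 then f (fst z, 2 * snd z) else g (fst z, 2 * snd z - 1))"

lemma interchange: "hcomp (vcomp a b) (vcomp c d) = vcomp (hcomp a c) (hcomp b d)"
  by (auto simp: hcomp_def vcomp_def fun_eq_iff)

lemma vcomp_swap: "vcomp f g = hcomp (f \<circ> prod.swap) (g \<circ> prod.swap) \<circ> prod.swap"
  by (auto simp: hcomp_def vcomp_def fun_eq_iff)

lemma swap_sq: "prod.swap z \<in> sq \<longleftrightarrow> z \<in> sq" "prod.swap z \<in> bsq \<longleftrightarrow> z \<in> bsq"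
  by (cases z; auto simp: sq_def bsq_def)+

lemma sqrel_swap: "sqrel P x0 f g \<Longrightarrow> sqrel P x0 (f \<circ> prod.swap) (g \<circ> prod.swap)"
proof -
  assume "sqrel P x0 f g"
  then obtain H where H: "continuous_on ({0..1::real} \<times> sq) H" "H ` ({0..1} \<times> sq) \<subseteq> P"
    "\<forall>z\<in>sq. H (0, z) = f z \<and> H (1, z) = g z" "\<forall>t\<in>{0..1}. \<forall>z\<in>bsq. H (t, z) = x0"
    unfolding sqrel_alt by (elim exE conjE)
  show ?thesis
    unfolding sqrel_alt
  proof (intro exI[of _ "\<lambda>w. H (fst w, prod.swap (snd w))"] conjI)
    show "continuous_on ({0..1} \<times> sq) (\<lambda>w. H (fst w, prod.swap (snd w)))"
      by (rule continuous_on_compose2[OF H(1)]) (use swap_sq(1) in \<open>auto intro!: continuous_intros simp: prod.swap_def\<close>)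
    show "(\<lambda>w. H (fst w, prod.swap (snd w))) ` ({0..1} \<times> sq) \<subseteq> P"
      using H(2) swap_sq by (auto simp: image_subset_iff)
    show "\<forall>z\<in>sq. H (fst (0, z), prod.swap (snd (0::real, z))) = (f \<circ> prod.swap) z \<and> H (fst (1, z), prod.swap (snd (1::real, z))) = (g \<circ> prod.swap) z"
      using H(3) swap_sq(1) by simp
    show "\<forall>t\<in>{0..1}. \<forall>z\<in>bsq. H (fst (t, z), prod.swap (snd (t, z))) = x0"
      using H(4) swap_sq(2) by simp
  qed
qed

lemma swap_sqs: "f \<in> sqs P x0 \<Longrightarrow> f \<circ> prod.swap \<in> sqs P x0"
  using sqrel_sqs[OF sqrel_swap[OF sqrel_refl[of f P x0]]] by blast

lemma sqrel_hcomp: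
  assumes "sqrel P x0 f f'" "sqrel P x0 g g'"
  shows "sqrel P x0 (hcomp f g) (hcomp f' g')"
proof -
  obtain H where H: "continuous_on ({0..1::real} \<times> sq) H" "H ` ({0..1} \<times> sq) \<subseteq> P"
    "\<forall>z\<in>sq. H (0, z) = f z \<and> H (1, z) = f' z" "\<forall>t\<in>{0..1}. \<forall>z\<in>bsq. H (t, z) = x0"
    using assms(1) unfolding sqrel_alt by (elim exE conjE)
  obtain K where K: "continuous_on ({0..1::real} \<times> sq) K" "K ` ({0..1} \<times> sq) \<subseteq> P"
    "\<forall>z\<in>sq. K (0, z) = g z \<and> K (1, z) = g' z" "\<forall>t\<in>{0..1}. \<forall>z\<in>bsq. K (t, z) = x0"
    using assms(2) unfolding sqrel_alt by (elim exE conjE)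
  define L where "L w = (if fst (snd w) \<le> 1/2 then H (fst w, (2 * fst (snd w), snd (snd w))) else K (fst w, (2 * fst (snd w) - 1, snd (snd w))))" for w
  have in1: "(fst w, (2 * fst (snd w), snd (snd w))) \<in> {0..1} \<times> sq" if "w \<in> {0..1} \<times> sq" "fst (snd w) \<le> 1/2" for w
    using that by (auto simp: sq_def)
  have in2: "(fst w, (2 * fst (snd w) - 1, snd (snd w))) \<in> {0..1} \<times> sq" if "w \<in> {0..1} \<times> sq" "1/2 \<le> fst (snd w)" for w
    using that by (auto simp: sq_def)
  show ?thesis
    unfolding sqrel_alt
  proof (intro exI[of _ L] conjI)
    show "continuous_on ({0..1} \<times> sq) L"
      unfolding L_def
    proof (rule continuous_on_cases_le)
      show "continuous_on {w \<in> {0..1} \<times> sq. fst (snd w) \<le> 1/2} (\<lambda>w. H (fst w, (2 * fst (snd w), snd (snd w))))"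
        by (rule continuous_on_compose2[OF H(1)]) (use in1 in \<open>auto intro!: continuous_intros\<close>)
      show "continuous_on {w \<in> {0..1} \<times> sq. 1/2 \<le> fst (snd w)} (\<lambda>w. K (fst w, (2 * fst (snd w) - 1, snd (snd w))))"
        by (rule continuous_on_compose2[OF K(1)]) (use in2 in \<open>auto intro!: continuous_intros\<close>)
      show "continuous_on ({0..1} \<times> sq) (\<lambda>w. fst (snd w))"
        by (intro continuous_intros)
      fix w assume w: "w \<in> {0..1::real} \<times> sq" "fst (snd w) = 1/2"
      then have "(1, snd (snd w)) \<in> bsq" "(0, snd (snd w)) \<in> bsq"
        by (auto simp: bsq_def sq_def)
      then show "H (fst w, (2 * fst (snd w), snd (snd w))) = K (fst w, (2 * fst (snd w) - 1, snd (snd w)))"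
        unfolding w(2) using H(4) K(4) w(1) by auto
    qed
    show "L ` ({0..1} \<times> sq) \<subseteq> P"
    proof (intro image_subsetI)
      fix w :: "real \<times> real \<times> real" assume w: "w \<in> {0..1} \<times> sq"
      show "L w \<in> P"
      proof (cases "fst (snd w) \<le> 1/2")
        case True
        then show ?thesis
          using in1[OF w True] H(2) by (simp add: L_def image_subset_iff)
      next
        case False
        then show ?thesis
          using in2[OF w] K(2) by (simp add: L_def image_subset_iff)
      qed
    qed
    show "\<forall>z\<in>sq. L (0, z) = hcomp f g z \<and> L (1, z) = hcomp f' g' z"
    proof
      fix z assume z: "z \<in> sq"
      have "(2 * fst z, snd z) \<in> sq" if "fst z \<le> 1/2"
        using z that by (auto simp: sq_def)
      moreover have "(2 * fst z - 1, snd z) \<in> sq" if "\<not> fst z \<le> 1/2"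
        using z that by (auto simp: sq_def)
      ultimately show "L (0, z) = hcomp f g z \<and> L (1, z) = hcomp f' g' z"
        using H(3) K(3) by (simp add: L_def hcomp_def)
    qed
    show "\<forall>t\<in>{0..1}. \<forall>z\<in>bsq. L (t, z) = x0"
    proof (intro ballI)
      fix t :: real and z assume t: "t \<in> {0..1}" and z: "z \<in> bsq"
      have "(2 * fst z, snd z) \<in> bsq" if "fst z \<le> 1/2"
        using z that by (auto simp: bsq_def sq_def)
      moreover have "(2 * fst z - 1, snd z) \<in> bsq" if "\<not> fst z \<le> 1/2"
        using z that by (auto simp: bsq_def sq_def)
      ultimately show "L (t, z) = x0"
        using H(4) K(4) t by (simp add: L_def)
    qed
  qed
qed

lemma sqrel_vcomp: "sqrel P x0 f f' \<Longrightarrow> sqrel P x0 g g' \<Longrightarrow> sqrel P x0 (vcomp f g) (vcomp f' g')"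
  unfolding vcomp_swap by (intro sqrel_swap sqrel_hcomp)

lemma hcomp_sqs: "f \<in> sqs P x0 \<Longrightarrow> g \<in> sqs P x0 \<Longrightarrow> hcomp f g \<in> sqs P x0"
  using sqrel_sqs[OF sqrel_hcomp[OF sqrel_refl sqrel_refl]] by blast

lemma const_sqs: "x0 \<in> P \<Longrightarrow> (\<lambda>_. x0) \<in> sqs P x0"
  by (auto simp: sqs_def)

text \<open>The straight-line homotopy from \<phi> to the identity keeps both ends of the interval
  fixed, so the boundary of the square stays in the boundary.\<close>

lemma sqrel_reparam_fst:
  assumes f: "f \<in> sqs P x0" and \<phi>: "continuous_on {0..1} \<phi>" "\<phi> ` {0..1} \<subseteq> {0..1::real}" "\<phi> 0 = 0" "\<phi> 1 = 1"
    and g: "\<And>z. z \<in> sq \<Longrightarrow> g z = f (\<phi> (fst z), snd z)"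
  shows "sqrel P x0 g f"
proof (rule sqrel_reparam[OF f, where \<Phi> = "\<lambda>(r, z). ((1 - r) * \<phi> (fst z) + r * fst z, snd z)"])
  have \<phi>in: "\<phi> s \<in> {0..1}" if "s \<in> {0..1}" for s
    using subsetD[OF \<phi>(2) imageI[OF that]] .
  have cv: "(1 - r) * \<phi> s + r * s \<in> {0..1}" if "r \<in> {0..1}" "s \<in> {0..1}" for r s
    using \<phi>in[OF that(2)] that convexD[of "{0..1::real}" "\<phi> s" s "1 - r" r] by auto
  show "continuous_on ({0..1} \<times> sq) (\<lambda>(r, z). ((1 - r) * \<phi> (fst z) + r * fst z, snd z))"
    unfolding case_prod_unfold
    by (intro continuous_intros; rule continuous_on_compose2[OF \<phi>(1)]) (auto simp: sq_def intro!: continuous_intros)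
  show "(\<lambda>(r, z). ((1 - r) * \<phi> (fst z) + r * fst z, snd z)) ` ({0..1} \<times> sq) \<subseteq> sq"
    using cv by (auto simp: sq_def)
  show "f (case (r, z) of (r, z) \<Rightarrow> ((1 - r) * \<phi> (fst z) + r * fst z, snd z)) = x0" if "r \<in> {0..1}" "z \<in> bsq" for r z
  proof -
    have "((1 - r) * \<phi> (fst z) + r * fst z, snd z) \<in> bsq"
      using that cv[of r "fst z"] \<phi>(3,4) by (auto simp: bsq_def sq_def)
    then show ?thesis
      using f by (auto simp: sqs_def)
  qed
qed (use g in auto)

lemma hcomp_const_right: "f \<in> sqs P x0 \<Longrightarrow> sqrel P x0 (hcomp f (\<lambda>_. x0)) f"
proof (rule sqrel_reparam_fst[where \<phi> = "\<lambda>s. min 1 (2 * s)"])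
  show "hcomp f (\<lambda>_. x0) z = f (min 1 (2 * fst z), snd z)" if "f \<in> sqs P x0" "z \<in> sq" for z
  proof -
    have "(1, snd z) \<in> bsq"
      using that by (auto simp: bsq_def sq_def)
    moreover have "min 1 (2 * fst z) = (if fst z \<le> 1/2 then 2 * fst z else 1)"
      by simp
    ultimately show ?thesis
      using that by (simp add: hcomp_def sqs_def)
  qed
qed (auto intro!: continuous_intros)

lemma hcomp_const_left: "f \<in> sqs P x0 \<Longrightarrow> sqrel P x0 (hcomp (\<lambda>_. x0) f) f"
proof (rule sqrel_reparam_fst[where \<phi> = "\<lambda>s. max 0 (2 * s - 1)"])
  show "hcomp (\<lambda>_. x0) f z = f (max 0 (2 * fst z - 1), snd z)" if "f \<in> sqs P x0" "z \<in> sq" for z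
  proof -
    have "(0, snd z) \<in> bsq"
      using that by (auto simp: bsq_def sq_def)
    moreover have "max 0 (2 * fst z - 1) = (if fst z \<le> 1/2 then 0 else 2 * fst z - 1)"
      by simp
    ultimately show ?thesis
      using that by (simp add: hcomp_def sqs_def)
  qed
qed (auto intro!: continuous_intros)

text \<open>For first coordinate \<open>s\<close> the composite evaluates \<open>f\<close> at the
  absolute value of \<open>2 * s - 1\<close>: from the right edge to the left one and back. Cutting
  this value off from below at \<open>r\<close> ends at the right edge, where \<open>f\<close> is
  \<open>x0\<close>.\<close>

lemma hcomp_inverse:
  assumes f: "f \<in> sqs P x0"
  shows "sqrel P x0 (hcomp (\<lambda>z. f (1 - fst z, snd z)) f) (\<lambda>_. x0)"
proof (rule sqrel_reparam[OF f, where \<Phi> = "\<lambda>(r, z). (max (max (1 - 2 * fst z) (2 * fst z - 1)) r, snd z)"])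
  show "continuous_on ({0..1} \<times> sq) (\<lambda>(r, z). (max (max (1 - 2 * fst z) (2 * fst z - 1)) r, snd z))"
    unfolding case_prod_unfold by (intro continuous_intros)
  show "(\<lambda>(r, z). (max (max (1 - 2 * fst z) (2 * fst z - 1)) r, snd z)) ` ({0..1} \<times> sq) \<subseteq> sq"
    by (auto simp: sq_def)
  show "f (case (r, z) of (r, z) \<Rightarrow> (max (max (1 - 2 * fst z) (2 * fst z - 1)) r, snd z)) = x0" if "r \<in> {0..1}" "z \<in> bsq" for r z
  proof -
    have "(max (max (1 - 2 * fst z) (2 * fst z - 1)) r, snd z) \<in> bsq"
      using that by (auto simp: bsq_def sq_def)
    then show ?thesis
      using f by (auto simp: sqs_def)
  qed
  show "hcomp (\<lambda>z. f (1 - fst z, snd z)) f z = f (case (0, z) of (r, z) \<Rightarrow> (max (max (1 - 2 * fst z) (2 * fst z - 1)) r, snd z))" for z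
    by (auto simp: hcomp_def max_def)
  show "x0 = f (case (1, z) of (r, z) \<Rightarrow> (max (max (1 - 2 * fst z) (2 * fst z - 1)) r, snd z))" if "z \<in> sq" for z
  proof -
    have "max (max (1 - 2 * fst z) (2 * fst z - 1)) 1 = 1" "(1, snd z) \<in> bsq"
      using that by (auto simp: sq_def bsq_def)
    then show ?thesis
      using f by (auto simp: sqs_def)
  qed
qed

lemma reverse_sqs: "f \<in> sqs P x0 \<Longrightarrow> (\<lambda>z. f (1 - fst z, snd z)) \<in> sqs P x0"
proof -
  assume f: "f \<in> sqs P x0"
  have "continuous_on sq (\<lambda>z. f (1 - fst z, snd z))"
  proof (rule continuous_on_compose2[of sq f])
    show "continuous_on sq f"
      using f by (simp add: sqs_def)
    show "continuous_on sq (\<lambda>z. (1 - fst z, snd z))"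
      by (intro continuous_intros)
  qed (auto simp: sq_def)
  moreover have "(1 - fst z, snd z) \<in> sq" if "z \<in> sq" for z
    using that by (auto simp: sq_def)
  moreover have "(1 - fst z, snd z) \<in> bsq" if "z \<in> bsq" for z
    using that by (auto simp: sq_def bsq_def)
  ultimately show ?thesis
    using f by (auto simp: sqs_def)
qed

lemma vcomp_const_right: "f \<in> sqs P x0 \<Longrightarrow> sqrel P x0 (vcomp f (\<lambda>_. x0)) f"
  using sqrel_swap[OF hcomp_const_right[OF swap_sqs]] by (fastforce simp: vcomp_swap comp_def)

lemma vcomp_const_left: "f \<in> sqs P x0 \<Longrightarrow> sqrel P x0 (vcomp (\<lambda>_. x0) f) f"
  using sqrel_swap[OF hcomp_const_left[OF swap_sqs]] by (fastforce simp: vcomp_swap comp_def)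

context
  fixes P :: "'a::topological_space set" and x0
  assumes x0: "x0 \<in> P"
begin

private abbreviation rel (infix "\<approx>" 50) where "f \<approx> g \<equiv> sqrel P x0 f g"

text \<open>The Eckmann-Hilton argument: insert constant squares and exchange the order of the two
  compositions.\<close>

lemma hcomp_vcomp:
  assumes "f \<in> sqs P x0" "g \<in> sqs P x0"
  shows "hcomp f g \<approx> vcomp f g"
proof -
  have "hcomp f g \<approx> hcomp (vcomp f (\<lambda>_. x0)) (vcomp (\<lambda>_. x0) g)"
    using assms by (intro sqrel_hcomp sqrel_sym[OF vcomp_const_right] sqrel_sym[OF vcomp_const_left])
  also have "hcomp (vcomp f (\<lambda>_. x0)) (vcomp (\<lambda>_. x0) g) = vcomp (hcomp f (\<lambda>_. x0)) (hcomp (\<lambda>_. x0) g)"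
    by (rule interchange)
  finally have 1: "hcomp f g \<approx> vcomp (hcomp f (\<lambda>_. x0)) (hcomp (\<lambda>_. x0) g)" .
  have 2: "vcomp (hcomp f (\<lambda>_. x0)) (hcomp (\<lambda>_. x0) g) \<approx> vcomp f g"
    using assms by (intro sqrel_vcomp hcomp_const_right hcomp_const_left)
  show ?thesis
    by (rule sqrel_trans[OF 1 2])
qed

lemma hcomp_commute:
  assumes "f \<in> sqs P x0" "g \<in> sqs P x0"
  shows "hcomp f g \<approx> hcomp g f"
proof -
  have "hcomp f g \<approx> hcomp (vcomp (\<lambda>_. x0) f) (vcomp g (\<lambda>_. x0))"
    using assms by (intro sqrel_hcomp sqrel_sym[OF vcomp_const_right] sqrel_sym[OF vcomp_const_left])
  also have "hcomp (vcomp (\<lambda>_. x0) f) (vcomp g (\<lambda>_. x0)) = vcomp (hcomp (\<lambda>_. x0) g) (hcomp f (\<lambda>_. x0))"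
    by (rule interchange)
  finally have 1: "hcomp f g \<approx> vcomp (hcomp (\<lambda>_. x0) g) (hcomp f (\<lambda>_. x0))" .
  have 2: "vcomp (hcomp (\<lambda>_. x0) g) (hcomp f (\<lambda>_. x0)) \<approx> vcomp g f"
    using assms by (intro sqrel_vcomp hcomp_const_right hcomp_const_left)
  show ?thesis
    by (rule sqrel_trans[OF sqrel_trans[OF 1 2] sqrel_sym[OF hcomp_vcomp[OF assms(2,1)]]])
qed

text \<open>Again by interchange with constant squares, which replaces the usual threefold
  reparametrisation.\<close>

lemma hcomp_assoc:
  assumes "f \<in> sqs P x0" "g \<in> sqs P x0" "h \<in> sqs P x0"
  shows "hcomp (hcomp f g) h \<approx> hcomp f (hcomp g h)"
proof -
  have "hcomp (hcomp f g) h \<approx> hcomp (vcomp f g) (vcomp (\<lambda>_. x0) h)"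
    using assms by (intro sqrel_hcomp hcomp_vcomp sqrel_sym[OF vcomp_const_left])
  also have "hcomp (vcomp f g) (vcomp (\<lambda>_. x0) h) = vcomp (hcomp f (\<lambda>_. x0)) (hcomp g h)"
    by (rule interchange)
  finally have 1: "hcomp (hcomp f g) h \<approx> vcomp (hcomp f (\<lambda>_. x0)) (hcomp g h)" .
  have 2: "vcomp (hcomp f (\<lambda>_. x0)) (hcomp g h) \<approx> vcomp f (hcomp g h)"
    using assms by (intro sqrel_vcomp hcomp_const_right sqrel_refl hcomp_sqs)
  have 3: "vcomp f (hcomp g h) \<approx> hcomp f (hcomp g h)"
    using assms by (intro sqrel_sym[OF hcomp_vcomp] hcomp_sqs)
  show ?thesis
    by (rule sqrel_trans[OF sqrel_trans[OF 1 2] 3])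
qed

end

definition sqclass :: "'a::topological_space set \<Rightarrow> 'a \<Rightarrow> (real \<times> real \<Rightarrow> 'a) \<Rightarrow> (real \<times> real \<Rightarrow> 'a) set" where
  "sqclass P x0 f = {g. sqrel P x0 f g}"

lemma sqclass_eq: "f \<in> sqs P x0 \<Longrightarrow> g \<in> sqs P x0 \<Longrightarrow> sqclass P x0 f = sqclass P x0 g \<longleftrightarrow> sqrel P x0 f g"
  unfolding sqclass_def by (auto intro: sqrel_trans sqrel_sym dest: sqrel_refl)

text \<open>Representatives in the product are selected by choice; by \<open>sqrel_hcomp\<close> the
  class of the result does not depend on the selection.\<close>

definition pi2 :: "'a::topological_space set \<Rightarrow> 'a \<Rightarrow> (real \<times> real \<Rightarrow> 'a) set monoid" where
  "pi2 P x0 = \<lparr> carrier = sqclass P x0 ` sqs P x0,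
     mult = (\<lambda>A B. sqclass P x0 (hcomp (SOME f. f \<in> A) (SOME g. g \<in> B))),
     one = sqclass P x0 (\<lambda>_. x0) \<rparr>"

lemma mult_pi2:
  assumes "f \<in> sqs P x0" "g \<in> sqs P x0"
  shows "sqclass P x0 f \<otimes>\<^bsub>pi2 P x0\<^esub> sqclass P x0 g = sqclass P x0 (hcomp f g)"
proof -
  have r: "sqrel P x0 f (SOME h. h \<in> sqclass P x0 f)" if "f \<in> sqs P x0" for f
    using someI[of "\<lambda>h. h \<in> sqclass P x0 f" f] sqrel_refl[OF that] by (simp add: sqclass_def)
  have *: "sqrel P x0 (hcomp f g) (hcomp (SOME h. h \<in> sqclass P x0 f) (SOME h. h \<in> sqclass P x0 g))"
    using assms by (intro sqrel_hcomp r)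
  have "sqclass P x0 (hcomp f g) = sqclass P x0 (hcomp (SOME h. h \<in> sqclass P x0 f) (SOME h. h \<in> sqclass P x0 g))"
    using sqclass_eq sqrel_sqs[OF *] * by blast
  then show ?thesis
    by (simp add: pi2_def)
qed

lemma comm_group_pi2:
  assumes x0: "x0 \<in> P"
  shows "comm_group (pi2 P x0)"
proof (rule comm_groupI)
  have car: "carrier (pi2 P x0) = sqclass P x0 ` sqs P x0" and one: "\<one>\<^bsub>pi2 P x0\<^esub> = sqclass P x0 (\<lambda>_. x0)"
    by (simp_all add: pi2_def)
  note c = const_sqs[OF x0]
  show "\<one>\<^bsub>pi2 P x0\<^esub> \<in> carrier (pi2 P x0)"
    using c by (simp add: car one)
  fix A assume "A \<in> carrier (pi2 P x0)"
  then obtain f where f: "f \<in> sqs P x0" "A = sqclass P x0 f"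
    by (auto simp: car)
  show "\<one>\<^bsub>pi2 P x0\<^esub> \<otimes>\<^bsub>pi2 P x0\<^esub> A = A"
    using f c hcomp_const_left[OF f(1)] by (simp add: one mult_pi2 sqclass_eq hcomp_sqs)
  show "\<exists>B\<in>carrier (pi2 P x0). B \<otimes>\<^bsub>pi2 P x0\<^esub> A = \<one>\<^bsub>pi2 P x0\<^esub>"
    using f c hcomp_inverse[OF f(1)] reverse_sqs[OF f(1)]
    by (intro bexI[of _ "sqclass P x0 (\<lambda>z. f (1 - fst z, snd z))"]) (simp_all add: car one mult_pi2 sqclass_eq hcomp_sqs)
  fix B assume "B \<in> carrier (pi2 P x0)"
  then obtain g where g: "g \<in> sqs P x0" "B = sqclass P x0 g"
    by (auto simp: car)
  show "A \<otimes>\<^bsub>pi2 P x0\<^esub> B \<in> carrier (pi2 P x0)"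
    using f g by (simp add: car mult_pi2 hcomp_sqs)
  show "A \<otimes>\<^bsub>pi2 P x0\<^esub> B = B \<otimes>\<^bsub>pi2 P x0\<^esub> A"
    using f g hcomp_commute[OF x0 f(1) g(1)] by (simp add: mult_pi2 hcomp_sqs sqclass_eq)
  fix C assume "C \<in> carrier (pi2 P x0)"
  then obtain h where h: "h \<in> sqs P x0" "C = sqclass P x0 h"
    by (auto simp: car)
  show "A \<otimes>\<^bsub>pi2 P x0\<^esub> B \<otimes>\<^bsub>pi2 P x0\<^esub> C = A \<otimes>\<^bsub>pi2 P x0\<^esub> (B \<otimes>\<^bsub>pi2 P x0\<^esub> C)"
    using f g h hcomp_assoc[OF x0 f(1) g(1) h(1)] by (simp add: mult_pi2 hcomp_sqs sqclass_eq)
qed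

section \<open>Triangles and tetrahedra in barycentric coordinates\<close>

lemma simplex_topology: "subtopology (powertop_real UNIV) S = top_of_set S"
  by (simp add: euclidean_product_topology)

lemma continuous_on_into_fun:
  fixes f :: "'b::topological_space \<Rightarrow> nat \<Rightarrow> real"
  shows "continuous_on S f \<longleftrightarrow> (\<forall>i. continuous_on S (\<lambda>x. f x i))"
  using continuous_on_coordinatewise_then_product[of S f] continuous_on_product_then_coordinatewise[of S f] by blast

lemma continuous_on_coord: "continuous_on S (\<lambda>x :: nat \<Rightarrow> real. x i)"
  using continuous_on_into_fun[of S "\<lambda>x. x"] by simp

lemma continuous_on_if_const:
  "continuous_on S f \<Longrightarrow> continuous_on S g \<Longrightarrow> continuous_on S (\<lambda>x. if b then f x else g x)"
  by (cases b) auto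

abbreviation simplex_boundary :: "nat \<Rightarrow> (nat \<Rightarrow> real) set" where
  "simplex_boundary n \<equiv> {x \<in> standard_simplex n. \<exists>i\<le>n. x i = 0}"

definition one_skeleton :: "nat \<Rightarrow> (nat \<Rightarrow> real) set" where
  "one_skeleton n = {x \<in> standard_simplex n. \<exists>i j. \<forall>k. k \<noteq> i \<and> k \<noteq> j \<longrightarrow> x k = 0}"

text \<open>The triangle is parametrised by its coordinates 0 and 2, so the pair
  \<open>(0, 0)\<close> is vertex 1.\<close>

definition tri :: "real \<Rightarrow> real \<Rightarrow> nat \<Rightarrow> real" where
  "tri a c i = (if i = 0 then a else if i = Suc 0 then 1 - a - c else if i = 2 then c else 0)"

lemma sum_upto_2: "(\<Sum>i\<le>2. f i) = f 0 + f (Suc 0) + f (2::nat)"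
  by (simp add: numeral_2_eq_2)

lemma sum_upto_3: "(\<Sum>i\<le>3. f i) = f 0 + f (Suc 0) + f 2 + f (3::nat)"
  by (simp add: numeral_2_eq_2 numeral_3_eq_3)

lemma simplex_2_iff: "x \<in> standard_simplex 2 \<longleftrightarrow> (\<exists>a c. 0 \<le> a \<and> 0 \<le> c \<and> a + c \<le> 1 \<and> x = tri a c)"
proof
  assume x: "x \<in> standard_simplex 2"
  then have s: "x 0 + x (Suc 0) + x 2 = 1" and x0: "\<And>i. 0 \<le> x i" "\<And>i. 2 < i \<Longrightarrow> x i = 0"
    by (auto simp: standard_simplex_def sum_upto_2)
  have "x i = tri (x 0) (x 2) i" for i
  proof -
    consider "i = 0" | "i = Suc 0" | "i = 2" | "i > 2"
      by linarith
    then show ?thesis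
      using s x0(2)[of i] by cases (auto simp: tri_def)
  qed
  then have "x = tri (x 0) (x 2)"
    by (rule ext)
  moreover have "0 \<le> x 0" "0 \<le> x 2" "x 0 + x 2 \<le> 1"
    using s x0(1)[of 0] x0(1)[of "Suc 0"] x0(1)[of 2] by linarith+
  ultimately show "\<exists>a c. 0 \<le> a \<and> 0 \<le> c \<and> a + c \<le> 1 \<and> x = tri a c"
    by blast
next
  assume "\<exists>a c. 0 \<le> a \<and> 0 \<le> c \<and> a + c \<le> 1 \<and> x = tri a c"
  then show "x \<in> standard_simplex 2"
    by (auto simp: standard_simplex_def sum_upto_2 tri_def)
qed

lemma tri_in_simplex: "0 \<le> a \<Longrightarrow> 0 \<le> c \<Longrightarrow> a + c \<le> 1 \<Longrightarrow> tri a c \<in> standard_simplex 2"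
  by (auto simp: simplex_2_iff)

lemma tri_boundary:
  assumes "0 \<le> a" "0 \<le> c" "a + c \<le> 1" "a = 0 \<or> c = 0 \<or> a + c = 1"
  shows "tri a c \<in> simplex_boundary 2"
proof -
  have "tri a c 0 = a" "tri a c (Suc 0) = 1 - a - c" "tri a c 2 = c"
    by (simp_all add: tri_def)
  with assms(4) have "tri a c 0 = 0 \<or> tri a c (Suc 0) = 0 \<or> tri a c 2 = 0"
    by linarith
  then have "\<exists>i\<le>2. tri a c i = 0"
    by (metis le_refl less_2_cases_iff less_imp_le_nat)
  with tri_in_simplex[OF assms(1-3)] show ?thesis
    by blast
qed

lemma boundary_tri:
  assumes "x \<in> simplex_boundary 2"
  obtains a c where "0 \<le> a" "0 \<le> c" "a + c \<le> 1" "a = 0 \<or> c = 0 \<or> a + c = 1" "x = tri a c"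
proof -
  obtain a c where ac: "0 \<le> a" "0 \<le> c" "a + c \<le> 1" "x = tri a c"
    using assms by (auto simp: simplex_2_iff)
  obtain i where "i \<le> 2" "tri a c i = 0"
    using assms ac by auto
  then have "a = 0 \<or> c = 0 \<or> a + c = 1"
    by (auto simp: tri_def le_Suc_eq numeral_2_eq_2 split: if_splits)
  with ac that show thesis
    by blast
qed

lemma continuous_on_tri:
  assumes "continuous_on S f" "continuous_on S g"
  shows "continuous_on S (\<lambda>x. tri (f x) (g x))"
  unfolding continuous_on_into_fun tri_def using assms by (intro allI continuous_on_if_const continuous_intros)

text \<open>The square is swept out by paths from vertex 0 to vertex 2, starting with the broken path through
  vertex 1 and ending with the edge opposite to it.\<close>

definition sweep :: "real \<times> real \<Rightarrow> nat \<Rightarrow> real" where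
  "sweep z = tri ((1 - snd z) * max 0 (1 - 2 * fst z) + snd z * (1 - fst z)) ((1 - snd z) * max 0 (2 * fst z - 1) + snd z * fst z)"

lemma continuous_on_sweep: "continuous_on S sweep"
  unfolding sweep_def[abs_def] by (intro continuous_on_tri continuous_intros)

definition sw0 :: "real \<Rightarrow> real \<Rightarrow> real" where
  "sw0 s t = (1 - t) * max 0 (1 - 2 * s) + t * (1 - s)"

definition sw2 :: "real \<Rightarrow> real \<Rightarrow> real" where
  "sw2 s t = (1 - t) * max 0 (2 * s - 1) + t * s"

lemma sweep_sw: "sweep (s, t) = tri (sw0 s t) (sw2 s t)"
  by (simp add: sweep_def sw0_def sw2_def)

lemma sw_bounds:
  assumes "0 \<le> s" "s \<le> 1" "0 \<le> t" "t \<le> 1"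
  shows "0 \<le> sw0 s t" "0 \<le> sw2 s t" "sw0 s t + sw2 s t \<le> 1"
proof -
  show "0 \<le> sw0 s t" "0 \<le> sw2 s t"
    unfolding sw0_def sw2_def using assms by (intro add_nonneg_nonneg mult_nonneg_nonneg; simp)+
  have "(1 - t) * max 0 (1 - 2 * s) + (1 - t) * max 0 (2 * s - 1) = (1 - t) * (max 0 (1 - 2 * s) + max 0 (2 * s - 1))"
    by (simp add: distrib_left)
  also have "\<dots> \<le> (1 - t) * 1"
    using assms by (intro mult_left_mono) auto
  finally show "sw0 s t + sw2 s t \<le> 1"
    by (simp add: sw0_def sw2_def algebra_simps)
qed

lemma sweep_in: "z \<in> sq \<Longrightarrow> sweep z \<in> standard_simplex 2"
  using sw_bounds[of "fst z" "snd z"] sweep_sw[of "fst z" "snd z"] by (auto simp: sq_def intro!: tri_in_simplex)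

lemma sweep_bdry:
  assumes "z \<in> bsq"
  shows "sweep z \<in> simplex_boundary 2"
proof -
  obtain s t where z: "z = (s, t)" "0 \<le> s" "s \<le> 1" "0 \<le> t" "t \<le> 1" and b: "s = 0 \<or> s = 1 \<or> t = 0 \<or> t = 1"
    using assms by (auto simp: sq_def bsq_def)
  have "sw0 s t = 0 \<or> sw2 s t = 0 \<or> sw0 s t + sw2 s t = 1"
    using b z by (auto simp: sw0_def sw2_def max_def)
  then show ?thesis
    unfolding z(1) sweep_sw using sw_bounds[OF z(2-5)] by (intro tri_boundary)
qed

definition kappa :: "((nat \<Rightarrow> real) \<Rightarrow> 'a) \<Rightarrow> real \<times> real \<Rightarrow> 'a" where
  "kappa K = K \<circ> sweep"

lemma kappa_sqs:
  assumes "continuous_on (standard_simplex 2) K" "K ` standard_simplex 2 \<subseteq> P" "\<And>x. x \<in> simplex_boundary 2 \<Longrightarrow> K x = x0"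
  shows "kappa K \<in> sqs P x0"
proof -
  have "continuous_on sq (K \<circ> sweep)"
    using sweep_in by (intro continuous_on_compose continuous_on_sweep continuous_on_subset[OF assms(1)]) auto
  then show ?thesis
    using assms sweep_in sweep_bdry by (auto simp: sqs_def kappa_def)
qed

lemma simplical_face_tri:
  "simplical_face 3 (tri a c) = (\<lambda>i. if i = 0 then a else if i = Suc 0 then 1 - a - c else if i = 2 then c else 0)"
  "simplical_face 2 (tri a c) = (\<lambda>i. if i = 0 then a else if i = Suc 0 then 1 - a - c else if i = 2 then 0 else if i = 3 then c else 0)"
  "simplical_face (Suc 0) (tri a c) = (\<lambda>i. if i = 0 then a else if i = Suc 0 then 0 else if i = 2 then 1 - a - c else if i = 3 then c else 0)"
  "simplical_face 0 (tri a c) = (\<lambda>i. if i = 0 then 0 else if i = Suc 0 then a else if i = 2 then 1 - a - c else if i = 3 then c else 0)"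
  by (auto simp: simplical_face_def tri_def fun_eq_iff)

definition tetra :: "real \<Rightarrow> real \<Rightarrow> real \<Rightarrow> nat \<Rightarrow> real" where
  "tetra a b c i = (if i = 0 then a else if i = Suc 0 then b else if i = 2 then c else if i = 3 then 1 - a - b - c else 0)"

lemma tetra_in: "0 \<le> a \<Longrightarrow> 0 \<le> b \<Longrightarrow> 0 \<le> c \<Longrightarrow> a + b + c \<le> 1 \<Longrightarrow> tetra a b c \<in> standard_simplex 3"
  by (auto simp: standard_simplex_def sum_upto_3 tetra_def)

lemma continuous_on_tetra:
  assumes "continuous_on S f" "continuous_on S g" "continuous_on S h"
  shows "continuous_on S (\<lambda>x. tetra (f x) (g x) (h x))"
  unfolding continuous_on_into_fun tetra_def using assms by (intro allI continuous_on_if_const continuous_intros)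

lemma face_tetra:
  "simplical_face 3 (tri a c) = tetra a (1 - a - c) c"
  "simplical_face 2 (tri a c) = tetra a (1 - a - c) 0"
  "simplical_face (Suc 0) (tri a c) = tetra a 0 (1 - a - c)"
  "simplical_face 0 (tri a c) = tetra 0 a (1 - a - c)"
  by (auto simp: simplical_face_tri tetra_def fun_eq_iff)

text \<open>The broken path 0-1-2-3 of edges is divided at the parameters 1/2 and 3/4. Its part
  0-1-2, with corner at 1/2, is run through by \<open>psi\<close> with matching speeds: identity up
  to 1/2, double speed up to 3/4, then rest at the end.\<close>

definition psi :: "real \<Rightarrow> real" where
  "psi s = min 1 (max s (2 * s - 1/2))"

text \<open>Adapted to \<open>psi\<close> so that the two halves of \<open>Q1\<close> fit along
  their common line: half of \<open>psi\<close> while the edge from 0 to 2 is traversed, then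
  \<open>2 * s - 1\<close> for the edge from 2 to 3.\<close>

definition chi :: "real \<Rightarrow> real" where
  "chi s = max (psi s / 2) (2 * s - 1)"

lemma psi_bounds: "0 \<le> s \<Longrightarrow> s \<le> 1 \<Longrightarrow> 0 \<le> psi s \<and> psi s \<le> 1" "psi 0 = 0" "psi 1 = 1"
  by (auto simp: psi_def)

lemma chi_bounds: "0 \<le> s \<Longrightarrow> s \<le> 1 \<Longrightarrow> 0 \<le> chi s \<and> chi s \<le> 1" "chi 0 = 0" "chi 1 = 1"
  by (auto simp: psi_def chi_def)

text \<open>Two ways to sweep the broken path 0-1-2-3 over the surface of the tetrahedron to the
  edge from 0 to 3: \<open>Q1\<close> crosses face 3 and then face 1, \<open>Q2\<close> crosses face
  0 and then face 2. The part of the path not yet moved stays on its edge.\<close>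

definition Q1 :: "real \<times> real \<Rightarrow> nat \<Rightarrow> real" where
  "Q1 z = (if snd z \<le> 1/2
     then (if fst z \<le> 3/4 then simplical_face 3 (sweep (psi (fst z), 2 * snd z)) else tetra 0 0 (4 - 4 * fst z))
     else simplical_face (Suc 0) (sweep (chi (fst z), 2 * snd z - 1)))"

definition Q2 :: "real \<times> real \<Rightarrow> nat \<Rightarrow> real" where
  "Q2 z = (if snd z \<le> 1/2
     then (if fst z \<le> 1/2 then tetra (1 - 2 * fst z) (2 * fst z) 0 else simplical_face 0 (sweep (2 * fst z - 1, 2 * snd z)))
     else simplical_face 2 (sweep (fst z, 2 * snd z - 1)))"

lemma continuous_on_sw:
  assumes "continuous_on S f" "continuous_on S g"
  shows "continuous_on S (\<lambda>x. sw0 (f x) (g x))" "continuous_on S (\<lambda>x. sw2 (f x) (g x))"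
  unfolding sw0_def sw2_def using assms by (auto intro!: continuous_intros)

lemma continuous_on_psi: "continuous_on S f \<Longrightarrow> continuous_on S (\<lambda>x. psi (f x))"
  unfolding psi_def by (intro continuous_intros)

lemma continuous_on_chi: "continuous_on S f \<Longrightarrow> continuous_on S (\<lambda>x. chi (f x))"
  unfolding chi_def by (intro continuous_intros continuous_on_psi) auto

lemma continuous_on_Q1: "continuous_on sq Q1"
  unfolding Q1_def[abs_def] sweep_sw face_tetra
proof (rule continuous_on_cases_le)
  let ?A = "{z \<in> sq. snd z \<le> 1/2}"
  show "continuous_on ?A (\<lambda>z. if fst z \<le> 3/4 then tetra (sw0 (psi (fst z)) (2 * snd z)) (1 - sw0 (psi (fst z)) (2 * snd z) - sw2 (psi (fst z)) (2 * snd z)) (sw2 (psi (fst z)) (2 * snd z)) else tetra 0 0 (4 - 4 * fst z))"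
  proof (rule continuous_on_cases_le)
    fix z :: "real \<times> real" assume "z \<in> ?A" and z: "fst z = 3/4"
    show "tetra (sw0 (psi (fst z)) (2 * snd z)) (1 - sw0 (psi (fst z)) (2 * snd z) - sw2 (psi (fst z)) (2 * snd z)) (sw2 (psi (fst z)) (2 * snd z)) = tetra 0 0 (4 - 4 * fst z)"
      unfolding z by (simp add: psi_def sw0_def sw2_def)
  qed (intro continuous_on_tetra continuous_on_sw continuous_on_psi continuous_intros)+
  show "continuous_on {z \<in> sq. 1/2 \<le> snd z} (\<lambda>z. tetra (sw0 (chi (fst z)) (2 * snd z - 1)) 0 (1 - sw0 (chi (fst z)) (2 * snd z - 1) - sw2 (chi (fst z)) (2 * snd z - 1)))"
    by (intro continuous_on_tetra continuous_on_sw continuous_on_chi continuous_intros)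
  show "continuous_on sq snd"
    by (intro continuous_intros)
  fix z :: "real \<times> real" assume "z \<in> sq" and z: "snd z = 1/2"
  then have s: "0 \<le> fst z" "fst z \<le> 1"
    by (auto simp: sq_def)
  have 1: "psi (fst z) = 1" "chi (fst z) = 2 * fst z - 1" if "\<not> fst z \<le> 3/4"
    using s that by (auto simp: psi_def chi_def max_def min_def)
  have 2: "psi (fst z) = 2 * chi (fst z)" "0 \<le> chi (fst z)" "2 * chi (fst z) \<le> 1" if "fst z \<le> 3/4"
    using s that by (auto simp: psi_def chi_def max_def min_def)
  show "(if fst z \<le> 3/4 then tetra (sw0 (psi (fst z)) (2 * snd z)) (1 - sw0 (psi (fst z)) (2 * snd z) - sw2 (psi (fst z)) (2 * snd z)) (sw2 (psi (fst z)) (2 * snd z)) else tetra 0 0 (4 - 4 * fst z))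
    = tetra (sw0 (chi (fst z)) (2 * snd z - 1)) 0 (1 - sw0 (chi (fst z)) (2 * snd z - 1) - sw2 (chi (fst z)) (2 * snd z - 1))"
  proof (cases "fst z \<le> 3/4")
    case True
    then show ?thesis
      using 2 s unfolding z by (simp add: sw0_def sw2_def)
  next
    case False
    then show ?thesis
      using 1 s unfolding z by (simp add: sw0_def sw2_def)
  qed
qed

lemma continuous_on_Q2: "continuous_on sq Q2"
  unfolding Q2_def[abs_def] sweep_sw face_tetra
proof (rule continuous_on_cases_le)
  let ?A = "{z \<in> sq. snd z \<le> 1/2}"
  show "continuous_on ?A (\<lambda>z. if fst z \<le> 1/2 then tetra (1 - 2 * fst z) (2 * fst z) 0 else tetra 0 (sw0 (2 * fst z - 1) (2 * snd z)) (1 - sw0 (2 * fst z - 1) (2 * snd z) - sw2 (2 * fst z - 1) (2 * snd z)))"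
  proof (rule continuous_on_cases_le)
    fix z :: "real \<times> real" assume "z \<in> ?A" and z: "fst z = 1/2"
    show "tetra (1 - 2 * fst z) (2 * fst z) 0 = tetra 0 (sw0 (2 * fst z - 1) (2 * snd z)) (1 - sw0 (2 * fst z - 1) (2 * snd z) - sw2 (2 * fst z - 1) (2 * snd z))"
      unfolding z by (simp add: sw0_def sw2_def)
  qed (intro continuous_on_tetra continuous_on_sw continuous_intros)+
  show "continuous_on {z \<in> sq. 1/2 \<le> snd z} (\<lambda>z. tetra (sw0 (fst z) (2 * snd z - 1)) (1 - sw0 (fst z) (2 * snd z - 1) - sw2 (fst z) (2 * snd z - 1)) 0)"
    by (intro continuous_on_tetra continuous_on_sw continuous_intros)
  show "continuous_on sq snd"
    by (intro continuous_intros)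
  fix z :: "real \<times> real" assume "z \<in> sq" and z: "snd z = 1/2"
  then have s: "0 \<le> fst z" "fst z \<le> 1"
    by (auto simp: sq_def)
  show "(if fst z \<le> 1/2 then tetra (1 - 2 * fst z) (2 * fst z) 0 else tetra 0 (sw0 (2 * fst z - 1) (2 * snd z)) (1 - sw0 (2 * fst z - 1) (2 * snd z) - sw2 (2 * fst z - 1) (2 * snd z)))
    = tetra (sw0 (fst z) (2 * snd z - 1)) (1 - sw0 (fst z) (2 * snd z - 1) - sw2 (fst z) (2 * snd z - 1)) 0"
    using s unfolding z by (simp add: sw0_def sw2_def)
qed

lemma Q1_in:
  assumes "z \<in> sq"
  shows "Q1 z \<in> standard_simplex 3"
proof -
  have s: "0 \<le> fst z" "fst z \<le> 1" "0 \<le> snd z" "snd z \<le> 1"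
    using assms by (auto simp: sq_def)
  note p = psi_bounds(1)[OF s(1,2)] and c = chi_bounds(1)[OF s(1,2)]
  show ?thesis
    using s p c sw_bounds[of "psi (fst z)" "2 * snd z"] sw_bounds[of "chi (fst z)" "2 * snd z - 1"]
    unfolding Q1_def sweep_sw face_tetra by (auto intro!: tetra_in)
qed

lemma Q2_in:
  assumes "z \<in> sq"
  shows "Q2 z \<in> standard_simplex 3"
proof -
  have s: "0 \<le> fst z" "fst z \<le> 1" "0 \<le> snd z" "snd z \<le> 1"
    using assms by (auto simp: sq_def)
  show ?thesis
    using s sw_bounds[of "2 * fst z - 1" "2 * snd z"] sw_bounds[of "fst z" "2 * snd z - 1"]
    unfolding Q2_def sweep_sw face_tetra by (auto intro!: tetra_in)
qed

definition edge_hom :: "real \<times> (real \<times> real) \<Rightarrow> nat \<Rightarrow> real" where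
  "edge_hom w = (\<lambda>i. (1 - fst w) * Q1 (snd w) i + fst w * Q2 (snd w) i)"

lemma edge_hom_in:
  assumes "w \<in> {0..1} \<times> sq"
  shows "edge_hom w \<in> standard_simplex 3"
  unfolding edge_hom_def using assms Q1_in[of "snd w"] Q2_in[of "snd w"]
  by (intro convex_standard_simplex) auto

text \<open>The speeds in \<open>Q1\<close> and \<open>Q2\<close> are matched so that over every
  boundary point of the square both values lie on a common edge of the tetrahedron; so does the
  segment between them.\<close>

lemma edge_hom_bdry:
  assumes r: "r \<in> {0..1}" and z: "z \<in> bsq"
  shows "edge_hom (r, z) \<in> one_skeleton 3"
proof -
  have zs: "z \<in> sq"
    using z bsq_subset by blast
  then have s: "0 \<le> fst z" "fst z \<le> 1" "0 \<le> snd z" "snd z \<le> 1"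
    by (auto simp: sq_def)
  have "\<exists>i j. \<forall>k. k \<noteq> i \<and> k \<noteq> j \<longrightarrow> Q1 z k = 0 \<and> Q2 z k = 0"
  proof -
    have "fst z = 0 \<or> fst z = 1 \<or> snd z = 1 \<or> snd z = 0"
      using z by (auto simp: bsq_def)
    then consider "fst z = 0" | "fst z = 1" | "snd z = 1" | "snd z = 0"
      by blast
    then show ?thesis
    proof cases
      case 1
      then show ?thesis
        unfolding Q1_def Q2_def sweep_sw face_tetra
        by (intro exI[of _ 0]) (auto simp: psi_bounds chi_bounds sw0_def sw2_def tetra_def)
    next
      case 2
      then show ?thesis
        unfolding Q1_def Q2_def sweep_sw face_tetra
        by (intro exI[of _ 3]) (auto simp: psi_bounds chi_bounds sw0_def sw2_def tetra_def)
    next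
      case 3
      then show ?thesis
        unfolding Q1_def Q2_def sweep_sw face_tetra
        by (intro exI[of _ 0] exI[of _ 3]) (auto simp: sw0_def sw2_def tetra_def)
    next
      case 4
      consider "fst z \<le> 1/2" | "1/2 < fst z" "fst z \<le> 3/4" | "3/4 < fst z"
        by linarith
      then show ?thesis
      proof cases
        case 1
        then have "psi (fst z) = fst z"
          using s by (auto simp: psi_def)
        with 1 4 s show ?thesis
          unfolding Q1_def Q2_def sweep_sw face_tetra
          by (intro exI[of _ 0] exI[of _ 1]) (auto simp: sw0_def sw2_def tetra_def)
      next
        case 2
        then have "psi (fst z) = 2 * fst z - 1/2"
          using s by (auto simp: psi_def)
        with 2 4 s show ?thesis
          unfolding Q1_def Q2_def sweep_sw face_tetra
          by (intro exI[of _ 1] exI[of _ 2]) (auto simp: sw0_def sw2_def tetra_def)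
      next
        case 3
        with 4 s show ?thesis
          unfolding Q1_def Q2_def sweep_sw face_tetra
          by (intro exI[of _ 2] exI[of _ 3]) (auto simp: sw0_def sw2_def tetra_def)
      qed
    qed
  qed
  then obtain i j where "\<And>k. k \<noteq> i \<Longrightarrow> k \<noteq> j \<Longrightarrow> Q1 z k = 0 \<and> Q2 z k = 0"
    by blast
  then have "\<forall>k. k \<noteq> i \<and> k \<noteq> j \<longrightarrow> edge_hom (r, z) k = 0"
    by (simp add: edge_hom_def)
  moreover have "edge_hom (r, z) \<in> standard_simplex 3"
    using r zs by (intro edge_hom_in) auto
  ultimately show ?thesis
    unfolding one_skeleton_def by blast
qed

lemma edge_one_skeleton:
  assumes "a \<in> {0..1}"
  shows "tetra 0 0 a \<in> one_skeleton 3" "tetra (1 - a) a 0 \<in> one_skeleton 3"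
proof -
  have "\<forall>k. k \<noteq> 2 \<and> k \<noteq> 3 \<longrightarrow> tetra 0 0 a k = 0" "\<forall>k. k \<noteq> 0 \<and> k \<noteq> Suc 0 \<longrightarrow> tetra (1 - a) a 0 k = 0"
    by (simp_all add: tetra_def)
  moreover have "tetra 0 0 a \<in> standard_simplex 3" "tetra (1 - a) a 0 \<in> standard_simplex 3"
    using assms by (simp_all add: tetra_in)
  ultimately show "tetra 0 0 a \<in> one_skeleton 3" "tetra (1 - a) a 0 \<in> one_skeleton 3"
    unfolding one_skeleton_def by blast+
qed

lemma one_skeleton_face:
  assumes "x \<in> simplex_boundary 2" "k \<le> 3"
  shows "simplical_face k x \<in> one_skeleton 3"
proof -
  obtain i where i: "i \<le> 2" "x i = 0" and x: "x \<in> standard_simplex 2"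
    using assms by auto
  have "simplical_face k x \<in> standard_simplex 3"
    using simplical_face_in_standard_simplex[of 3 k x] assms x by (simp add: numeral_3_eq_3 numeral_2_eq_2)
  moreover have "\<exists>a b. \<forall>l. l \<noteq> a \<and> l \<noteq> b \<longrightarrow> simplical_face k x l = 0"
  proof -
    have x0: "x l = 0" if "2 < l" for l
      using x that by (auto simp: standard_simplex_def)
    define a where "a = (if i = 0 then 1 else 0 :: nat)"
    define b where "b = (if i = 2 then 1 else 2 :: nat)"
    have ab: "x l = 0" if "l \<noteq> a" "l \<noteq> b" for l
    proof (cases "l \<le> 2")
      case True
      with that i have "l = i"
        by (auto simp: a_def b_def split: if_splits)
      with i show ?thesis
        by simp
    qed (use x0 in auto)
    define up where "up l = (if l < k then l else Suc l)" for l
    have "simplical_face k x l = 0" if "l \<noteq> up a" "l \<noteq> up b" for l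
    proof -
      consider "l < k" | "l = k" | "l > k"
        by linarith
      then show ?thesis
      proof cases
        case 1
        then show ?thesis
          using that ab[of l] by (auto simp: simplical_face_def up_def split: if_splits)
      next
        case 3
        have "l - 1 \<noteq> a" "l - 1 \<noteq> b"
          using 3 that by (auto simp: up_def split: if_splits)
        then show ?thesis
          using 3 ab[of "l - 1"] by (auto simp: simplical_face_def)
      qed (simp add: simplical_face_def)
    qed
    then show ?thesis
      by blast
  qed
  ultimately show ?thesis
    by (simp add: one_skeleton_def)
qed

text \<open>Collapsing the edges to \<open>x0\<close> makes \<open>T \<circ> Q1\<close> the vertical
  composite of faces 3 and 1, and \<open>T \<circ> Q2\<close> that of faces 0 and 2, up to
  reparametrisation and constants. The solid tetrahedron supplies the homotopy between them.\<close>

lemma tetrahedron_relation: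
  fixes P :: "'a::topological_space set"
  assumes x0: "x0 \<in> P" and T: "continuous_on (standard_simplex 3) T" "T ` standard_simplex 3 \<subseteq> P"
    and sk: "\<And>x. x \<in> one_skeleton 3 \<Longrightarrow> T x = x0"
  defines "K i \<equiv> kappa (T \<circ> simplical_face i)"
  shows "K i \<in> sqs P x0 \<or> i > 3"
    "sqclass P x0 (K 3) \<otimes>\<^bsub>pi2 P x0\<^esub> sqclass P x0 (K (Suc 0)) = sqclass P x0 (K 0) \<otimes>\<^bsub>pi2 P x0\<^esub> sqclass P x0 (K 2)"
proof -
  have face: "simplical_face i x \<in> standard_simplex 3" if "i \<le> 3" "x \<in> standard_simplex 2" for i and x :: "nat \<Rightarrow> real"
    using simplical_face_in_standard_simplex[of 3 i x] that by (simp add: numeral_3_eq_3 numeral_2_eq_2)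
  have Ks: "K i \<in> sqs P x0" if i: "i \<le> 3" for i
    unfolding K_def
  proof (rule kappa_sqs)
    have "continuous_on (standard_simplex 2) (simplical_face i :: (nat \<Rightarrow> real) \<Rightarrow> _)"
      unfolding continuous_on_into_fun simplical_face_def by (intro allI continuous_on_if_const continuous_on_coord continuous_intros)
    then show "continuous_on (standard_simplex 2) (T \<circ> simplical_face i)"
      using face[OF i] by (intro continuous_on_compose continuous_on_subset[OF T(1)]) auto
    show "(T \<circ> simplical_face i) ` standard_simplex 2 \<subseteq> P"
      using face[OF i] T(2) by auto
    show "(T \<circ> simplical_face i) x = x0" if "x \<in> simplex_boundary 2" for x
      using sk[OF one_skeleton_face[OF that i]] by simp
  qed
  then show "K i \<in> sqs P x0 \<or> i > 3"
    by (meson not_le)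
  have Tz: "(1, t) \<in> bsq" if "t \<in> {0..1}" for t
    using that by (auto simp: bsq_def sq_def)
  let ?A = "\<lambda>z. K 3 (psi (fst z), snd z)" and ?B = "\<lambda>z. K (Suc 0) (chi (fst z), snd z)"
  have A: "sqrel P x0 ?A (K 3)"
    by (rule sqrel_reparam_fst[where \<phi> = psi]) (use Ks psi_bounds in \<open>auto intro!: continuous_on_psi continuous_intros\<close>)
  have B: "sqrel P x0 ?B (K (Suc 0))"
    by (rule sqrel_reparam_fst[where \<phi> = chi]) (use Ks chi_bounds in \<open>auto intro!: continuous_on_chi continuous_intros\<close>)
  have eq1: "vcomp ?A ?B z = T (Q1 z)" if z: "z \<in> sq" for z
  proof -
    have s: "0 \<le> fst z" "fst z \<le> 1" "0 \<le> snd z" "snd z \<le> 1"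
      using z by (auto simp: sq_def)
    show ?thesis
    proof (cases "snd z \<le> 1/2 \<and> \<not> fst z \<le> 3/4")
      case True
      then have "psi (fst z) = 1"
        using s by (auto simp: psi_def max_def min_def)
      moreover have "K 3 (1, 2 * snd z) = x0"
        using Ks[of 3] Tz[of "2 * snd z"] True s by (auto simp: sqs_def)
      moreover have "T (tetra 0 0 (4 - 4 * fst z)) = x0"
        using True s by (intro sk edge_one_skeleton) auto
      ultimately show ?thesis
        using True by (simp add: vcomp_def Q1_def)
    next
      case False
      then show ?thesis
        by (auto simp: vcomp_def Q1_def K_def kappa_def)
    qed
  qed
  have eq2: "vcomp (hcomp (\<lambda>_. x0) (K 0)) (K 2) z = T (Q2 z)" if z: "z \<in> sq" for z
  proof -
    have s: "0 \<le> fst z" "fst z \<le> 1" "0 \<le> snd z" "snd z \<le> 1"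
      using z by (auto simp: sq_def)
    have "T (tetra (1 - 2 * fst z) (2 * fst z) 0) = x0" if "fst z \<le> 1/2"
      using that s edge_one_skeleton(2)[of "2 * fst z"] by (intro sk) auto
    then show ?thesis
      by (auto simp: vcomp_def hcomp_def Q2_def K_def kappa_def)
  qed
  have "sqrel P x0 (vcomp ?A ?B) (vcomp (hcomp (\<lambda>_. x0) (K 0)) (K 2))"
    unfolding sqrel_alt
  proof (intro exI[of _ "T \<circ> edge_hom"] conjI)
    have "continuous_on ({0..1} \<times> sq) edge_hom"
      unfolding continuous_on_into_fun edge_hom_def
    proof
      fix i
      have "continuous_on sq (\<lambda>z. Q1 z i)" "continuous_on sq (\<lambda>z. Q2 z i)"
        using continuous_on_Q1 continuous_on_Q2 unfolding continuous_on_into_fun by auto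
      then show "continuous_on ({0..1::real} \<times> sq) (\<lambda>x. (1 - fst x) * Q1 (snd x) i + fst x * Q2 (snd x) i)"
        by (auto intro!: continuous_intros intro: continuous_on_compose2)
    qed
    then show "continuous_on ({0..1} \<times> sq) (T \<circ> edge_hom)"
      using edge_hom_in by (intro continuous_on_compose continuous_on_subset[OF T(1)]) auto
    show "(T \<circ> edge_hom) ` ({0..1} \<times> sq) \<subseteq> P"
      using edge_hom_in T(2) by (auto simp: image_subset_iff)
    show "\<forall>z\<in>sq. (T \<circ> edge_hom) (0, z) = vcomp ?A ?B z \<and> (T \<circ> edge_hom) (1, z) = vcomp (hcomp (\<lambda>_. x0) (K 0)) (K 2) z"
      by (simp add: eq1 eq2 edge_hom_def)
    show "\<forall>t\<in>{0..1}. \<forall>z\<in>bsq. (T \<circ> edge_hom) (t, z) = x0"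
      using sk edge_hom_bdry by simp
  qed
  moreover have "sqrel P x0 (hcomp (K 3) (K (Suc 0))) (vcomp ?A ?B)"
    using sqrel_trans[OF hcomp_vcomp[OF x0] sqrel_vcomp[OF sqrel_sym[OF A] sqrel_sym[OF B]]] Ks by simp
  moreover have "sqrel P x0 (vcomp (hcomp (\<lambda>_. x0) (K 0)) (K 2)) (hcomp (K 0) (K 2))"
    using sqrel_trans[OF sqrel_vcomp[OF hcomp_const_left sqrel_refl] sqrel_sym[OF hcomp_vcomp[OF x0]]] Ks by simp
  ultimately have "sqrel P x0 (hcomp (K 3) (K (Suc 0))) (hcomp (K 0) (K 2))"
    by (blast intro: sqrel_trans)
  then show "sqclass P x0 (K 3) \<otimes>\<^bsub>pi2 P x0\<^esub> sqclass P x0 (K (Suc 0)) = sqclass P x0 (K 0) \<otimes>\<^bsub>pi2 P x0\<^esub> sqclass P x0 (K 2)"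
    using Ks by (simp add: mult_pi2 sqclass_eq hcomp_sqs)
qed

section \<open>Extension over prisms\<close>

primrec min_coord :: "nat \<Rightarrow> (nat \<Rightarrow> real) \<Rightarrow> real" where
  "min_coord 0 x = x 0"
| "min_coord (Suc n) x = min (min_coord n x) (x (Suc n))"

lemma min_coord_le: "i \<le> n \<Longrightarrow> min_coord n x \<le> x i"
proof (induction n)
  case (Suc n)
  then show ?case
    by (cases "i = Suc n") (auto simp: min_def)
qed simp

lemma min_coord_attained: "\<exists>i\<le>n. min_coord n x = x i"
proof (induction n)
  case (Suc n)
  then obtain i where "i \<le> n" "min_coord n x = x i"
    by blast
  then show ?case
    by (cases "x i \<le> x (Suc n)") (auto simp: min_def intro: exI[of _ i] exI[of _ "Suc n"])
qed auto

lemma continuous_on_min_coord: "continuous_on S (min_coord n)"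
proof (induction n)
  case 0
  then show ?case
    using continuous_on_coord[of S 0] by simp
next
  case (Suc n)
  then show ?case
    by (simp, intro continuous_intros continuous_on_coord)
qed

definition wall :: "nat \<Rightarrow> ((nat \<Rightarrow> real) \<times> real) set" where
  "wall n = simplex_boundary n \<times> {0..1} \<union> standard_simplex n \<times> {1}"

text \<open>Radial projection of the prism onto its walls and its top, from the point at height \<open>-1\<close> below the
  barycentre.\<close>

definition dil :: "nat \<Rightarrow> (nat \<Rightarrow> real) \<times> real \<Rightarrow> real" where
  "dil n w = 1 / max ((snd w + 1) / 2) (1 - (real n + 1) * min_coord n (fst w))"

definition retr :: "nat \<Rightarrow> (nat \<Rightarrow> real) \<times> real \<Rightarrow> (nat \<Rightarrow> real) \<times> real" where
  "retr n w = ((\<lambda>i. if i \<le> n then 1 / (real n + 1) + dil n w * (fst w i - 1 / (real n + 1)) else 0),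
     dil n w * (snd w + 1) - 1)"

lemma continuous_on_retr: "continuous_on (standard_simplex n \<times> {0..1}) (retr n)"
proof -
  let ?B = "standard_simplex n \<times> {0..1::real}"
  have m: "continuous_on ?B (\<lambda>w. min_coord n (fst w))"
    using continuous_on_compose[OF continuous_on_fst[OF continuous_on_id] continuous_on_min_coord] by (simp add: comp_def)
  have c: "continuous_on ?B (\<lambda>w. fst w i)" for i
    using continuous_on_compose[OF continuous_on_fst[OF continuous_on_id] continuous_on_coord, of ?B i] by (simp add: comp_def)
  have "max ((snd w + 1) / 2) (1 - (real n + 1) * min_coord n (fst w)) \<noteq> 0" if "w \<in> ?B" for w
    using that by (auto simp: max_def)
  then have d: "continuous_on ?B (dil n)"
    unfolding dil_def[abs_def] using m by (intro continuous_intros) auto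
  have ci: "continuous_on ?B (\<lambda>w. if i \<le> n then 1 / (real n + 1) + dil n w * (fst w i - 1 / (real n + 1)) else 0)" for i
    by (rule continuous_on_if_const; intro continuous_intros d c)
  then have "continuous_on ?B (\<lambda>w. \<lambda>i. if i \<le> n then 1 / (real n + 1) + dil n w * (fst w i - 1 / (real n + 1)) else 0)"
    unfolding continuous_on_into_fun by blast
  moreover have "continuous_on ?B (\<lambda>w. dil n w * (snd w + 1) - 1)"
    using d by (intro continuous_intros)
  ultimately show ?thesis
    unfolding retr_def[abs_def] by (rule continuous_on_Pair)
qed

lemma retr_wall:
  assumes w: "w \<in> standard_simplex n \<times> {0..1}"
  shows "retr n w \<in> wall n"
proof -
  obtain x t where wx: "w = (x, t)" and x: "x \<in> standard_simplex n" and t: "0 \<le> t" "t \<le> 1"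
    using w by auto
  define b where "b = 1 / (real n + 1)"
  define m where "m = min_coord n x"
  \<comment> \<open>The gauge of the prism as seen from the projection centre: the first term is 1
    on the top, the second is 1 where some coordinate vanishes. Dividing by the larger one moves the
    point to whichever of the two is met first.\<close>
  define D where "D = max ((t + 1) / 2) (1 - (real n + 1) * m)"
  have b: "b > 0" "(real n + 1) * b = 1"
    by (simp_all add: b_def field_simps)
  have m: "m \<le> x i" if "i \<le> n" for i
    using min_coord_le[OF that] by (simp add: m_def)
  obtain i0 where i0: "i0 \<le> n" "m = x i0"
    using min_coord_attained[of n x] by (auto simp: m_def)
  have sum1: "(\<Sum>i\<le>n. x i) = 1" and xpos: "\<And>i. 0 \<le> x i"
    using x by (auto simp: standard_simplex_def)
  have D: "D > 0" "(t + 1) / 2 \<le> D" "1 - (real n + 1) * m \<le> D" "D = (t + 1) / 2 \<or> D = 1 - (real n + 1) * m"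
    using t by (auto simp: D_def max_def)
  have m0: "0 \<le> m"
    using xpos i0 by simp
  have "1 - (real n + 1) * m \<le> 1"
    using m0 by simp
  then have D1: "D \<le> 1"
    using t by (simp add: D_def)
  have dil: "dil n (x, t) = 1 / D"
    by (simp add: dil_def wx D_def m_def)
  define y where "y i = (if i \<le> n then b + (x i - b) / D else 0)" for i
  define r where "r = (t + 1) / D - 1"
  have retr: "retr n w = (y, r)"
    by (auto simp: retr_def dil wx y_def r_def b_def fun_eq_iff)
  have "b * (1 - (real n + 1) * m) = b - ((real n + 1) * b) * m"
    by (simp add: algebra_simps)
  then have bm: "b - m = b * (1 - (real n + 1) * m)"
    using b(2) by simp
  have ypos: "0 \<le> y i" for i
  proof (cases "i \<le> n")
    case True
    have "b - m = b * (1 - (real n + 1) * m)"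
      by (rule bm)
    also have "\<dots> \<le> b * D"
      using b D by simp
    finally have "b - x i \<le> b * D"
      using m[OF True] by simp
    then show ?thesis
      using D True by (simp add: y_def field_simps)
  qed (simp add: y_def)
  have "(\<Sum>i\<le>n. y i) = (\<Sum>i\<le>n. b + (x i - b) / D)"
    by (simp add: y_def)
  also have "\<dots> = (real n + 1) * b + ((\<Sum>i\<le>n. x i) - (real n + 1) * b) / D"
    by (simp add: sum.distrib sum_subtractf add.commute flip: sum_divide_distrib)
  also have "\<dots> = 1"
    using sum1 b by simp
  finally have ysum: "(\<Sum>i\<le>n. y i) = 1" .
  have "y i \<le> 1" for i
  proof (cases "i \<le> n")
    case True
    then have "y i \<le> (\<Sum>i\<le>n. y i)"
      using ypos by (intro member_le_sum) auto
    then show ?thesis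
      using ysum by simp
  qed (simp add: y_def)
  with ypos ysum have y: "y \<in> standard_simplex n"
    by (auto simp: standard_simplex_def y_def)
  have r: "0 \<le> r" "r \<le> 1"
    using D D1 t by (auto simp: r_def field_simps)
  from D(4) show ?thesis
  proof
    assume "D = (t + 1) / 2"
    then have "r = 1"
      using t by (simp add: r_def field_simps)
    with y show ?thesis
      by (simp add: retr wall_def)
  next
    assume D: "D = 1 - (real n + 1) * m"
    have "b - m = b * D"
      using bm D by simp
    then have "(m - b) / D = - b"
      using \<open>D > 0\<close> by (simp add: field_simps)
    then have "y i0 = 0"
      using i0 by (simp add: y_def)
    with y r i0 show ?thesis
      by (auto simp: retr wall_def)
  qed
qed

lemma retr_id:
  assumes w: "w \<in> wall n"
  shows "retr n w = w"
proof -
  obtain x t where wx: "w = (x, t)" and x: "x \<in> standard_simplex n" and t: "0 \<le> t" "t \<le> 1"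
    and c: "t = 1 \<or> (\<exists>i\<le>n. x i = 0)"
  proof (cases w)
    case (Pair x t)
    show ?thesis
      by (rule that[of x t]) (use w Pair in \<open>auto simp: wall_def\<close>)
  qed
  have xpos: "\<And>i. 0 \<le> x i"
    using x by (auto simp: standard_simplex_def)
  obtain i0 where i0: "i0 \<le> n" "min_coord n x = x i0"
    using min_coord_attained[of n x] by auto
  have "max ((t + 1) / 2) (1 - (real n + 1) * min_coord n x) = 1"
    using c
  proof
    assume "t = 1"
    then show ?thesis
      using i0 xpos[of i0] by simp
  next
    assume "\<exists>i\<le>n. x i = 0"
    then have "min_coord n x \<le> 0"
      using min_coord_le by metis
    then have "min_coord n x = 0"
      using i0 xpos[of i0] by simp
    then show ?thesis
      using t by simp
  qed
  then have "dil n w = 1"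
    by (simp add: dil_def wx)
  then show ?thesis
    using x by (auto simp: retr_def wx fun_eq_iff standard_simplex_def)
qed

definition drop_coord :: "nat \<Rightarrow> (nat \<Rightarrow> real) \<Rightarrow> nat \<Rightarrow> real" where
  "drop_coord i y k = (if k < i then y k else y (Suc k))"

lemma drop_face [simp]: "drop_coord i (simplical_face i z) = z"
  by (auto simp: drop_coord_def simplical_face_def fun_eq_iff)

lemma face_drop: "y i = 0 \<Longrightarrow> simplical_face i (drop_coord i y) = y"
  by (auto simp: drop_coord_def simplical_face_def fun_eq_iff)

lemma face_face:
  "i < j \<Longrightarrow> simplical_face j (simplical_face i z) = simplical_face i (simplical_face (j - 1) z)"
  by (auto simp: simplical_face_def fun_eq_iff)

lemma drop_coord_in:
  assumes "y \<in> standard_simplex (Suc m)" "y i = 0" "i \<le> Suc m"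
  shows "drop_coord i y \<in> standard_simplex m"
proof -
  have "(\<Sum>k\<in>{..Suc m} - {i}. y k) = (\<Sum>k\<le>m. drop_coord i y k)"
    by (rule sum.reindex_bij_witness[of _ "\<lambda>k. if k < i then k else Suc k" "\<lambda>k. if k < i then k else k - 1"])
      (use assms(3) in \<open>auto simp: drop_coord_def\<close>)
  moreover have "(\<Sum>k\<le>Suc m. y k) = y i + (\<Sum>k\<in>{..Suc m} - {i}. y k)"
    using assms(3) by (intro sum.remove) auto
  ultimately have "(\<Sum>k\<le>m. drop_coord i y k) = 1"
    using assms by (simp add: standard_simplex_def)
  then show ?thesis
    using assms by (auto simp: standard_simplex_def drop_coord_def)
qed

lemma face_in: "z \<in> standard_simplex m \<Longrightarrow> i \<le> Suc m \<Longrightarrow> simplical_face i z \<in> standard_simplex (Suc m)"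
  using simplical_face_in_standard_simplex[of "Suc m" i z] by simp

lemma drop_drop: "i < j \<Longrightarrow> drop_coord i (drop_coord j y) = drop_coord (j - 1) (drop_coord i y)"
  by (auto simp: drop_coord_def fun_eq_iff)

lemma continuous_on_drop_coord: "continuous_on S (drop_coord i)"
  unfolding continuous_on_into_fun drop_coord_def by (intro allI continuous_on_if_const continuous_on_coord)

text \<open>The top and the prisms over the faces paste to a map on \<open>wall n\<close>, which the
  retraction \<open>retr\<close> extends. The faces of faces in \<open>compat\<close> call for
  dimension at least 2; the prism over an edge is treated in
  \<open>fill_edge_exists\<close>.\<close>

lemma prism_extension:
  fixes s :: "(nat \<Rightarrow> real) \<Rightarrow> 'a::topological_space" and w :: "nat \<Rightarrow> (nat \<Rightarrow> real) \<times> real \<Rightarrow> 'a"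
  assumes n: "n = Suc (Suc m)"
    and s: "continuous_on (standard_simplex n) s" "s ` standard_simplex n \<subseteq> P"
    and w: "\<And>i. i \<le> n \<Longrightarrow> continuous_on (standard_simplex (Suc m) \<times> {0..1}) (w i)"
      "\<And>i. i \<le> n \<Longrightarrow> w i ` (standard_simplex (Suc m) \<times> {0..1}) \<subseteq> P"
    and top: "\<And>i y. i \<le> n \<Longrightarrow> y \<in> standard_simplex (Suc m) \<Longrightarrow> w i (y, 1) = s (simplical_face i y)"
    and compat: "\<And>i j z t. i < j \<Longrightarrow> j \<le> n \<Longrightarrow> z \<in> standard_simplex m \<Longrightarrow> t \<in> {0..1} \<Longrightarrow>
       w j (simplical_face i z, t) = w i (simplical_face (j - 1) z, t)"
  shows "\<exists>W. continuous_on (standard_simplex n \<times> {0..1}) W \<and> W ` (standard_simplex n \<times> {0..1}) \<subseteq> P \<and>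
    (\<forall>x\<in>standard_simplex n. W (x, 1) = s x) \<and>
    (\<forall>i\<le>n. \<forall>y\<in>standard_simplex (Suc m). \<forall>t\<in>{0..1}. W (simplical_face i y, t) = w i (y, t))"
proof -
  \<comment> \<open>Closed pieces of the wall: an index up to \<open>n\<close> is the prism over
    that face, and \<open>Suc n\<close> stands for the top.\<close>
  define T where "T i = (if i \<le> n then {q \<in> wall n. fst q i = 0} else {q \<in> wall n. snd q = 1})" for i
  define f where "f i q = (if i \<le> n then w i (drop_coord i (fst q), snd q) else s (fst q))" for i q
  have wall: "fst q \<in> standard_simplex n" "snd q \<in> {0..1}" if "q \<in> wall n" for q
    using that by (auto simp: wall_def)
  have dropin: "(drop_coord i (fst q), snd q) \<in> standard_simplex (Suc m) \<times> {0..1}" if "i \<le> n" "q \<in> T i" for i q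
    using that wall[of q] drop_coord_in[of "fst q" "Suc m" i] n by (auto simp: T_def)
  have lt: "f i q = f j q" if ij: "i < j" "j \<le> Suc n" and q: "q \<in> T i" "q \<in> T j" for i j q
  proof (cases "j \<le> n")
    case True
    have qi: "fst q i = 0" "fst q j = 0" "q \<in> wall n"
      using q True ij by (auto simp: T_def)
    define z where "z = drop_coord i (drop_coord j (fst q))"
    have dj: "drop_coord j (fst q) \<in> standard_simplex (Suc m)"
      using dropin[OF True q(2)] by simp
    have "drop_coord j (fst q) i = 0"
      using qi ij by (simp add: drop_coord_def)
    then have fj: "simplical_face i z = drop_coord j (fst q)" and z: "z \<in> standard_simplex m"
      using face_drop drop_coord_in[OF dj, of i] ij True n by (auto simp: z_def)
    have z': "z = drop_coord (j - 1) (drop_coord i (fst q))"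
      using drop_drop[OF ij(1)] by (simp add: z_def)
    have "drop_coord i (fst q) (j - 1) = 0"
      using qi ij by (simp add: drop_coord_def)
    then have fi: "simplical_face (j - 1) z = drop_coord i (fst q)"
      using face_drop by (simp add: z')
    show ?thesis
      using compat[OF ij(1) True z wall(2)[OF qi(3)]] True ij by (simp add: f_def fj fi[unfolded One_nat_def])
  next
    case False
    then have i: "i \<le> n" and q1: "snd q = 1" "fst q i = 0"
      using ij q by (auto simp: T_def)
    have "drop_coord i (fst q) \<in> standard_simplex (Suc m)"
      using dropin[OF i q(1)] by simp
    from top[OF i this] show ?thesis
      using False i q1 by (simp add: f_def face_drop)
  qed
  define g where "g q = f (SOME i. i \<le> Suc n \<and> q \<in> T i) q" for q
  have agree: "f i q = f j q" if "i \<le> Suc n" "j \<le> Suc n" "q \<in> T i" "q \<in> T j" for i j q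
  proof (cases i j rule: linorder_cases)
    case less
    then show ?thesis
      by (rule lt[OF _ that(2-4)])
  next
    case greater
    show ?thesis
      by (rule lt[OF greater that(1,4,3), symmetric])
  qed simp
  have g: "g q = f i q" if "i \<le> Suc n" "q \<in> T i" for i q
  proof -
    have "(SOME i. i \<le> Suc n \<and> q \<in> T i) \<le> Suc n \<and> q \<in> T (SOME i. i \<le> Suc n \<and> q \<in> T i)"
      by (rule someI[of "\<lambda>i. i \<le> Suc n \<and> q \<in> T i" i]) (use that in simp)
    then show ?thesis
      unfolding g_def by (intro agree) (use that in auto)
  qed
  have cov: "\<exists>i. i \<le> Suc n \<and> q \<in> T i" if "q \<in> wall n" for q
  proof (cases "snd q = 1")
    case True
    then show ?thesis
      using that by (intro exI[of _ "Suc n"]) (simp add: T_def)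
  next
    case False
    then have "\<exists>i\<le>n. fst q i = 0"
      using that by (auto simp: wall_def)
    then obtain i where "i \<le> n" "fst q i = 0"
      by blast
    then show ?thesis
      using that by (intro exI[of _ i]) (simp add: T_def)
  qed
  have cg: "continuous_map (top_of_set (wall n)) euclidean g"
  proof (rule pasting_lemma_closed[where I = "{..Suc n}" and T = T and f = f])
    show "closedin (top_of_set (wall n)) (T i)" for i
    proof (cases "i \<le> n")
      case True
      have "continuous_on (wall n) (\<lambda>q. fst q i)"
        using continuous_on_compose[OF continuous_on_fst[OF continuous_on_id] continuous_on_coord, of "wall n" i] by (simp add: comp_def)
      from continuous_closedin_preimage[OF this closed_singleton[of 0]] show ?thesis
        using True by (simp add: T_def vimage_def Collect_conj_eq[symmetric] Int_def)
    next
      case False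
      have "continuous_on (wall n) snd"
        by (intro continuous_intros)
      from continuous_closedin_preimage[OF this closed_singleton[of 1]] show ?thesis
        using False by (simp add: T_def vimage_def Int_def)
    qed
    show "continuous_map (subtopology (top_of_set (wall n)) (T i)) euclidean (f i)" if "i \<in> {..Suc n}" for i
    proof -
      have "wall n \<inter> T i = T i"
        by (auto simp: T_def)
      moreover have "continuous_on (T i) (f i)"
      proof (cases "i \<le> n")
        case True
        have d: "continuous_on (T i) (\<lambda>q. drop_coord i (fst q))"
          using continuous_on_compose[OF continuous_on_fst[OF continuous_on_id] continuous_on_drop_coord, of "T i" i] by (simp add: comp_def)
        have "continuous_on (T i) (\<lambda>q. w i (drop_coord i (fst q), snd q))"
          by (rule continuous_on_compose2[OF w(1)[OF True]]) (use d dropin[OF True] in \<open>auto intro!: continuous_intros\<close>)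
        then show ?thesis
          using True by (simp add: f_def)
      next
        case False
        have "continuous_on (T i) (\<lambda>q. s (fst q))"
          by (rule continuous_on_compose2[OF s(1)]) (use wall False in \<open>auto intro!: continuous_on_fst continuous_on_id simp: T_def\<close>)
        then show ?thesis
          using False by (simp add: f_def)
      qed
      ultimately show ?thesis
        by (simp add: subtopology_subtopology)
    qed
    show "f i q = f j q" if "i \<in> {..Suc n}" "j \<in> {..Suc n}" "q \<in> topspace (top_of_set (wall n)) \<inter> T i \<inter> T j" for i j q
      using agree[of i j q] that by simp
    show "\<exists>j. j \<in> {..Suc n} \<and> q \<in> T j \<and> g q = f j q" if "q \<in> topspace (top_of_set (wall n))" for q
    proof -
      have "q \<in> wall n"
        using that by simp
      then obtain j where "j \<le> Suc n" "q \<in> T j"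
        using cov[of q] by blast
      then show ?thesis
        by (intro exI[of _ j]) (simp add: g)
    qed
  qed simp
  then have cg': "continuous_on (wall n) g"
    by simp
  have gP: "g q \<in> P" if "q \<in> wall n" for q
  proof -
    from cov[OF that] obtain i where i: "i \<le> Suc n" "q \<in> T i"
      by blast
    show ?thesis
    proof (cases "i \<le> n")
      case True
      then show ?thesis
        using g[OF i] dropin[OF True i(2)] w(2)[OF True] by (auto simp: f_def image_subset_iff)
    next
      case False
      then show ?thesis
        using g[OF i] wall(1)[OF that] s(2) by (auto simp: f_def)
    qed
  qed
  show ?thesis
  proof (intro exI[of _ "g \<circ> retr n"] conjI allI impI ballI)
    show "continuous_on (standard_simplex n \<times> {0..1}) (g \<circ> retr n)"
      using retr_wall by (intro continuous_on_compose continuous_on_retr continuous_on_subset[OF cg']) auto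
    show "(g \<circ> retr n) ` (standard_simplex n \<times> {0..1}) \<subseteq> P"
      by (auto intro!: gP retr_wall)
    fix x assume x: "x \<in> standard_simplex n"
    then have "(x, 1) \<in> wall n"
      by (simp add: wall_def)
    then show "(g \<circ> retr n) (x, 1) = s x"
      using g[of "Suc n" "(x, 1)"] by (simp add: retr_id T_def f_def)
  next
    fix i y and t :: real assume i: "i \<le> n" and y: "y \<in> standard_simplex (Suc m)" and t: "t \<in> {0..1}"
    have 0: "simplical_face i y i = 0"
      by (simp add: simplical_face_def)
    then have wl: "(simplical_face i y, t) \<in> wall n"
      using face_in[OF y, of i] i n t by (auto simp: wall_def)
    then show "(g \<circ> retr n) (simplical_face i y, t) = w i (y, t)"
      using g[of i "(simplical_face i y, t)"] i 0 by (simp add: retr_id T_def f_def)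
  qed
qed

subsection \<open>From homologous to homotopic discs\<close>

text \<open>If the lift of \<open>p\<close> starting at \<open>w\<close> is closed, then \<open>om w +++ p\<close> is homotopic to \<open>om w\<close>, so \<open>p\<close> is
  null-homotopic: the covering space is simply connected.\<close>

locale based_transport = transport P E \<rho> for P :: "'a::euclidean_space set" and E :: "'e set" and \<rho> +
  fixes x0 :: 'a and om :: "'a \<times> 'e \<Rightarrow> real \<Rightarrow> 'a"
  assumes x0: "x0 \<in> P"
    and om: "y \<in> P \<Longrightarrow> e \<in> E \<Longrightarrow> path (om (y, e)) \<and> path_image (om (y, e)) \<subseteq> P \<and>
      pathstart (om (y, e)) = x0 \<and> pathfinish (om (y, e)) = y"
    and om_transport: "path p \<Longrightarrow> path_image p \<subseteq> P \<Longrightarrow> e \<in> E \<Longrightarrow>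
      homotopic_paths P (om (pathstart p, e) +++ p) (om (pathfinish p, \<rho> p e))"
begin

text \<open>The level 0 is prescribed only over edges, where it is constant. In higher dimensions
  the walls then force it to be \<open>x0\<close> on the boundary of a triangle and on the edges of
  a tetrahedron; over a triangle its interior carries the homotopy class.\<close>

definition fills :: "nat \<Rightarrow> (((nat \<Rightarrow> real) \<Rightarrow> 'a \<times> 'e) \<Rightarrow> (nat \<Rightarrow> real) \<times> real \<Rightarrow> 'a) \<Rightarrow> ((nat \<Rightarrow> real) \<Rightarrow> 'a \<times> 'e) \<Rightarrow>
    ((nat \<Rightarrow> real) \<times> real \<Rightarrow> 'a) \<Rightarrow> bool" where
  "fills n F s W \<longleftrightarrow> continuous_on (standard_simplex n \<times> {0..1}) W \<and> W ` (standard_simplex n \<times> {0..1}) \<subseteq> P \<and>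
     (\<forall>y\<in>standard_simplex n. W (y, 1) = fst (s y)) \<and>
     (\<forall>i\<le>n. \<forall>y\<in>standard_simplex (n - 1). \<forall>t\<in>{0..1}. W (simplical_face i y, t) = F (singular_face n i s) (y, t)) \<and>
     (n = 1 \<longrightarrow> (\<forall>y\<in>standard_simplex n. W (y, 0) = x0))"

text \<open>A singular simplex of the covering space is pushed to the base point along a prism over its image in
  \<open>P\<close>, compatibly with faces. Over a vertex \<open>w\<close> the prism is the path \<open>om w\<close>; it is run through in the first
  half, which makes room for the prism over an edge.\<close>

primrec fill :: "nat \<Rightarrow> ((nat \<Rightarrow> real) \<Rightarrow> 'a \<times> 'e) \<Rightarrow> (nat \<Rightarrow> real) \<times> real \<Rightarrow> 'a" where
  "fill 0 s = (\<lambda>w. om (s (fst w)) (min 1 (2 * snd w)))"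
| "fill (Suc n) s = (SOME W. fills (Suc n) (fill n) s W)"

lemma singular_simplex_alt: "singular_simplex n X s \<longleftrightarrow>
   continuous_map (top_of_set (standard_simplex n)) X s \<and> s \<in> extensional (standard_simplex n)"
  by (simp add: singular_simplex_def simplex_topology)

lemma singular_simplex_in: "singular_simplex n X s \<Longrightarrow> y \<in> standard_simplex n \<Longrightarrow> s y \<in> P \<times> E"
  using continuous_map_image_subset_topspace[of "top_of_set (standard_simplex n)" X s]
  by (auto simp: singular_simplex_alt)

lemma singular_simplex_fst:
  assumes "singular_simplex n X s"
  shows "continuous_on (standard_simplex n) (\<lambda>y. fst (s y))" "(\<lambda>y. fst (s y)) ` standard_simplex n \<subseteq> P"
proof -
  have "continuous_map (top_of_set (standard_simplex n)) (top_of_set P) (fst \<circ> s)"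
    by (rule continuous_map_compose[OF _ continuous_map_fst_cover]) (use assms in \<open>simp add: singular_simplex_alt\<close>)
  then show "continuous_on (standard_simplex n) (\<lambda>y. fst (s y))" "(\<lambda>y. fst (s y)) ` standard_simplex n \<subseteq> P"
    by (auto simp: comp_def)
qed

text \<open>By unique path lifting, transport along the edge takes one end to the other, so
  \<open>om_transport\<close> gives a homotopy \<Gamma> from \<open>om q0 +++ e\<close> to
  \<open>om q1\<close>. It only remains to wrap it onto the prism.\<close>

lemma fill_edge_exists:
  assumes s: "singular_simplex 1 X s"
  shows "\<exists>W. fills 1 (fill 0) s W"
proof -
  define pt where "pt t i = (if i = 0 then 1 - t else if i = Suc 0 then t else 0)" for t :: real and i :: nat
  have pt_in: "pt t \<in> standard_simplex 1" if "t \<in> {0..1}" for t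
    using that by (auto simp: standard_simplex_def pt_def)
  have pt_y: "pt (y 1) = y" and y1: "y 1 \<in> {0..1}" if "y \<in> standard_simplex 1" for y
    using that by (auto simp: standard_simplex_def pt_def fun_eq_iff)
  define e where "e t = fst (s (pt t))" for t
  have cpt: "continuous_on {0..1} pt"
    unfolding continuous_on_into_fun pt_def by (intro allI continuous_on_if_const continuous_intros)
  then have "continuous_map (top_of_set {0..1}) (top_of_set (standard_simplex 1)) pt"
    using pt_in by auto
  with s have lift: "continuous_map (top_of_set {0..1}) X (s \<circ> pt)"
    by (intro continuous_map_compose[where X' = "top_of_set (standard_simplex 1)"]) (simp_all add: singular_simplex_alt)
  have e: "path e" "path_image e \<subseteq> P"
  proof -
    have "continuous_map (top_of_set {0..1}) (top_of_set P) (fst \<circ> (s \<circ> pt))"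
      by (rule continuous_map_compose[OF lift continuous_map_fst_cover])
    then show "path e" "path_image e \<subseteq> P"
      by (auto simp: e_def comp_def path_def path_image_def)
  qed
  define q0 q1 where "q0 = s (pt 0)" and "q1 = s (pt 1)"
  have q: "q0 \<in> P \<times> E" "q1 \<in> P \<times> E" "fst q0 = e 0" "fst q1 = e 1"
    using singular_simplex_in[OF s pt_in] by (auto simp: q0_def q1_def e_def)
  have "snd q1 = \<rho> e (snd q0)"
    using unique_path_lifting[OF lift] by (simp add: q0_def q1_def e_def[abs_def] comp_def)
  moreover have "homotopic_paths P (om (pathstart e, snd q0) +++ e) (om (pathfinish e, \<rho> e (snd q0)))"
    using om_transport[OF e] q by auto
  moreover have qe: "(e 0, snd q0) = q0" "(e 1, snd q1) = q1"
    using q by (metis prod.collapse)+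
  ultimately have "homotopic_paths P (om q0 +++ e) (om q1)"
    by (simp add: pathstart_def pathfinish_def)
  then have "\<exists>\<Gamma>. continuous_on ({0..1} \<times> {0..1}) \<Gamma> \<and> \<Gamma> ` ({0..1} \<times> {0..1}) \<subseteq> P \<and>
      (\<forall>t\<in>{0..1}. \<Gamma> (0, t) = (om q0 +++ e) t) \<and> (\<forall>t\<in>{0..1}. \<Gamma> (1, t) = om q1 t) \<and>
      (\<forall>r\<in>{0..1::real}. pathstart (\<Gamma> \<circ> Pair r) = pathstart (om q0 +++ e) \<and> pathfinish (\<Gamma> \<circ> Pair r) = pathfinish (om q0 +++ e))"
    unfolding homotopic_paths image_subset_iff_funcset by simp
  then obtain \<Gamma> :: "real \<times> real \<Rightarrow> 'a" where \<Gamma>: "continuous_on ({0..1} \<times> {0..1}) \<Gamma>" "\<Gamma> ` ({0..1} \<times> {0..1}) \<subseteq> P"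
      and \<Gamma>': "\<forall>t\<in>{0..1}. \<Gamma> (0, t) = (om q0 +++ e) t" "\<forall>t\<in>{0..1}. \<Gamma> (1, t) = om q1 t"
      and \<Gamma>end: "\<forall>r\<in>{0..1}. pathstart (\<Gamma> \<circ> Pair r) = pathstart (om q0 +++ e) \<and> pathfinish (\<Gamma> \<circ> Pair r) = pathfinish (om q0 +++ e)"
    by (elim exE conjE) (rule that)
  note \<Gamma> = \<Gamma> \<Gamma>'[rule_format]
  have om0: "pathstart (om q0) = x0" "pathfinish (om q1) = e 1" "pathfinish (om q0) = e 0"
    using om[of "fst q0" "snd q0"] om[of "fst q1" "snd q1"] q qe by (auto simp: mem_Times_iff)
  have \<Gamma>0: "\<Gamma> (r, 0) = x0" and \<Gamma>1: "\<Gamma> (r, 1) = e 1" if "r \<in> {0..1}" for r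
    using bspec[OF \<Gamma>end that] om0 by (simp_all add: pathstart_def pathfinish_def joinpaths_def)
  \<comment> \<open>Boundary of the prism in the square of \<Gamma>: the bottom goes to the side
    where \<Gamma> is \<open>x0\<close>, the wall over \<open>pt 0\<close> to the first half of
    \<open>om q0 +++ e\<close>, the top to its second half, and the wall over \<open>pt 1\<close>
    follows \<open>om q1\<close> and then the side where \<Gamma> is \<open>e 1\<close>. This is why
    \<open>fill 0\<close> finishes at half height.\<close>
  define R where "R w = (fst w 1 * min 1 (2 - 2 * snd w),
     (1 - fst w 1) * min (snd w) (1/2) + fst w 1 * min (2 * snd w) 1)" for w :: "(nat \<Rightarrow> real) \<times> real"
  have R_in: "R w \<in> {0..1} \<times> {0..1}" if "w \<in> standard_simplex 1 \<times> {0..1}" for w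
  proof -
    from that obtain y t where w: "w = (y, t)" "y \<in> standard_simplex 1" "t \<in> {0..1}"
      by auto
    have 1: "a * b \<in> {0..1}" if "a \<in> {0..1}" "b \<in> {0..1}" for a b :: real
      using that by (auto intro: mult_le_one)
    have 2: "(1 - a) * b + a * c \<in> {0..1}" if "a \<in> {0..1}" "b \<in> {0..1}" "c \<in> {0..1}" for a b c :: real
      using that convexD[of "{0..1::real}" b c "1 - a" a] by simp
    show ?thesis
      unfolding R_def w(1) fst_conv snd_conv using w(3) by (intro SigmaI 1 2 y1[OF w(2)]) auto
  qed
  have cR: "continuous_on (standard_simplex 1 \<times> {0..1}) R"
  proof -
    have "continuous_on (standard_simplex 1 \<times> {0..1::real}) (\<lambda>w. fst w 1)"
      using continuous_on_compose[OF continuous_on_fst[OF continuous_on_id] continuous_on_coord, of "standard_simplex 1 \<times> {0..1::real}" 1] by (simp add: comp_def)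
    then show ?thesis
      unfolding R_def[abs_def] by (intro continuous_intros)
  qed
  define W where "W = \<Gamma> \<circ> R"
  have face0: "simplical_face 0 z = pt 1" and face1: "simplical_face 1 z = pt 0" if "z \<in> standard_simplex 0" for z
    using that by (auto simp: standard_simplex_def simplical_face_def pt_def fun_eq_iff)
  show ?thesis
    unfolding fills_def
  proof (intro exI[of _ W] conjI ballI allI impI)
    show "continuous_on (standard_simplex 1 \<times> {0..1}) W"
      unfolding W_def using R_in by (intro continuous_on_compose cR continuous_on_subset[OF \<Gamma>(1)]) blast
    show "W ` (standard_simplex 1 \<times> {0..1}) \<subseteq> P"
    proof
      fix v assume "v \<in> W ` (standard_simplex 1 \<times> {0..1})"
      then obtain w where "w \<in> standard_simplex 1 \<times> {0..1}" "v = \<Gamma> (R w)"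
        by (auto simp: W_def)
      then show "v \<in> P"
        using R_in \<Gamma>(2) by blast
    qed
  next
    fix y :: "nat \<Rightarrow> real" assume y: "y \<in> standard_simplex 1"
    have "W (y, 1) = (om q0 +++ e) ((1 + y 1) / 2)"
      using \<Gamma>(3)[of "(1 + y 1) / 2"] y1[OF y] by (simp add: W_def R_def field_simps)
    moreover have "2 * ((1 + y 1) / 2) - 1 = y 1"
      by (simp add: field_simps)
    then have "(om q0 +++ e) ((1 + y 1) / 2) = e (y 1)"
      using y1[OF y] om0 by (cases "y 1 = 0") (auto simp: joinpaths_def pathfinish_def)
    ultimately show "W (y, 1) = fst (s y)"
      using pt_y[OF y] by (simp add: e_def)
    show "W (y, 0) = x0"
      using \<Gamma>0[of "y 1"] y1[OF y] by (simp add: W_def R_def)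
  next
    fix i :: nat and z :: "nat \<Rightarrow> real" and t :: real
    assume i: "i \<le> 1" and z: "z \<in> standard_simplex (1 - 1)" and t: "t \<in> {0..1}"
    then have z: "z \<in> standard_simplex 0"
      by simp
    have "i = 0 \<or> i = 1"
      using i by auto
    then show "W (simplical_face i z, t) = fill 0 (singular_face 1 i s) (z, t)"
    proof
      assume i: "i = 0"
      have "W (pt 1, t) = om q1 (min 1 (2 * t))"
      proof (cases "t < 1/2")
        case True
        then show ?thesis
          using t \<Gamma>(4)[of "2 * t"] by (simp add: W_def R_def pt_def min_def)
      next
        case False
        then have "min 1 (2 - 2 * t) = 2 - 2 * t" "min (2 * t) 1 = 1" "min 1 (2 * t) = 1"
          by auto
        then show ?thesis
          using False t \<Gamma>1[of "2 - 2 * t"] om0 by (simp add: W_def R_def pt_def pathfinish_def)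
      qed
      then show ?thesis
        using face0[OF z] z by (simp add: i singular_face_def q1_def)
    next
      assume i: "i = 1"
      have "W (pt 0, t) = om q0 (min 1 (2 * t))"
      proof (cases "t < 1/2")
        case True
        then show ?thesis
          using t \<Gamma>(3)[of t] by (simp add: W_def R_def pt_def joinpaths_def)
      next
        case False
        then have "min t (1/2) = 1/2" "min 1 (2 * t) = 1"
          by auto
        then show ?thesis
          using \<Gamma>(3)[of "1/2"] by (simp add: W_def R_def pt_def joinpaths_def)
      qed
      then show ?thesis
        using face1[OF z] z by (simp add: i singular_face_def q0_def)
    qed
  qed
qed

lemma face_swap:
  assumes "i < j" "j \<le> Suc (Suc n)"
  shows "singular_face (Suc n) i (singular_face (Suc (Suc n)) j s) = singular_face (Suc n) (j - 1) (singular_face (Suc (Suc n)) i s)"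
proof
  fix z
  show "singular_face (Suc n) i (singular_face (Suc (Suc n)) j s) z = singular_face (Suc n) (j - 1) (singular_face (Suc (Suc n)) i s) z"
    using assms face_in[of z n i] face_in[of z n "j - 1"] face_face[OF assms(1), of z]
    by (auto simp: singular_face_def restrict_def)
qed

text \<open>The choice in \<open>fill\<close> is sound once a filling exists: over edges by
  \<open>fill_edge_exists\<close>, above that by \<open>prism_extension\<close>, whose walls are the
  fillings of the faces and fit by the identity for faces of faces.\<close>

lemma fills_fill: "singular_simplex (Suc n) X s \<Longrightarrow> fills (Suc n) (fill n) s (fill (Suc n) s)"
proof (induction n arbitrary: s)
  case 0
  then have "singular_simplex 1 X s"
    by simp
  from someI_ex[OF fill_edge_exists[OF this]] show ?case
    unfolding fill.simps(2)[of 0] One_nat_def .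
next
  case (Suc n)
  have f: "singular_simplex (Suc n) X (singular_face (Suc (Suc n)) i s)" if "i \<le> Suc (Suc n)" for i
    using singular_simplex_singular_face[OF Suc.prems _ that] by simp
  note F = Suc.IH[OF f, unfolded fills_def]
  have "\<exists>W. continuous_on (standard_simplex (Suc (Suc n)) \<times> {0..1}) W \<and> W ` (standard_simplex (Suc (Suc n)) \<times> {0..1}) \<subseteq> P \<and>
    (\<forall>x\<in>standard_simplex (Suc (Suc n)). W (x, 1) = fst (s x)) \<and>
    (\<forall>i\<le>Suc (Suc n). \<forall>y\<in>standard_simplex (Suc n). \<forall>t\<in>{0..1}.
        W (simplical_face i y, t) = fill (Suc n) (singular_face (Suc (Suc n)) i s) (y, t))"
  proof (rule prism_extension[OF HOL.refl singular_simplex_fst[OF Suc.prems]])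
    fix i assume i: "i \<le> Suc (Suc n)"
    show "continuous_on (standard_simplex (Suc n) \<times> {0..1}) (fill (Suc n) (singular_face (Suc (Suc n)) i s))"
      using F[OF i] by blast
    show "fill (Suc n) (singular_face (Suc (Suc n)) i s) ` (standard_simplex (Suc n) \<times> {0..1}) \<subseteq> P"
      using F[OF i] by blast
    show "fill (Suc n) (singular_face (Suc (Suc n)) i s) (y, 1) = fst (s (simplical_face i y))" if y: "y \<in> standard_simplex (Suc n)" for y
    proof -
      have "fill (Suc n) (singular_face (Suc (Suc n)) i s) (y, 1) = fst (singular_face (Suc (Suc n)) i s y)"
        using F[OF i] y by blast
      then show ?thesis
        using y by (simp add: singular_face_def)
    qed
  next
    fix i j z and t :: real
    assume ij: "i < j" "j \<le> Suc (Suc n)" and z: "z \<in> standard_simplex n" and t: "t \<in> {0..1}"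
    have "fill (Suc n) (singular_face (Suc (Suc n)) j s) (simplical_face i z, t)
        = fill n (singular_face (Suc n) i (singular_face (Suc (Suc n)) j s)) (z, t)"
    proof -
      have "\<forall>i\<le>Suc n. \<forall>y\<in>standard_simplex (Suc n - 1). \<forall>t\<in>{0..1}.
         fill (Suc n) (singular_face (Suc (Suc n)) j s) (simplical_face i y, t) = fill n (singular_face (Suc n) i (singular_face (Suc (Suc n)) j s)) (y, t)"
        using F[OF ij(2)] by blast
      then show ?thesis
        using ij z t by simp
    qed
    moreover have "fill (Suc n) (singular_face (Suc (Suc n)) i s) (simplical_face (j - 1) z, t)
        = fill n (singular_face (Suc n) (j - 1) (singular_face (Suc (Suc n)) i s)) (z, t)"
    proof -
      have i: "i \<le> Suc (Suc n)"
        using ij by simp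
      have "\<forall>k\<le>Suc n. \<forall>y\<in>standard_simplex (Suc n - 1). \<forall>t\<in>{0..1}.
         fill (Suc n) (singular_face (Suc (Suc n)) i s) (simplical_face k y, t) = fill n (singular_face (Suc n) k (singular_face (Suc (Suc n)) i s)) (y, t)"
        using F[OF i] by blast
      then show ?thesis
        using ij z t by simp
    qed
    ultimately show "fill (Suc n) (singular_face (Suc (Suc n)) j s) (simplical_face i z, t) =
        fill (Suc n) (singular_face (Suc (Suc n)) i s) (simplical_face (j - 1) z, t)"
      using face_swap[OF ij, of s] by simp
  qed
  then have "\<exists>W. fills (Suc (Suc n)) (fill (Suc n)) s W"
    unfolding fills_def by simp
  then show ?case
    unfolding fill.simps(2)[of "Suc n"] by (rule someI_ex)
qed

lemma fill_props:
  assumes s: "singular_simplex n X s" and n: "0 < n"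
  shows "continuous_on (standard_simplex n \<times> {0..1}) (fill n s)"
    "fill n s ` (standard_simplex n \<times> {0..1}) \<subseteq> P"
    "y \<in> standard_simplex n \<Longrightarrow> fill n s (y, 1) = fst (s y)"
    "i \<le> n \<Longrightarrow> z \<in> standard_simplex (n - 1) \<Longrightarrow> t \<in> {0..1} \<Longrightarrow>
      fill n s (simplical_face i z, t) = fill (n - 1) (singular_face n i s) (z, t)"
    "n = 1 \<Longrightarrow> y \<in> standard_simplex n \<Longrightarrow> fill n s (y, 0) = x0"
proof -
  obtain m where m: "n = Suc m"
    using n by (cases n) auto
  have "fills n (fill (n - 1)) s (fill n s)"
    using fills_fill[of m s] s by (simp add: m del: fill.simps)
  then show "continuous_on (standard_simplex n \<times> {0..1}) (fill n s)"
    "fill n s ` (standard_simplex n \<times> {0..1}) \<subseteq> P"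
    "y \<in> standard_simplex n \<Longrightarrow> fill n s (y, 1) = fst (s y)"
    "i \<le> n \<Longrightarrow> z \<in> standard_simplex (n - 1) \<Longrightarrow> t \<in> {0..1} \<Longrightarrow>
      fill n s (simplical_face i z, t) = fill (n - 1) (singular_face n i s) (z, t)"
    "n = 1 \<Longrightarrow> y \<in> standard_simplex n \<Longrightarrow> fill n s (y, 0) = x0"
    unfolding fills_def by blast+
qed

lemma fill_bdry_2:
  assumes s: "singular_simplex 2 X s" and x: "x \<in> simplex_boundary 2"
  shows "fill 2 s (x, 0) = x0"
proof -
  obtain i where i: "i \<le> 2" "x i = 0" and x': "x \<in> standard_simplex 2"
    using x by auto
  then have d: "drop_coord i x \<in> standard_simplex 1"
    using drop_coord_in[of x 1 i] by (simp add: numeral_2_eq_2)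
  have f: "singular_simplex 1 X (singular_face 2 i s)"
    using singular_simplex_singular_face[OF s _ i(1)] by simp
  have "fill 2 s (simplical_face i (drop_coord i x), 0) = fill 1 (singular_face 2 i s) (drop_coord i x, 0)"
    using fill_props(4)[OF s _ i(1), of "drop_coord i x" 0] d by simp
  also have "\<dots> = x0"
    using fill_props(5)[OF f _ _ d] by simp
  finally show ?thesis
    using i by (simp add: face_drop)
qed

lemma fill_bdry_3:
  assumes s: "singular_simplex 3 X s" and x: "x \<in> one_skeleton 3"
  shows "fill 3 s (x, 0) = x0"
proof -
  obtain i j where x': "x \<in> standard_simplex 3" and ij: "\<And>k. k \<noteq> i \<Longrightarrow> k \<noteq> j \<Longrightarrow> x k = 0"
    using x by (auto simp: one_skeleton_def)
  \<comment> \<open>At most two of the four coordinates are nonzero, so two vanish; dropping one of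
    them leaves a boundary point of a triangle, where \<open>fill_bdry_2\<close> applies.\<close>
  obtain k l :: nat where kl: "l < k" "k \<le> 3" "x k = 0" "x l = 0"
  proof -
    have "card ({..3::nat} - {i, j}) \<ge> 2"
      using diff_card_le_card_Diff[of "{i, j}" "{..3::nat}"] card_insert_le_m1[of 2 "{j}" i] by simp
    then obtain a b where "a \<in> {..3::nat} - {i, j}" "b \<in> {..3::nat} - {i, j}" "a \<noteq> b"
      by (metis One_nat_def card_le_Suc0_iff_eq finite_Diff finite_atMost numeral_2_eq_2 not_less_eq_eq)
    then show ?thesis
      using that[of a b] that[of b a] ij by (cases "a < b") auto
  qed
  have d: "drop_coord k x \<in> standard_simplex 2"
    using drop_coord_in[of x 2 k] x' kl by (simp add: numeral_3_eq_3 numeral_2_eq_2)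
  then have d': "drop_coord k x \<in> simplex_boundary 2"
    using kl by (auto simp: drop_coord_def intro!: exI[of _ l])
  have f: "singular_simplex 2 X (singular_face 3 k s)"
    using singular_simplex_singular_face[OF s _ kl(2)] by simp
  have "fill 3 s (simplical_face k (drop_coord k x), 0) = fill 2 (singular_face 3 k s) (drop_coord k x, 0)"
    using fill_props(4)[OF s _ kl(2), of "drop_coord k x" 0] d by simp
  also have "\<dots> = x0"
    by (rule fill_bdry_2[OF f d'])
  finally show ?thesis
    using kl by (simp add: face_drop)
qed

end

text \<open>A planar copy of the standard triangle, with the parameters of \<open>tri\<close>:
  homotopy extension is applied in Euclidean space, whereas singular simplices live on
  sequences.\<close>

definition T2 :: "(real \<times> real) set" where
  "T2 = {z. 0 \<le> fst z \<and> 0 \<le> snd z \<and> fst z + snd z \<le> 1}"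

definition bT2 :: "(real \<times> real) set" where
  "bT2 = {z \<in> T2. fst z = 0 \<or> snd z = 0 \<or> fst z + snd z = 1}"

definition tr :: "real \<times> real \<Rightarrow> nat \<Rightarrow> real" where
  "tr z = tri (fst z) (snd z)"

lemma tr_in: "z \<in> T2 \<Longrightarrow> tr z \<in> standard_simplex 2"
  by (auto simp: tr_def T2_def intro: tri_in_simplex)

lemma tr_bdry: "z \<in> bT2 \<Longrightarrow> tr z \<in> simplex_boundary 2"
  using tri_boundary[of "fst z" "snd z"] by (auto simp: tr_def bT2_def T2_def)

lemma continuous_on_tr: "continuous_on S tr"
  unfolding tr_def[abs_def] by (intro continuous_on_tri continuous_intros)

lemma convex_T2: "convex T2"
proof -
  have T2: "T2 = {z. (1, 0) \<bullet> z \<ge> 0} \<inter> {z. (0, 1) \<bullet> z \<ge> 0} \<inter> {z. (1, 1) \<bullet> z \<le> 1}"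
    by (auto simp: T2_def inner_prod_def)
  show ?thesis
    unfolding T2 by (intro convex_Int convex_halfspace_le convex_halfspace_ge)
qed

lemma closed_T2: "closed T2" "closed bT2"
proof -
  have T2: "T2 = {z. 0 \<le> fst z} \<inter> {z. 0 \<le> snd z} \<inter> {z. fst z + snd z \<le> 1}"
    by (auto simp: T2_def)
  show 1: "closed T2"
    unfolding T2 by (intro closed_Int closed_Collect_le continuous_intros)
  have bT2: "bT2 = T2 \<inter> ({z. fst z = 0} \<union> {z. snd z = 0} \<union> {z. fst z + snd z = 1})"
    by (auto simp: bT2_def)
  show "closed bT2"
    unfolding bT2 using 1 by (intro closed_Int closed_Un closed_Collect_eq continuous_intros)
qed

lemma compact_T2: "compact T2"
proof (rule compact_eq_bounded_closed[THEN iffD2], rule conjI[OF _ closed_T2(1)], rule bounded_subset[of "cbox (0, 0) (1, 1)"])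
  show "T2 \<subseteq> cbox (0, 0) (1, 1)"
    by (auto simp: T2_def cbox_Pair_eq)
qed (rule bounded_cbox)

text \<open>A one-sided inverse of \<open>sweep\<close> up to a homotopy preserving every edge of the triangle.\<close>

definition unsweep :: "real \<times> real \<Rightarrow> real \<times> real" where
  "unsweep z = (max 0 (min 1 (1/2 + 3/2 * (snd z - fst z))), min 1 (min (3 * fst z) (3 * snd z)))"

definition slide :: "real \<times> (real \<times> real) \<Rightarrow> real \<times> real" where
  "slide w = ((1 - fst w) * fst (snd w) + fst w * sw0 (fst (unsweep (snd w))) (snd (unsweep (snd w))),
              (1 - fst w) * snd (snd w) + fst w * sw2 (fst (unsweep (snd w))) (snd (unsweep (snd w))))"

lemma continuous_on_unsweep: "continuous_on S unsweep"
  unfolding unsweep_def[abs_def] by (intro continuous_intros)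

lemma continuous_on_slide: "continuous_on S slide"
proof -
  have "continuous_on S (\<lambda>w. unsweep (snd w))"
    by (rule continuous_on_compose2[OF continuous_on_unsweep[of UNIV]]) (auto intro: continuous_intros)
  then show ?thesis
    unfolding slide_def[abs_def] by (intro continuous_intros continuous_on_sw)
qed

lemma unsweep_in: "z \<in> T2 \<Longrightarrow> unsweep z \<in> sq"
  by (auto simp: T2_def sq_def unsweep_def)

text \<open>The middle third of the hypotenuse goes to the top side of the square, which
  \<open>sweep\<close> sends to the edge from vertex 0 to vertex 2; the outer thirds go to the
  vertical sides, which \<open>sweep\<close> collapses to these vertices. Hence the factor 3 in
  \<open>unsweep\<close>.\<close>

lemma unsweep_hypotenuse:
  assumes "fst z + snd z = 1"
  shows "unsweep z = (max 0 (min 1 (2 - 3 * fst z)), min 1 (min (3 * fst z) (3 - 3 * fst z)))"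
proof -
  have "snd z - fst z = 1 - 2 * fst z"
    using assms by linarith
  then have 1: "1/2 + 3/2 * (snd z - fst z) = 2 - 3 * fst z"
    by (simp add: field_simps)
  have 2: "3 * snd z = 3 - 3 * fst z"
    using assms by linarith
  show ?thesis
    unfolding unsweep_def 1 2 by simp
qed

lemma unsweep_bdry:
  assumes "z \<in> bT2"
  shows "unsweep z \<in> bsq"
proof -
  have "fst (unsweep z) = 0 \<or> fst (unsweep z) = 1 \<or> snd (unsweep z) = 0 \<or> snd (unsweep z) = 1"
  proof (cases "fst z + snd z = 1")
    case True
    then show ?thesis
      unfolding unsweep_hypotenuse[OF True] by (auto simp: min_def max_def)
  next
    case False
    then show ?thesis
      using assms by (auto simp: bT2_def T2_def unsweep_def)
  qed
  then show ?thesis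
    using assms unsweep_in[of z] by (auto simp: bT2_def bsq_def)
qed

lemma slide_1: "tr (slide (1, z)) = sweep (unsweep z)"
  by (simp add: tr_def slide_def sweep_sw flip: prod.collapse) (metis prod.collapse sweep_sw)

lemma slide_0: "slide (0, z) = z"
  by (simp add: slide_def)

lemma unsweep_edges:
  assumes "z \<in> T2"
  defines "a \<equiv> sw0 (fst (unsweep z)) (snd (unsweep z))" and "c \<equiv> sw2 (fst (unsweep z)) (snd (unsweep z))"
  shows "fst z = 0 \<Longrightarrow> a = 0" "snd z = 0 \<Longrightarrow> c = 0" "fst z + snd z = 1 \<Longrightarrow> a + c = 1"
proof -
  show "fst z = 0 \<Longrightarrow> a = 0" "snd z = 0 \<Longrightarrow> c = 0"
    using assms(1) by (auto simp: a_def c_def T2_def unsweep_def sw0_def sw2_def min_def max_def)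
  show "a + c = 1" if s: "fst z + snd z = 1"
    unfolding a_def c_def unsweep_hypotenuse[OF s] by (auto simp: sw0_def sw2_def min_def max_def)
qed

lemma slide_in:
  assumes r: "r \<in> {0..1}" and z: "z \<in> T2"
  shows "slide (r, z) \<in> T2"
proof -
  define a c where "a = sw0 (fst (unsweep z)) (snd (unsweep z))" and "c = sw2 (fst (unsweep z)) (snd (unsweep z))"
  have "(a, c) \<in> T2"
    using sw_bounds[of "fst (unsweep z)" "snd (unsweep z)"] unsweep_in[OF z] by (auto simp: T2_def sq_def a_def c_def mem_Times_iff)
  then have "(1 - r) *\<^sub>R z + r *\<^sub>R (a, c) \<in> T2"
    using convexD[OF convex_T2 z, of "(a, c)" "1 - r" r] r by simp
  moreover have "(1 - r) *\<^sub>R z + r *\<^sub>R (a, c) = slide (r, z)"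
    by (cases z) (simp add: slide_def a_def c_def)
  ultimately show ?thesis
    by simp
qed

lemma slide_bdry:
  assumes r: "r \<in> {0..1}" and z: "z \<in> bT2"
  shows "slide (r, z) \<in> bT2"
proof -
  have zT: "z \<in> T2"
    using z by (simp add: bT2_def)
  have "(1 - r) * fst z + r * a + ((1 - r) * snd z + r * c) = 1" if "fst z + snd z = 1" "a + c = 1" for a c
  proof -
    have "(1 - r) * fst z + r * a + ((1 - r) * snd z + r * c) = (1 - r) * (fst z + snd z) + r * (a + c)"
      by (simp add: algebra_simps)
    then show ?thesis
      using that by simp
  qed
  then show ?thesis
    using slide_in[OF r zT] unsweep_edges[OF zT] z by (auto simp: bT2_def slide_def)
qed

section \<open>The inverse of the Hurewicz map on singular triangles\<close>

context based_transport begin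

text \<open>Pushing the boundary of a singular triangle of a simply connected covering space to the base point gives
  an element of the second homotopy group of \<open>P\<close>. By the tetrahedron relation this kills boundaries, so
  it inverts the Hurewicz map.\<close>

definition theta :: "((nat \<Rightarrow> real) \<Rightarrow> 'a \<times> 'e) \<Rightarrow> (real \<times> real \<Rightarrow> 'a) set" where
  "theta s = sqclass P x0 (kappa (\<lambda>x. fill 2 s (x, 0)))"

lemma fill_base:
  assumes s: "singular_simplex 2 X s"
  shows "continuous_on (standard_simplex 2) (\<lambda>x. fill 2 s (x, 0))" "(\<lambda>x. fill 2 s (x, 0)) ` standard_simplex 2 \<subseteq> P"
    "kappa (\<lambda>x. fill 2 s (x, 0)) \<in> sqs P x0"
proof -
  note F = fill_props(1,2)[OF s]
  show 1: "continuous_on (standard_simplex 2) (\<lambda>x. fill 2 s (x, 0))"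
    by (rule continuous_on_compose2[OF F(1)]) (auto intro!: continuous_on_Pair continuous_on_id continuous_on_const)
  show 2: "(\<lambda>x. fill 2 s (x, 0)) ` standard_simplex 2 \<subseteq> P"
    using F(2) by auto
  show "kappa (\<lambda>x. fill 2 s (x, 0)) \<in> sqs P x0"
    by (rule kappa_sqs[OF 1 2 fill_bdry_2[OF s]])
qed

lemma theta_in: "singular_simplex 2 X s \<Longrightarrow> theta s \<in> carrier (pi2 P x0)"
  using fill_base(3) by (simp add: theta_def pi2_def)

lemma sqclass_cong:
  assumes "f \<in> sqs P x0" "\<And>z. z \<in> sq \<Longrightarrow> f z = g z"
  shows "sqclass P x0 f = sqclass P x0 g"
proof -
  have "sqrel P x0 f g"
    by (rule sqrel_reparam[OF assms(1), where \<Phi> = snd])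
      (use assms in \<open>auto simp: sqs_def intro!: continuous_on_snd continuous_on_id\<close>)
  then show ?thesis
    using sqclass_eq sqrel_sqs by blast
qed

lemma theta_boundary:
  assumes s: "singular_simplex 3 X s"
  shows "theta (singular_face 3 3 s) \<otimes>\<^bsub>pi2 P x0\<^esub> theta (singular_face 3 1 s) =
    theta (singular_face 3 0 s) \<otimes>\<^bsub>pi2 P x0\<^esub> theta (singular_face 3 2 s)"
proof -
  note F = fill_props(1,2,4)[OF s]
  define T where "T x = fill 3 s (x, 0)" for x
  have T: "continuous_on (standard_simplex 3) T" "T ` standard_simplex 3 \<subseteq> P"
    unfolding T_def
    by (rule continuous_on_compose2[OF F(1)]; auto intro!: continuous_on_Pair continuous_on_id continuous_on_const)
      (use F(2) in auto)
  have sk: "T x = x0" if "x \<in> one_skeleton 3" for x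
    using fill_bdry_3[OF s that] by (simp add: T_def)
  have eq: "sqclass P x0 (kappa (T \<circ> simplical_face i)) = theta (singular_face 3 i s)" if i: "i \<le> 3" for i
    unfolding theta_def
  proof (rule sqclass_cong)
    show "kappa (T \<circ> simplical_face i) \<in> sqs P x0"
      using tetrahedron_relation(1)[OF x0 T sk, of i] i by auto
    show "kappa (T \<circ> simplical_face i) z = kappa (\<lambda>x. fill 2 (singular_face 3 i s) (x, 0)) z" if "z \<in> sq" for z
      using F(3)[OF _ i, of "sweep z" 0] sweep_in[OF that] by (simp add: kappa_def T_def)
  qed
  show ?thesis
    using tetrahedron_relation(2)[OF x0 T sk] by (simp add: eq flip: One_nat_def)
qed

text \<open>\<open>theta\<close> extends to a homomorphism from the 2-chains to the second homotopy
  group, and \<open>theta_boundary\<close> says that it vanishes on boundaries of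
  3-simplices.\<close>

lemma theta_eq:
  assumes f: "singular_simplex 2 X f" and g: "singular_simplex 2 X g"
    and fg: "singular_relboundary 2 X {} (frag_of f - frag_of g)"
  shows "theta f = theta g"
proof -
  let ?G = "pi2 P x0"
  let ?F = "free_Abelian_group (Collect (singular_simplex 2 X))"
  interpret comm_group ?G
    by (rule comm_group_pi2[OF x0])
  obtain h where h: "h \<in> hom ?F ?G" and hf: "\<And>x. x \<in> Collect (singular_simplex 2 X) \<Longrightarrow> h (frag_of x) = theta x"
    using free_Abelian_group_universal[of theta "Collect (singular_simplex 2 X)"] theta_in by blast
  have hadd: "h (a + b) = h a \<otimes>\<^bsub>?G\<^esub> h b" and hc: "h a \<in> carrier ?G"
    if "singular_chain 2 X a" "singular_chain 2 X b" for a b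
    using hom_mult[OF h, of a b] hom_in_carrier[OF h, of a] that by (simp_all add: singular_chain_def)
  \<comment> \<open>Vanishing is obtained by cancelling a common summand, which avoids computing
    inverses in \<open>pi2\<close>.\<close>
  have h0: "h z = \<one>\<^bsub>?G\<^esub>" if "singular_chain 2 X z" "singular_chain 2 X a" "h (z + a) = h a" for z a
    using that hadd[OF that(1,2)] hc[OF that(1,2)] hc[OF that(2,2)] by (simp add: r_cancel_one')
  obtain d where d: "singular_chain 3 X d" "chain_boundary 3 d = frag_of f - frag_of g"
    using fg by (auto simp: singular_boundary numeral_3_eq_3 numeral_2_eq_2)
  have "singular_chain 2 X (chain_boundary 3 d) \<and> h (chain_boundary 3 d) = \<one>\<^bsub>?G\<^esub>"
    using d(1) unfolding singular_chain_def[of 3]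
  proof (induction d rule: frag_induction)
    case zero
    have "h (0 + 0) = h 0"
      by simp
    then show ?case
      using h0[of 0 0] by simp
  next
    case (one s)
    then have s: "singular_simplex 3 X s"
      by simp
    have fc: "singular_simplex 2 X (singular_face 3 i s)" if "i \<le> 3" for i
      using singular_simplex_singular_face[OF s _ that] by simp
    then have fc': "singular_chain 2 X (frag_of (singular_face 3 i s))" if "i \<le> 3" for i
      using that by (simp add: singular_chain_of)
    let ?a = "frag_of (singular_face 3 3 s) + frag_of (singular_face 3 1 s)"
    let ?b = "frag_of (singular_face 3 0 s) + frag_of (singular_face 3 2 s)"
    have ch: "singular_chain 2 X ?a" "singular_chain 2 X ?b"
      using fc' by (auto intro!: singular_chain_add)
    have eq: "chain_boundary 3 (frag_of s) = ?b - ?a"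
      by (simp add: chain_boundary_of sum_upto_3)
    have "h ?a = h ?b"
      using theta_boundary[OF s] fc fc' by (simp add: hadd hf)
    then show ?case
      using h0[of "?b - ?a" ?a] ch by (simp add: eq singular_chain_diff)
  next
    case (diff a b)
    then show ?case
      using h0[of "chain_boundary 3 a - chain_boundary 3 b" "chain_boundary 3 b"]
      by (simp add: chain_boundary_diff singular_chain_diff)
  qed
  then have z: "singular_chain 2 X (frag_of f - frag_of g)" "h (frag_of f - frag_of g) = \<one>\<^bsub>?G\<^esub>"
    using d(2) by simp_all
  have "h ((frag_of f - frag_of g) + frag_of g) = h (frag_of f - frag_of g) \<otimes>\<^bsub>?G\<^esub> h (frag_of g)"
    using z(1) g by (intro hadd) (simp_all add: singular_chain_of)
  then show ?thesis
    using f g z(2) theta_in by (simp add: hf)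
qed

text \<open>Both discs slide down their prisms to squares based at \<open>x0\<close>, which are
  homotopic by \<open>theta_eq\<close>. Over the boundary the two prisms coincide, being fillings of
  the same edges, so the two homotopies have a common trace that can be retracted.\<close>

lemma homologous_imp_homotopic:
  assumes f: "singular_simplex 2 X f" and g: "singular_simplex 2 X g" and P: "ANR P"
    and bd: "\<And>x. x \<in> simplex_boundary 2 \<Longrightarrow> f x = g x"
    and fg: "singular_relboundary 2 X {} (frag_of f - frag_of g)"
  obtains \<Psi> :: "real \<times> (real \<times> real) \<Rightarrow> 'a" where "continuous_on ({0..1} \<times> T2) \<Psi>" "\<Psi> ` ({0..1} \<times> T2) \<subseteq> P"
    "\<And>z. z \<in> T2 \<Longrightarrow> \<Psi> (0, z) = fst (f (tr z))" "\<And>z. z \<in> T2 \<Longrightarrow> \<Psi> (1, z) = fst (g (tr z))"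
    "\<And>t z. t \<in> {0..1} \<Longrightarrow> z \<in> bT2 \<Longrightarrow> \<Psi> (t, z) = fst (f (tr z))"
proof -
  define K where "K s z = fill 2 s (tr z, 0)" for s z
  let ?q = "\<lambda>h::real \<times> real \<Rightarrow> 'a. \<forall>z\<in>bT2. h z = x0"
  have slide: "homotopic_with_canon ?q T2 P (K s) (kappa (\<lambda>x. fill 2 s (x, 0)) \<circ> unsweep)"
    if s: "singular_simplex 2 X s" for s
    unfolding homotopic_with_def
  proof (intro exI[of _ "\<lambda>w. fill 2 s (tr (slide w), 0)"] conjI ballI allI)
    have "continuous_on ({0..1} \<times> T2) (\<lambda>w. tr (slide w))"
      by (rule continuous_on_compose2[OF continuous_on_tr[of UNIV] continuous_on_slide]) auto
    then have "continuous_on ({0..1} \<times> T2) (\<lambda>w. fill 2 s (tr (slide w), 0))"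
      by (rule continuous_on_compose2[OF fill_base(1)[OF s]]) (auto intro!: tr_in slide_in)
    moreover have "(\<lambda>w. fill 2 s (tr (slide w), 0)) ` ({0..1} \<times> T2) \<subseteq> P"
      by (auto intro!: subsetD[OF fill_base(2)[OF s]] imageI tr_in slide_in)
    ultimately show "continuous_map (prod_topology (top_of_set {0..1}) (top_of_set T2)) (top_of_set P) (\<lambda>w. fill 2 s (tr (slide w), 0))"
      by (simp add: prod_topology_subtopology_eu image_subset_iff_funcset)
  qed (auto simp: slide_0 slide_1 K_def kappa_def intro!: fill_bdry_2[OF s] tr_bdry slide_bdry simp del: mem_Collect_eq)
  have "sqrel P x0 (kappa (\<lambda>x. fill 2 f (x, 0))) (kappa (\<lambda>x. fill 2 g (x, 0)))"
    using theta_eq[OF f g fg] sqclass_eq[OF fill_base(3)[OF f] fill_base(3)[OF g]] by (simp add: theta_def)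
  then have mid: "homotopic_with_canon ?q T2 P (kappa (\<lambda>x. fill 2 f (x, 0)) \<circ> unsweep) (kappa (\<lambda>x. fill 2 g (x, 0)) \<circ> unsweep)"
    unfolding sqrel_def
    by (rule homotopic_with_compose_continuous_map_right)
      (use unsweep_in unsweep_bdry continuous_on_unsweep in auto)
  have "homotopic_with_canon ?q T2 P (K f) (K g)"
    using homotopic_with_trans[OF homotopic_with_trans[OF slide[OF f] mid] homotopic_with_symD[OF slide[OF g]]] .
  then obtain H :: "real \<times> (real \<times> real) \<Rightarrow> 'a" where H: "continuous_on ({0..1} \<times> T2) H" "H ` ({0..1} \<times> T2) \<subseteq> P"
    "\<And>z. z \<in> T2 \<Longrightarrow> H (0, z) = K f z" "\<And>z. z \<in> T2 \<Longrightarrow> H (1, z) = K g z" "\<And>t z. t \<in> {0..1} \<Longrightarrow> z \<in> bT2 \<Longrightarrow> H (t, z) = x0"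
  proof -
    assume "homotopic_with_canon ?q T2 P (K f) (K g)"
    then obtain h :: "real \<times> (real \<times> real) \<Rightarrow> 'a" where h: "continuous_map (prod_topology (top_of_set {0..1::real}) (top_of_set T2)) (top_of_set P) h"
      "\<forall>z. h (0, z) = K f z" "\<forall>z. h (1, z) = K g z" "\<forall>t\<in>{0..1::real}. \<forall>z\<in>bT2. h (t, z) = x0"
      unfolding homotopic_with_def by (elim exE conjE) blast
    then show ?thesis
      using that[of h] by (auto simp: prod_topology_subtopology_eu image_subset_iff_funcset)
  qed
  \<comment> \<open>First half: from the top of the prism down to its bottom. Second half: \<Phi>1
    moves the bottom of \<open>f\<close> to that of \<open>g\<close>, while \<Phi>2 waits. Both end
    in \<open>K g\<close>, and over the boundary both rest at \<open>x0\<close> during the second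
    half.\<close>
  define \<Phi>1 where "\<Phi>1 w = (if fst w \<le> 1/2 then fill 2 f (tr (snd w), 1 - 2 * fst w) else H (2 * fst w - 1, snd w))" for w :: "real \<times> (real \<times> real)"
  define \<Phi>2 where "\<Phi>2 w = (if fst w \<le> 1/2 then fill 2 g (tr (snd w), 1 - 2 * fst w) else K g (snd w))" for w :: "real \<times> (real \<times> real)"
  have cf: "continuous_on ({0..1/2::real} \<times> T2) (\<lambda>w. fill 2 s (tr (snd w), 1 - 2 * fst w))" if s: "singular_simplex 2 X s" for s
  proof (rule continuous_on_compose2[OF fill_props(1)[OF s]])
    have "continuous_on ({0..1/2::real} \<times> T2) (\<lambda>w. tr (snd w))"
      by (rule continuous_on_compose2[OF continuous_on_tr[of UNIV]]) (auto intro: continuous_intros)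
    then show "continuous_on ({0..1/2::real} \<times> T2) (\<lambda>w. (tr (snd w), 1 - 2 * fst w))"
      by (rule continuous_on_Pair) (intro continuous_intros)
  qed (auto intro: tr_in)
  have cK: "continuous_on T2 (K s)" if "singular_simplex 2 X s" for s
    unfolding K_def[abs_def]
    by (rule continuous_on_compose2[OF fill_base(1)[OF that] continuous_on_tr]) (auto intro: tr_in)
  have KP: "K s ` T2 \<subseteq> P" if "singular_simplex 2 X s" for s
    using fill_base(2)[OF that] tr_in by (auto simp: K_def)
  have split: "{0..1::real} \<times> T2 = {0..1/2} \<times> T2 \<union> {1/2..1} \<times> T2"
    by auto
  have c1: "continuous_on ({0..1::real} \<times> T2) \<Phi>1"
    unfolding split \<Phi>1_def
  proof (rule continuous_on_cases[of _ _ _ _ "\<lambda>w. fst w \<le> 1/2"])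
    show "continuous_on ({1/2..1} \<times> T2) (\<lambda>w. H (2 * fst w - 1, snd w))"
      by (rule continuous_on_compose2[OF H(1)]) (auto intro!: continuous_intros)
    show "\<forall>w. w \<in> {0..1/2} \<times> T2 \<and> \<not> fst w \<le> 1/2 \<or> w \<in> {1/2..1} \<times> T2 \<and> fst w \<le> 1/2 \<longrightarrow>
        fill 2 f (tr (snd w), 1 - 2 * fst w) = H (2 * fst w - 1, snd w)"
    proof (intro allI impI)
      fix w :: "real \<times> real \<times> real"
      assume "w \<in> {0..1/2} \<times> T2 \<and> \<not> fst w \<le> 1/2 \<or> w \<in> {1/2..1} \<times> T2 \<and> fst w \<le> 1/2"
      then obtain v where "w = (1/2, v)" "v \<in> T2"
        by (cases w) auto
      then show "fill 2 f (tr (snd w), 1 - 2 * fst w) = H (2 * fst w - 1, snd w)"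
        using H(3) by (simp add: K_def)
    qed
  qed (use cf[OF f] closed_T2 in \<open>auto intro: closed_Times\<close>)
  have c2: "continuous_on ({0..1} \<times> T2) \<Phi>2"
    unfolding split \<Phi>2_def
  proof (rule continuous_on_cases[of _ _ _ _ "\<lambda>w. fst w \<le> 1/2"])
    show "continuous_on ({1/2..1} \<times> T2) (\<lambda>w. K g (snd w))"
      by (rule continuous_on_compose2[OF cK[OF g]]) (auto intro!: continuous_intros)
    show "\<forall>w. w \<in> {0..1/2} \<times> T2 \<and> \<not> fst w \<le> 1/2 \<or> w \<in> {1/2..1} \<times> T2 \<and> fst w \<le> 1/2 \<longrightarrow>
        fill 2 g (tr (snd w), 1 - 2 * fst w) = K g (snd w)"
    proof (intro allI impI)
      fix w :: "real \<times> real \<times> real"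
      assume "w \<in> {0..1/2} \<times> T2 \<and> \<not> fst w \<le> 1/2 \<or> w \<in> {1/2..1} \<times> T2 \<and> fst w \<le> 1/2"
      then obtain v where "w = (1/2, v)" "v \<in> T2"
        by (cases w) auto
      then show "fill 2 g (tr (snd w), 1 - 2 * fst w) = K g (snd w)"
        by (simp add: K_def)
    qed
  qed (use cf[OF g] closed_T2 in \<open>auto intro: closed_Times\<close>)
  have im1: "\<Phi>1 ` ({0..1::real} \<times> T2) \<subseteq> P"
  proof (intro image_subsetI)
    fix w :: "real \<times> (real \<times> real)" assume "w \<in> {0..1} \<times> T2"
    then show "\<Phi>1 w \<in> P"
      using fill_props(2)[OF f] H(2) tr_in by (cases w) (auto simp: \<Phi>1_def image_subset_iff)
  qed
  have im2: "\<Phi>2 ` ({0..1::real} \<times> T2) \<subseteq> P"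
  proof (intro image_subsetI)
    fix w :: "real \<times> (real \<times> real)" assume "w \<in> {0..1} \<times> T2"
    then show "\<Phi>2 w \<in> P"
      using fill_props(2)[OF g] KP[OF g] tr_in by (cases w) (auto simp: \<Phi>2_def image_subset_iff)
  qed
  have edge: "fill 2 f (x, t) = fill 2 g (x, t)" if x: "x \<in> simplex_boundary 2" and t: "t \<in> {0..1}" for x t
  proof -
    from x obtain i where i: "i \<le> 2" "x i = 0" "x \<in> standard_simplex 2"
      by auto
    then have d: "drop_coord i x \<in> standard_simplex 1"
      using drop_coord_in[of x 1 i] by (simp add: numeral_2_eq_2)
    have "singular_face 2 i f = singular_face 2 i g"
    proof
      fix z
      show "singular_face 2 i f z = singular_face 2 i g z"
      proof (cases "z \<in> standard_simplex 1")
        case True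
        then have "simplical_face i z \<in> simplex_boundary 2"
          using face_in[of z 1 i] i(1) by (auto simp: numeral_2_eq_2 simplical_face_def)
        then show ?thesis
          using bd by (simp add: singular_face_def)
      qed (simp add: singular_face_def)
    qed
    then have "fill 2 f (simplical_face i (drop_coord i x), t) = fill 2 g (simplical_face i (drop_coord i x), t)"
      using fill_props(4)[OF f _ i(1), of "drop_coord i x" t] fill_props(4)[OF g _ i(1), of "drop_coord i x" t] d t by simp
    then show ?thesis
      using i by (simp add: face_drop)
  qed
  have agree: "\<Phi>1 (t, z) = \<Phi>2 (t, z)" if t: "t \<in> {0..1}" and z: "z \<in> bT2" for t z
  proof (cases "t \<le> 1/2")
    case True
    then show ?thesis
      using edge[OF tr_bdry[OF z], of "1 - 2 * t"] t by (simp add: \<Phi>1_def \<Phi>2_def)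
  next
    case False
    then show ?thesis
      using H(5)[of "2 * t - 1", OF _ z] fill_bdry_2[OF g tr_bdry[OF z]] t by (simp add: \<Phi>1_def \<Phi>2_def K_def)
  qed
  have fin: "\<Phi>1 (1, z) = \<Phi>2 (1, z)" if "z \<in> T2" for z
    using H(4)[OF that] by (simp add: \<Phi>1_def \<Phi>2_def)
  have bsub: "closedin (top_of_set T2) bT2"
    using closed_T2 by (intro closed_subset) (auto simp: bT2_def)
  have start: "\<Phi>1 (0, z) = fst (f (tr z))" "\<Phi>2 (0, z) = fst (g (tr z))" if "z \<in> T2" for z
    using fill_props(3)[OF f _ tr_in[OF that]] fill_props(3)[OF g _ tr_in[OF that]] by (simp_all add: \<Phi>1_def \<Phi>2_def)
  obtain \<Psi> :: "real \<times> (real \<times> real) \<Rightarrow> 'a" where \<Psi>: "continuous_on ({0..1} \<times> T2) \<Psi>" "\<Psi> ` ({0..1} \<times> T2) \<subseteq> P"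
    "\<And>x. x \<in> T2 \<Longrightarrow> \<Psi> (0, x) = \<Phi>1 (0, x)" "\<And>x. x \<in> T2 \<Longrightarrow> \<Psi> (1, x) = \<Phi>2 (0, x)"
    "\<And>t x. t \<in> {0..1} \<Longrightarrow> x \<in> bT2 \<Longrightarrow> \<Psi> (t, x) = \<Phi>1 (0, x)"
    by (rule homotopy_rel_from_common_trace[OF bsub P c1 im1 c2 im2 agree fin]) (assumption | rule that)+
  have "\<Psi> (t, z) = fst (f (tr z))" if "t \<in> {0..1}" "z \<in> bT2" for t z
    using \<Psi>(5)[OF that] start(1)[of z] that(2) by (simp add: bT2_def)
  moreover have "\<Psi> (0, z) = fst (f (tr z))" "\<Psi> (1, z) = fst (g (tr z))" if "z \<in> T2" for z
    using \<Psi>(3,4)[OF that] start[OF that] by simp_all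
  ultimately show ?thesis
    using that[OF \<Psi>(1,2)] by blast
qed

end

subsection \<open>Transports from group actions\<close>

lemma homotopic_paths_cancel_right:
  fixes p :: "real \<Rightarrow> 'a::real_normed_vector"
  assumes "path p" "path_image p \<subseteq> P" "path b" "path_image b \<subseteq> P" "pathfinish p = pathfinish b"
  shows "homotopic_paths P ((p +++ reversepath b) +++ b) p"
proof -
  have "homotopic_paths P ((p +++ reversepath b) +++ b) (p +++ (reversepath b +++ b))"
    using assms by (intro homotopic_paths_sym[OF homotopic_paths_assoc]) auto
  moreover have "homotopic_paths P (p +++ (reversepath b +++ b)) (p +++ linepath (pathfinish p) (pathfinish p))"
    using assms homotopic_paths_linv[of b P] by (intro homotopic_paths_join) auto
  moreover have "homotopic_paths P (p +++ linepath (pathfinish p) (pathfinish p)) p"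
    using assms by (intro homotopic_paths_rid) auto
  ultimately show ?thesis
    by (blast intro: homotopic_paths_trans)
qed

lemma homotopic_paths_cancel_left:
  fixes q :: "real \<Rightarrow> 'a::real_normed_vector"
  assumes "path q" "path_image q \<subseteq> P" "path a" "path_image a \<subseteq> P" "pathfinish a = pathstart q"
  shows "homotopic_paths P (reversepath a +++ (a +++ q)) q"
proof -
  have "homotopic_paths P (reversepath a +++ (a +++ q)) ((reversepath a +++ a) +++ q)"
    using assms by (intro homotopic_paths_assoc) auto
  moreover have "homotopic_paths P ((reversepath a +++ a) +++ q) (linepath (pathstart q) (pathstart q) +++ q)"
    using assms homotopic_paths_linv[of a P] by (intro homotopic_paths_join) auto
  moreover have "homotopic_paths P (linepath (pathstart q) (pathstart q) +++ q) q"
    using assms by (intro homotopic_paths_lid) auto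
  ultimately show ?thesis
    by (blast intro: homotopic_paths_trans)
qed

text \<open>The paths \<open>c\<close> play the part of a maximal tree: closing up with them turns
  every path into an element of the fundamental group at \<open>x\<close>. As \<open>c x\<close>
  need not be constant, \<open>cls\<close> of a loop is in general only conjugate to the class of
  the loop.\<close>

locale based_paths =
  fixes P :: "'a::euclidean_space set" and x :: 'a and c :: "'a \<Rightarrow> real \<Rightarrow> 'a"
  assumes star: "locally_starlike P" and x: "x \<in> P"
    and c: "y \<in> P \<Longrightarrow> path (c y) \<and> path_image (c y) \<subseteq> P \<and> pathstart (c y) = x \<and> pathfinish (c y) = y"
begin

abbreviation G where "G \<equiv> fundamental_group P x"

sublocale G: group G
  by (rule group_fundamental_group[OF x])

definition loop_of :: "(real \<Rightarrow> 'a) \<Rightarrow> real \<Rightarrow> 'a" where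
  "loop_of p = c (pathstart p) +++ (p +++ reversepath (c (pathfinish p)))"

definition cls :: "(real \<Rightarrow> 'a) \<Rightarrow> (real \<Rightarrow> 'a) set" where
  "cls p = loop_rel P x `` {loop_of p}"

lemma ends: "path p \<Longrightarrow> path_image p \<subseteq> P \<Longrightarrow> pathstart p \<in> P \<and> pathfinish p \<in> P"
  by auto

lemma loop_of_in:
  assumes "path p" "path_image p \<subseteq> P"
  shows "loop_of p \<in> loops_at P x"
  using assms c[of "pathstart p"] c[of "pathfinish p"] ends[OF assms]
  by (simp add: loops_at_def loop_of_def path_image_join)

lemma class_eq: "p \<in> loops_at P x \<Longrightarrow> q \<in> loops_at P x \<Longrightarrow>
    loop_rel P x `` {p} = loop_rel P x `` {q} \<longleftrightarrow> homotopic_paths P p q"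
  using eq_equiv_class_iff[OF equiv_loop_rel, of p P x q] by (simp add: loop_rel_def)

lemma carrier_G: "carrier G = (\<lambda>p. loop_rel P x `` {p}) ` loops_at P x"
  by (auto simp: fundamental_group_def quotient_def)

lemma cls_in: "path p \<Longrightarrow> path_image p \<subseteq> P \<Longrightarrow> cls p \<in> carrier G"
  using loop_of_in by (auto simp: carrier_G cls_def)

lemma loop_of_conj:
  assumes "path p" "path_image p \<subseteq> P"
  shows "homotopic_paths P (loop_of p +++ c (pathfinish p)) (c (pathstart p) +++ p)"
proof -
  define a b where "a = c (pathstart p)" and "b = c (pathfinish p)"
  note ab = c[OF conjunct1[OF ends[OF assms]], folded a_def] c[OF conjunct2[OF ends[OF assms]], folded b_def]
  have "homotopic_paths P ((a +++ (p +++ reversepath b)) +++ b) (a +++ ((p +++ reversepath b) +++ b))"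
    using assms ab by (intro homotopic_paths_sym[OF homotopic_paths_assoc]) (auto simp: path_image_join)
  moreover have "homotopic_paths P (a +++ ((p +++ reversepath b) +++ b)) (a +++ p)"
    using assms ab by (intro homotopic_paths_join homotopic_paths_cancel_right) (auto simp: homotopic_paths_refl)
  ultimately show ?thesis
    unfolding loop_of_def a_def[symmetric] b_def[symmetric] by (rule homotopic_paths_trans)
qed

lemma loop_of_cong:
  assumes "homotopic_paths P p q"
  shows "homotopic_paths P (loop_of p) (loop_of q)"
proof -
  note pq = homotopic_paths_imp_path[OF assms] homotopic_paths_imp_subset[OF assms]
    homotopic_paths_imp_pathstart[OF assms] homotopic_paths_imp_pathfinish[OF assms]
  show ?thesis
    using pq assms c[of "pathstart p"] c[of "pathfinish p"] ends[of p]
    unfolding loop_of_def by (intro homotopic_paths_join) (auto simp: homotopic_paths_refl)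
qed

lemma cls_eq_iff:
  assumes "path p" "path_image p \<subseteq> P" "path q" "path_image q \<subseteq> P" "pathstart q = pathstart p" "pathfinish q = pathfinish p"
  shows "cls p = cls q \<longleftrightarrow> homotopic_paths P p q"
proof
  assume "homotopic_paths P p q"
  then show "cls p = cls q"
    using loop_of_cong loop_of_in assms class_eq by (simp add: cls_def)
next
  define a b where "a = c (pathstart p)" and "b = c (pathfinish p)"
  note ab = c[OF conjunct1[OF ends[OF assms(1,2)]], folded a_def] c[OF conjunct2[OF ends[OF assms(1,2)]], folded b_def]
  note lp = loop_of_in[OF assms(1,2), unfolded loops_at_def, simplified] loop_of_in[OF assms(3,4), unfolded loops_at_def, simplified]
  assume "cls p = cls q"
  then have "homotopic_paths P (loop_of p) (loop_of q)"
    using loop_of_in assms class_eq by (simp add: cls_def)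
  then have "homotopic_paths P (loop_of p +++ b) (loop_of q +++ b)"
    using ab lp by (intro homotopic_paths_join) (auto simp: homotopic_paths_refl)
  with loop_of_conj[OF assms(1,2)] loop_of_conj[OF assms(3,4)] have "homotopic_paths P (a +++ p) (a +++ q)"
    unfolding assms(5,6) a_def[symmetric] b_def[symmetric] by (blast intro: homotopic_paths_trans homotopic_paths_sym)
  then have "homotopic_paths P (reversepath a +++ (a +++ p)) (reversepath a +++ (a +++ q))"
    using ab by (intro homotopic_paths_join[of P "reversepath a" "reversepath a" "a +++ p" "a +++ q"]) (auto simp: homotopic_paths_refl)
  then show "homotopic_paths P p q"
    using homotopic_paths_cancel_left[of p P a] homotopic_paths_cancel_left[of q P a] assms ab
    by (auto intro: homotopic_paths_trans homotopic_paths_sym)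
qed

text \<open>At the common end point the connecting path is run through backwards and then forwards,
  and this detour cancels.\<close>

lemma cls_join:
  assumes "path p" "path_image p \<subseteq> P" "path q" "path_image q \<subseteq> P" "pathfinish p = pathstart q"
  shows "cls (p +++ q) = cls p \<otimes>\<^bsub>G\<^esub> cls q"
proof -
  define a b e where "a = c (pathstart p)" and "b = c (pathfinish p)" and "e = c (pathfinish q)"
  note abe = c[OF conjunct1[OF ends[OF assms(1,2)]], folded a_def] c[OF conjunct2[OF ends[OF assms(1,2)]], folded b_def]
    c[OF conjunct2[OF ends[OF assms(3,4)]], folded e_def]
  have pq: "path (p +++ q)" "path_image (p +++ q) \<subseteq> P"
    using assms by (auto simp: path_image_join)
  let ?r = "q +++ reversepath e"
  have "homotopic_paths P (loop_of p +++ loop_of q) (a +++ ((p +++ reversepath b) +++ (b +++ ?r)))"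
    unfolding loop_of_def assms(5)[symmetric] a_def[symmetric] b_def[symmetric] e_def[symmetric]
    using assms abe by (intro homotopic_paths_sym[OF homotopic_paths_assoc]) (auto simp: path_image_join)
  moreover have "homotopic_paths P (a +++ ((p +++ reversepath b) +++ (b +++ ?r))) (a +++ (p +++ (reversepath b +++ (b +++ ?r))))"
    using assms abe by (intro homotopic_paths_join homotopic_paths_sym[OF homotopic_paths_assoc]) (auto simp: path_image_join homotopic_paths_refl)
  moreover have "homotopic_paths P (a +++ (p +++ (reversepath b +++ (b +++ ?r)))) (a +++ (p +++ ?r))"
    using assms abe by (intro homotopic_paths_join homotopic_paths_cancel_left) (auto simp: path_image_join homotopic_paths_refl)
  moreover have "homotopic_paths P (a +++ (p +++ ?r)) (loop_of (p +++ q))"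
    unfolding loop_of_def pathstart_join pathfinish_join a_def[symmetric] e_def[symmetric]
    using assms abe by (intro homotopic_paths_join homotopic_paths_assoc) (auto simp: path_image_join homotopic_paths_refl)
  ultimately have "homotopic_paths P (loop_of p +++ loop_of q) (loop_of (p +++ q))"
    by (blast intro: homotopic_paths_trans)
  then have "loop_rel P x `` {loop_of p +++ loop_of q} = loop_rel P x `` {loop_of (p +++ q)}"
    using class_eq loop_of_in assms pq by (simp add: join_loops_at)
  then show ?thesis
    using mult_fundamental_group[OF loop_of_in[OF assms(1,2)] loop_of_in[OF assms(3,4)]] by (simp add: cls_def)
qed

text \<open>Right actions become transports because \<open>cls\<close> is multiplicative on
  concatenations. The two instances are the finite actions of limit groups and right
  multiplication.\<close>

lemma transport_action:
  assumes bij: "\<And>g. g \<in> carrier G \<Longrightarrow> bij_betw (act g) V V"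
    and mult: "\<And>g h e. g \<in> carrier G \<Longrightarrow> h \<in> carrier G \<Longrightarrow> e \<in> V \<Longrightarrow> act (g \<otimes>\<^bsub>G\<^esub> h) e = act h (act g e)"
  shows "transport P V (\<lambda>p. act (cls p))"
proof
  show "locally_starlike P"
    by (rule star)
  show "bij_betw (act (cls p)) V V" if "path p" "path_image p \<subseteq> P" for p
    using bij cls_in that by blast
  show "act (cls p) e = act (cls q) e" if pq: "homotopic_paths P p q" and "e \<in> V" for p q e
  proof -
    have "cls p = cls q"
      using cls_eq_iff[of p q] pq homotopic_paths_imp_path[OF pq] homotopic_paths_imp_subset[OF pq]
        homotopic_paths_imp_pathstart[OF pq] homotopic_paths_imp_pathfinish[OF pq] by simp
    then show ?thesis
      by simp
  qed
  show "act (cls (p +++ q)) e = act (cls q) (act (cls p) e)"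
    if "path p" "path_image p \<subseteq> P" "path q" "path_image q \<subseteq> P" "pathfinish p = pathstart q" "e \<in> V" for p q e
    using that by (simp add: cls_join mult cls_in)
qed

lemma right_mult_bij: "g \<in> carrier G \<Longrightarrow> bij_betw (\<lambda>e. e \<otimes>\<^bsub>G\<^esub> g) (carrier G) (carrier G)"
  by (rule bij_betw_byWitness[where f' = "\<lambda>e. e \<otimes>\<^bsub>G\<^esub> inv\<^bsub>G\<^esub> g"]) (auto simp: G.m_assoc)

definition rep :: "(real \<Rightarrow> 'a) set \<Rightarrow> real \<Rightarrow> 'a" where
  "rep g = (SOME p. p \<in> loops_at P x \<and> g = loop_rel P x `` {p})"

lemma rep: "g \<in> carrier G \<Longrightarrow> rep g \<in> loops_at P x \<and> g = loop_rel P x `` {rep g}"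
proof -
  assume "g \<in> carrier G"
  then have "\<exists>p. p \<in> loops_at P x \<and> g = loop_rel P x `` {p}"
    unfolding carrier_G by (elim imageE) (intro exI conjI)
  then show ?thesis
    unfolding rep_def by (rule someI_ex)
qed

definition path_rep :: "'a \<times> (real \<Rightarrow> 'a) set \<Rightarrow> real \<Rightarrow> 'a" where
  "path_rep w = rep (snd w) +++ c (fst w)"

text \<open>The fibre is the group itself under right multiplication. A point \<open>(y, g)\<close>
  stands for a homotopy class of paths from \<open>x\<close> to \<open>y\<close>, of which
  \<open>path_rep\<close> selects one.\<close>

lemma universal_cover: "based_transport P (carrier G) (\<lambda>p g. g \<otimes>\<^bsub>G\<^esub> cls p) x path_rep"
proof -
  interpret transport P "carrier G" "\<lambda>p g. g \<otimes>\<^bsub>G\<^esub> cls p"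
    by (rule transport_action[where act = "\<lambda>h g. g \<otimes>\<^bsub>G\<^esub> h"]) (auto simp: right_mult_bij G.m_assoc)
  show ?thesis
  proof
    show "x \<in> P"
      by (rule x)
    show "path (path_rep (y, g)) \<and> path_image (path_rep (y, g)) \<subseteq> P \<and> pathstart (path_rep (y, g)) = x \<and>
        pathfinish (path_rep (y, g)) = y" if "y \<in> P" "g \<in> carrier G" for y g
      using rep[OF that(2)] c[OF that(1)] by (auto simp: path_rep_def loops_at_def path_image_join)
    show "homotopic_paths P (path_rep (pathstart p, g) +++ p) (path_rep (pathfinish p, g \<otimes>\<^bsub>G\<^esub> cls p))"
      if p: "path p" "path_image p \<subseteq> P" and g: "g \<in> carrier G" for p g
    proof -
      define a b r where "a = c (pathstart p)" and "b = c (pathfinish p)" and "r = rep g"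
      note ab = c[OF conjunct1[OF ends[OF p]], folded a_def] c[OF conjunct2[OF ends[OF p]], folded b_def]
      have r: "r \<in> loops_at P x" "g = loop_rel P x `` {r}"
        using rep[OF g] by (auto simp: r_def)
      have r': "path r" "path_image r \<subseteq> P" "pathstart r = x" "pathfinish r = x"
        using r by (auto simp: loops_at_def)
      note lp = loop_of_in[OF p]
      have lp': "path (loop_of p)" "path_image (loop_of p) \<subseteq> P" "pathstart (loop_of p) = x" "pathfinish (loop_of p) = x"
        using lp by (auto simp: loops_at_def)
      define r2 where "r2 = rep (g \<otimes>\<^bsub>G\<^esub> cls p)"
      have gp: "g \<otimes>\<^bsub>G\<^esub> cls p \<in> carrier G"
        using g cls_in[OF p] by simp
      have r2: "r2 \<in> loops_at P x" "g \<otimes>\<^bsub>G\<^esub> cls p = loop_rel P x `` {r2}"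
        using rep[OF gp] by (auto simp: r2_def)
      have r2': "path r2" "path_image r2 \<subseteq> P" "pathstart r2 = x" "pathfinish r2 = x"
        using r2 by (auto simp: loops_at_def)
      have "g \<otimes>\<^bsub>G\<^esub> cls p = loop_rel P x `` {r +++ loop_of p}"
        using mult_fundamental_group[OF r(1) lp] r(2) by (simp add: cls_def)
      then have "homotopic_paths P (r +++ loop_of p) r2"
        using class_eq[of "r +++ loop_of p" r2] r2 join_loops_at[OF r(1) lp] by simp
      then have "homotopic_paths P ((r +++ loop_of p) +++ b) (r2 +++ b)"
        using ab lp' r' by (intro homotopic_paths_join) (auto simp: homotopic_paths_refl)
      moreover have "homotopic_paths P (r +++ (loop_of p +++ b)) ((r +++ loop_of p) +++ b)"
        using ab lp' r' by (intro homotopic_paths_assoc) auto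
      moreover have "homotopic_paths P (r +++ (a +++ p)) (r +++ (loop_of p +++ b))"
        using loop_of_conj[OF p, THEN homotopic_paths_sym] r' ab
        unfolding a_def[symmetric] b_def[symmetric] by (intro homotopic_paths_join[of P r r "a +++ p"]) (auto simp: homotopic_paths_refl)
      moreover have "homotopic_paths P ((r +++ a) +++ p) (r +++ (a +++ p))"
        using ab p r' by (intro homotopic_paths_sym[OF homotopic_paths_assoc]) auto
      ultimately have "homotopic_paths P ((r +++ a) +++ p) (r2 +++ b)"
        by (blast intro: homotopic_paths_trans)
      then show ?thesis
        by (simp add: path_rep_def a_def b_def r_def r2_def)
    qed
  qed
qed

end

text \<open>An isomorphism of coverings over the identity of \<open>P\<close>: a permutation of the
  fibre at each point, compatible with transport.\<close>

definition gauge :: "'a::topological_space set \<Rightarrow> 'e set \<Rightarrow> ((real \<Rightarrow> 'a) \<Rightarrow> 'e \<Rightarrow> 'e) \<Rightarrow> ((real \<Rightarrow> 'a) \<Rightarrow> 'e \<Rightarrow> 'e) \<Rightarrow>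
    ('a \<Rightarrow> 'e \<Rightarrow> 'e) \<Rightarrow> bool" where
  "gauge P V \<rho> \<sigma> s \<longleftrightarrow> (\<forall>y\<in>P. bij_betw (s y) V V) \<and>
     (\<forall>p e. path p \<longrightarrow> path_image p \<subseteq> P \<longrightarrow> e \<in> V \<longrightarrow> s (pathfinish p) (\<rho> p e) = \<sigma> p (s (pathstart p) e))"

text \<open>Monodromy of the covering pulled back along \<open>f\<close>.\<close>

definition pull :: "('a \<Rightarrow> 'a) \<Rightarrow> ((real \<Rightarrow> 'a) \<Rightarrow> 'e \<Rightarrow> 'e) \<Rightarrow> (real \<Rightarrow> 'a) \<Rightarrow> 'e \<Rightarrow> 'e" where
  "pull f \<rho> p = \<rho> (f \<circ> p)"

lemma pull_pull: "pull f (pull g \<rho>) = pull (g \<circ> f) \<rho>"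
  by (simp add: pull_def fun_eq_iff comp_assoc)

lemma pull_id [simp]: "pull id \<rho> = \<rho>"
  by (simp add: pull_def fun_eq_iff)

lemma gauge_trans:
  assumes "gauge P V \<rho> \<sigma> s" "gauge P V \<sigma> \<tau> t"
  shows "gauge P V \<rho> \<tau> (\<lambda>y. t y \<circ> s y)"
  unfolding gauge_def
proof (intro conjI ballI allI impI)
  show "bij_betw (t y \<circ> s y) V V" if "y \<in> P" for y
    using assms that by (auto simp: gauge_def intro: bij_betw_trans)
  fix p e assume p: "path p" "path_image p \<subseteq> P" and e: "e \<in> V"
  then have "s (pathstart p) e \<in> V"
    using assms(1) by (auto simp: gauge_def dest: bij_betwE)
  then show "(t (pathfinish p) \<circ> s (pathfinish p)) (\<rho> p e) = \<tau> p ((t (pathstart p) \<circ> s (pathstart p)) e)"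
    using assms p e by (simp add: gauge_def)
qed

lemma gauge_sym:
  assumes s: "gauge P V \<rho> \<sigma> s" and \<rho>: "\<And>p e. path p \<Longrightarrow> path_image p \<subseteq> P \<Longrightarrow> e \<in> V \<Longrightarrow> \<rho> p e \<in> V"
  shows "gauge P V \<sigma> \<rho> (\<lambda>y. inv_into V (s y))"
  unfolding gauge_def
proof (intro conjI ballI allI impI)
  have bij: "bij_betw (s y) V V" if "y \<in> P" for y
    using s that by (simp add: gauge_def)
  then show "bij_betw (inv_into V (s y)) V V" if "y \<in> P" for y
    using that bij_betw_inv_into by blast
  fix p e assume p: "path p" "path_image p \<subseteq> P" and e: "e \<in> V"
  have ends: "pathstart p \<in> P" "pathfinish p \<in> P"
    using p by auto
  define e' where "e' = inv_into V (s (pathstart p)) e"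
  have e': "e' \<in> V" "s (pathstart p) e' = e"
    using bij[OF ends(1)] e unfolding e'_def
    by (auto simp: bij_betw_def inv_into_into f_inv_into_f)
  have "s (pathfinish p) (\<rho> p e') = \<sigma> p e"
    using s p e' by (auto simp: gauge_def)
  then have "inv_into V (s (pathfinish p)) (\<sigma> p e) = \<rho> p e'"
    using bij[OF ends(2)] \<rho>[OF p e'(1)] by (metis bij_betw_def inv_into_f_f)
  then show "inv_into V (s (pathfinish p)) (\<sigma> p e) = \<rho> p (inv_into V (s (pathstart p)) e)"
    by (simp add: e'_def)
qed

lemma gauge_pull:
  assumes s: "gauge P V \<rho> \<sigma> s" and f: "continuous_on P f" "f ` P \<subseteq> P"
  shows "gauge P V (pull f \<rho>) (pull f \<sigma>) (s \<circ> f)"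
  unfolding gauge_def
proof (intro conjI ballI allI impI)
  show "bij_betw ((s \<circ> f) y) V V" if "y \<in> P" for y
    using s f that by (auto simp: gauge_def)
  fix p e assume p: "path p" "path_image p \<subseteq> P" and e: "e \<in> V"
  have "path (f \<circ> p)" "path_image (f \<circ> p) \<subseteq> P"
    using p f path_continuous_image[of p f] continuous_on_subset[of P f "path_image p"] by (auto simp: path_image_compose)
  then show "(s \<circ> f) (pathfinish p) (pull f \<rho> p e) = pull f \<sigma> p ((s \<circ> f) (pathstart p) e)"
    using s e by (auto simp: gauge_def pull_def pathstart_compose pathfinish_compose)
qed

lemma (in transport) transport_pull:
  assumes f: "continuous_on P f" "f ` P \<subseteq> P"
  shows "transport P E (pull f \<rho>)"
proof
  have fp: "path (f \<circ> p)" "path_image (f \<circ> p) \<subseteq> P" if "path p" "path_image p \<subseteq> P" for p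
    using that f path_continuous_image[of p f] continuous_on_subset[of P f "path_image p"] by (auto simp: path_image_compose)
  show "locally_starlike P"
    by (rule star)
  show "bij_betw (pull f \<rho> p) E E" if "path p" "path_image p \<subseteq> P" for p
    using bij fp that by (simp add: pull_def[abs_def])
  show "pull f \<rho> p e = pull f \<rho> q e" if "homotopic_paths P p q" "e \<in> E" for p q e
    unfolding pull_def using f that
    by (intro homotopic) (auto intro!: homotopic_paths_continuous_image simp: image_subset_iff_funcset)
  show "pull f \<rho> (p +++ q) e = pull f \<rho> q (pull f \<rho> p e)"
    if "path p" "path_image p \<subseteq> P" "path q" "path_image q \<subseteq> P" "pathfinish p = pathstart q" "e \<in> E" for p q e
    using that fp by (simp add: pull_def path_compose_join join pathstart_compose pathfinish_compose)
qed

lemma square_homotopic_paths: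
  fixes a :: "real \<times> real \<Rightarrow> 'a::real_normed_vector"
  assumes "continuous_on ({0..1} \<times> {0..1}) a" "a ` ({0..1} \<times> {0..1}) \<subseteq> P"
  shows "homotopic_paths P ((\<lambda>s. a (0, s)) +++ (\<lambda>t. a (t, 1))) ((\<lambda>t. a (t, 0)) +++ (\<lambda>s. a (1, s)))"
proof -
  let ?Q = "{0..1} \<times> {0..1} :: (real \<times> real) set"
  let ?p = "linepath (0, 0) (0, 1) +++ linepath (0, 1) (1, 1) :: real \<Rightarrow> real \<times> real"
  let ?q = "linepath (0, 0) (1, 0) +++ linepath (1, 0) (1, 1) :: real \<Rightarrow> real \<times> real"
  have Q: "convex ?Q"
    by (intro convex_Times) auto
  have seg: "path_image (linepath u v) \<subseteq> ?Q" if "u \<in> ?Q" "v \<in> ?Q" for u v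
    using closed_segment_subset[OF that Q] by simp
  have "homotopic_paths ?Q ?p ?q"
    using convex_imp_simply_connected[OF Q] seg
    by (auto simp: simply_connected_eq_homotopic_paths path_image_join)
  then have "homotopic_paths P (a \<circ> ?p) (a \<circ> ?q)"
    using assms by (auto intro: homotopic_paths_continuous_image simp: image_subset_iff_funcset)
  moreover have "a \<circ> linepath (0, 0) (0, 1) = (\<lambda>s. a (0, s))" "a \<circ> linepath (0, 1) (1, 1) = (\<lambda>t. a (t, 1))"
    "a \<circ> linepath (0, 0) (1, 0) = (\<lambda>t. a (t, 0))" "a \<circ> linepath (1, 0) (1, 1) = (\<lambda>s. a (1, s))"
    by (auto simp: fun_eq_iff linepath_def)
  ultimately show ?thesis
    by (simp add: path_compose_join)
qed

text \<open>Homotopic maps have isomorphic pullbacks: transport along the tracks is compatible with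
  paths since the two ways around the square over a path are homotopic.\<close>

lemma (in transport) gauge_homotopic:
  assumes h: "continuous_on ({0..1::real} \<times> P) h" "h ` ({0..1} \<times> P) \<subseteq> P"
  shows "gauge P E (pull (\<lambda>y. h (0, y)) \<rho>) (pull (\<lambda>y. h (1, y)) \<rho>) (\<lambda>y. \<rho> (\<lambda>t. h (t, y)))"
  unfolding gauge_def
proof (intro conjI ballI allI impI)
  have track: "path (\<lambda>t. h (t, y))" "path_image (\<lambda>t. h (t, y)) \<subseteq> P" if "y \<in> P" for y
    using h that unfolding path_def path_image_def
    by (auto intro!: continuous_on_compose2[OF h(1)] continuous_on_Pair continuous_on_id continuous_on_const)
  show "bij_betw (\<rho> (\<lambda>t. h (t, y))) E E" if "y \<in> P" for y
    using bij track that by simp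
  fix p e assume p: "path p" "path_image p \<subseteq> P" and e: "e \<in> E"
  define a where "a w = h (fst w, p (snd w))" for w
  have pin: "p s \<in> P" if "s \<in> {0..1}" for s
    using p that by (auto simp: path_image_def)
  have "continuous_on ({0..1} \<times> {0..1::real}) (\<lambda>w. p (snd w))"
    by (rule continuous_on_compose2[OF p(1)[unfolded path_def]]) (auto intro: continuous_intros)
  then have "continuous_on ({0..1::real} \<times> {0..1::real}) a"
    unfolding a_def[abs_def] using pin
    by (intro continuous_on_compose2[OF h(1)] continuous_on_Pair continuous_on_fst continuous_on_id) auto
  moreover have "a ` ({0..1} \<times> {0..1}) \<subseteq> P"
    using h(2) pin by (auto simp: a_def)
  ultimately have *: "homotopic_paths P ((\<lambda>s. a (0, s)) +++ (\<lambda>t. a (t, 1))) ((\<lambda>t. a (t, 0)) +++ (\<lambda>s. a (1, s)))"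
    by (rule square_homotopic_paths)
  have side: "path (\<lambda>s. a (i, s))" "path_image (\<lambda>s. a (i, s)) \<subseteq> P" if "i \<in> {0..1}" for i
  proof -
    have "continuous_on {0..1} (\<lambda>s. h (i, p s))"
      using p pin that by (intro continuous_on_compose2[OF h(1)] continuous_on_Pair continuous_on_const) (auto simp: path_def)
    then show "path (\<lambda>s. a (i, s))" "path_image (\<lambda>s. a (i, s)) \<subseteq> P"
      using h(2) pin that by (auto simp: a_def path_def path_image_def)
  qed
  have ends: "p 0 \<in> P" "p 1 \<in> P"
    using pin by auto
  have "\<rho> (\<lambda>t. a (t, 1)) (\<rho> (\<lambda>s. a (0, s)) e) = \<rho> ((\<lambda>s. a (0, s)) +++ (\<lambda>t. a (t, 1))) e"
    using side[of 0] track[OF ends(2)] e by (intro join[symmetric]) (auto simp: a_def pathstart_def pathfinish_def)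
  also have "\<dots> = \<rho> ((\<lambda>t. a (t, 0)) +++ (\<lambda>s. a (1, s))) e"
    by (rule homotopic[OF * e])
  also have "\<dots> = \<rho> (\<lambda>s. a (1, s)) (\<rho> (\<lambda>t. a (t, 0)) e)"
    using side[of 1] track[OF ends(1)] e by (intro join) (auto simp: a_def pathstart_def pathfinish_def)
  finally show "\<rho> (\<lambda>t. h (t, pathfinish p)) (pull (\<lambda>y. h (0, y)) \<rho> p e) =
      pull (\<lambda>y. h (1, y)) \<rho> p (\<rho> (\<lambda>t. h (t, pathstart p)) e)"
    by (simp add: a_def pull_def comp_def pathstart_def pathfinish_def)
qed

subsection \<open>Periodicity of finite coverings under a self-domination\<close>

text \<open>The local degrees at the centres of the triangles embed the second homology in a power of the integers,
  where a surjective endomorphism is injective.\<close>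

lemma (in complex_cover) homology_injective:
  assumes dim: "\<And>S. S \<in> \<T> \<Longrightarrow> aff_dim S \<le> 2" and E: "finite E"
    and D: "continuous_map X X D" and R: "continuous_map X X R"
    and DR: "homotopic_with (\<lambda>_. True) X X (D \<circ> R) id"
    and z: "singular_relcycle 2 X {} z" and bd: "singular_relboundary 2 X {} (chain_map 2 D z)"
  shows "singular_relboundary 2 X {} z"
proof -
  have skel2: "skel 2 = \<Union>\<T>"
    using dim by (auto simp: skel_def)
  let ?A = "homology_group 2 X"
  let ?\<phi> = "hom_induced 2 X {} X {} D"
  let ?loc = "\<lambda>i. relative_homology_group 2 X (topspace X - {(centre (fst i), snd i)})"
  let ?ind = "\<lambda>i. hom_induced 2 X {} X (topspace X - {(centre (fst i), snd i)}) id"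
  define I where "I = {S \<in> \<T>. aff_dim S = 2} \<times> E"
  have "\<exists>j. j \<in> iso (?loc i) integer_group" if "i \<in> I" for i
  proof -
    have "?loc i \<cong> integer_group"
      using local_homology_triangle[of "fst i" "snd i"] that by (auto simp: I_def skel2)
    then show ?thesis
      by (auto simp: is_iso_def)
  qed
  then obtain j where j: "\<And>i. i \<in> I \<Longrightarrow> j i \<in> iso (?loc i) integer_group"
    by metis
  \<comment> \<open>The local degree at the centre of a triangle of the covering. With a finite
    fibre there are finitely many of them, and by \<open>boundary_if_locally_boundary\<close> they
    jointly separate homology classes.\<close>
  define lam where "lam i = j i \<circ> ?ind i" for i
  let ?x = "homologous_rel_set 2 X {} z"
  have car: "carrier ?A = homologous_rel_set 2 X {} ` singular_relcycle_set 2 X {}"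
    using carrier_relative_homology_group[of 2 X "{}"] by simp
  have one: "\<one>\<^bsub>relative_homology_group 2 X S\<^esub> = singular_relboundary_set 2 X S" for S
    using one_relative_homology_group[of 2 X S] by simp
  have "?x = \<one>\<^bsub>?A\<^esub>"
  proof (rule surj_endomorphism_finite_rank_inj[of ?A ?\<phi> I lam])
    show "comm_group ?A"
      by simp
    show phi: "?\<phi> \<in> hom ?A ?A"
      by (rule hom_induced_empty_hom)
    show "?\<phi> ` carrier ?A = carrier ?A"
    proof
      show "?\<phi> ` carrier ?A \<subseteq> carrier ?A"
        using hom_in_carrier[OF phi] by blast
      show "carrier ?A \<subseteq> ?\<phi> ` carrier ?A"
      proof
        fix y assume y: "y \<in> carrier ?A"
        have "?\<phi> (hom_induced 2 X {} X {} R y) = hom_induced 2 X {} X {} (D \<circ> R) y"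
          using hom_induced_compose'[OF R _ D, of "{}" "{}" "{}" 2 y] by simp
        also have "\<dots> = hom_induced 2 X {} X {} id y"
          using homology_homotopy_empty[OF DR, of 2] by simp
        also have "\<dots> = y"
          by (rule hom_induced_id[OF y])
        finally have "y = ?\<phi> (hom_induced 2 X {} X {} R y)" ..
        moreover have "hom_induced 2 X {} X {} R y \<in> carrier ?A"
          using hom_in_carrier[OF hom_induced_empty_hom y] .
        ultimately show "y \<in> ?\<phi> ` carrier ?A"
          by blast
      qed
    qed
    show "finite I"
      using finite_T E by (simp add: I_def)
    show "lam i \<in> hom ?A integer_group" if "i \<in> I" for i
      unfolding lam_def using hom_induced_hom j[OF that] by (blast intro: hom_compose dest: iso_imp_homomorphism)
    show "y = \<one>\<^bsub>?A\<^esub>" if y: "y \<in> carrier ?A" and l: "\<And>i. i \<in> I \<Longrightarrow> lam i y = 0" for y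
    proof -
      obtain c where c: "singular_relcycle 2 X {} c" "y = homologous_rel_set 2 X {} c"
        using y by (auto simp: car)
      have "singular_relboundary 2 X {} c"
      proof (rule boundary_if_locally_boundary[OF dim c(1)])
        fix S e assume S: "S \<in> \<T>" "aff_dim S = 2" and e: "e \<in> E"
        then have i: "(S, e) \<in> I"
          by (simp add: I_def)
        let ?T = "topspace X - {(centre S, e)}"
        have "j (S, e) \<in> iso (?loc (S, e)) integer_group"
          by (rule j[OF i])
        moreover have "?ind (S, e) y \<in> carrier (?loc (S, e))"
          by (rule hom_in_carrier[OF hom_induced_hom y])
        moreover have "j (S, e) (?ind (S, e) y) = 0"
          using l[OF i] by (simp add: lam_def)
        ultimately have "?ind (S, e) y = \<one>\<^bsub>?loc (S, e)\<^esub>"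
          using group_hom.iso_iff[of "?loc (S, e)" integer_group "j (S, e)"]
          by (simp add: group_hom_def group_hom_axioms_def iso_imp_homomorphism)
        moreover have "?ind (S, e) y = homologous_rel_set 2 X ?T (chain_map 2 id c)"
          unfolding c(2) fst_conv snd_conv using hom_induced_chain_map[of X X id "{}" ?T 2 c] c(1) by simp
        moreover have "chain_map 2 id c = c"
          using c(1) by (intro chain_map_ident[of 2 X]) (simp add: singular_relcycle_def)
        ultimately show "singular_relboundary 2 X ?T c"
          by (simp add: one flip: homologous_rel_set_eq_relboundary)
      qed
      then show ?thesis
        by (simp add: c(2) one homologous_rel_set_eq_relboundary)
    qed
    show "?x \<in> carrier ?A"
      using z by (auto simp: car)
    have "?\<phi> ?x = homologous_rel_set 2 X {} (chain_map 2 D z)"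
      using hom_induced_chain_map[OF D _ z, of "{}"] by simp
    then show "?\<phi> ?x = \<one>\<^bsub>?A\<^esub>"
      using bd by (simp add: one homologous_rel_set_eq_relboundary)
  qed
  then show ?thesis
    by (simp add: one homologous_rel_set_eq_relboundary)
qed

section \<open>Transports determined by generating loops\<close>

context based_paths begin

text \<open>The group elements on whose representing loops both transports agree form a subgroup.
  The induction over \<open>generate\<close> is stated for all representatives at once, so that it
  can pass between homotopic loops.\<close>

lemma transport_agree_on_loops:
  assumes \<rho>: "transport P V \<rho>" and \<sigma>: "transport P V \<sigma>"
    and gen: "S \<subseteq> carrier G" "generate G S = carrier G"
    and eq: "\<And>g e. g \<in> S \<Longrightarrow> e \<in> V \<Longrightarrow> \<rho> (rep g) e = \<sigma> (rep g) e"
    and p: "p \<in> loops_at P x" and e: "e \<in> V"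
  shows "\<rho> p e = \<sigma> p e"
proof -
  interpret \<rho>: transport P V \<rho> by (rule \<rho>)
  interpret \<sigma>: transport P V \<sigma> by (rule \<sigma>)
  have loop: "path q \<and> path_image q \<subseteq> P \<and> pathstart q = x \<and> pathfinish q = x" if "q \<in> loops_at P x" for q
    using that by (simp add: loops_at_def)
  have one: "\<one>\<^bsub>G\<^esub> = loop_rel P x `` {linepath x x}"
    by (simp add: fundamental_group_def)
  have lin: "linepath x x \<in> loops_at P x"
    using x by (simp add: loops_at_def)
  have main: "\<forall>q e. q \<in> loops_at P x \<longrightarrow> g = loop_rel P x `` {q} \<longrightarrow> e \<in> V \<longrightarrow> \<rho> q e = \<sigma> q e"
    if "g \<in> generate G S" for g
    using that
  proof (induction g rule: generate.induct)
    case one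
    show ?case
    proof (intro allI impI)
      fix q e assume q: "q \<in> loops_at P x" "\<one>\<^bsub>G\<^esub> = loop_rel P x `` {q}" and e: "e \<in> V"
      then have "homotopic_paths P q (linepath x x)"
        using class_eq[OF q(1) lin] \<open>\<one>\<^bsub>G\<^esub> = loop_rel P x `` {linepath x x}\<close> by simp
      then show "\<rho> q e = \<sigma> q e"
        using \<rho>.homotopic[of q "linepath x x" e] \<sigma>.homotopic[of q "linepath x x" e] e \<rho>.rho_const[OF x e] \<sigma>.rho_const[OF x e] by simp
    qed
  next
    case (incl h)
    show ?case
    proof (intro allI impI)
      fix q e assume q: "q \<in> loops_at P x" "h = loop_rel P x `` {q}" and e: "e \<in> V"
      have h: "h \<in> carrier G"
        using incl gen by blast
      have "loop_rel P x `` {q} = loop_rel P x `` {rep h}"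
        using rep[OF h] q by simp
      then have "homotopic_paths P q (rep h)"
        using class_eq[OF q(1), of "rep h"] rep[OF h] by blast
      then show "\<rho> q e = \<sigma> q e"
        using \<rho>.homotopic[of q "rep h" e] \<sigma>.homotopic[of q "rep h" e] e eq[OF incl e] by simp
    qed
  next
    case (inv h)
    show ?case
    proof (intro allI impI)
      fix q e assume q: "q \<in> loops_at P x" "inv\<^bsub>G\<^esub> h = loop_rel P x `` {q}" and e: "e \<in> V"
      have h: "h \<in> carrier G"
        using inv gen by blast
      have r: "rep h \<in> loops_at P x" "h = loop_rel P x `` {rep h}"
        using rep[OF h] by blast+
      have "loop_rel P x `` {q +++ rep h} = inv\<^bsub>G\<^esub> h \<otimes>\<^bsub>G\<^esub> h"
        using mult_fundamental_group[OF q(1) r(1)] q(2) r(2) by simp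
      then have "loop_rel P x `` {q +++ rep h} = loop_rel P x `` {linepath x x}"
        using h one by simp
      then have "homotopic_paths P (q +++ rep h) (linepath x x)"
        using class_eq[OF join_loops_at[OF q(1) r(1)] lin] by simp
      then have "\<rho> (q +++ rep h) e = e" "\<sigma> (q +++ rep h) e = e"
        using \<rho>.homotopic[of "q +++ rep h" "linepath x x" e] \<sigma>.homotopic[of "q +++ rep h" "linepath x x" e] e
          \<rho>.rho_const[OF x e] \<sigma>.rho_const[OF x e] by simp_all
      moreover have "\<rho> (q +++ rep h) e = \<rho> (rep h) (\<rho> q e)" "\<sigma> (q +++ rep h) e = \<sigma> (rep h) (\<sigma> q e)"
        using loop[OF q(1)] loop[OF r(1)] e by (auto intro!: \<rho>.join \<sigma>.join)
      moreover have in_V: "\<rho> q e \<in> V" "\<sigma> q e \<in> V"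
        using loop[OF q(1)] e by (auto intro: \<rho>.rho_in \<sigma>.rho_in)
      ultimately have "\<sigma> (rep h) (\<rho> q e) = \<sigma> (rep h) (\<sigma> q e)"
        using eq[OF inv in_V(1)] by simp
      then show "\<rho> q e = \<sigma> q e"
        using \<sigma>.rho_inj[of "rep h"] loop[OF r(1)] in_V by simp
    qed
  next
    case (eng h1 h2)
    show ?case
    proof (intro allI impI)
      fix q e assume q: "q \<in> loops_at P x" "h1 \<otimes>\<^bsub>G\<^esub> h2 = loop_rel P x `` {q}" and e: "e \<in> V"
      have h: "h1 \<in> carrier G" "h2 \<in> carrier G"
        using eng(1,2) gen(2) by auto
      have r: "rep h1 \<in> loops_at P x" "h1 = loop_rel P x `` {rep h1}" "rep h2 \<in> loops_at P x" "h2 = loop_rel P x `` {rep h2}"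
        using rep[OF h(1)] rep[OF h(2)] by blast+
      have "loop_rel P x `` {q} = loop_rel P x `` {rep h1 +++ rep h2}"
        using mult_fundamental_group[OF r(1,3)] q(2) r(2,4) by simp
      then have "homotopic_paths P q (rep h1 +++ rep h2)"
        using class_eq[OF q(1) join_loops_at[OF r(1,3)]] by simp
      then have "\<rho> q e = \<rho> (rep h1 +++ rep h2) e" "\<sigma> q e = \<sigma> (rep h1 +++ rep h2) e"
        using \<rho>.homotopic \<sigma>.homotopic e by blast+
      moreover have "\<rho> (rep h1 +++ rep h2) e = \<rho> (rep h2) (\<rho> (rep h1) e)" "\<sigma> (rep h1 +++ rep h2) e = \<sigma> (rep h2) (\<sigma> (rep h1) e)"
        using loop[OF r(1)] loop[OF r(3)] e by (auto intro!: \<rho>.join \<sigma>.join)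
      moreover have "\<rho> (rep h1) e \<in> V"
        using loop[OF r(1)] e by (auto intro: \<rho>.rho_in)
      ultimately show "\<rho> q e = \<sigma> q e"
        using eng(3)[rule_format, OF r(1,2) e] eng(4)[rule_format, OF r(3,4)] by simp
    qed
  qed
  have "loop_rel P x `` {p} \<in> generate G S"
    using p gen(2) by (auto simp: carrier_G)
  from main[OF this, rule_format, OF p HOL.refl e] show ?thesis .
qed

text \<open>Go back to the base point with \<rho> and out again with \<sigma>. Compatibility along a
  path amounts to agreement of both transports on the loop that closes it up.\<close>

lemma gauge_from_loops:
  assumes \<rho>: "transport P V \<rho>" and \<sigma>: "transport P V \<sigma>"
    and eq: "\<And>p e. p \<in> loops_at P x \<Longrightarrow> e \<in> V \<Longrightarrow> \<rho> p e = \<sigma> p e"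
  shows "gauge P V \<rho> \<sigma> (\<lambda>y. \<sigma> (c y) \<circ> \<rho> (reversepath (c y)))"
  unfolding gauge_def
proof (intro conjI ballI allI impI)
  interpret \<rho>: transport P V \<rho> by (rule \<rho>)
  interpret \<sigma>: transport P V \<sigma> by (rule \<sigma>)
  have bij: "bij_betw (\<rho> (reversepath (c y))) V V" "bij_betw (\<sigma> (c y)) V V" if "y \<in> P" for y
    using c[OF that] by (simp_all add: \<rho>.bij \<sigma>.bij)
  show "bij_betw (\<sigma> (c y) \<circ> \<rho> (reversepath (c y))) V V" if "y \<in> P" for y
    using bij[OF that] by (rule bij_betw_trans)
  fix p e assume p: "path p" "path_image p \<subseteq> P" and e: "e \<in> V"
  define a b where "a = c (pathstart p)" and "b = c (pathfinish p)"
  note ab = c[OF conjunct1[OF ends[OF p]], folded a_def] c[OF conjunct2[OF ends[OF p]], folded b_def]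
  define e' where "e' = \<rho> (reversepath a) e"
  have e': "e' \<in> V" "\<rho> a e' = e"
    using ab e \<rho>.rho_reverse[of "reversepath a" e] \<rho>.rho_in[of "reversepath a" e] by (simp_all add: e'_def)
  have l: "\<rho> (loop_of p) e' = \<rho> (reversepath b) (\<rho> p e)"
  proof -
    have "\<rho> (loop_of p) e' = \<rho> (p +++ reversepath b) (\<rho> a e')"
      unfolding loop_of_def a_def[symmetric] b_def[symmetric]
      using ab p e' by (intro \<rho>.join) (auto simp: path_image_join)
    also have "\<dots> = \<rho> (reversepath b) (\<rho> p e)"
      using ab p e e'(2) by (simp add: \<rho>.join)
    finally show ?thesis .
  qed
  have s: "\<sigma> (loop_of p) e' = \<sigma> (reversepath b) (\<sigma> p (\<sigma> a e'))"
  proof -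
    have "\<sigma> (loop_of p) e' = \<sigma> (p +++ reversepath b) (\<sigma> a e')"
      unfolding loop_of_def a_def[symmetric] b_def[symmetric]
      using ab p e' by (intro \<sigma>.join) (auto simp: path_image_join)
    also have "\<dots> = \<sigma> (reversepath b) (\<sigma> p (\<sigma> a e'))"
      using ab p e' by (simp add: \<sigma>.join \<sigma>.rho_in)
    finally show ?thesis .
  qed
  have "\<sigma> b (\<rho> (reversepath b) (\<rho> p e)) = \<sigma> b (\<sigma> (reversepath b) (\<sigma> p (\<sigma> a e')))"
    using l s eq[OF loop_of_in[OF p] e'(1)] by simp
  also have "\<dots> = \<sigma> p (\<sigma> a e')"
    using ab p e' \<sigma>.rho_reverse[of "reversepath b" "\<sigma> p (\<sigma> a e')"] by (simp add: \<sigma>.rho_in)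
  finally show "(\<sigma> (c (pathfinish p)) \<circ> \<rho> (reversepath (c (pathfinish p)))) (\<rho> p e) =
      \<sigma> p ((\<sigma> (c (pathstart p)) \<circ> \<rho> (reversepath (c (pathstart p)))) e)"
    by (simp add: a_def b_def e'_def)
qed

end

lemma (in transport) gauge_homotopic_canon:
  assumes "homotopic_with_canon (\<lambda>_. True) P P f g"
  obtains s where "gauge P E (pull f \<rho>) (pull g \<rho>) s"
proof -
  obtain h where h: "continuous_map (prod_topology (top_of_set {0..1::real}) (top_of_set P)) (top_of_set P) h"
    "\<forall>y. h (0, y) = f y" "\<forall>y. h (1, y) = g y"
    using assms unfolding homotopic_with_def by (elim exE conjE) (rule that)
  have "continuous_on ({0..1::real} \<times> P) h" "h ` ({0..1} \<times> P) \<subseteq> P"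
    using h(1) by (auto simp: prod_topology_subtopology_eu)
  from gauge_homotopic[OF this] that show ?thesis
    using h(2,3) by simp
qed

lemma funpow_map:
  fixes f :: "'a::topological_space \<Rightarrow> 'a"
  assumes "continuous_on P f" "f ` P \<subseteq> P"
  shows "continuous_on P (f ^^ i)" "(f ^^ i) ` P \<subseteq> P"
proof -
  have "continuous_on P (f ^^ i) \<and> (f ^^ i) ` P \<subseteq> P"
  proof (induction i)
    case (Suc i)
    then show ?case
      using assms by (auto simp: image_subset_iff intro!: continuous_on_compose[of P "f ^^ i" f, unfolded comp_def] intro: continuous_on_subset)
  qed auto
  then show "continuous_on P (f ^^ i)" "(f ^^ i) ` P \<subseteq> P"
    by auto
qed

locale self_domination = complex2 \<T> + based_paths "\<Union>\<T>" x c
  for \<T> :: "'a::euclidean_space set set" and x c +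
  fixes d u :: "'a \<Rightarrow> 'a"
  assumes dim: "S \<in> \<T> \<Longrightarrow> aff_dim S \<le> 2"
    and d: "continuous_on (\<Union>\<T>) d" "d ` \<Union>\<T> \<subseteq> \<Union>\<T>"
    and u: "continuous_on (\<Union>\<T>) u" "u ` \<Union>\<T> \<subseteq> \<Union>\<T>"
    and du: "homotopic_with_canon (\<lambda>_. True) (\<Union>\<T>) (\<Union>\<T>) (d \<circ> u) id"
    and limit: "limit_group (fundamental_group (\<Union>\<T>) x)"
begin

abbreviation P where "P \<equiv> \<Union>\<T>"

lemma du_pow: "homotopic_with_canon (\<lambda>_. True) P P ((d ^^ i) \<circ> (u ^^ i)) id"
proof (induction i)
  case 0
  then show ?case
    by simp
next
  case (Suc i)
  have "homotopic_with_canon (\<lambda>_. True) P P ((d ^^ i) \<circ> (d \<circ> u)) ((d ^^ i) \<circ> id)"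
    by (rule homotopic_with_compose_continuous_map_left[OF du]) (use funpow_map[OF d, of i] in auto)
  then have "homotopic_with_canon (\<lambda>_. True) P P (((d ^^ i) \<circ> (d \<circ> u)) \<circ> (u ^^ i)) (((d ^^ i) \<circ> id) \<circ> (u ^^ i))"
    by (rule homotopic_with_compose_continuous_map_right) (use funpow_map[OF u, of i] in auto)
  moreover have "((d ^^ i) \<circ> (d \<circ> u)) \<circ> (u ^^ i) = (d ^^ Suc i) \<circ> (u ^^ Suc i)"
    by (simp add: fun_eq_iff funpow_swap1)
  ultimately have "homotopic_with_canon (\<lambda>_. True) P P ((d ^^ Suc i) \<circ> (u ^^ Suc i)) ((d ^^ i) \<circ> (u ^^ i))"
    by (simp del: funpow.simps)
  then show ?case
    by (rule homotopic_with_trans[OF _ Suc])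
qed

text \<open>A transport with finite fibre is determined up to gauge by its values on finitely many loops, so two of
  its pullbacks along powers of \<open>d\<close> are equivalent; pulling back along a power of \<open>u\<close> cancels the smaller
  exponent.\<close>

lemma periodic:
  assumes \<rho>: "transport P V \<rho>" and V: "finite V"
  obtains k s where "1 \<le> k" "gauge P V \<rho> (pull (d ^^ k) \<rho>) s"
proof -
  interpret transport P V \<rho> by (rule \<rho>)
  obtain S where S: "finite S" "S \<subseteq> carrier G" "generate G S = carrier G"
    using limit by (auto simp: limit_group_def finitely_generated_group_def)
  \<comment> \<open>The monodromy of the pullback along \<open>d ^^ i\<close> on the generating
    loops is a point of a finite set that does not depend on \<open>i\<close>, so two exponents give
    the same point.\<close>
  define tup where "tup i = restrict (\<lambda>w. pull (d ^^ i) \<rho> (rep (fst w)) (snd w)) (S \<times> V)" for i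
  have tr: "transport P V (pull (d ^^ i) \<rho>)" for i
    by (rule transport_pull[OF funpow_map[OF d]])
  have "tup i \<in> (S \<times> V) \<rightarrow>\<^sub>E V" for i
  proof -
    interpret i: transport P V "pull (d ^^ i) \<rho>" by (rule tr)
    show ?thesis
      unfolding tup_def restrict_PiE_iff
    proof
      fix w assume w: "w \<in> S \<times> V"
      then have "rep (fst w) \<in> loops_at P x"
        using rep S(2) by auto
      then show "pull (d ^^ i) \<rho> (rep (fst w)) (snd w) \<in> V"
        using w by (intro i.rho_in) (simp_all add: loops_at_def mem_Times_iff)
    qed
  qed
  moreover have "finite ((S \<times> V) \<rightarrow>\<^sub>E V)"
    using S V by (intro finite_PiE) auto
  ultimately have "finite (range tup)"
    by (auto intro: finite_subset)
  then have "\<not> inj tup"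
    using finite_imageD infinite_UNIV_nat by blast
  then obtain i j where ij: "i < j" "tup i = tup j"
    unfolding inj_def by (metis nat_neq_iff)
  have eq: "pull (d ^^ i) \<rho> (rep g) e = pull (d ^^ j) \<rho> (rep g) e" if "g \<in> S" "e \<in> V" for g e
    using fun_cong[OF ij(2), of "(g, e)"] that by (simp add: tup_def)
  obtain s0 where s0: "gauge P V (pull (d ^^ i) \<rho>) (pull (d ^^ j) \<rho>) s0"
    using gauge_from_loops[OF tr tr transport_agree_on_loops[OF tr tr S(2,3) eq]] by blast
  define k where "k = j - i"
  have k: "1 \<le> k" "d ^^ j = (d ^^ k) \<circ> (d ^^ i)"
    using ij(1) by (auto simp: k_def simp flip: funpow_add)
  interpret k: transport P V "pull (d ^^ k) \<rho>" by (rule tr)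
  have "gauge P V (pull ((d ^^ i) \<circ> (u ^^ i)) \<rho>) (pull ((d ^^ i) \<circ> (u ^^ i)) (pull (d ^^ k) \<rho>)) (s0 \<circ> (u ^^ i))"
    using gauge_pull[OF s0 funpow_map[OF u, of i]] by (simp add: pull_pull k(2) comp_assoc)
  moreover obtain s2 where s2: "gauge P V (pull ((d ^^ i) \<circ> (u ^^ i)) (pull (d ^^ k) \<rho>)) (pull id (pull (d ^^ k) \<rho>)) s2"
    by (rule k.gauge_homotopic_canon[OF du_pow])
  moreover obtain s1 where s1: "gauge P V (pull id \<rho>) (pull ((d ^^ i) \<circ> (u ^^ i)) \<rho>) s1"
    by (rule gauge_homotopic_canon[OF homotopic_with_symD[OF du_pow]])
  ultimately have "\<exists>s. gauge P V (pull id \<rho>) (pull id (pull (d ^^ k) \<rho>)) s"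
    using gauge_trans by blast
  then show ?thesis
    using that k(1) by auto
qed

text \<open>If the classes differed, some finite covering would separate them. A power of
  \<open>d\<close> lifts to it by bijections of the fibres, so the images under that power would act
  differently on the fibre, although they are homotopic.\<close>

lemma paths_injective:
  assumes p: "path p" "path_image p \<subseteq> P" and q: "path q" "path_image q \<subseteq> P"
    and ends: "pathstart q = pathstart p" "pathfinish q = pathfinish p"
    and dpq: "homotopic_paths P (d \<circ> p) (d \<circ> q)"
  shows "homotopic_paths P p q"
proof (rule ccontr)
  assume "\<not> homotopic_paths P p q"
  then have ne: "cls p \<noteq> cls q"
    using cls_eq_iff[OF p q ends] by simp
  have S: "finite {cls p, cls q}" "{cls p, cls q} \<subseteq> carrier G"
    using cls_in p q by auto
  obtain V :: "nat word set" and act e0 where V: "finite V" "e0 \<in> V"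
    and act: "\<And>g. g \<in> carrier G \<Longrightarrow> bij_betw (act g) V V"
      "\<And>g h e. g \<in> carrier G \<Longrightarrow> h \<in> carrier G \<Longrightarrow> e \<in> V \<Longrightarrow> act (g \<otimes>\<^bsub>G\<^esub> h) e = act h (act g e)"
    and inj: "inj_on (\<lambda>g. act g e0) {cls p, cls q}"
    by (rule limit_group_finite_action[OF limit S]) (rule that)
  interpret transport P V "\<lambda>p. act (cls p)"
    by (rule transport_action[OF act])
  obtain k s where k: "1 \<le> k" and s: "gauge P V (\<lambda>p. act (cls p)) (pull (d ^^ k) (\<lambda>p. act (cls p))) s"
    by (rule periodic[OF transport_axioms V(1)])
  obtain m where m: "k = Suc m"
    using k by (cases k) auto
  have "homotopic_paths P ((d ^^ m) \<circ> (d \<circ> p)) ((d ^^ m) \<circ> (d \<circ> q))"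
    using dpq funpow_map[OF d, of m] by (auto intro: homotopic_paths_continuous_image simp: image_subset_iff_funcset)
  then have h: "homotopic_paths P ((d ^^ k) \<circ> p) ((d ^^ k) \<circ> q)"
    by (simp add: m comp_assoc funpow_Suc_right del: funpow.simps)
  have bs: "bij_betw (s y) V V" if "y \<in> P" for y
    using s that unfolding gauge_def by blast
  have pe: "pathstart p \<in> P" "pathfinish p \<in> P"
    using ends p by auto
  have e: "s (pathstart p) e0 \<in> V" and bij: "bij_betw (s (pathfinish p)) V V"
    using bij_betwE[OF bs[OF pe(1)]] bs[OF pe(2)] V(2) by auto
  have "s (pathfinish p) (act (cls p) e0) = s (pathfinish p) (act (cls q) e0)"
    using s p q ends V(2) homotopic[OF h e] by (auto simp: gauge_def pull_def)
  moreover have "act (cls p) e0 \<in> V" "act (cls q) e0 \<in> V"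
    using rho_in p q V(2) by auto
  ultimately have "act (cls p) e0 = act (cls q) e0"
    by (rule inj_onD[OF bij_betw_imp_inj_on[OF bij]])
  then show False
    using inj ne by simp
qed

end

subsection \<open>Injectivity on discs\<close>

definition tri_simplex :: "(real \<times> real \<Rightarrow> 'b) \<Rightarrow> (nat \<Rightarrow> real) \<Rightarrow> 'b" where
  "tri_simplex \<alpha> = restrict (\<lambda>y. \<alpha> (y 0, y 2)) (standard_simplex 2)"

lemma tri_simplex_tr [simp]: "z \<in> T2 \<Longrightarrow> tri_simplex \<alpha> (tr z) = \<alpha> z"
  using tr_in[of z] by (simp add: tri_simplex_def) (simp add: tr_def tri_def)

lemma simplex_2_tr: "y \<in> standard_simplex 2 \<Longrightarrow> (y 0, y 2) \<in> T2"
  unfolding simplex_2_iff by (auto simp: T2_def tri_def)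

lemma simplex_boundary_2_tr: "y \<in> simplex_boundary 2 \<Longrightarrow> (y 0, y 2) \<in> bT2"
  by (erule boundary_tri) (auto simp: bT2_def T2_def tri_def)

lemma singular_simplex_tri:
  assumes "continuous_map (top_of_set T2) X \<alpha>"
  shows "singular_simplex 2 X (tri_simplex \<alpha>)"
proof -
  have "continuous_map (top_of_set (standard_simplex 2)) (top_of_set T2) (\<lambda>y. (y 0, y 2))"
    using simplex_2_tr by (auto intro!: continuous_on_Pair continuous_on_coord)
  then have "continuous_map (top_of_set (standard_simplex 2)) X (\<alpha> \<circ> (\<lambda>y. (y 0, y 2)))"
    using assms by (rule continuous_map_compose)
  then have "continuous_map (top_of_set (standard_simplex 2)) X (tri_simplex \<alpha>)"
    by (rule continuous_map_eq) (simp add: tri_simplex_def)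
  then show ?thesis
    by (simp add: singular_simplex_def simplex_topology) (simp add: tri_simplex_def)
qed

lemma tri_simplex_cong: "(\<And>z. z \<in> T2 \<Longrightarrow> \<alpha> z = \<beta> z) \<Longrightarrow> tri_simplex \<alpha> = tri_simplex \<beta>"
  using simplex_2_tr by (auto simp: tri_simplex_def fun_eq_iff restrict_def)

lemma chain_map_tri:
  "chain_map 2 f (frag_of (tri_simplex \<alpha>) - frag_of (tri_simplex \<beta>)) =
     frag_of (tri_simplex (f \<circ> \<alpha>)) - frag_of (tri_simplex (f \<circ> \<beta>))"
  by (simp add: chain_map_diff simplex_map_def tri_simplex_def restrict_def comp_def if_distrib cong: if_cong)

lemma tri_cycle:
  assumes \<alpha>: "continuous_map (top_of_set T2) X \<alpha>" and \<beta>: "continuous_map (top_of_set T2) X \<beta>"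
    and eq: "\<And>z. z \<in> bT2 \<Longrightarrow> \<alpha> z = \<beta> z"
  shows "singular_relcycle 2 X {} (frag_of (tri_simplex \<alpha>) - frag_of (tri_simplex \<beta>))"
proof -
  have "singular_face 2 k (tri_simplex \<alpha>) = singular_face 2 k (tri_simplex \<beta>)" if k: "k \<le> 2" for k
  proof
    fix y
    show "singular_face 2 k (tri_simplex \<alpha>) y = singular_face 2 k (tri_simplex \<beta>) y"
    proof (cases "y \<in> standard_simplex 1")
      case True
      then have f: "simplical_face k y \<in> simplex_boundary 2"
        using face_in[of y 1 k] k by (auto simp: numeral_2_eq_2 simplical_face_def)
      then have "simplical_face k y \<in> standard_simplex 2"
        by simp
      then show ?thesis
        using True eq[OF simplex_boundary_2_tr[OF f]] by (simp add: singular_face_def tri_simplex_def)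
    qed (simp add: singular_face_def)
  qed
  then have "chain_boundary 2 (frag_of (tri_simplex \<alpha>) - frag_of (tri_simplex \<beta>)) = 0"
    by (simp add: chain_boundary_diff chain_boundary_of)
  then show ?thesis
    using singular_simplex_tri[OF \<alpha>] singular_simplex_tri[OF \<beta>]
    by (simp add: singular_cycle singular_chain_diff singular_chain_of)
qed

text \<open>Two discs that are homotopic relative to their common boundary extend to the lens-shaped body
  bounded by them; as this body is convex, the difference of its two faces bounds.\<close>

lemma rel_homotopic_imp_homologous:
  assumes \<Theta>: "continuous_map (prod_topology (top_of_set {0..1::real}) (top_of_set T2)) X \<Theta>"
    and \<Theta>0: "\<And>z. z \<in> T2 \<Longrightarrow> \<Theta> (0, z) = \<alpha> z" and \<Theta>1: "\<And>z. z \<in> T2 \<Longrightarrow> \<Theta> (1, z) = \<beta> z"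
    and b: "\<And>t z. t \<in> {0..1} \<Longrightarrow> z \<in> bT2 \<Longrightarrow> \<Theta> (t, z) = \<alpha> z"
  shows "singular_relboundary 2 X {} (frag_of (tri_simplex \<alpha>) - frag_of (tri_simplex \<beta>))"
proof -
  \<comment> \<open>On the triangle \<open>m\<close> vanishes exactly on the boundary. Hence
    \<open>q\<close> collapses precisely the intervals on which \<Theta> is constant by hypothesis,
    and \<Theta> descends to the body \<open>M\<close>.\<close>
  define m :: "real \<times> real \<Rightarrow> real" where "m z = min (fst z) (min (snd z) (1 - fst z - snd z))" for z
  define M :: "(real \<times> (real \<times> real)) set"
    where "M = {w. \<bar>fst w\<bar> \<le> fst (snd w) \<and> \<bar>fst w\<bar> \<le> snd (snd w) \<and> \<bar>fst w\<bar> \<le> 1 - fst (snd w) - snd (snd w)}"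
  have M: "w \<in> M \<longleftrightarrow> snd w \<in> T2 \<and> \<bar>fst w\<bar> \<le> m (snd w)" for w
    by (auto simp: M_def T2_def m_def)
  have m0: "0 \<le> m z" if "z \<in> T2" for z
    using that by (auto simp: m_def T2_def)
  have mb: "z \<in> bT2" if "z \<in> T2" "m z = 0" for z
    using that by (auto simp: m_def bT2_def min_def split: if_splits)
  have mb': "m z = 0" if "z \<in> bT2" for z
    using that by (auto simp: m_def bT2_def T2_def min_def)
  have cm: "continuous_on A m" for A
    unfolding m_def[abs_def] by (intro continuous_intros)
  have Meq: "M = {w. (-1, (1, 0)) \<bullet> w \<ge> 0} \<inter> {w. (1, (1, 0)) \<bullet> w \<ge> 0} \<inter> {w. (-1, (0, 1)) \<bullet> w \<ge> 0} \<inter> {w. (1, (0, 1)) \<bullet> w \<ge> 0}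
      \<inter> {w. (1, (1, 1)) \<bullet> w \<le> 1} \<inter> {w. (-1, (1, 1)) \<bullet> w \<le> 1}"
    by (auto simp: M_def inner_prod_def abs_le_iff)
  have "convex M"
    unfolding Meq by (intro convex_Int convex_halfspace_le convex_halfspace_ge)
  define q :: "real \<times> (real \<times> real) \<Rightarrow> real \<times> (real \<times> real)" where "q w = ((2 * fst w - 1) * m (snd w), snd w)" for w
  let ?C = "{0..1::real} \<times> T2"
  have cq: "continuous_on ?C q"
  proof -
    have "continuous_on ?C (\<lambda>w. m (snd w))"
      by (rule continuous_on_compose2[OF cm[of UNIV]]) (auto intro: continuous_intros)
    then show ?thesis
      unfolding q_def[abs_def] by (intro continuous_intros)
  qed
  have qM: "q ` ?C = M"
  proof (intro equalityI subsetI)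
    fix w assume "w \<in> q ` ?C"
    then obtain r z where rz: "r \<in> {0..1}" "z \<in> T2" "w = ((2 * r - 1) * m z, z)"
      by (auto simp: q_def)
    have "\<bar>(2 * r - 1) * m z\<bar> \<le> 1 * m z"
      unfolding abs_mult using m0[OF rz(2)] rz(1) by (intro mult_mono) auto
    then show "w \<in> M"
      using rz by (simp add: M)
  next
    fix w assume w: "w \<in> M"
    obtain t z where tz: "w = (t, z)"
      by (cases w)
    have z: "z \<in> T2" and t: "\<bar>t\<bar> \<le> m z"
      using w by (auto simp: M tz)
    show "w \<in> q ` ?C"
    proof (cases "m z = 0")
      case True
      then have "q (0, z) = w"
        using t by (simp add: q_def tz)
      then show ?thesis
        using z by (intro image_eqI[of _ _ "(0, z)"]) auto
    next
      case False
      then have "m z > 0"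
        using m0[OF z] by simp
      then have "(t / m z + 1) / 2 \<in> {0..1}" "q ((t / m z + 1) / 2, z) = w"
        using t by (auto simp: q_def tz field_simps abs_le_iff)
      then show ?thesis
        using z by (intro image_eqI[of _ _ "((t / m z + 1) / 2, z)"]) auto
    qed
  qed
  have "compact ?C"
    using compact_T2 by (intro compact_Times) auto
  then have quot: "quotient_map (top_of_set ?C) (top_of_set M) q"
    using cq qM by (intro continuous_imp_quotient_map) (auto simp: compact_space_subtopology Hausdorff_space_subtopology)
  have wd: "\<Theta> w = \<Theta> w'" if w: "w \<in> ?C" "w' \<in> ?C" "q w = q w'" for w w'
  proof -
    obtain r z r' where rz: "w = (r, z)" "w' = (r', z)" "r \<in> {0..1}" "r' \<in> {0..1}" "z \<in> T2" "(2 * r - 1) * m z = (2 * r' - 1) * m z"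
      using w by (auto simp: q_def)
    then show ?thesis
      using mb[OF rz(5)] b[of r z] b[of r' z] by (cases "m z = 0") auto
  qed
  have "continuous_map (top_of_set ?C) X \<Theta>"
    using \<Theta> by (simp add: prod_topology_subtopology_eu)
  then obtain F where F: "continuous_map (top_of_set M) X F" "\<And>w. w \<in> topspace (top_of_set ?C) \<Longrightarrow> F (q w) = \<Theta> w"
  proof (rule quotient_map_lift_exists[OF quot])
    show "\<Theta> w = \<Theta> w'" if "w \<in> topspace (top_of_set ?C)" "w' \<in> topspace (top_of_set ?C)" "q w = q w'" for w w'
      by (rule wd) (use that in simp_all)
  qed (rule that)
  define f0 f1 where "f0 z = (- m z, z)" and "f1 z = (m z, z)" for z
  have cf: "continuous_map (top_of_set T2) (top_of_set M) f0" "continuous_map (top_of_set T2) (top_of_set M) f1"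
    unfolding f0_def[abs_def] f1_def[abs_def] using m0 by (auto simp: M intro!: continuous_intros cm)
  have "contractible_space (top_of_set M)"
    using convex_imp_contractible[OF \<open>convex M\<close>] by simp
  then have "trivial_group (homology_group (int 2) (top_of_set M))"
    using trivial_reduced_homology_group_contractible_space[of "top_of_set M" 2] by (simp add: un_reduced_homology_group)
  then have "singular_relboundary 2 (top_of_set M) {} (frag_of (tri_simplex f0) - frag_of (tri_simplex f1))"
    by (rule trivial_imp_singular_relboundary) (rule tri_cycle[OF cf], simp add: f0_def f1_def mb')
  then have "singular_relboundary 2 X {} (chain_map 2 F (frag_of (tri_simplex f0) - frag_of (tri_simplex f1)))"
    using F(1) by (rule singular_relboundary_chain_map) simp
  moreover have "tri_simplex (F \<circ> f0) = tri_simplex \<alpha>"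
  proof (rule tri_simplex_cong)
    show "(F \<circ> f0) z = \<alpha> z" if "z \<in> T2" for z
      using F(2)[of "(0, z)"] that by (simp add: f0_def q_def \<Theta>0)
  qed
  moreover have "tri_simplex (F \<circ> f1) = tri_simplex \<beta>"
  proof (rule tri_simplex_cong)
    show "(F \<circ> f1) z = \<beta> z" if "z \<in> T2" for z
      using F(2)[of "(1, z)"] that by (simp add: f1_def q_def \<Theta>1)
  qed
  ultimately show ?thesis
    by (simp add: chain_map_tri)
qed

lemma path_in_bT2:
  assumes z: "z \<in> bT2"
  obtains p where "path p" "path_image p \<subseteq> bT2" "pathstart p = (0, 0)" "pathfinish p = z"
proof -
  obtain a c where ac: "z = (a, c)" "0 \<le> a" "0 \<le> c" "a + c \<le> 1" "a = 0 \<or> c = 0 \<or> a + c = 1"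
    using z by (cases z) (auto simp: bT2_def T2_def)
  have conv: "convex (bT2 \<inter> {z. fst z = 0})" "convex (bT2 \<inter> {z. snd z = 0})" "convex (bT2 \<inter> {z. fst z + snd z = 1})"
  proof -
    have "bT2 \<inter> {z. fst z = 0} = T2 \<inter> {z. (1, 0) \<bullet> z = 0}" "bT2 \<inter> {z. snd z = 0} = T2 \<inter> {z. (0, 1) \<bullet> z = 0}"
      "bT2 \<inter> {z. fst z + snd z = 1} = T2 \<inter> {z. (1, 1) \<bullet> z = 1}"
      by (auto simp: bT2_def inner_prod_def)
    then show "convex (bT2 \<inter> {z. fst z = 0})" "convex (bT2 \<inter> {z. snd z = 0})" "convex (bT2 \<inter> {z. fst z + snd z = 1})"
      using convex_T2 by (simp_all add: convex_Int convex_hyperplane)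
  qed
  have o: "(0, 0) \<in> bT2" "(1, 0) \<in> bT2"
    by (auto simp: bT2_def T2_def)
  show ?thesis
  proof (cases "a = 0 \<or> c = 0")
    case True
    then have "closed_segment (0, 0) z \<subseteq> bT2"
      using closed_segment_subset[OF _ _ conv(1), of "(0, 0)" z] closed_segment_subset[OF _ _ conv(2), of "(0, 0)" z] z o ac by auto
    then show ?thesis
      by (intro that[of "linepath (0, 0) z"]) auto
  next
    case False
    then have s: "closed_segment (0, 0) (1, 0) \<subseteq> bT2" "closed_segment (1, 0) z \<subseteq> bT2"
      using closed_segment_subset[OF _ _ conv(2), of "(0, 0)" "(1, 0)"] closed_segment_subset[OF _ _ conv(3), of "(1, 0)" z] z o ac by auto
    show ?thesis
      by (rule that[of "linepath (0, 0) (1, 0) +++ linepath (1, 0) z"]) (use s in \<open>auto simp: path_image_join\<close>)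
  qed
qed

context transport begin

lemma rho_cong:
  assumes "path p" "path_image p \<subseteq> P" "\<And>t. t \<in> {0..1} \<Longrightarrow> q t = p t" "e \<in> E"
  shows "\<rho> q e = \<rho> p e"
  using homotopic[OF homotopic_paths_eq[of p P q] assms(4)] assms by simp

text \<open>The boundary of the triangle is path connected and contains \<open>(0, 0)\<close>, so
  both lifts can be computed along one path in it, where \<open>a\<close> and \<open>b\<close>
  agree.\<close>

lemma lift_agree:
  assumes a: "continuous_on T2 a" "a ` T2 \<subseteq> P" and b: "continuous_on T2 b" "b ` T2 \<subseteq> P"
    and ab: "\<And>z. z \<in> bT2 \<Longrightarrow> a z = b z" and z: "z \<in> bT2" and e: "e \<in> E"
  shows "lift a (0, 0) e z = lift b (0, 0) e z"
proof -
  obtain p where p: "path p" "path_image p \<subseteq> bT2" "pathstart p = (0, 0)" "pathfinish p = z"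
    by (rule path_in_bT2[OF z])
  have pT: "path_image p \<subseteq> T2"
    using p(2) by (auto simp: bT2_def)
  have bp: "path (b \<circ> p)" "path_image (b \<circ> p) \<subseteq> P"
    using path_continuous_image[OF p(1), of b] continuous_on_subset[OF b(1) pT] b(2) pT by (auto simp: path_image_compose)
  have "\<rho> (a \<circ> p) e = \<rho> (b \<circ> p) e"
  proof (rule rho_cong[OF bp _ e])
    show "(a \<circ> p) t = (b \<circ> p) t" if "t \<in> {0..1}" for t
      using ab[of "p t"] p(2) that by (simp add: path_image_def image_subset_iff)
  qed
  then show ?thesis
    using lift_transport[OF convex_T2 a e p(1) pT p(3,4)] lift_transport[OF convex_T2 b e p(1) pT p(3,4)] ab[OF z] by simp
qed

text \<open>The homotopy is lifted starting with the lift of \<open>a\<close>. At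
  \<open>(0, 0)\<close>, a boundary point, the lifted homotopy is stationary, so by unique path
  lifting it ends in the lift of \<open>b\<close> with the same initial fibre point. The lifted
  discs are thus homotopic relative to the boundary.\<close>

lemma lifts_homologous:
  assumes \<Theta>: "continuous_on ({0..1::real} \<times> T2) \<Theta>" "\<Theta> ` ({0..1} \<times> T2) \<subseteq> P"
    and \<Theta>0: "\<And>z. z \<in> T2 \<Longrightarrow> \<Theta> (0, z) = a z" and \<Theta>1: "\<And>z. z \<in> T2 \<Longrightarrow> \<Theta> (1, z) = b z"
    and bd: "\<And>t z. t \<in> {0..1} \<Longrightarrow> z \<in> bT2 \<Longrightarrow> \<Theta> (t, z) = a z" and e: "e \<in> E"
  shows "singular_relboundary 2 X {} (frag_of (tri_simplex (lift a (0, 0) e)) - frag_of (tri_simplex (lift b (0, 0) e)))"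
proof -
  have o: "(0, 0) \<in> bT2" "(0, 0) \<in> T2"
    by (auto simp: bT2_def T2_def)
  have side: "continuous_on T2 (\<lambda>z. \<Theta> (i, z))" "(\<lambda>z. \<Theta> (i, z)) ` T2 \<subseteq> P" if "i \<in> {0..1}" for i
    using \<Theta> that by (auto intro!: continuous_on_compose2[OF \<Theta>(1)] continuous_on_Pair continuous_on_id continuous_on_const)
  have a: "continuous_on T2 a" "a ` T2 \<subseteq> P"
    using side[of 0] \<Theta>0 by (auto cong: continuous_on_cong)
  have b: "continuous_on T2 b" "b ` T2 \<subseteq> P"
    using side[of 1] \<Theta>1 by (auto cong: continuous_on_cong)
  have ca: "continuous_map (top_of_set T2) X (lift a (0, 0) e)"
    by (rule continuous_map_lift[OF convex_T2 o(2) a e])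
  let ?H = "\<lambda>w. (\<Theta> w, \<rho> (\<lambda>s. \<Theta> (fst w * s, snd w)) (snd (lift a (0, 0) e (snd w))))"
  have H: "continuous_map (prod_topology (top_of_set {0..1::real}) (top_of_set T2)) X ?H"
  proof (rule covering_homotopy[OF locally_path_connected_space_convex[OF convex_T2] ca])
    show "continuous_map (prod_topology (top_of_set {0..1}) (top_of_set T2)) (top_of_set P) \<Theta>"
      using \<Theta> by (simp add: prod_topology_subtopology_eu image_subset_iff_funcset)
    show "\<Theta> (0, z) = fst (lift a (0, 0) e z)" if "z \<in> topspace (top_of_set T2)" for z
      using \<Theta>0 that by (simp add: lift_def)
  qed
  have lin: "snd (lift a (0, 0) e z) \<in> E" and ain: "a z \<in> P" if "z \<in> T2" for z
    using continuous_map_image_subset_topspace[OF ca] that a by (auto simp: image_subset_iff mem_Times_iff)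
  have const: "\<rho> (\<lambda>s. \<Theta> (t * s, z)) (snd (lift a (0, 0) e z)) = snd (lift a (0, 0) e z)"
    if z: "z \<in> T2" and t: "\<And>s. s \<in> {0..1} \<Longrightarrow> \<Theta> (t * s, z) = a z" for t z
  proof -
    have "path (\<lambda>_. a z)" "path_image (\<lambda>_. a z) \<subseteq> P"
      using ain[OF z] by (auto simp: path_def path_image_def)
    then have "\<rho> (\<lambda>s. \<Theta> (t * s, z)) (snd (lift a (0, 0) e z)) = \<rho> (\<lambda>_. a z) (snd (lift a (0, 0) e z))"
      by (rule rho_cong[OF _ _ t lin[OF z]])
    then show ?thesis
      using rho_const'[OF ain[OF z] lin[OF z]] by simp
  qed
  show ?thesis
  proof (rule rel_homotopic_imp_homologous[OF H])
    fix z assume z: "z \<in> T2"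
    show "?H (0, z) = lift a (0, 0) e z"
      using const[OF z, of 0] \<Theta>0[OF z] by (simp add: lift_def)
    have c1: "continuous_map (top_of_set {0..1}) X (\<lambda>t. ?H (1, linepath (0, 0) z t))"
    proof -
      have seg: "linepath (0, 0) z t \<in> T2" if "t \<in> {0..1}" for t
        using closed_segment_subset[OF o(2) z convex_T2] that linepath_in_path[of t "(0, 0)" z] by auto
      have "continuous_map (top_of_set {0..1::real}) (prod_topology (top_of_set {0..1::real}) (top_of_set T2)) (\<lambda>t. (1, linepath (0, 0) z t))"
        using seg by (auto simp: prod_topology_subtopology_eu intro!: continuous_on_Pair continuous_on_linepath)
      from continuous_map_compose[OF this H] show ?thesis
        by (simp only: comp_def)
    qed
    have lz: "linepath (0, 0) z 0 = (0, 0)" "linepath (0, 0) z 1 = z"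
      by (simp_all add: linepath_def zero_prod_def)
    have "snd (?H (1, z)) = \<rho> (\<lambda>t. \<Theta> (1, linepath (0, 0) z t)) (snd (?H (1, (0, 0))))"
      using unique_path_lifting[OF c1] by (simp only: lz comp_def fst_conv snd_conv)
    also have "snd (?H (1, (0, 0))) = snd (lift a (0, 0) e (0, 0))"
      using const[OF o(2), of 1] bd[OF _ o(1)] by simp
    also have "snd (lift a (0, 0) e (0, 0)) = e"
      using rho_const'[OF ain[OF o(2)] e] by (simp add: lift_def comp_def)
    also have "\<rho> (\<lambda>t. \<Theta> (1, linepath (0, 0) z t)) e = \<rho> (b \<circ> linepath (0, 0) z) e"
    proof -
      have seg: "path_image (linepath (0, 0) z) \<subseteq> T2"
        using closed_segment_subset[OF o(2) z convex_T2] by simp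
      have bp: "path (b \<circ> linepath (0, 0) z)" "path_image (b \<circ> linepath (0, 0) z) \<subseteq> P"
        using path_continuous_image[of "linepath (0, 0) z" b] continuous_on_subset[OF b(1) seg] b(2) seg by (auto simp: path_image_compose)
      show ?thesis
      proof (rule rho_cong[OF bp _ e])
        show "\<Theta> (1, linepath (0, 0) z t) = (b \<circ> linepath (0, 0) z) t" if "t \<in> {0..1}" for t
          using \<Theta>1[of "linepath (0, 0) z t"] seg that by (simp add: path_image_def image_subset_iff)
      qed
    qed
    finally show "?H (1, z) = lift b (0, 0) e z"
      using \<Theta>1[OF z] by (simp add: lift_def)
  next
    fix t :: real and z assume t: "t \<in> {0..1}" and z: "z \<in> bT2"
    then have "z \<in> T2"
      by (simp add: bT2_def)
    moreover have "\<Theta> (t * s, z) = a z" if "s \<in> {0..1}" for s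
      using t that by (intro bd z) (auto intro: mult_le_one)
    ultimately show "?H (t, z) = lift a (0, 0) e z"
      using const[of z t] bd[OF t z] by (simp add: lift_def)
  qed
qed

text \<open>A map of coverings takes lifts to lifts: this is its equivariance along the image of the
  segment from \<open>(0, 0)\<close>, whose initial fibre point moves by \<open>s\<close>.\<close>

lemma cover_map_lift:
  assumes Q: "transport P E' \<rho>'"
    and f: "continuous_on P f" "f ` P \<subseteq> P"
    and eqv: "\<And>p e. path p \<Longrightarrow> path_image p \<subseteq> P \<Longrightarrow> e \<in> E' \<Longrightarrow>
      s (pathfinish p) (\<rho>' p e) = \<rho> (f \<circ> p) (s (pathstart p) e)"
    and a: "continuous_on T2 a" "a ` T2 \<subseteq> P" and e: "e \<in> E'" and z: "z \<in> T2"
  shows "(\<lambda>w. (f (fst w), s (fst w) (snd w))) (transport.lift \<rho>' a (0, 0) e z) = lift (f \<circ> a) (0, 0) (s (a (0, 0)) e) z"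
proof -
  interpret Q: transport P E' \<rho>' by (rule Q)
  have "(0, 0) \<in> T2"
    by (simp add: T2_def)
  then have seg: "path_image (linepath (0, 0) z) \<subseteq> T2"
    using closed_segment_subset[OF _ z convex_T2] by simp
  have ap: "path (a \<circ> linepath (0, 0) z)" "path_image (a \<circ> linepath (0, 0) z) \<subseteq> P"
    using path_continuous_image[of "linepath (0, 0) z" a] continuous_on_subset[OF a(1) seg] a(2) seg by (auto simp: path_image_compose)
  show ?thesis
    using eqv[OF ap e] by (simp add: lift_def Q.lift_def pathstart_compose pathfinish_compose comp_assoc)
qed

end

lemma (in transport) continuous_map_gauge:
  assumes f: "continuous_on P f" "f ` P \<subseteq> P" and s: "gauge P E \<rho> (pull f \<rho>) s"
  shows "continuous_map X X (\<lambda>w. (f (fst w), s (fst w) (snd w)))"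
proof (rule continuous_map_cover_map[OF transport_axioms f])
  show "s y e \<in> E" if "y \<in> P" "e \<in> E" for y e
    using s that unfolding gauge_def by (blast dest: bij_betwE)
  show "s (pathfinish p) (\<rho> p e) = \<rho> (f \<circ> p) (s (pathstart p) e)" if "path p" "path_image p \<subseteq> P" "e \<in> E" for p e
    using s that by (simp add: gauge_def pull_def)
qed

text \<open>The composite of the lifts of \<open>f\<close> and \<open>g\<close> need not be homotopic to the identity, but only to a deck
  transformation, by which the lift of \<open>g\<close> has to be corrected.\<close>

lemma (in transport) cover_right_inverse:
  assumes f: "continuous_on P f" "f ` P \<subseteq> P" and g: "continuous_on P g" "g ` P \<subseteq> P"
    and fg: "homotopic_with_canon (\<lambda>_. True) P P (f \<circ> g) id"
    and s: "gauge P E \<rho> (pull f \<rho>) s"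
  obtains R where "continuous_map X X R"
    "homotopic_with (\<lambda>_. True) X X ((\<lambda>w. (f (fst w), s (fst w) (snd w))) \<circ> R) id"
proof -
  obtain h where h: "continuous_map (prod_topology (top_of_set {0..1::real}) (top_of_set P)) (top_of_set P) h"
    "\<forall>y. h (0, y) = (f \<circ> g) y" "\<forall>y. h (1, y) = id y"
    using fg unfolding homotopic_with_def by (elim exE conjE) (rule that)
  have h': "continuous_on ({0..1::real} \<times> P) h" "h ` ({0..1} \<times> P) \<subseteq> P"
    using h(1) by (auto simp: prod_topology_subtopology_eu)
  interpret g: transport P E "pull g \<rho>"
    by (rule transport_pull[OF g])
  have fg_id: "(\<lambda>y. h (0, y)) = f \<circ> g" "(\<lambda>y. h (1, y)) = id"
    using h(2,3) by auto
  have 1: "gauge P E (pull g \<rho>) (pull (f \<circ> g) \<rho>) (s \<circ> g)"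
    using gauge_pull[OF s g] by (simp add: pull_pull)
  have 2: "gauge P E (pull (f \<circ> g) \<rho>) \<rho> (\<lambda>y. \<rho> (\<lambda>t. h (t, y)))"
    using gauge_homotopic[OF h'] by (simp add: fg_id)
  \<comment> \<open>Fibre by fibre, \<open>s'\<close> inverts the map \<open>s\<close> followed by
    transport along the track of \<open>h\<close>; therefore the lifted homotopy starting at
    \<open>D \<circ> R\<close> ends exactly in the identity.\<close>
  define s' where "s' y = inv_into E (\<rho> (\<lambda>t. h (t, y)) \<circ> (s \<circ> g) y)" for y
  have s': "gauge P E \<rho> (pull g \<rho>) s'"
    unfolding s'_def by (rule gauge_sym[OF gauge_trans[OF 1 2] g.rho_in])
  define D where "D = (\<lambda>w. (f (fst w), s (fst w) (snd w)))"
  define R where "R = (\<lambda>w. (g (fst w), s' (fst w) (snd w)))"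
  have D: "continuous_map X X D"
    unfolding D_def by (rule continuous_map_gauge[OF f s])
  have R: "continuous_map X X R"
    unfolding R_def by (rule continuous_map_gauge[OF g s'])
  have DR: "continuous_map X X (D \<circ> R)"
    by (rule continuous_map_compose[OF R D])
  have fst: "continuous_map (prod_topology (top_of_set {0..1::real}) X) (prod_topology (top_of_set {0..1}) (top_of_set P)) (\<lambda>w. (fst w, fst (snd w)))"
    by (intro continuous_map_pairedI continuous_map_fst continuous_map_compose[OF continuous_map_snd continuous_map_fst_cover, unfolded comp_def])
  have hc: "continuous_map (prod_topology (top_of_set {0..1::real}) X) (top_of_set P) (\<lambda>w. h (fst w, fst (snd w)))"
    using continuous_map_compose[OF fst h(1)] by (simp add: comp_def)
  have H: "continuous_map (prod_topology (top_of_set {0..1::real}) X) X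
      (\<lambda>w. (h (fst w, fst (snd w)), \<rho> (\<lambda>t. h (fst w * t, fst (snd w))) (snd ((D \<circ> R) (snd w)))))"
    using covering_homotopy[OF locally_path_connected_cover DR hc] h(2) by (simp add: D_def R_def)
  have bij: "bij_betw (\<rho> (\<lambda>t. h (t, y)) \<circ> (s \<circ> g) y) E E" if "y \<in> P" for y
    using gauge_trans[OF 1 2] that by (simp add: gauge_def)
  define H where "H = (\<lambda>w. (h (fst w, fst (snd w)), \<rho> (\<lambda>t. h (fst w * t, fst (snd w))) (snd ((D \<circ> R) (snd w)))))"
  have H0: "H (0, w) = (D \<circ> R) w" and H1: "H (1, w) = w" if w: "w \<in> topspace X" for w
  proof -
    have "(D \<circ> R) w \<in> topspace X"
      using continuous_map_image_subset_topspace[OF DR] w by blast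
    then have "fst ((D \<circ> R) w) \<in> P" "snd ((D \<circ> R) w) \<in> E"
      by (simp_all only: topspace_cover mem_Times_iff)
    moreover have "h (0, fst w) = fst ((D \<circ> R) w)"
      using h(2) by (simp add: D_def R_def)
    ultimately show "H (0, w) = (D \<circ> R) w"
      using rho_const'[of "fst ((D \<circ> R) w)" "snd ((D \<circ> R) w)"] by (simp add: H_def)
    have w': "fst w \<in> P" "snd w \<in> E"
      using w by (simp_all only: topspace_cover mem_Times_iff)
    have "\<rho> (\<lambda>t. h (t, fst w)) (s (g (fst w)) (s' (fst w) (snd w))) = snd w"
      using bij_betw_inv_into_right[OF bij[OF w'(1)] w'(2)] by (simp add: s'_def)
    then show "H (1, w) = w"
      using h(3) by (simp add: H_def D_def R_def)
  qed
  have "\<exists>k. continuous_map (prod_topology (top_of_set {0..1::real}) X) X k \<and>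
      (\<forall>w\<in>topspace X. k (0, w) = (D \<circ> R) w) \<and> (\<forall>w\<in>topspace X. k (1, w) = id w) \<and> (\<forall>t\<in>{0..1::real}. True)"
    using H[folded H_def] H0 H1 by (intro exI[of _ H]) (simp del: topspace_cover)
  then have "homotopic_with (\<lambda>_. True) X X (D \<circ> R) id"
    using homotopic_with[of X "\<lambda>_. True" X "D \<circ> R" id] by (simp del: topspace_cover)
  then show ?thesis
    using that[of R] R by (simp add: D_def)
qed

context complex_cover begin

lemma openin_off_fibre: "openin X {w \<in> topspace X. fst w \<noteq> y}"
proof -
  have "openin (top_of_set (\<Union>\<T>)) (\<Union>\<T> - {y})"
    unfolding openin_open by (intro exI[of _ "- {y}"]) auto
  from openin_continuous_map_preimage[OF continuous_map_fst_cover this] show ?thesis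
    by (rule back_subst[of "openin X"]) auto
qed

lemma cell_centre:
  assumes "S \<in> \<T>" "aff_dim S = 2" "e \<in> E" "e' \<in> E" "(centre S, e) \<in> cell S e'"
  shows "e = e'"
proof -
  have "centre S \<in> \<Union>\<T>"
    using centre_in[of S] assms(1,2) rel_interior_subset by fastforce
  then show ?thesis
    using assms(4,5) rho_const by (auto simp: cell_def)
qed

text \<open>The cells over \<open>S\<close>, together with the complement of the fibre over its
  centre, form an open cover in which each point of that fibre lies in exactly one member.\<close>

lemma finite_fibre:
  assumes dim: "\<And>S. S \<in> \<T> \<Longrightarrow> aff_dim S \<le> 2" and S: "S \<in> \<T>" "aff_dim S = 2" and K: "compactin X K"
  shows "finite {e \<in> E. (centre S, e) \<in> K}"
proof -
  have skel2: "skel 2 = \<Union>\<T>"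
    using dim by (auto simp: skel_def)
  have op: "openin X (cell S e)" if "e \<in> E" for e
    using openin_cell[OF S _ that] by (simp add: skel2)
  define \<U> where "\<U> = insert {w \<in> topspace X. fst w \<noteq> centre S} (cell S ` E)"
  have cov: "K \<subseteq> \<Union>\<U>"
  proof
    fix w assume "w \<in> K"
    then have w: "w \<in> topspace X"
      using compactin_subset_topspace[OF K] by blast
    show "w \<in> \<Union>\<U>"
    proof (cases "fst w = centre S")
      case True
      have e: "snd w \<in> E"
        using w by (simp add: mem_Times_iff)
      then have "w \<in> cell S (snd w)"
        using centre_in_cell[OF S _ e] True by (metis prod.collapse zero_le_numeral)
      then show ?thesis
        using e by (auto simp: \<U>_def)
    qed (use w in \<open>auto simp: \<U>_def\<close>)
  qed
  have "\<And>U. U \<in> \<U> \<Longrightarrow> openin X U"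
    using op openin_off_fibre by (auto simp: \<U>_def)
  then obtain \<F> where F: "finite \<F>" "\<F> \<subseteq> \<U>" "K \<subseteq> \<Union>\<F>"
    using K cov unfolding compactin_def by metis
  have "{e \<in> E. (centre S, e) \<in> K} \<subseteq> cell S -` \<F> \<inter> E"
  proof
    fix e assume "e \<in> {e \<in> E. (centre S, e) \<in> K}"
    then have e: "e \<in> E" "(centre S, e) \<in> K"
      by auto
    then obtain U where U: "U \<in> \<F>" "(centre S, e) \<in> U"
      using F by blast
    then obtain e' where e': "e' \<in> E" "U = cell S e'"
      using F(2) by (auto simp: \<U>_def)
    then show "e \<in> cell S -` \<F> \<inter> E"
      using cell_centre[OF S e(1) e'(1)] U e by auto
  qed
  moreover have "inj_on (cell S) E"
  proof
    fix e e' assume e: "e \<in> E" "e' \<in> E" "cell S e = cell S e'"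
    have "(centre S, e) \<in> cell S e'"
      using centre_in_cell[OF S _ e(1)] e(3) by simp
    then show "e = e'"
      by (rule cell_centre[OF S e(1,2)])
  qed
  ultimately show ?thesis
    using finite_vimage_IntI[OF F(1)] finite_subset by blast
qed

end

section \<open>Discs that become homotopic under \<open>d\<close>\<close>

context self_domination begin

lemma ANR_P: "ANR P"
  using finite_T simplex_props by (intro ANR_finite_Union_convex_closed) auto

lemma complex_cover_I: "transport P E \<rho> \<Longrightarrow> complex_cover \<T> E \<rho>"
  by (simp add: complex_cover_def complex2_axioms)

text \<open>A power of \<open>d\<close> lifts to the finite covering and has a right inverse up to
  homotopy there, so \<open>homology_injective\<close> applies to the lift.\<close>

lemma cover_injective:
  assumes \<rho>: "transport P V \<rho>" and V: "finite V"
  obtains k s where "1 \<le> k" "gauge P V \<rho> (pull (d ^^ k) \<rho>) s"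
    "\<And>z. singular_relcycle 2 (cover_space P V \<rho>) {} z \<Longrightarrow>
      singular_relboundary 2 (cover_space P V \<rho>) {} (chain_map 2 (\<lambda>w. ((d ^^ k) (fst w), s (fst w) (snd w))) z) \<Longrightarrow>
      singular_relboundary 2 (cover_space P V \<rho>) {} z"
proof -
  obtain k s where k: "1 \<le> k" and s: "gauge P V \<rho> (pull (d ^^ k) \<rho>) s"
    by (rule periodic[OF \<rho> V])
  interpret complex_cover \<T> V \<rho>
    by (rule complex_cover_I[OF \<rho>])
  note dk = funpow_map[OF d, of k] and uk = funpow_map[OF u, of k]
  obtain R where R: "continuous_map X X R"
    "homotopic_with (\<lambda>_. True) X X ((\<lambda>w. ((d ^^ k) (fst w), s (fst w) (snd w))) \<circ> R) id"
    by (rule cover_right_inverse[OF dk uk du_pow s])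
  show ?thesis
    by (rule that[OF k s]) (rule homology_injective[OF dim V continuous_map_gauge[OF dk s] R])
qed

context
  fixes a b :: "real \<times> real \<Rightarrow> 'a" and \<Theta> :: "real \<times> (real \<times> real) \<Rightarrow> 'a"
  assumes a: "continuous_on T2 a" "a ` T2 \<subseteq> P" and b: "continuous_on T2 b" "b ` T2 \<subseteq> P"
    and ab: "\<And>z. z \<in> bT2 \<Longrightarrow> a z = b z"
    and \<Theta>: "continuous_on ({0..1} \<times> T2) \<Theta>" "\<Theta> ` ({0..1} \<times> T2) \<subseteq> P"
    and \<Theta>0: "\<And>z. z \<in> T2 \<Longrightarrow> \<Theta> (0, z) = d (a z)" and \<Theta>1: "\<And>z. z \<in> T2 \<Longrightarrow> \<Theta> (1, z) = d (b z)"
    and \<Theta>b: "\<And>t z. t \<in> {0..1} \<Longrightarrow> z \<in> bT2 \<Longrightarrow> \<Theta> (t, z) = d (a z)"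
begin

lemma origin: "(0, 0) \<in> T2" "(0, 0) \<in> bT2"
  by (auto simp: T2_def bT2_def)

text \<open>The lifted power of \<open>d\<close> maps the difference of the lifted discs to that of
  the lifts of \<open>(d ^^ k) \<circ> a\<close> and \<open>(d ^^ k) \<circ> b\<close>, with a
  common initial fibre point. These are homotopic relative to the boundary by \<Theta> followed by
  the remaining \<open>k - 1\<close> applications of \<open>d\<close>, so injectivity of the lift on
  homology applies.\<close>

lemma finite_cover_boundary:
  assumes \<rho>: "transport P V \<rho>" and V: "finite V" and e: "e \<in> V"
  shows "singular_relboundary 2 (cover_space P V \<rho>) {}
    (frag_of (tri_simplex (transport.lift \<rho> a (0, 0) e)) - frag_of (tri_simplex (transport.lift \<rho> b (0, 0) e)))"
proof -
  interpret transport P V \<rho> by (rule \<rho>)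
  obtain k s where k: "1 \<le> k" and s: "gauge P V \<rho> (pull (d ^^ k) \<rho>) s"
    and inj: "\<And>z. singular_relcycle 2 X {} z \<Longrightarrow>
      singular_relboundary 2 X {} (chain_map 2 (\<lambda>w. ((d ^^ k) (fst w), s (fst w) (snd w))) z) \<Longrightarrow>
      singular_relboundary 2 X {} z"
    by (rule cover_injective[OF \<rho> V]) (rule that)
  obtain m where m: "k = Suc m"
    using k by (cases k) auto
  let ?D = "\<lambda>w. ((d ^^ k) (fst w), s (fst w) (snd w))"
  note dk = funpow_map[OF d, of k] and dm = funpow_map[OF d, of m]
  have eqv: "s (pathfinish p) (\<rho> p e) = \<rho> ((d ^^ k) \<circ> p) (s (pathstart p) e)" if "path p" "path_image p \<subseteq> P" "e \<in> V" for p e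
    using s that by (simp add: gauge_def pull_def)
  have "a (0, 0) \<in> P"
    using a(2) origin by blast
  then have se: "s (a (0, 0)) e \<in> V"
    using s e unfolding gauge_def by (blast dest: bij_betwE)
  have lD: "tri_simplex (?D \<circ> lift a (0, 0) e) = tri_simplex (lift ((d ^^ k) \<circ> a) (0, 0) (s (a (0, 0)) e))"
    "tri_simplex (?D \<circ> lift b (0, 0) e) = tri_simplex (lift ((d ^^ k) \<circ> b) (0, 0) (s (a (0, 0)) e))"
    using cover_map_lift[OF \<rho> dk eqv a e] cover_map_lift[OF \<rho> dk eqv b e] ab[OF origin(2)]
    by (auto intro!: tri_simplex_cong)
  have kd: "(d ^^ k) y = (d ^^ m) (d y)" for y
    by (simp add: m funpow_swap1)
  show ?thesis
  proof (rule inj)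
    show "singular_relcycle 2 X {} (frag_of (tri_simplex (lift a (0, 0) e)) - frag_of (tri_simplex (lift b (0, 0) e)))"
      by (intro tri_cycle continuous_map_lift[OF convex_T2 origin(1) a e] continuous_map_lift[OF convex_T2 origin(1) b e]
          lift_agree[OF a b ab _ e])
    show "singular_relboundary 2 X {} (chain_map 2 ?D (frag_of (tri_simplex (lift a (0, 0) e)) - frag_of (tri_simplex (lift b (0, 0) e))))"
      unfolding chain_map_tri lD
    proof (rule lifts_homologous[of "(d ^^ m) \<circ> \<Theta>"])
      show "continuous_on ({0..1} \<times> T2) ((d ^^ m) \<circ> \<Theta>)"
        using \<Theta> dm by (intro continuous_on_compose continuous_on_subset[OF dm(1)])
      show "((d ^^ m) \<circ> \<Theta>) ` ({0..1} \<times> T2) \<subseteq> P"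
        unfolding image_comp[symmetric] using image_mono[OF \<Theta>(2), of "d ^^ m"] dm(2) by (rule subset_trans)
    qed (simp_all add: \<Theta>0 \<Theta>1 \<Theta>b kd se)
  qed
qed

text \<open>Local vanishing in the universal covering is read off in a finite one. The two discs
  meet only finitely many points over the centre of a triangle, and a finite action keeps these
  apart, so passing to the finite covering does not change the local degree of their difference at
  the given point.\<close>

lemma discs_injective:
  obtains \<Psi> :: "real \<times> (real \<times> real) \<Rightarrow> 'a" where "continuous_on ({0..1} \<times> T2) \<Psi>" "\<Psi> ` ({0..1} \<times> T2) \<subseteq> P"
    "\<And>z. z \<in> T2 \<Longrightarrow> \<Psi> (0, z) = a z" "\<And>z. z \<in> T2 \<Longrightarrow> \<Psi> (1, z) = b z"
    "\<And>t z. t \<in> {0..1} \<Longrightarrow> z \<in> bT2 \<Longrightarrow> \<Psi> (t, z) = a z"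
proof -
  let ?\<rho>u = "\<lambda>p g. g \<otimes>\<^bsub>G\<^esub> cls p"
  let ?XU = "cover_space P (carrier G) ?\<rho>u"
  interpret B: based_transport P "carrier G" ?\<rho>u x path_rep
    by (rule universal_cover)
  interpret U: complex_cover \<T> "carrier G" ?\<rho>u
    by (rule complex_cover_I[OF B.transport_axioms])
  have skel2: "skel 2 = P"
    using dim by (auto simp: skel_def)
  note one = G.one_closed
  define \<alpha> \<beta> where "\<alpha> = B.lift a (0, 0) \<one>\<^bsub>G\<^esub>" and "\<beta> = B.lift b (0, 0) \<one>\<^bsub>G\<^esub>"
  have c\<alpha>: "continuous_map (top_of_set T2) ?XU \<alpha>" and c\<beta>: "continuous_map (top_of_set T2) ?XU \<beta>"
    unfolding \<alpha>_def \<beta>_def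
    by (intro B.continuous_map_lift[OF convex_T2 origin(1) a one] B.continuous_map_lift[OF convex_T2 origin(1) b one])+
  have agree: "\<alpha> z = \<beta> z" if "z \<in> bT2" for z
    unfolding \<alpha>_def \<beta>_def by (rule B.lift_agree[OF a b ab that one])
  let ?f = "tri_simplex \<alpha>" and ?g = "tri_simplex \<beta>"
  have cyc: "singular_relcycle 2 ?XU {} (frag_of ?f - frag_of ?g)"
    by (rule tri_cycle[OF c\<alpha> c\<beta> agree])
  have "compactin (top_of_set T2) T2"
    using compact_T2 by (simp add: compactin_subtopology)
  then have K: "compactin ?XU (\<alpha> ` T2 \<union> \<beta> ` T2)"
    using image_compactin[OF _ c\<alpha>] image_compactin[OF _ c\<beta>] by (intro compactin_Un) auto
  have "singular_relboundary 2 ?XU {} (frag_of ?f - frag_of ?g)"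
  proof (rule U.boundary_if_locally_boundary[OF dim cyc])
    fix S g assume S: "S \<in> \<T>" "aff_dim S = 2" and g: "g \<in> carrier G"
    \<comment> \<open>The points over the centre that one of the discs meets, and \<open>g\<close>
      itself: these have to remain distinct in the finite covering.\<close>
    define Hs where "Hs = insert g {h \<in> carrier G. (centre S, h) \<in> \<alpha> ` T2 \<union> \<beta> ` T2}"
    have Hs: "finite Hs" "Hs \<subseteq> carrier G"
      using U.finite_fibre[OF dim S K] g by (auto simp: Hs_def)
    obtain V :: "nat word set" and act e0 where V: "finite V" "e0 \<in> V"
      and act: "\<And>g. g \<in> carrier G \<Longrightarrow> bij_betw (act g) V V"
        "\<And>g h e. g \<in> carrier G \<Longrightarrow> h \<in> carrier G \<Longrightarrow> e \<in> V \<Longrightarrow> act (g \<otimes>\<^bsub>G\<^esub> h) e = act h (act g e)"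
      and inj: "inj_on (\<lambda>g. act g e0) Hs"
      by (rule limit_group_finite_action[OF limit Hs]) (rule that)
    have actV: "act h e \<in> V" if "h \<in> carrier G" "e \<in> V" for h e
      using act(1)[OF that(1)] that(2) by (blast dest: bij_betwE)
    interpret W: complex_cover \<T> V "\<lambda>p. act (cls p)"
      by (rule complex_cover_I[OF transport_action[OF act]])
    let ?\<Phi> = "\<lambda>w. (id (fst w), act (snd w) e0)"
    have \<Phi>: "continuous_map ?XU W.X ?\<Phi>"
    proof (rule W.continuous_map_cover_map[OF B.transport_axioms, of id "\<lambda>_ g. act g e0"])
      show "act (h \<otimes>\<^bsub>G\<^esub> cls p) e0 = act (cls (id \<circ> p)) (act h e0)"
        if "path p" "path_image p \<subseteq> P" "h \<in> carrier G" for p h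
        using act(2)[OF that(3) cls_in[OF that(1,2)] V(2)] by simp
    qed (auto simp: actV V(2))
    \<comment> \<open>\<open>Y\<close> is the universal covering without those points over the
      centre, other than the one for \<open>g\<close>, that have the same image as it in the finite
      covering. It is open and still contains both discs.\<close>
    define A where "A = {h \<in> carrier G. h = g \<or> act h e0 \<noteq> act g e0}"
    define Y where "Y = {w \<in> topspace ?XU. fst w \<noteq> centre S} \<union> (\<Union>h\<in>A. U.cell S h)"
    have opU: "openin ?XU (U.cell S h)" if "h \<in> carrier G" for h
      using U.openin_cell[OF S _ that] by (simp add: skel2)
    have opW: "openin W.X (W.cell S e)" if "e \<in> V" for e
      using W.openin_cell[OF S _ that] by (simp add: skel2)
    have opY: "openin ?XU Y"
      unfolding Y_def using opU U.openin_off_fibre by (intro openin_Un openin_Union) (auto simp: A_def)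
    have YS: "h \<in> A" if "(centre S, h) \<in> Y" "h \<in> carrier G" for h
    proof -
      from that(1) obtain h' where "h' \<in> A" "(centre S, h) \<in> U.cell S h'"
        by (auto simp: Y_def)
      then show ?thesis
        using U.cell_centre[OF S that(2), of h'] by (auto simp: A_def)
    qed
    have KY: "\<alpha> ` T2 \<union> \<beta> ` T2 \<subseteq> Y"
    proof
      fix w assume w: "w \<in> \<alpha> ` T2 \<union> \<beta> ` T2"
      then have wX: "w \<in> topspace ?XU"
        using compactin_subset_topspace[OF K] by blast
      show "w \<in> Y"
      proof (cases "fst w = centre S")
        case True
        define h where "h = snd w"
        have h: "w = (centre S, h)" "h \<in> carrier G"
          using wX True by (auto simp: h_def mem_Times_iff prod_eq_iff)
        then have "h \<in> Hs" "g \<in> Hs"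
          using w by (auto simp: Hs_def)
        then have "h \<in> A"
          using inj h(2) by (auto simp: A_def dest: inj_onD)
        moreover have "w \<in> U.cell S h"
          using U.centre_in_cell[OF S _ h(2)] h(1) by simp
        ultimately show ?thesis
          by (auto simp: Y_def)
      qed (use wX in \<open>auto simp: Y_def\<close>)
    qed
    let ?q' = "(centre S, g)" and ?q = "(centre S, act g e0)"
    have ge0: "act g e0 \<in> V"
      by (rule actV[OF g V(2)])
    have cS: "centre S \<in> rel_interior S" "centre S \<in> P"
      using centre_in[OF S(1)] S rel_interior_subset by fastforce+
    have segS: "path (linepath (centre S) y)" "path_image (linepath (centre S) y) \<subseteq> P" if "y \<in> rel_interior S" for y
      using U.segment_ri[OF S _ that] U.ri_P[OF S] by auto
    have in_ri: "w \<in> W.cell S e \<Longrightarrow> fst w \<in> rel_interior S" for w e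
      by (auto simp: W.cell_def)
    \<comment> \<open>On the cell through \<open>g\<close> the map to the finite covering is
      inverted by keeping the point of \<open>P\<close> and transporting \<open>g\<close> from the
      centre in the universal covering.\<close>
    have "singular_relboundary 2 ?XU (topspace ?XU - {?q'}) (frag_of ?f - frag_of ?g)"
    proof (rule local_boundary_reflect[where Y = Y and X = W.X and f = ?\<Phi> and N = "W.cell S (act g e0)" and N' = "U.cell S g"
          and q = ?q and s = "\<lambda>w. (fst w, g \<otimes>\<^bsub>G\<^esub> cls (linepath (centre S) (fst w)))"])
      show "openin ?XU Y"
        by (rule opY)
      show "continuous_map (subtopology ?XU Y) W.X ?\<Phi>"
        by (rule continuous_map_from_subtopology[OF \<Phi>])
      show "openin W.X (W.cell S (act g e0))"
        by (rule opW[OF ge0])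
      show "?q \<in> W.cell S (act g e0)"
        using W.centre_in_cell[OF S _ ge0] by simp
      show "openin W.X (topspace W.X - {?q})"
        using W.closedin_centre[OF S _ ge0] by (simp add: skel2)
      show "openin ?XU (U.cell S g)"
        by (rule opU[OF g])
      show "U.cell S g \<subseteq> Y"
        using g by (auto simp: Y_def A_def)
      show "?q' \<in> U.cell S g"
        using U.centre_in_cell[OF S _ g] by simp
      show "openin ?XU (topspace ?XU - {?q'})"
        using U.closedin_centre[OF S _ g] by (simp add: skel2)
      show "?\<Phi> ` U.cell S g \<subseteq> W.cell S (act g e0)"
        using act(2)[OF g cls_in[OF segS] V(2)] by (auto simp: U.cell_def W.cell_def)
      show "continuous_map (subtopology W.X (W.cell S (act g e0))) (subtopology ?XU (U.cell S g))
          (\<lambda>w. (fst w, g \<otimes>\<^bsub>G\<^esub> cls (linepath (centre S) (fst w))))"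
      proof (rule continuous_map_into_subtopology)
        have "continuous_map (subtopology W.X (W.cell S (act g e0))) (top_of_set (rel_interior S)) fst"
          using continuous_map_from_subtopology[OF W.continuous_map_fst_cover, of "W.cell S (act g e0)"] in_ri
          by (auto simp: continuous_map_in_subtopology)
        moreover have "continuous_map (top_of_set (rel_interior S)) ?XU (\<lambda>y. (y, g \<otimes>\<^bsub>G\<^esub> cls (linepath (centre S) y)))"
          using U.cell_section[OF S _ g] by (simp add: skel2)
        ultimately show "continuous_map (subtopology W.X (W.cell S (act g e0))) ?XU (\<lambda>w. (fst w, g \<otimes>\<^bsub>G\<^esub> cls (linepath (centre S) (fst w))))"
          using continuous_map_compose by (fastforce simp: comp_def)
      qed (auto simp: U.cell_def W.cell_def)
      show "(fst (?\<Phi> w), g \<otimes>\<^bsub>G\<^esub> cls (linepath (centre S) (fst (?\<Phi> w)))) = w" if "w \<in> U.cell S g" for w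
        using that by (auto simp: U.cell_def)
      show "w = ?q'" if w: "w \<in> Y" "?\<Phi> w = ?q" for w
      proof -
        have "w \<in> topspace ?XU"
          using openin_subset[OF opY] w(1) by blast
        then obtain h where h: "w = (centre S, h)" "h \<in> carrier G"
          using w(2) by (cases w) auto
        then show ?thesis
          using YS[of h] w by (auto simp: A_def)
      qed
      show "w = ?q" if w: "w \<in> W.cell S (act g e0)" "(fst w, g \<otimes>\<^bsub>G\<^esub> cls (linepath (centre S) (fst w))) = ?q'" for w
        using w W.rho_const[OF cS(2) ge0] by (auto simp: W.cell_def)
      show "singular_relcycle 2 (subtopology ?XU Y) {} (frag_of ?f - frag_of ?g)"
        using KY c\<alpha> c\<beta> by (intro tri_cycle agree) (auto intro!: continuous_map_into_subtopology)
      have "act \<one>\<^bsub>G\<^esub> e0 \<in> V"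
        by (rule actV[OF one V(2)])
      from finite_cover_boundary[OF W.transport_axioms V(1) this]
      have "singular_relboundary 2 W.X {}
         (frag_of (tri_simplex (W.lift a (0, 0) (act \<one>\<^bsub>G\<^esub> e0))) - frag_of (tri_simplex (W.lift b (0, 0) (act \<one>\<^bsub>G\<^esub> e0))))" .
      moreover have eqv: "act (h \<otimes>\<^bsub>G\<^esub> cls p) e0 = act (cls (id \<circ> p)) (act h e0)"
        if "path p" "path_image p \<subseteq> P" "h \<in> carrier G" for p h
        using act(2)[OF that(3) cls_in[OF that(1,2)] V(2)] by simp
      have "tri_simplex (?\<Phi> \<circ> \<alpha>) = tri_simplex (W.lift a (0, 0) (act \<one>\<^bsub>G\<^esub> e0))"
        "tri_simplex (?\<Phi> \<circ> \<beta>) = tri_simplex (W.lift b (0, 0) (act \<one>\<^bsub>G\<^esub> e0))"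
        unfolding \<alpha>_def \<beta>_def
        using W.cover_map_lift[OF B.transport_axioms, of id "\<lambda>_ g. act g e0", OF _ _ eqv a one]
          W.cover_map_lift[OF B.transport_axioms, of id "\<lambda>_ g. act g e0", OF _ _ eqv b one]
        by (auto intro!: tri_simplex_cong)
      ultimately have "singular_relboundary 2 W.X {} (chain_map 2 ?\<Phi> (frag_of ?f - frag_of ?g))"
        by (simp only: chain_map_tri)
      then show "singular_relboundary 2 W.X (topspace W.X - {?q}) (chain_map 2 ?\<Phi> (frag_of ?f - frag_of ?g))"
        by (rule singular_relboundary_mono) simp
    qed
    then show "singular_relboundary 2 ?XU (topspace ?XU - {(centre S, g)}) (frag_of ?f - frag_of ?g)" .
  qed
  moreover note ANR_P
  moreover have "?f y = ?g y" if "y \<in> simplex_boundary 2" for y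
    using agree[OF simplex_boundary_2_tr[OF that]] that by (simp add: tri_simplex_def)
  ultimately obtain \<Psi> :: "real \<times> (real \<times> real) \<Rightarrow> 'a" where \<Psi>: "continuous_on ({0..1} \<times> T2) \<Psi>" "\<Psi> ` ({0..1} \<times> T2) \<subseteq> P"
    "\<And>z. z \<in> T2 \<Longrightarrow> \<Psi> (0, z) = fst (?f (tr z))" "\<And>z. z \<in> T2 \<Longrightarrow> \<Psi> (1, z) = fst (?g (tr z))"
    "\<And>t z. t \<in> {0..1} \<Longrightarrow> z \<in> bT2 \<Longrightarrow> \<Psi> (t, z) = fst (?f (tr z))"
    using B.homologous_imp_homotopic[OF singular_simplex_tri[OF c\<alpha>] singular_simplex_tri[OF c\<beta>]] by blast
  have fg: "fst (?f (tr z)) = a z" "fst (?g (tr z)) = b z" if "z \<in> T2" for z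
    using that by (simp_all add: \<alpha>_def \<beta>_def B.lift_def)
  have "\<Psi> (0, z) = a z" "\<Psi> (1, z) = b z" if "z \<in> T2" for z
    using \<Psi>(3,4)[OF that] fg[OF that] by simp_all
  moreover have "\<Psi> (t, z) = a z" if "t \<in> {0..1}" "z \<in> bT2" for t z
    using \<Psi>(5)[OF that] fg(1)[of z] that(2) by (simp add: bT2_def)
  ultimately show ?thesis
    using that[OF \<Psi>(1,2)] by blast
qed

end

end

subsection \<open>The homotopy inverse\<close>

text \<open>The homotopy extension property for maps into an ANR. On the union \<open>S\<close> of
  bottom and side, scaling time down to 0 makes the prescribed map homotopic to one that visibly
  extends, namely \<open>f\<close> of the space coordinate.\<close>

lemma homotopy_extension:
  fixes f :: "'b::euclidean_space \<Rightarrow> 'a::euclidean_space"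
  assumes L: "closedin (top_of_set M) L" and Q: "ANR Q"
    and f: "continuous_on M f" "f ` M \<subseteq> Q"
    and k: "continuous_on ({0..1::real} \<times> L) k" "k ` ({0..1} \<times> L) \<subseteq> Q" and k0: "\<And>y. y \<in> L \<Longrightarrow> k (0, y) = f y"
  obtains K where "continuous_on ({0..1::real} \<times> M) K" "K ` ({0..1} \<times> M) \<subseteq> Q" "\<And>y. y \<in> M \<Longrightarrow> K (0, y) = f y"
    "\<And>t y. t \<in> {0..1} \<Longrightarrow> y \<in> L \<Longrightarrow> K (t, y) = k (t, y)"
proof -
  let ?T = "{0..1::real} \<times> M"
  define S where "S = {0} \<times> M \<union> {0..1::real} \<times> L"
  have LM: "L \<subseteq> M"
    using closedin_imp_subset[OF L] .
  have cl: "closedin (top_of_set ?T) ({0} \<times> M)" "closedin (top_of_set ?T) ({0..1} \<times> L)"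
    by (rule closedin_Times; simp add: L closed_subset)+
  then have S: "closedin (top_of_set ?T) S"
    unfolding S_def by (rule closedin_Un)
  define F where "F w = (if fst w = 0 then f (snd w) else k w)" for w :: "real \<times> 'b"
  have FL: "F w = k w" if "w \<in> {0..1} \<times> L" for w
    using that k0 by (cases w) (auto simp: F_def)
  have cM: "continuous_on ({0} \<times> M) F"
  proof -
    have "continuous_on ({0::real} \<times> M) (\<lambda>w. f (snd w))"
      by (rule continuous_on_compose2[OF f(1)]) (auto intro: continuous_intros)
    then show ?thesis
      by (rule continuous_on_eq) (auto simp: F_def)
  qed
  have cL: "continuous_on ({0..1} \<times> L) F"
    using k(1) by (rule continuous_on_eq) (simp add: FL)
  have cS: "continuous_on S F"
    unfolding S_def
  proof (rule continuous_on_Un_local[OF _ _ cM cL])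
    show "closedin (top_of_set ({0::real} \<times> M \<union> {0..1} \<times> L)) ({0} \<times> M)"
      by (rule closedin_subset_trans[OF cl(1)]) (use LM in auto)
    show "closedin (top_of_set ({0::real} \<times> M \<union> {0..1} \<times> L)) ({0..1} \<times> L)"
      by (rule closedin_subset_trans[OF cl(2)]) (use LM in auto)
  qed
  have FQ: "F ` S \<subseteq> Q"
    using f(2) k(2) LM unfolding image_subset_iff by (auto simp: S_def F_def)
  have h1: "homotopic_with_canon (\<lambda>_. True) S Q (\<lambda>w. f (snd w)) F"
    unfolding homotopic_with_canon_alt
  proof (intro exI[of _ "\<lambda>w. F (fst w * fst (snd w), snd (snd w))"] conjI ballI)
    have in_S: "(fst w * fst (snd w), snd (snd w)) \<in> S" if "w \<in> {0..1} \<times> S" for w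
      using that by (auto simp: S_def intro: mult_le_one)
    show "continuous_on ({0..1} \<times> S) (\<lambda>w. F (fst w * fst (snd w), snd (snd w)))"
      by (rule continuous_on_compose2[OF cS]) (use in_S in \<open>auto intro!: continuous_intros\<close>)
    show "(\<lambda>w. F (fst w * fst (snd w), snd (snd w))) ` ({0..1} \<times> S) \<subseteq> Q"
      using FQ in_S by (auto simp: image_subset_iff)
    fix w assume "w \<in> S"
    show "F (fst (0, w) * fst (snd (0, w)), snd (snd (0, w))) = f (snd w)"
      "F (fst (1, w) * fst (snd (1, w)), snd (snd (1, w))) = F w"
      by (simp_all add: F_def)
  qed
  have h2: "continuous_on ?T (\<lambda>w. f (snd w))"
    by (rule continuous_on_compose2[OF f(1)]) (auto intro: continuous_intros)
  have h3: "(\<lambda>w. f (snd w)) \<in> ?T \<rightarrow> Q"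
    using f(2) by auto
  obtain K where K: "continuous_on ?T K" "K ` ?T \<subseteq> Q" "\<And>w. w \<in> S \<Longrightarrow> K w = F w"
    by (rule Borsuk_homotopy_extension_homotopic[OF S disjI2[OF Q] h2 h3 h1]) (rule that)
  show ?thesis
  proof (rule that[OF K(1,2)])
    show "K (0, y) = f y" if "y \<in> M" for y
      using K(3)[of "(0, y)"] that by (simp add: S_def F_def)
    show "K (t, y) = k (t, y)" if "t \<in> {0..1}" "y \<in> L" for t y
      using K(3)[of "(t, y)"] FL[of "(t, y)"] that by (simp add: S_def)
  qed
qed

lemma segment_1_simplex:
  fixes S :: "'a::euclidean_space set"
  assumes "1 simplex S"
  obtains \<phi> where "continuous_on {0..1::real} \<phi>" "inj_on \<phi> {0..1}" "\<phi> ` {0..1} = S" "\<phi> ` {0, 1} = rel_frontier S"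
proof -
  obtain C where C: "card C = 2" "S = convex hull C"
    using assms by (auto simp: simplex_def)
  then obtain v w where vw: "C = {v, w}" "v \<noteq> w"
    by (auto simp: card_2_iff)
  have S: "S = closed_segment v w"
    using C vw by (simp add: segment_convex_hull)
  have fr: "rel_frontier S = {v, w}"
    using vw(2) by (auto simp: S rel_frontier_def rel_interior_closed_segment open_segment_def)
  show ?thesis
  proof (rule that)
    show "continuous_on {0..1} (linepath v w)"
      by (rule continuous_on_linepath)
    show "inj_on (linepath v w) {0..1}"
      by (rule inj_on_linepath[OF vw(2)])
    show "linepath v w ` {0..1} = S"
      unfolding S by (rule linepath_image_01)
    show "linepath v w ` {0, 1} = rel_frontier S"
      by (simp add: fr linepath_0' linepath_1')
  qed
qed

text \<open>The chart has to match boundaries too: affine independence gives injectivity, and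
  positivity of all barycentric coordinates describes the relative interior.\<close>

lemma triangle_2_simplex:
  fixes S :: "'a::euclidean_space set"
  assumes "2 simplex S"
  obtains \<phi> where "continuous_on T2 \<phi>" "inj_on \<phi> T2" "\<phi> ` T2 = S" "\<phi> ` bT2 = rel_frontier S"
proof -
  obtain C where C: "card C = 3" "S = convex hull C" "\<not> affine_dependent C"
    using assms by (auto simp: simplex_def)
  then obtain p q r where pqr: "C = {p, q, r}" "p \<noteq> q" "p \<noteq> r" "q \<noteq> r"
    by (auto simp: card_3_iff)
  define \<phi> where "\<phi> z = fst z *\<^sub>R p + (1 - fst z - snd z) *\<^sub>R q + snd z *\<^sub>R r" for z :: "real \<times> real"
  have S: "S = {u *\<^sub>R p + v *\<^sub>R q + w *\<^sub>R r | u v w. 0 \<le> u \<and> 0 \<le> v \<and> 0 \<le> w \<and> u + v + w = 1}"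
    using C(2) by (simp add: pqr convex_hull_3)
  have im: "\<phi> ` T2 = S"
  proof (intro equalityI subsetI)
    fix y assume "y \<in> \<phi> ` T2"
    then obtain z where "z \<in> T2" "y = \<phi> z"
      by blast
    then show "y \<in> S"
      unfolding S mem_Collect_eq
      by (intro exI[of _ "fst z"] exI[of _ "1 - fst z - snd z"] exI[of _ "snd z"]) (simp add: \<phi>_def T2_def)
  next
    fix y assume "y \<in> S"
    then obtain u v w where uvw: "y = u *\<^sub>R p + v *\<^sub>R q + w *\<^sub>R r" "0 \<le> u" "0 \<le> v" "0 \<le> w" "u + v + w = 1"
      unfolding S by blast
    then have "v = 1 - u - w"
      by linarith
    then have "y = \<phi> (u, w)" "(u, w) \<in> T2"
      using uvw by (auto simp: \<phi>_def T2_def)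
    then show "y \<in> \<phi> ` T2"
      by blast
  qed
  have inj: "z = z'" if e: "\<phi> z = \<phi> z'" for z z'
  proof (rule ccontr)
    assume "z \<noteq> z'"
    \<comment> \<open>The difference of the barycentric coordinates of the two points is a
      nontrivial affine relation between the vertices.\<close>
    define U where "U v = (if v = p then fst z - fst z' else if v = r then snd z - snd z'
        else (fst z' - fst z) + (snd z' - snd z))" for v
    have "sum U C = 0" "(\<Sum>v\<in>C. U v *\<^sub>R v) = 0"
      using pqr e by (simp_all add: U_def \<phi>_def algebra_simps)
    moreover have "\<exists>v\<in>C. U v \<noteq> 0"
    proof (cases "fst z = fst z'")
      case True
      then have "U r \<noteq> 0"
        using \<open>z \<noteq> z'\<close> pqr by (auto simp: U_def prod_eq_iff)
      then show ?thesis
        by (auto simp: pqr(1))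
    next
      case False
      then have "U p \<noteq> 0"
        by (simp add: U_def)
      then show ?thesis
        by (auto simp: pqr(1))
    qed
    moreover have "finite C"
      by (simp add: pqr(1))
    ultimately have "affine_dependent C"
      using affine_dependent_explicit_finite by blast
    then show False
      using C(3) by simp
  qed
  have ri: "\<phi> ` (T2 - bT2) = rel_interior S"
  proof -
    have R: "rel_interior S = {y. \<exists>u. (\<forall>v\<in>C. 0 < u v) \<and> sum u C = 1 \<and> (\<Sum>v\<in>C. u v *\<^sub>R v) = y}"
      using rel_interior_convex_hull_explicit[OF C(3)] C(2) by simp
    show ?thesis
    proof (intro equalityI subsetI)
      fix y assume "y \<in> \<phi> ` (T2 - bT2)"
      then obtain z where z: "z \<in> T2" "z \<notin> bT2" "y = \<phi> z"
        by blast
      define u where "u v = (if v = p then fst z else if v = r then snd z else 1 - fst z - snd z)" for v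
      have "(\<forall>v\<in>C. 0 < u v) \<and> sum u C = 1 \<and> (\<Sum>v\<in>C. u v *\<^sub>R v) = y"
        using z pqr by (auto simp: u_def T2_def bT2_def \<phi>_def)
      then show "y \<in> rel_interior S"
        unfolding R by blast
    next
      fix y assume "y \<in> rel_interior S"
      then obtain u where u: "\<forall>v\<in>C. 0 < u v" "sum u C = 1" "(\<Sum>v\<in>C. u v *\<^sub>R v) = y"
        unfolding R by blast
      have s: "u p + (u q + u r) = 1"
        using u(2) pqr by simp
      then have q: "u q = 1 - u p - u r"
        by linarith
      have pos: "0 < u p" "0 < u q" "0 < u r"
        using u(1) by (auto simp: pqr(1))
      have "y = \<phi> (u p, u r)"
        using u(3) pqr by (simp add: \<phi>_def q add.assoc)
      moreover have "(u p, u r) \<in> T2 - bT2"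
        using pos s by (auto simp: T2_def bT2_def)
      ultimately show "y \<in> \<phi> ` (T2 - bT2)"
        by blast
    qed
  qed
  have "closed S"
    using C(2) pqr(1) by (simp add: finite_imp_compact_convex_hull compact_imp_closed)
  then have fr: "rel_frontier S = \<phi> ` T2 - \<phi> ` (T2 - bT2)"
    unfolding rel_frontier_def ri im by simp
  have "\<phi> ` bT2 = rel_frontier S"
    unfolding fr using inj by (auto simp: bT2_def)
  moreover have "continuous_on T2 \<phi>"
    unfolding \<phi>_def[abs_def] by (intro continuous_intros)
  ultimately show ?thesis
    using that im inj by (auto simp: inj_on_def)
qed

section \<open>Injectivity of \<open>d\<close> on simplices and extension over them\<close>

context self_domination begin

lemma compose_self_map:
  assumes "continuous_on A f" "f ` A \<subseteq> P" "continuous_on P g" "g ` P \<subseteq> P"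
  shows "continuous_on A (g \<circ> f)" "(g \<circ> f) ` A \<subseteq> P"
proof -
  show "continuous_on A (g \<circ> f)"
    using assms(1,2) by (intro continuous_on_compose continuous_on_subset[OF assms(3)])
  show "(g \<circ> f) ` A \<subseteq> P"
    unfolding image_comp[symmetric] using image_mono[OF assms(2), of g] assms(4) by (rule subset_trans)
qed

text \<open>Composition with \<open>d\<close> is injective on homotopy classes relative to
  \<open>B\<close> of maps from \<open>C\<close> to \<open>P\<close>. No relation between \<Psi> and
  \<Theta> is demanded.\<close>

definition rel_inj :: "'b::topological_space set \<Rightarrow> 'b set \<Rightarrow> bool" where
  "rel_inj C B \<longleftrightarrow> (\<forall>a b \<Theta>. continuous_on C a \<longrightarrow> a ` C \<subseteq> P \<longrightarrow> continuous_on C b \<longrightarrow> b ` C \<subseteq> P \<longrightarrow>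
     (\<forall>z\<in>B. a z = b z) \<longrightarrow> continuous_on ({0..1::real} \<times> C) \<Theta> \<longrightarrow> \<Theta> ` ({0..1} \<times> C) \<subseteq> P \<longrightarrow>
     (\<forall>z\<in>C. \<Theta> (0, z) = d (a z) \<and> \<Theta> (1, z) = d (b z)) \<longrightarrow> (\<forall>t\<in>{0..1}. \<forall>z\<in>B. \<Theta> (t, z) = d (a z)) \<longrightarrow>
     (\<exists>\<Psi>. continuous_on ({0..1::real} \<times> C) \<Psi> \<and> \<Psi> ` ({0..1} \<times> C) \<subseteq> P \<and>
       (\<forall>z\<in>C. \<Psi> (0, z) = a z \<and> \<Psi> (1, z) = b z) \<and> (\<forall>t\<in>{0..1}. \<forall>z\<in>B. \<Psi> (t, z) = a z)))"

lemma rel_inj_image: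
  fixes \<phi> :: "'b::topological_space \<Rightarrow> 'c::t2_space"
  assumes C: "rel_inj C B" "compact C" "B \<subseteq> C" and \<phi>: "continuous_on C \<phi>" "inj_on \<phi> C" "\<phi> ` C = S" "\<phi> ` B = F"
  shows "rel_inj S F"
  unfolding rel_inj_def
proof (intro allI impI)
  fix a b \<Theta>
  assume a: "continuous_on S a" "a ` S \<subseteq> P" and b: "continuous_on S b" "b ` S \<subseteq> P" and ab: "\<forall>z\<in>F. a z = b z"
    and \<Theta>: "continuous_on ({0..1::real} \<times> S) \<Theta>" "\<Theta> ` ({0..1} \<times> S) \<subseteq> P"
    and \<Theta>01: "\<forall>z\<in>S. \<Theta> (0, z) = d (a z) \<and> \<Theta> (1, z) = d (b z)" and \<Theta>B: "\<forall>t\<in>{0..1}. \<forall>z\<in>F. \<Theta> (t, z) = d (a z)"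
  obtain \<psi> where \<psi>: "homeomorphism C S \<phi> \<psi>"
    using homeomorphism_compact[OF C(2) \<phi>(1,3,2)] by blast
  have \<psi>C: "\<psi> z \<in> C" "\<phi> (\<psi> z) = z" if "z \<in> S" for z
    using \<psi> that by (auto simp: homeomorphism_def)
  have \<phi>S: "\<phi> z \<in> S" "\<psi> (\<phi> z) = z" if "z \<in> C" for z
    using \<psi> that by (auto simp: homeomorphism_def)
  have \<phi>B: "\<phi> z \<in> F" if "z \<in> B" for z
    using that \<phi>(4) by blast
  have \<psi>F: "\<psi> z \<in> B" if "z \<in> F" for z
    using that \<phi>(4) \<phi>S(2) C(3) by (metis imageE subsetD)
  have FS: "F \<subseteq> S"
    using \<phi>(3,4) C(3) by blast
  have "\<exists>\<Psi>. continuous_on ({0..1::real} \<times> C) \<Psi> \<and> \<Psi> ` ({0..1} \<times> C) \<subseteq> P \<and>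
       (\<forall>z\<in>C. \<Psi> (0, z) = (a \<circ> \<phi>) z \<and> \<Psi> (1, z) = (b \<circ> \<phi>) z) \<and> (\<forall>t\<in>{0..1}. \<forall>z\<in>B. \<Psi> (t, z) = (a \<circ> \<phi>) z)"
  proof (rule C(1)[unfolded rel_inj_def, rule_format, of "a \<circ> \<phi>" "b \<circ> \<phi>" "\<lambda>w. \<Theta> (fst w, \<phi> (snd w))"])
    show "continuous_on C (a \<circ> \<phi>)" "continuous_on C (b \<circ> \<phi>)"
      using a(1) b(1) \<phi>(1,3) by (simp_all add: continuous_on_compose del: comp_apply)
    show "(a \<circ> \<phi>) ` C \<subseteq> P" "(b \<circ> \<phi>) ` C \<subseteq> P"
      using a(2) b(2) \<phi>(3) by (auto simp: image_comp[symmetric])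
    have "continuous_on ({0..1::real} \<times> C) (\<lambda>w. \<phi> (snd w))"
      by (rule continuous_on_compose2[OF \<phi>(1)]) (auto intro: continuous_intros)
    then show "continuous_on ({0..1} \<times> C) (\<lambda>w. \<Theta> (fst w, \<phi> (snd w)))"
      by (intro continuous_on_compose2[OF \<Theta>(1)] continuous_on_Pair continuous_on_fst continuous_on_id) (use \<phi>S in auto)
    show "(\<lambda>w. \<Theta> (fst w, \<phi> (snd w))) ` ({0..1} \<times> C) \<subseteq> P"
      using \<phi>S by (intro image_subsetI subsetD[OF \<Theta>(2)] imageI) auto
  qed (use ab \<Theta>01 \<Theta>B \<phi>S \<phi>B in auto)
  then obtain \<Psi> where \<Psi>: "continuous_on ({0..1::real} \<times> C) \<Psi>" "\<Psi> ` ({0..1} \<times> C) \<subseteq> P"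
    "\<forall>z\<in>C. \<Psi> (0, z) = a (\<phi> z) \<and> \<Psi> (1, z) = b (\<phi> z)" "\<forall>t\<in>{0..1}. \<forall>z\<in>B. \<Psi> (t, z) = a (\<phi> z)"
    unfolding comp_def by (elim exE conjE)
  show "\<exists>\<Psi>. continuous_on ({0..1::real} \<times> S) \<Psi> \<and> \<Psi> ` ({0..1} \<times> S) \<subseteq> P \<and>
       (\<forall>z\<in>S. \<Psi> (0, z) = a z \<and> \<Psi> (1, z) = b z) \<and> (\<forall>t\<in>{0..1}. \<forall>z\<in>F. \<Psi> (t, z) = a z)"
  proof (intro exI[of _ "\<lambda>w. \<Psi> (fst w, \<psi> (snd w))"] conjI)
    have "continuous_on S \<psi>"
      using \<psi> by (simp add: homeomorphism_def)
    then have "continuous_on ({0..1::real} \<times> S) (\<lambda>w. \<psi> (snd w))"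
      by (rule continuous_on_compose2) (auto intro: continuous_intros)
    then show "continuous_on ({0..1} \<times> S) (\<lambda>w. \<Psi> (fst w, \<psi> (snd w)))"
      by (intro continuous_on_compose2[OF \<Psi>(1)] continuous_on_Pair continuous_on_fst continuous_on_id) (use \<psi>C in auto)
    show "(\<lambda>w. \<Psi> (fst w, \<psi> (snd w))) ` ({0..1} \<times> S) \<subseteq> P"
      using \<psi>C by (intro image_subsetI subsetD[OF \<Psi>(2)] imageI) auto
  qed (use \<Psi>(3,4) \<psi>C \<psi>F FS in auto)
qed

lemma rel_inj_triangle: "rel_inj T2 bT2"
  unfolding rel_inj_def
proof (intro allI impI)
  fix a b \<Theta>
  assume a: "continuous_on T2 a" "a ` T2 \<subseteq> P" and b: "continuous_on T2 b" "b ` T2 \<subseteq> P" and ab: "\<forall>z\<in>bT2. a z = b z"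
    and \<Theta>: "continuous_on ({0..1::real} \<times> T2) \<Theta>" "\<Theta> ` ({0..1} \<times> T2) \<subseteq> P"
    and \<Theta>01: "\<forall>z\<in>T2. \<Theta> (0, z) = d (a z) \<and> \<Theta> (1, z) = d (b z)" and \<Theta>B: "\<forall>t\<in>{0..1}. \<forall>z\<in>bT2. \<Theta> (t, z) = d (a z)"
  obtain \<Psi> :: "real \<times> (real \<times> real) \<Rightarrow> 'a" where "continuous_on ({0..1} \<times> T2) \<Psi>" "\<Psi> ` ({0..1} \<times> T2) \<subseteq> P"
    "\<And>z. z \<in> T2 \<Longrightarrow> \<Psi> (0, z) = a z" "\<And>z. z \<in> T2 \<Longrightarrow> \<Psi> (1, z) = b z"
    "\<And>t z. t \<in> {0..1} \<Longrightarrow> z \<in> bT2 \<Longrightarrow> \<Psi> (t, z) = a z"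
    by (rule discs_injective[OF a b _ \<Theta>]) (use ab \<Theta>01 \<Theta>B in blast)+
  then show "\<exists>\<Psi>. continuous_on ({0..1::real} \<times> T2) \<Psi> \<and> \<Psi> ` ({0..1} \<times> T2) \<subseteq> P \<and>
       (\<forall>z\<in>T2. \<Psi> (0, z) = a z \<and> \<Psi> (1, z) = b z) \<and> (\<forall>t\<in>{0..1}. \<forall>z\<in>bT2. \<Psi> (t, z) = a z)"
    by blast
qed

lemma rel_inj_interval: "rel_inj {0..1::real} {0, 1}"
  unfolding rel_inj_def
proof (intro allI impI)
  fix a b :: "real \<Rightarrow> 'a" and \<Theta>
  assume a: "continuous_on {0..1} a" "a ` {0..1} \<subseteq> P" and b: "continuous_on {0..1} b" "b ` {0..1} \<subseteq> P" and ab: "\<forall>z\<in>{0, 1}. a z = b z"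
    and \<Theta>: "continuous_on ({0..1::real} \<times> {0..1}) \<Theta>" "\<Theta> ` ({0..1} \<times> {0..1}) \<subseteq> P"
    and \<Theta>01: "\<forall>z\<in>{0..1}. \<Theta> (0, z) = d (a z) \<and> \<Theta> (1, z) = d (b z)" and \<Theta>B: "\<forall>t\<in>{0..1}. \<forall>z\<in>{0, 1}. \<Theta> (t, z) = d (a z)"
  have dab: "homotopic_paths P (d \<circ> a) (d \<circ> b)"
    unfolding homotopic_paths image_subset_iff_funcset[symmetric]
    using \<Theta> \<Theta>01 \<Theta>B by (intro exI[of _ \<Theta>]) (simp add: pathstart_def pathfinish_def)
  have "homotopic_paths P a b"
    by (rule paths_injective[OF _ _ _ _ _ _ dab])
      (use a b ab in \<open>simp_all add: path_def path_image_def pathstart_def pathfinish_def\<close>)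
  then show "\<exists>\<Psi>. continuous_on ({0..1::real} \<times> {0..1::real}) \<Psi> \<and> \<Psi> ` ({0..1} \<times> {0..1}) \<subseteq> P \<and>
       (\<forall>z\<in>{0..1}. \<Psi> (0, z) = a z \<and> \<Psi> (1, z) = b z) \<and> (\<forall>t\<in>{0..1}. \<forall>z\<in>{0, 1}. \<Psi> (t, z) = a z)"
    unfolding homotopic_paths image_subset_iff_funcset[symmetric]
    by (elim exE conjE) (rule exI, auto simp: pathstart_def pathfinish_def)
qed

text \<open>A vertex has empty frontier, so it suffices to join two points of \<open>P\<close>,
  which the chosen paths \<open>c\<close> do.\<close>

lemma rel_inj_point: "rel_inj {v} {}"
  unfolding rel_inj_def
proof (intro allI impI)
  fix a b and \<Theta>
  assume a: "a ` {v} \<subseteq> P" and b: "b ` {v} \<subseteq> P"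
  define p where "p = reversepath (c (a v)) +++ c (b v)"
  have p: "path p" "path_image p \<subseteq> P" "pathstart p = a v" "pathfinish p = b v"
    using c[of "a v"] c[of "b v"] a b by (auto simp: p_def path_image_join)
  show "\<exists>\<Psi>. continuous_on ({0..1::real} \<times> {v}) \<Psi> \<and> \<Psi> ` ({0..1} \<times> {v}) \<subseteq> P \<and>
       (\<forall>z\<in>{v}. \<Psi> (0, z) = a z \<and> \<Psi> (1, z) = b z) \<and> (\<forall>t\<in>{0..1}. \<forall>z\<in>{}. \<Psi> (t, z) = a z)"
  proof (intro exI[of _ "\<lambda>w. p (fst w)"] conjI)
    show "continuous_on ({0..1::real} \<times> {v}) (\<lambda>w. p (fst w))"
      by (rule continuous_on_compose2[OF p(1)[unfolded path_def]]) (auto intro: continuous_intros)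
  qed (use p in \<open>auto simp: path_image_def pathstart_def pathfinish_def\<close>)
qed

text \<open>Dimension at most 2 enters here: points, paths and discs are the only cases.\<close>

lemma rel_inj_simplex:
  assumes S: "S \<in> \<T>" "S \<noteq> {}"
  shows "rel_inj S (rel_frontier S)"
proof -
  obtain n where n: "n simplex S"
    using complex S(1) by (auto simp: simplicial_complex_def)
  have "n = aff_dim S"
    using aff_dim_simplex[OF n] by simp
  moreover have "\<not> aff_dim S < 0"
    using aff_dim_negative_iff S(2) by blast
  ultimately have "n \<le> 2" "0 \<le> n"
    using dim[OF S(1)] by linarith+
  then consider "n = 0" | "n = 1" | "n = 2"
    by linarith
  then show ?thesis
  proof cases
    case 1
    then obtain v where "S = {v}"
      using n by (auto simp: simplex_def card_1_singleton_iff)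
    then show ?thesis
      using rel_inj_point by (simp add: rel_frontier_sing)
  next
    case 2
    with n obtain \<phi> where \<phi>: "continuous_on {0..1::real} \<phi>" "inj_on \<phi> {0..1}" "\<phi> ` {0..1} = S" "\<phi> ` {0, 1} = rel_frontier S"
      using segment_1_simplex by blast
    show ?thesis
      by (rule rel_inj_image[OF rel_inj_interval _ _ \<phi>]) auto
  next
    case 3
    with n obtain \<phi> where \<phi>: "continuous_on T2 \<phi>" "inj_on \<phi> T2" "\<phi> ` T2 = S" "\<phi> ` bT2 = rel_frontier S"
      using triangle_2_simplex by blast
    show ?thesis
      by (rule rel_inj_image[OF rel_inj_triangle compact_T2 _ \<phi>]) (auto simp: bT2_def)
  qed
qed

text \<open>Extend \<open>u \<circ> g\<close> over \<open>S\<close> to a map \<open>a'\<close> homotopic to the inclusion, and \<open>g\<close> to a map \<open>g'\<close>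
  homotopic to \<open>d \<circ> a'\<close>. Then \<open>d \<circ> u \<circ> g'\<close> is homotopic to \<open>d \<circ> a'\<close> relative to the old part, and the
  injectivity of \<open>d\<close> on simplices removes \<open>d\<close>.\<close>

lemma extend_over_simplex:
  assumes \<L>: "\<L> \<subseteq> \<T>" "S \<in> \<T>" "S \<noteq> {}" and LS: "\<Union>\<L> \<inter> S = rel_frontier S"
    and g: "continuous_on (\<Union>\<L>) g" "g ` \<Union>\<L> \<subseteq> P"
    and ug: "homotopic_with_canon (\<lambda>_. True) (\<Union>\<L>) P id (u \<circ> g)"
  obtains g' where "continuous_on (\<Union>\<L> \<union> S) g'" "g' ` (\<Union>\<L> \<union> S) \<subseteq> P"
    "homotopic_with_canon (\<lambda>_. True) (\<Union>\<L> \<union> S) P id (u \<circ> g')"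
proof -
  define L M where "L = \<Union>\<L>" and "M = \<Union>\<L> \<union> S"
  have fin: "finite \<L>"
    using \<L>(1) finite_T finite_subset by blast
  have "closed L"
    unfolding L_def using fin \<L>(1) simplex_props(3) by (intro closed_Union) auto
  moreover have "closed S"
    by (rule simplex_props(3)[OF \<L>(2)])
  ultimately have clL: "closedin (top_of_set M) L" and clS: "closedin (top_of_set M) S"
    unfolding M_def L_def by (auto intro: closed_subset)
  have MP: "M \<subseteq> P" and LM: "L \<subseteq> M" and SM: "S \<subseteq> M"
    using \<L> by (auto simp: M_def L_def)
  note g = g[folded L_def]
  obtain k where k: "continuous_on ({0..1::real} \<times> L) k" "k ` ({0..1} \<times> L) \<subseteq> P"
    "\<forall>y\<in>L. k (0, y) = id y \<and> k (1, y) = (u \<circ> g) y"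
    using ug unfolding homotopic_with_canon_alt L_def[symmetric] by (elim exE conjE) (rule that)
  obtain K1 where K1: "continuous_on ({0..1::real} \<times> M) K1" "K1 ` ({0..1} \<times> M) \<subseteq> P" "\<And>y. y \<in> M \<Longrightarrow> K1 (0, y) = id y"
    "\<And>t y. t \<in> {0..1} \<Longrightarrow> y \<in> L \<Longrightarrow> K1 (t, y) = k (t, y)"
  proof (rule homotopy_extension[OF clL ANR_P _ _ k(1,2), of id])
    show "k (0, y) = id y" if "y \<in> L" for y
      using k(3) that by blast
  qed (use MP in \<open>auto intro: that\<close>)
  define a' where "a' y = K1 (1, y)" for y
  have side: "continuous_on M (\<lambda>y. F (1::real, y))" "(\<lambda>y. F (1, y)) ` M \<subseteq> P"
    if "continuous_on ({0..1::real} \<times> M) F" "F ` ({0..1} \<times> M) \<subseteq> P" for F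
    using that by (auto intro!: continuous_on_compose2[OF that(1)] continuous_on_Pair continuous_on_id continuous_on_const)
  have a': "continuous_on M a'" "a' ` M \<subseteq> P"
    using side[OF K1(1,2)] unfolding a'_def[abs_def] .
  have a'L: "a' y = u (g y)" if "y \<in> L" for y
    using K1(4)[of 1 y] k(3) that by (simp add: a'_def)
  obtain h where h: "continuous_on ({0..1::real} \<times> P) h" "h ` ({0..1} \<times> P) \<subseteq> P"
    "\<forall>y\<in>P. h (0, y) = (d \<circ> u) y \<and> h (1, y) = id y"
    using du unfolding homotopic_with_canon_alt by (elim exE conjE) (rule that)
  have ch: "continuous_on ({0..1::real} \<times> A) (\<lambda>w. h (fst w, f (snd w)))" "(\<lambda>w. h (fst w, f (snd w))) ` ({0..1::real} \<times> A) \<subseteq> P"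
    if f: "continuous_on A f" "f ` A \<subseteq> P" for f and A :: "'a set"
  proof -
    have fP: "f y \<in> P" if "y \<in> A" for y
      using f(2) that by blast
    have "continuous_on ({0..1::real} \<times> A) (\<lambda>w. f (snd w))"
      by (rule continuous_on_compose2[OF f(1)]) (auto intro: continuous_intros)
    then show "continuous_on ({0..1::real} \<times> A) (\<lambda>w. h (fst w, f (snd w)))"
      by (intro continuous_on_compose2[OF h(1)] continuous_on_Pair continuous_on_fst continuous_on_id) (use fP in \<open>auto simp del: Union_iff\<close>)
    show "(\<lambda>w. h (fst w, f (snd w))) ` ({0..1::real} \<times> A) \<subseteq> P"
      by (intro image_subsetI subsetD[OF h(2)] imageI) (use fP in \<open>auto simp del: Union_iff\<close>)
  qed
  have da': "continuous_on M (d \<circ> a')" "(d \<circ> a') ` M \<subseteq> P"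
    by (rule compose_self_map[OF a' d])+
  obtain K2 where K2: "continuous_on ({0..1::real} \<times> M) K2" "K2 ` ({0..1} \<times> M) \<subseteq> P" "\<And>y. y \<in> M \<Longrightarrow> K2 (0, y) = (d \<circ> a') y"
    "\<And>t y. t \<in> {0..1} \<Longrightarrow> y \<in> L \<Longrightarrow> K2 (t, y) = (\<lambda>w. h (fst w, g (snd w))) (t, y)"
  proof (rule homotopy_extension[OF clL ANR_P da' ch[OF g]])
    show "h (fst (0, y), g (snd (0, y))) = (d \<circ> a') y" if "y \<in> L" for y
    proof -
      have "g y \<in> P"
        using g(2) that by blast
      from bspec[OF h(3) this] show ?thesis
        using a'L[OF that] by simp
    qed
  qed (rule that)
  define g' where "g' y = K2 (1, y)" for y
  have g': "continuous_on M g'" "g' ` M \<subseteq> P"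
    using side[OF K2(1,2)] unfolding g'_def[abs_def] .
  have g'P: "g' y \<in> P" if "y \<in> M" for y
    using g'(2) that by blast
  have g'L: "g' y = g y" if "y \<in> L" for y
  proof -
    have "g y \<in> P"
      using g(2) that by blast
    from bspec[OF h(3) this] show ?thesis
      using K2(4)[of 1 y] that by (simp add: g'_def)
  qed
  \<comment> \<open>Over \<open>L\<close> the track of \<open>g'\<close> under \<open>h\<close> is
    that of \<open>K2\<close>, and both homotopies end in \<open>g'\<close>. Retracting the common
    track leaves a homotopy from \<open>d \<circ> u \<circ> g'\<close> to
    \<open>d \<circ> a'\<close> that is stationary on \<open>L\<close>.\<close>
  obtain \<Psi> where \<Psi>: "continuous_on ({0..1::real} \<times> M) \<Psi>" "\<Psi> ` ({0..1} \<times> M) \<subseteq> P"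
    "\<And>y. y \<in> M \<Longrightarrow> \<Psi> (0, y) = (\<lambda>w. h (fst w, g' (snd w))) (0, y)" "\<And>y. y \<in> M \<Longrightarrow> \<Psi> (1, y) = K2 (0, y)"
    "\<And>t y. t \<in> {0..1} \<Longrightarrow> y \<in> L \<Longrightarrow> \<Psi> (t, y) = (\<lambda>w. h (fst w, g' (snd w))) (0, y)"
  proof (rule homotopy_rel_from_common_trace[OF clL ANR_P ch[OF g'] K2(1,2)])
    show "h (fst (t, y), g' (snd (t, y))) = K2 (t, y)" if "t \<in> {0..1}" "y \<in> L" for t y
      using K2(4)[OF that] g'L[OF that(2)] by simp
    show "h (fst (1, y), g' (snd (1, y))) = K2 (1, y)" if "y \<in> M" for y
      using bspec[OF h(3) g'P[OF that]] by (simp add: g'_def)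
  qed (rule that)
  have \<Psi>0: "\<Psi> (0, y) = d (u (g' y))" if "y \<in> M" for y
    using \<Psi>(3)[OF that] bspec[OF h(3) g'P[OF that]] by simp
  have \<Psi>L: "\<Psi> (t, y) = d (u (g' y))" if "t \<in> {0..1}" "y \<in> L" for t y
    using \<Psi>(5)[OF that] bspec[OF h(3) g'P[OF subsetD[OF LM that(2)]]] by simp
  have ug': "continuous_on M (u \<circ> g')" "(u \<circ> g') ` M \<subseteq> P"
    by (rule compose_self_map[OF g' u])+
  have FL: "rel_frontier S \<subseteq> L"
    using LS by (auto simp: L_def)
  have "\<exists>\<Psi>'. continuous_on ({0..1::real} \<times> S) \<Psi>' \<and> \<Psi>' ` ({0..1} \<times> S) \<subseteq> P \<and>
      (\<forall>z\<in>S. \<Psi>' (0, z) = (u \<circ> g') z \<and> \<Psi>' (1, z) = a' z) \<and> (\<forall>t\<in>{0..1}. \<forall>z\<in>rel_frontier S. \<Psi>' (t, z) = (u \<circ> g') z)"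
  proof (rule rel_inj_simplex[OF \<L>(2,3), unfolded rel_inj_def, rule_format, of "u \<circ> g'" a' \<Psi>])
    show "continuous_on S (u \<circ> g')" "continuous_on S a'" "continuous_on ({0..1} \<times> S) \<Psi>"
      using ug'(1) a'(1) \<Psi>(1) SM by (auto intro: continuous_on_subset)
    show "(u \<circ> g') ` S \<subseteq> P"
      by (rule subset_trans[OF image_mono[OF SM] ug'(2)])
    show "a' ` S \<subseteq> P"
      by (rule subset_trans[OF image_mono[OF SM] a'(2)])
    show "\<Psi> ` ({0..1} \<times> S) \<subseteq> P"
      by (rule subset_trans[OF image_mono \<Psi>(2)]) (use SM in auto)
    show "(u \<circ> g') z = a' z" if "z \<in> rel_frontier S" for z
      using g'L[of z] a'L[of z] that FL by (simp add: subset_iff)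
    show "\<Psi> (0, z) = d ((u \<circ> g') z) \<and> \<Psi> (1, z) = d (a' z)" if "z \<in> S" for z
      using \<Psi>0[of z] \<Psi>(4)[of z] K2(3)[of z] that SM by (simp add: subset_iff)
    show "\<Psi> (t, z) = d ((u \<circ> g') z)" if "t \<in> {0..1}" "z \<in> rel_frontier S" for t z
      using \<Psi>L[of t z] that FL by (simp add: subset_iff)
  qed
  then obtain \<Psi>' where \<Psi>': "continuous_on ({0..1::real} \<times> S) \<Psi>'" "\<Psi>' ` ({0..1} \<times> S) \<subseteq> P"
      "\<forall>z\<in>S. \<Psi>' (0, z) = (u \<circ> g') z \<and> \<Psi>' (1, z) = a' z" "\<forall>t\<in>{0..1}. \<forall>z\<in>rel_frontier S. \<Psi>' (t, z) = (u \<circ> g') z"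
    by (elim exE conjE)
  \<comment> \<open>The homotopy without \<open>d\<close> on \<open>S\<close>, extended by a
    stationary one; the two fit because \<Psi>' is stationary on the frontier of
    \<open>S\<close>.\<close>
  define H where "H w = (if snd w \<in> S then \<Psi>' w else u (g' (snd w)))" for w :: "real \<times> 'a"
  have HL: "H (t, y) = u (g' y)" if "t \<in> {0..1}" "y \<in> L" for t y
  proof (cases "y \<in> S")
    case True
    then have "y \<in> rel_frontier S"
      using LS that(2) by (auto simp: L_def)
    then show ?thesis
      using \<Psi>'(4) that(1) True by (simp add: H_def)
  qed (simp add: H_def)
  have split: "{0..1::real} \<times> M = {0..1} \<times> S \<union> {0..1} \<times> L"
    by (auto simp: M_def L_def)
  have cH: "continuous_on ({0..1} \<times> M) H"
    unfolding split
  proof (rule continuous_on_Un_local)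
    show "closedin (top_of_set ({0..1::real} \<times> S \<union> {0..1} \<times> L)) ({0..1} \<times> S)"
      "closedin (top_of_set ({0..1::real} \<times> S \<union> {0..1} \<times> L)) ({0..1} \<times> L)"
      unfolding split[symmetric] by (rule closedin_Times; simp add: clL clS)+
    show "continuous_on ({0..1} \<times> S) H"
      using \<Psi>'(1) by (rule continuous_on_eq) (auto simp: H_def)
    have "continuous_on ({0..1::real} \<times> L) (\<lambda>w. (u \<circ> g') (snd w))"
      by (rule continuous_on_compose2[OF continuous_on_subset[OF ug'(1) LM]]) (auto intro: continuous_intros)
    then show "continuous_on ({0..1} \<times> L) H"
      by (rule continuous_on_eq) (auto simp: HL)
  qed
  have HP: "H ` ({0..1} \<times> M) \<subseteq> P"
  proof (intro image_subsetI)
    fix w :: "real \<times> 'a" assume w: "w \<in> {0..1} \<times> M"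
    show "H w \<in> P"
    proof (cases "snd w \<in> S")
      case True
      then have "w \<in> {0..1} \<times> S"
        using w by (simp add: mem_Times_iff)
      then have "\<Psi>' w \<in> P"
        using \<Psi>'(2) by blast
      then show ?thesis
        using True by (simp only: H_def if_True)
    next
      case False
      have "(u \<circ> g') (snd w) \<in> P"
        using w ug'(2) by (intro subsetD[OF ug'(2)] imageI) (simp add: mem_Times_iff)
      then show ?thesis
        using False by (simp only: H_def if_False comp_apply)
    qed
  qed
  have "homotopic_with_canon (\<lambda>_. True) M P (u \<circ> g') a'"
    unfolding homotopic_with_canon_alt
  proof (intro exI[of _ H] conjI ballI cH HP)
    fix y assume y: "y \<in> M"
    show "H (0, y) = (u \<circ> g') y"
      using \<Psi>'(3) by (simp add: H_def)
    show "H (1, y) = a' y"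
    proof (cases "y \<in> S")
      case True
      then show ?thesis
        using \<Psi>'(3) by (simp add: H_def)
    next
      case False
      then have "y \<in> L"
        using y by (auto simp: M_def L_def)
      then show ?thesis
        using HL[of 1 y] g'L a'L by simp
    qed
  qed
  moreover have "homotopic_with_canon (\<lambda>_. True) M P id a'"
    unfolding homotopic_with_canon_alt using K1(1-3) by (intro exI[of _ K1]) (auto simp: a'_def)
  ultimately have "homotopic_with_canon (\<lambda>_. True) M P id (u \<circ> g')"
    using homotopic_with_trans homotopic_with_symD by blast
  then show ?thesis
    using that g' unfolding M_def by blast
qed

text \<open>A simplex of maximal dimension is a face of no other simplex. Removing it leaves a
  subcomplex, which meets it exactly in its frontier.\<close>

lemma right_inverse_on_subcomplex:
  assumes "\<L> \<subseteq> \<T>" "\<And>S F. S \<in> \<L> \<Longrightarrow> F face_of S \<Longrightarrow> F \<in> \<L>"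
  shows "\<exists>g. continuous_on (\<Union>\<L>) g \<and> g ` \<Union>\<L> \<subseteq> P \<and> homotopic_with_canon (\<lambda>_. True) (\<Union>\<L>) P id (u \<circ> g)"
  using assms
proof (induction "card \<L>" arbitrary: \<L>)
  case 0
  then have "\<L> = {}"
    using finite_subset[OF _ finite_T] by auto
  show ?case
    unfolding \<open>\<L> = {}\<close> homotopic_with_canon_alt by (intro exI[of _ id]) auto
next
  case (Suc n)
  have fin: "finite \<L>"
    using Suc.prems(1) finite_subset[OF _ finite_T] by blast
  have ne: "\<L> \<noteq> {}"
    using Suc.hyps(2) by auto
  then have "Max (aff_dim ` \<L>) \<in> aff_dim ` \<L>"
    using fin by (intro Max_in) auto
  then obtain S where S: "S \<in> \<L>" "aff_dim S = Max (aff_dim ` \<L>)"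
    by auto
  then have max: "aff_dim S' \<le> aff_dim S" if "S' \<in> \<L>" for S'
    using that fin by simp
  have ST: "S \<in> \<T>"
    using S(1) Suc.prems(1) by blast
  define \<L>' where "\<L>' = \<L> - {S}"
  have sub: "\<L>' \<subseteq> \<T>" and card: "n = card \<L>'"
    using Suc.prems(1) Suc.hyps(2) S(1) fin by (auto simp: \<L>'_def)
  have face: "F \<in> \<L>'" if S': "S' \<in> \<L>'" and F: "F face_of S'" for S' F
  proof -
    have S'T: "S' \<in> \<T>" "S' \<in> \<L>" "S' \<noteq> S"
      using S' sub by (auto simp: \<L>'_def)
    have "F \<noteq> S"
    proof
      assume "F = S"
      then have "aff_dim S < aff_dim S'"
        using face_of_aff_dim_lt[OF simplex_props(1)[OF S'T(1)] F] S'T(3) by simp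
      then show False
        using max[OF S'T(2)] by simp
    qed
    then show ?thesis
      using Suc.prems(2)[OF S'T(2) F] by (simp add: \<L>'_def)
  qed
  have "\<exists>g. continuous_on (\<Union>\<L>') g \<and> g ` \<Union>\<L>' \<subseteq> P \<and> homotopic_with_canon (\<lambda>_. True) (\<Union>\<L>') P id (u \<circ> g)"
    by (rule Suc.hyps(1)[OF card sub]) (rule face)
  then obtain g where g: "continuous_on (\<Union>\<L>') g" "g ` \<Union>\<L>' \<subseteq> P" "homotopic_with_canon (\<lambda>_. True) (\<Union>\<L>') P id (u \<circ> g)"
    by blast
  have U: "\<Union>\<L> = \<Union>\<L>' \<union> S"
    using S(1) by (auto simp: \<L>'_def)
  show ?case
  proof (cases "S = {}")
    case True
    then show ?thesis
      using g U by auto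
  next
    case False
    have "\<Union>\<L>' \<inter> S = rel_frontier S"
    proof (intro equalityI subsetI)
      fix y assume "y \<in> \<Union>\<L>' \<inter> S"
      then obtain S' where S': "S' \<in> \<L>'" "y \<in> S'" "y \<in> S"
        by blast
      have S'T: "S' \<in> \<T>" "S' \<in> \<L>" "S' \<noteq> S"
        using S' sub by (auto simp: \<L>'_def)
      have "(S \<inter> S') face_of S"
        by (rule Int_face[OF ST S'T(1)])
      moreover have "S \<inter> S' \<noteq> S"
      proof
        assume "S \<inter> S' = S"
        then have "S face_of S'"
          using Int_face[OF S'T(1) ST] by (simp add: Int_commute)
        then have "S \<in> \<L>'"
          by (rule face[OF S'(1)])
        then show False
          by (simp add: \<L>'_def)
      qed
      ultimately show "y \<in> rel_frontier S"
        using face_of_subset_rel_frontier S'(2,3) by blast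
    next
      fix y assume "y \<in> rel_frontier S"
      then have "y \<in> S \<inter> skel (aff_dim S - 1)"
        using rel_frontier_skel[OF ST HOL.refl] by simp
      then obtain S' where S': "S' \<in> \<T>" "aff_dim S' \<le> aff_dim S - 1" "y \<in> S'" "y \<in> S"
        by (auto simp: skel_def)
      have "S \<inter> S' \<in> \<L>"
        using Suc.prems(2)[OF S(1)] Int_face[OF ST S'(1)] by blast
      moreover have "aff_dim (S \<inter> S') \<le> aff_dim S'"
        by (rule aff_dim_subset) auto
      then have "S \<inter> S' \<noteq> S"
        using S'(2) by auto
      ultimately have "S \<inter> S' \<in> \<L>'"
        by (simp add: \<L>'_def)
      then show "y \<in> \<Union>\<L>' \<inter> S"
        using S'(3,4) by blast
    qed
    from extend_over_simplex[OF sub ST False this g] show ?thesis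
      unfolding U by metis
  qed
qed

text \<open>Let \<open>w\<close> be a right inverse of \<open>u\<close> up to homotopy. Then
  \<open>u \<circ> d\<close> is homotopic to \<open>u \<circ> d \<circ> u \<circ> w\<close>, hence
  to \<open>u \<circ> w\<close>, hence to the identity.\<close>

lemma left_inverse: "homotopic_with_canon (\<lambda>_. True) P P (u \<circ> d) id"
proof -
  obtain w where w: "continuous_on P w" "w ` P \<subseteq> P" "homotopic_with_canon (\<lambda>_. True) P P id (u \<circ> w)"
    using right_inverse_on_subcomplex[of \<T>] face_in_T by blast
  have ud: "continuous_on P (u \<circ> d)" "(u \<circ> d) ` P \<subseteq> P"
    by (rule compose_self_map[OF d u])+
  have "homotopic_with_canon (\<lambda>_. True) P P ((u \<circ> d) \<circ> id) ((u \<circ> d) \<circ> (u \<circ> w))"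
    by (rule homotopic_with_compose_continuous_map_left[OF w(3)])
      (use ud in \<open>auto simp: Pi_iff image_subset_iff simp del: Union_iff\<close>)
  moreover have "homotopic_with_canon (\<lambda>_. True) P P (u \<circ> (d \<circ> u) \<circ> w) (u \<circ> id \<circ> w)"
  proof (rule homotopic_with_compose_continuous_map_right[of "\<lambda>_. True" _ "top_of_set P"])
    show "homotopic_with_canon (\<lambda>_. True) P P (u \<circ> (d \<circ> u)) (u \<circ> id)"
      by (rule homotopic_with_compose_continuous_map_left[OF du]) (use u in auto)
  qed (use w in auto)
  ultimately have "homotopic_with_canon (\<lambda>_. True) P P (u \<circ> d) (u \<circ> w)"
    using homotopic_with_trans by (simp add: comp_assoc) blast
  then show ?thesis
    using homotopic_with_trans[OF _ homotopic_with_symD[OF w(3)]] by blast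
qed

end

theorem theorem7:
  fixes P :: "'a::euclidean_space set" and x :: 'a and d :: "'a \<Rightarrow> 'a"
  assumes "finite_polyhedron_of_dim P 2"
    and "connected P"
    and "x \<in> P"
    and "limit_group (fundamental_group P x)"
    and "has_finite_aspherical_presentation (fundamental_group P x)"
    and "homotopy_domination (top_of_set P) (top_of_set P) d"
  shows "homotopy_equivalence_map (top_of_set P) (top_of_set P) d"
proof -
  obtain \<T> where \<T>: "simplicial_complex \<T>" "\<Union>\<T> = P" "\<T> \<noteq> {}" "Max (aff_dim ` \<T>) = 2"
    using assms(1) by (auto simp: finite_polyhedron_of_dim_def)
  interpret complex2 \<T>
    by unfold_locales (rule \<T>(1))
  have dim: "aff_dim S \<le> 2" if "S \<in> \<T>" for S
    using that finite_T \<T>(4) Max_ge[of "aff_dim ` \<T>" "aff_dim S"] by simp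
  have star: "locally_starlike P"
    using locally_starlike_Union_convex[of \<T> "{}"] finite_T simplex_props \<T>(2) by auto
  have "ANR P"
    unfolding \<T>(2)[symmetric] using finite_T simplex_props by (intro ANR_finite_Union_convex_closed) auto
  \<comment> \<open>An ANR is locally path connected, so connectedness provides the paths from
    \<open>x\<close> to all other points.\<close>
  then have "path_connected P"
    using path_component_eq_connected_component[OF ANR_imp_locally_path_connected, of P] assms(2)
    by (simp add: path_connected_component connected_iff_connected_component)
  then have "\<forall>y\<in>P. \<exists>p. path p \<and> path_image p \<subseteq> P \<and> pathstart p = x \<and> pathfinish p = y"
    using assms(3) unfolding path_connected_def by blast
  then obtain c where c: "\<And>y. y \<in> P \<Longrightarrow> path (c y) \<and> path_image (c y) \<subseteq> P \<and> pathstart (c y) = x \<and> pathfinish (c y) = y"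
    by metis
  obtain u where dom: "continuous_map (top_of_set P) (top_of_set P) d" "continuous_map (top_of_set P) (top_of_set P) u"
    "homotopic_with_canon (\<lambda>_. True) P P (d \<circ> u) id"
    using assms(6) by (auto simp: homotopy_domination_def)
  interpret self_domination \<T> x c d u
    by unfold_locales (use \<T>(2) star c assms(3,4) dom dim in \<open>auto simp: image_subset_iff_funcset\<close>)
  show ?thesis
    using dom left_inverse[unfolded \<T>(2)] unfolding homotopy_equivalence_map_def by blast
qed

end
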